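(* Let $u^{[0]}(X)=u^0$ for all $X\in M_n(\mathbb{R})$, and let $(u^{[k]}(X))_{k\ge 0}$ be the generalized AMP orbit corresponding to $(X,Z)$, the Lipschitz functions $(F_k)_{k\ge0}$, and $u^{[0]}$. For any $k\geq 0$ and any Lipschitz function $\phi:\mathbb{R}^{k+1}\to\mathbb{R}$, we have that in probability $$\lim_{n\to\infty}\bigl|\Phi_{k,n}(A)-\Phi_{k,n}(G)\bigr|=0,$$ where $$\Phi_{k,n}(X):=\frac{1}{n}\sum_{i=1}^n\phi\bigl(u_i^{[k]}(X),\ldots,u_i^{[0]}(X)\bigr),\qquad X\in M_n(\mathbb{R}).$$
   Context: Notation. $M_n(\mathbb{R})$ is the set of real symmetric $n\times n$ matrices, $[n]=\{1,\dots,n\}$, $\|\cdot\|_2$ is the Euclidean norm on $\mathbb{R}^n$. A function $f:\mathbb{R}^{k+1}\to\mathbb{R}$ is applied to vectors coordinatewise: $f(u^k,\ldots,u^0)_i=f(u^k_i,\ldots,u^0_i)$. For $X,Z\in M_n(\mathbb{R})$ put $\hat X_n=\frac{X}{\sqrt n}+\frac{Z}{n}$. Generalized AMP. For each $k\ge 0$ let $F_k\in C(\mathbb{R}^{k+1})$ be Lipschitz (not depending on $n$). Given an initialization $u^{[0]}:M_n(\mathbb{R})\to\mathbb{R}^n$, the generalized AMP orbit corresponding to $(X,Z)$, $(F_k)$, $u^{[0]}$ is defined iteratively by $$u^{[k+1]}(X)=F_k\bigl(\hat X_nu^{[k]}(X),u^{[k-1]}(X),u^{[k-2]}(X),\ldots,u^{[0]}(X)\bigr),\quad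 k\ge0.$$ Randomness. Fix $\sigma>0$. For every $n\ge1$, $u^0=(u^0_i)_{i\in[n]}$ is an $n$-dimensional random vector and $Z=(z_{ii'})_{i,i'\in[n]}$ is a random symmetric matrix (possibly dependent on $u^0$) such that, for some constant $C(\sigma)$, each of $\mathbb{E}\exp(\|u^0\|_2^2/(\sigma n))$, $\max_{i\in[n]}\mathbb{E}\exp(|u^0_i|/\sigma)$, $\max_{i,i'\in[n]}\mathbb{E}\exp(|z_{ii'}|/\sigma)$ is at most $C(\sigma)$ for all $n\ge1$. $A=(a_{ii'})_{i,i'\in[n]}$ is a random symmetric matrix whose upper triangular entries ($i\le i'$) are independent with zero mean and unit variance and $\sigma$-subgaussian, i.e. $\mathbb{E}e^{\lambda a_{ii'}}\le e^{\lambda^2\sigma^2/2}$ for all $\lambda\in\mathbb{R}$. $G$ is a random symmetric matrix whose upper triangular entries are independent standard normal. Each of $A$ and $G$ is independent of $(u^0,Z)$. *)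

theory Defs
  imports "HOL-Probability.Probability"
begin

text \<open>
  Since the dimension n tends to infinity, vectors in \<open>\<real>\<^sup>n\<close> are functions \<open>nat \<Rightarrow> real\<close> and
  n by n matrices are functions \<open>nat \<Rightarrow> nat \<Rightarrow> real\<close>, of which only the values at indices
  in \<open>{1..n}\<close> are ever used.
\<close>

type_synonym vect = "nat \<Rightarrow> real"
type_synonym matr = "nat \<Rightarrow> nat \<Rightarrow> real"

definition sym_mats :: "nat \<Rightarrow> matr set" where
  "sym_mats n = {X. \<forall>i\<in>{1..n}. \<forall>j\<in>{1..n}. X i j = X j i}"

text \<open>
  Lipschitz functions on \<open>\<real>\<^sup>m\<close>. The arguments are numbered \<open>0, \<dots>, m - 1\<close>. The right-hand
  side only involves these coordinates, so such an \<open>f\<close> does not depend on any other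
  coordinate of its argument.
\<close>

definition lipschitz_fun :: "nat \<Rightarrow> ((nat \<Rightarrow> real) \<Rightarrow> real) \<Rightarrow> bool" where
  "lipschitz_fun m f \<longleftrightarrow>
     (\<exists>L\<ge>0. \<forall>x y. \<bar>f x - f y\<bar> \<le> L * L2_set (\<lambda>j. x j - y j) {..<m})"

definition X_hat :: "nat \<Rightarrow> matr \<Rightarrow> matr \<Rightarrow> matr" where
  "X_hat n Z X = (\<lambda>i j. X i j / sqrt (real n) + Z i j / real n)"

definition mat_vec :: "nat \<Rightarrow> matr \<Rightarrow> vect \<Rightarrow> vect" where
  "mat_vec n B v = (\<lambda>i. \<Sum>j\<in>{1..n}. B i j * v j)"

text \<open>
  In the recursive equation, argument 0 of \<open>F k\<close> is the i-th entry of \<open>X_hat n Z X\<close> applied to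
  the k-th iterate, and argument \<open>j \<in> {1..k}\<close> is the i-th entry of iterate \<open>k - j\<close>;
  arguments beyond \<open>k\<close> are immaterial when \<open>F k\<close> is Lipschitz on \<open>\<real>\<^sup>k\<^sup>+\<^sup>1\<close>.
\<close>

fun gen_amp :: "nat \<Rightarrow> (nat \<Rightarrow> (nat \<Rightarrow> real) \<Rightarrow> real) \<Rightarrow> matr \<Rightarrow> (matr \<Rightarrow> vect) \<Rightarrow> nat \<Rightarrow> matr \<Rightarrow> vect"
where
  "gen_amp n F Z u_init 0 X = u_init X"
| "gen_amp n F Z u_init (Suc k) X =
     (\<lambda>i. F k (\<lambda>j. if j = 0 then mat_vec n (X_hat n Z X) (gen_amp n F Z u_init k X) i
                  else gen_amp n F Z u_init (k - j) X i))"

text \<open>Argument \<open>j \<in> {0..k}\<close> of \<open>\<phi>\<close> is the i-th entry of iterate \<open>k - j\<close>.\<close>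

definition amp_avg ::
  "nat \<Rightarrow> (nat \<Rightarrow> (nat \<Rightarrow> real) \<Rightarrow> real) \<Rightarrow> matr \<Rightarrow> (matr \<Rightarrow> vect) \<Rightarrow> ((nat \<Rightarrow> real) \<Rightarrow> real) \<Rightarrow> nat
    \<Rightarrow> matr \<Rightarrow> real" where
  "amp_avg n F Z u_init \<phi> k X =
     (1 / real n) * (\<Sum>i\<in>{1..n}. \<phi> (\<lambda>j. gen_amp n F Z u_init (k - j) X i))"

definition random_vec :: "'a measure \<Rightarrow> nat \<Rightarrow> ('a \<Rightarrow> vect) \<Rightarrow> bool" where
  "random_vec M n u \<longleftrightarrow> (\<forall>i\<in>{1..n}. (\<lambda>\<omega>. u \<omega> i) \<in> borel_measurable M)"

definition random_sym_mat :: "'a measure \<Rightarrow> nat \<Rightarrow> ('a \<Rightarrow> matr) \<Rightarrow> bool" where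
  "random_sym_mat M n X \<longleftrightarrow>
     (\<forall>\<omega>\<in>space M. X \<omega> \<in> sym_mats n) \<and>
     (\<forall>i\<in>{1..n}. \<forall>j\<in>{1..n}. (\<lambda>\<omega>. X \<omega> i j) \<in> borel_measurable M)"

definition upper_tri :: "nat \<Rightarrow> (nat \<times> nat) set" where
  "upper_tri n = {(i, j). 1 \<le> i \<and> i \<le> j \<and> j \<le> n}"

definition indep_upper_tri :: "'a measure \<Rightarrow> nat \<Rightarrow> ('a \<Rightarrow> matr) \<Rightarrow> bool" where
  "indep_upper_tri M n X \<longleftrightarrow>
     prob_space.indep_vars M (\<lambda>_. borel) (\<lambda>(i, j) \<omega>. X \<omega> i j) (upper_tri n)"

text \<open>The moment generating function is a nonnegative integral, hence the bound includes finiteness.\<close>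

definition subgaussian :: "'a measure \<Rightarrow> real \<Rightarrow> ('a \<Rightarrow> real) \<Rightarrow> bool" where
  "subgaussian M \<sigma> X \<longleftrightarrow>
     (\<forall>l::real. (\<integral>\<^sup>+\<omega>. ennreal (exp (l * X \<omega>)) \<partial>M) \<le> ennreal (exp (l\<^sup>2 * \<sigma>\<^sup>2 / 2)))"

text \<open>
  Vectors and matrices as random elements of the finite product spaces \<open>\<real>\<^sup>n\<close> and
  \<open>\<real>\<^sup>n\<^sup>*\<^sup>n\<close>; restriction discards the irrelevant values outside \<open>{1..n}\<close>.
\<close>

abbreviation vec_space :: "nat \<Rightarrow> (nat \<Rightarrow> real) measure" where
  "vec_space n \<equiv> Pi\<^sub>M {1..n} (\<lambda>_. borel)"

abbreviation mat_space :: "nat \<Rightarrow> (nat \<times> nat \<Rightarrow> real) measure" where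
  "mat_space n \<equiv> Pi\<^sub>M ({1..n} \<times> {1..n}) (\<lambda>_. borel)"

definition vec_elem :: "nat \<Rightarrow> vect \<Rightarrow> nat \<Rightarrow> real" where
  "vec_elem n u = restrict u {1..n}"

definition mat_elem :: "nat \<Rightarrow> matr \<Rightarrow> nat \<times> nat \<Rightarrow> real" where
  "mat_elem n X = restrict (\<lambda>(i, j). X i j) ({1..n} \<times> {1..n})"

text \<open>
  Independence of two random elements with values in possibly different types
  (\<open>indep_var\<close> requires a common type).
\<close>

definition indep_elems ::
  "'a measure \<Rightarrow> 'b measure \<Rightarrow> ('a \<Rightarrow> 'b) \<Rightarrow> 'c measure \<Rightarrow> ('a \<Rightarrow> 'c) \<Rightarrow> bool" where
  "indep_elems M S X T Y \<longleftrightarrow>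
     X \<in> measurable M S \<and> Y \<in> measurable M T \<and>
     prob_space.indep_set M {X -` B \<inter> space M | B. B \<in> sets S} {Y -` B \<inter> space M | B. B \<in> sets T}"

definition indep_of_pair ::
  "'a measure \<Rightarrow> nat \<Rightarrow> ('a \<Rightarrow> matr) \<Rightarrow> ('a \<Rightarrow> vect) \<Rightarrow> ('a \<Rightarrow> matr) \<Rightarrow> bool" where
  "indep_of_pair M n X u Z \<longleftrightarrow>
     indep_elems M (mat_space n) (\<lambda>\<omega>. mat_elem n (X \<omega>))
       (vec_space n \<Otimes>\<^sub>M mat_space n) (\<lambda>\<omega>. (vec_elem n (u \<omega>), mat_elem n (Z \<omega>)))"

text \<open>
  Convergence in probability of (measurable) \<open>Y n\<close> to a constant; as only the individual laws matter, the n-th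
  variable may live on its own probability space.
\<close>

definition tendsto_in_prob :: "(nat \<Rightarrow> 'a measure) \<Rightarrow> (nat \<Rightarrow> 'a \<Rightarrow> real) \<Rightarrow> real \<Rightarrow> bool" where
  "tendsto_in_prob M Y c \<longleftrightarrow>
     (\<forall>\<epsilon>>0. (\<lambda>n. measure (M n) {\<omega>\<in>space (M n). \<bar>Y n \<omega> - c\<bar> > \<epsilon>}) \<longlonglongrightarrow> 0)"

end

theory Submission
  imports Defs "HOL-Real_Asymp.Real_Asymp"
begin

text \<open>
  Appending \<open>\<phi>\<close> to the sequence \<open>F\<close> turns \<open>\<Phi>\<close> into the mean of the coordinates of one more iterate.
  The iteration is stable in the normalized Euclidean norm as long as the operator norm of the
  matrix is bounded, so each \<open>F\<^sub>l\<close> may be replaced by a uniformly close function with bounded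
  derivatives. For smooth \<open>F\<close> the law of the entries is exchanged one entry at a time (Lindeberg). A
  single entry enters with weight \<open>1 / \<surd>n\<close>, the first two moments agree, and there are of order \<open>n\<^sup>2\<close>
  entries, so the mean of the coordinates must have a third-order Taylor remainder of order
  \<open>n\<^sup>-\<^sup>1 n\<^sup>-\<^sup>3\<^sup>/\<^sup>2\<close> up to logarithms. Its derivatives are
  computed backwards: pairing the linearized iteration with its adjoint expresses them through the
  coordinates of the iterates and of the adjoint vectors at the two affected indices, together
  with Euclidean norms. Both kinds of coordinates are polylogarithmic with high probability, since
  removing row and column \<open>i\<close> of the noise makes the row independent of the vectors it is applied to.
  The Efron-Stein inequality, fed with the same derivative bound, shows that the mean concentrates.
  All this is applied to the sine of the (rescaled) mean, which is bounded and so insensitive to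
  exceptional events, and conditionally on \<open>(u\<^sup>0, Z)\<close>.
\<close>

section \<open>Smoothing of Lipschitz functions\<close>

text \<open>No joint law of \<open>A\<close> and \<open>G\<close> is given, so comparing
  expectations is not enough: both means have to be close to one and the same function of the
  initialization, for which the expected sine under the law of \<open>G\<close> is taken. This
  forces a second-moment estimate, bias plus variance; for \<open>G\<close> itself it is obtained by
  comparing \<open>G\<close> with \<open>G\<close>. The obstacle is the backward recursion. Its
  coefficients are derivatives of the \<open>F l\<close> at the iterates, so removing a row changes
  coefficients and adjoint vectors at once. In the difference of their products one factor is small
  in Euclidean norm only, the other must be bounded in supremum norm, and this bound is needed for
  the matrix with the row already removed. Hence the induction runs over the levels, for all sets of
  remaining entries simultaneously, and every level multiplies the bound by a fixed multiple of the
  truncation level \<open>q\<close>. The choice \<open>q = (ln n)^2\<close> has two sides: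
  exponential tails of the initialization need \<open>n^2 * exp (- q / \<sigma>)\<close> to vanish
  for every \<open>\<sigma>\<close>, while powers of \<open>q\<close> must still lose against
  \<open>sqrt n\<close>.\<close>

definition ldist :: "nat \<Rightarrow> (nat \<Rightarrow> real) \<Rightarrow> (nat \<Rightarrow> real) \<Rightarrow> real" where
  "ldist m x y = (\<Sum>j<m. \<bar>x j - y j\<bar>)"

text \<open>The sum norm splits into moves of single coordinates, which suits the averages and
  Taylor bounds below; a Lipschitz bound in the Euclidean norm implies this one. The condition
  already forces \<open>f\<close> to ignore coordinates from \<open>m\<close> on.\<close>

definition lip :: "nat \<Rightarrow> real \<Rightarrow> ((nat \<Rightarrow> real) \<Rightarrow> real) \<Rightarrow> bool" where
  "lip m L f \<longleftrightarrow> (\<forall>x y. \<bar>f x - f y\<bar> \<le> L * ldist m x y)"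

lemma ldist_nonneg [simp]: "ldist m x y \<ge> 0"
  by (auto simp: ldist_def intro: sum_nonneg)

lemma ldist_shift: "ldist m (x(j := x j + s)) (y(j := y j + s)) = ldist m x y"
  unfolding ldist_def by (intro sum.cong) auto

lemma ldist_upd: "ldist m (x(j := s)) (x(j := t)) \<le> \<bar>s - t\<bar>"
proof -
  have "ldist m (x(j := s)) (x(j := t)) = (\<Sum>i<m. if i = j then \<bar>s - t\<bar> else 0)"
    unfolding ldist_def by (intro sum.cong) auto
  also have "\<dots> \<le> \<bar>s - t\<bar>"
    by (auto simp: sum.delta)
  finally show ?thesis .
qed

lemma lipD: "lip m L f \<Longrightarrow> \<bar>f x - f y\<bar> \<le> L * ldist m x y"
  by (simp add: lip_def)

lemma lip_mono: "lip m L f \<Longrightarrow> L \<le> L' \<Longrightarrow> lip m L' f"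
  unfolding lip_def by (meson ldist_nonneg mult_right_mono order_trans)

lemma lip_upd:
  assumes "lip m L f" "L \<ge> 0"
  shows "\<bar>f (x(j := s)) - f (x(j := t))\<bar> \<le> L * \<bar>s - t\<bar>"
  using lipD[OF assms(1), of "x(j := s)" "x(j := t)"] mult_left_mono[OF ldist_upd[of m x j s t] assms(2)]
  by linarith

lemma lip_continuous_upd:
  assumes "lip m L f" "L \<ge> 0"
  shows "continuous_on S (\<lambda>s. f (x(j := s)))"
proof -
  have "L-lipschitz_on UNIV (\<lambda>s. f (x(j := s)))"
    using lip_upd[OF assms] assms(2) by (auto simp: lipschitz_on_def dist_real_def)
  from lipschitz_on_continuous_on[OF this] show ?thesis
    using continuous_on_subset by blast
qed

lemma lip_continuous_shift:
  assumes "lip m L f" "L \<ge> 0"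
  shows "continuous_on S (\<lambda>s. f (x(j := x j + s)))"
  by (rule continuous_on_compose2[OF lip_continuous_upd[OF assms, of UNIV x j], of S "\<lambda>s. x j + s"])
     (auto intro!: continuous_intros)

text \<open>Convolution with the uniform density on a window of length \<open>h\<close> in direction
  \<open>j\<close>, one-sided so that its partial derivative in that direction is exactly the
  difference quotient \<open>slope\<close>.\<close>

definition av :: "real \<Rightarrow> nat \<Rightarrow> ((nat \<Rightarrow> real) \<Rightarrow> real) \<Rightarrow> (nat \<Rightarrow> real) \<Rightarrow> real" where
  "av h j f = (\<lambda>y. (1/h) * integral {0..h} (\<lambda>s. f (y(j := y j + s))))"

definition slope :: "real \<Rightarrow> nat \<Rightarrow> ((nat \<Rightarrow> real) \<Rightarrow> real) \<Rightarrow> (nat \<Rightarrow> real) \<Rightarrow> real" where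
  "slope h j f = (\<lambda>y. (1/h) * (f (y(j := y j + h)) - f y))"

lemma lip_integrable:
  assumes "lip m L f" "L \<ge> 0"
  shows "(\<lambda>s. f (x(j := x j + s))) integrable_on {a..b::real}"
  by (rule integrable_continuous_real[OF lip_continuous_shift[OF assms]])

text \<open>Allowing two functions and two base points at once lets the same estimate yield both the
  Lipschitz constant of an average and its distance to the averaged function.\<close>

lemma av_diff_bound:
  assumes f: "lip m L f" "L \<ge> 0" and g: "lip m L' g" "L' \<ge> 0" and h: "h > 0"
    and B: "\<And>s. 0 \<le> s \<Longrightarrow> s \<le> h \<Longrightarrow> \<bar>f (x(j := x j + s)) - g (y(j := y j + s))\<bar> \<le> B"
  shows "\<bar>av h j f x - av h j g y\<bar> \<le> B"
proof -
  have "integral {0..h} (\<lambda>s. f (x(j := x j + s))) - integral {0..h} (\<lambda>s. g (y(j := y j + s)))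
     = integral {0..h} (\<lambda>s. f (x(j := x j + s)) - g (y(j := y j + s)))"
    by (rule integral_diff[symmetric]) (auto intro!: lip_integrable[OF f] lip_integrable[OF g])
  moreover have "\<bar>integral {0..h} (\<lambda>s. f (x(j := x j + s)) - g (y(j := y j + s)))\<bar> \<le> B * (h - 0)"
    using integral_bound[of 0 h "\<lambda>s. f (x(j := x j + s)) - g (y(j := y j + s))" B, OF _
      continuous_on_diff[OF lip_continuous_shift[OF f] lip_continuous_shift[OF g]]] B h
    by auto
  moreover have "av h j f x - av h j g y
    = (1/h) * (integral {0..h} (\<lambda>s. f (x(j := x j + s))) - integral {0..h} (\<lambda>s. g (y(j := y j + s))))"
    by (simp add: av_def algebra_simps)
  ultimately have "\<bar>av h j f x - av h j g y\<bar> \<le> (1/h) * (B * h)"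
    using h by (simp add: abs_mult pos_divide_le_eq)
  thus ?thesis using h by simp
qed

lemma lip_av:
  assumes "lip m L f" "L \<ge> 0" "h > 0"
  shows "lip m L (av h j f)"
  unfolding lip_def
proof (intro allI)
  fix x y
  show "\<bar>av h j f x - av h j f y\<bar> \<le> L * ldist m x y"
    by (rule av_diff_bound[OF assms(1,2,1,2,3)]) (metis ldist_shift lipD[OF assms(1)])
qed

lemma lip_const: "lip m 0 (\<lambda>_. c)"
  by (simp add: lip_def)

lemma av_const: "h > 0 \<Longrightarrow> av h j (\<lambda>_. c) = (\<lambda>_. c)"
  by (auto simp: av_def)

lemma av_close:
  assumes "lip m L f" "L \<ge> 0" "h > 0"
  shows "\<bar>av h j f x - f x\<bar> \<le> L * h"
proof -
  have "\<bar>av h j f x - av h j (\<lambda>_. f x) x\<bar> \<le> L * h"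
  proof (rule av_diff_bound[OF assms(1,2) lip_const order_refl assms(3)])
    fix s assume "0 \<le> s" "s \<le> h"
    have "\<bar>f (x(j := x j + s)) - f (x(j := x j))\<bar> \<le> L * \<bar>x j + s - x j\<bar>"
      by (rule lip_upd[OF assms(1,2)])
    also have "\<dots> \<le> L * h" using \<open>0 \<le> s\<close> \<open>s \<le> h\<close> assms(2) by (intro mult_left_mono) auto
    finally show "\<bar>f (x(j := x j + s)) - f x\<bar> \<le> L * h" by simp
  qed
  thus ?thesis using assms(3) by (simp add: av_const)
qed

lemma lip_slope:
  assumes "lip m L f" "h > 0"
  shows "lip m (2*L/h) (slope h j f)"
  unfolding lip_def
proof (intro allI)
  fix x y
  have a: "\<bar>f (x(j := x j + h)) - f (y(j := y j + h))\<bar> \<le> L * ldist m x y"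
    using lipD[OF assms(1), of "x(j := x j + h)" "y(j := y j + h)"] by (simp only: ldist_shift)
  have "slope h j f x - slope h j f y
      = ((f (x(j := x j + h)) - f (y(j := y j + h))) - (f x - f y)) / h"
    by (simp add: slope_def diff_divide_distrib)
  also have "\<bar>\<dots>\<bar> \<le> (2 * L * ldist m x y) / h"
    using a lipD[OF assms(1), of x y] assms(2) by (simp add: abs_divide divide_right_mono)
  finally show "\<bar>slope h j f x - slope h j f y\<bar> \<le> 2 * L / h * ldist m x y" by simp
qed

lemma slope_bounded:
  assumes "lip m L f" "L \<ge> 0" "h > 0"
  shows "\<bar>slope h j f x\<bar> \<le> L"
proof -
  have "\<bar>f (x(j := x j + h)) - f (x(j := x j))\<bar> \<le> L * \<bar>x j + h - x j\<bar>"
    by (rule lip_upd[OF assms(1,2)])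
  thus ?thesis using assms(3) by (simp add: slope_def abs_mult field_simps)
qed

text \<open>Averages and difference quotients are built from shifts of single coordinates, and
  shifts commute, also when \<open>i = j\<close>.\<close>

lemma av_slope:
  assumes "lip m L f" "L \<ge> 0" "h > 0"
  shows "av h i (slope h j f) = slope h j (av h i f)"
proof
  fix y
  have eq: "(y(i := y i + s))(j := (y(i := y i + s)) j + h) = (y(j := y j + h))(i := (y(j := y j + h)) i + s)" for s
    by (auto simp: fun_eq_iff)
  have c: "continuous_on S (\<lambda>s. f ((y(j := y j + h))(i := (y(j := y j + h)) i + s)))" for S
    by (rule lip_continuous_shift[OF assms(1,2)])
  have "integral {0..h} (\<lambda>s. slope h j f (y(i := y i + s)))
    = (1/h) * integral {0..h} (\<lambda>s. f ((y(j := y j + h))(i := (y(j := y j + h)) i + s)) - f (y(i := y i + s)))"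
    by (simp only: slope_def eq integral_mult_right)
  also have "integral {0..h} (\<lambda>s. f ((y(j := y j + h))(i := (y(j := y j + h)) i + s)) - f (y(i := y i + s)))
    = integral {0..h} (\<lambda>s. f ((y(j := y j + h))(i := (y(j := y j + h)) i + s)))
      - integral {0..h} (\<lambda>s. f (y(i := y i + s)))"
    by (rule integral_diff) (intro lip_integrable[OF assms(1,2)])+
  finally have 1: "av h i (slope h j f) y = (1/h) * ((1/h) *
      (integral {0..h} (\<lambda>s. f ((y(j := y j + h))(i := (y(j := y j + h)) i + s)))
       - integral {0..h} (\<lambda>s. f (y(i := y i + s)))))"
    by (simp only: av_def)
  show "av h i (slope h j f) y = slope h j (av h i f) y"
    unfolding 1 by (simp only: av_def slope_def right_diff_distrib)
qed

text \<open>Fubini on a square, with joint continuity from the Lipschitz bound. It is needed to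
  bring the average in any chosen coordinate to the outside, where it can be differentiated.\<close>

lemma av_commute:
  assumes "lip m L f" "L \<ge> 0" "h > 0"
  shows "av h i (av h j f) = av h j (av h i f)"
proof (cases "i = j")
  case False
  show ?thesis
  proof
    fix y
    define k where "k = (\<lambda>s t. f (y(i := y i + s, j := y j + t)))"
    have "continuous_on (cbox (0,0) (h,h)) (\<lambda>(s,t). k s t)"
    proof -
      have "\<bar>k s t - k s' t'\<bar> \<le> 2 * L * dist (s,t) (s',t')" for s t s' t'
      proof -
        have 1: "\<bar>k s t - k s' t\<bar> \<le> L * \<bar>s - s'\<bar>"
          unfolding k_def using lip_upd[OF assms(1,2), of "y(j := y j + t)" i "y i + s" "y i + s'"] False
          by (simp add: fun_upd_twist)
        have 2: "\<bar>k s' t - k s' t'\<bar> \<le> L * \<bar>t - t'\<bar>"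
          unfolding k_def using lip_upd[OF assms(1,2), of "y(i := y i + s')" j "y j + t" "y j + t'"] False
          by simp
        have 3: "\<bar>s - s'\<bar> \<le> dist (s,t) (s',t')" "\<bar>t - t'\<bar> \<le> dist (s,t) (s',t')"
          using dist_fst_le[of "(s,t)" "(s',t')"] dist_snd_le[of "(s,t)" "(s',t')"]
          by (simp_all add: dist_real_def)
        show ?thesis using 1 2 mult_left_mono[OF 3(1) assms(2)] mult_left_mono[OF 3(2) assms(2)] by linarith
      qed
      hence "(2*L)-lipschitz_on (cbox (0,0) (h,h)) (\<lambda>(s,t). k s t)"
        using assms(2) by (auto simp: lipschitz_on_def dist_real_def)
      thus ?thesis by (rule lipschitz_on_continuous_on)
    qed
    from integral_swap_continuous[OF this]
    have sw: "integral {0..h} (\<lambda>s. integral {0..h} (k s)) = integral {0..h} (\<lambda>t. integral {0..h} (\<lambda>s. k s t))"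
      by simp
    have "av h i (av h j f) y = (1/h) * ((1/h) * integral {0..h} (\<lambda>s. integral {0..h} (k s)))"
      using False by (simp add: av_def k_def fun_upd_twist)
    also have "\<dots> = (1/h) * ((1/h) * integral {0..h} (\<lambda>t. integral {0..h} (\<lambda>s. k s t)))"
      by (simp only: sw)
    also have "\<dots> = av h j (av h i f) y"
      using False by (simp add: av_def k_def fun_upd_twist)
    finally show "av h i (av h j f) y = av h j (av h i f) y" .
  qed
qed simp

text \<open>Fundamental theorem of calculus: the average is \<open>(G (t + h) - G t) / h\<close> for
  an antiderivative \<open>G\<close> of the section of \<open>f\<close> in coordinate
  \<open>j\<close>.\<close>

lemma av_deriv:
  assumes "lip m L f" "L \<ge> 0" "h > 0"
  shows "((\<lambda>t. av h j f (y(j := t))) has_real_derivative slope h j f (y(j := t))) (at t)"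
proof -
  define g where "g = (\<lambda>s. f (y(j := s)))"
  have cg: "continuous_on S g" for S unfolding g_def by (rule lip_continuous_upd[OF assms(1,2)])
  \<comment> \<open>Any base point left of \<open>t\<close> will do: the antiderivative must exist
    on a two-sided neighbourhood of \<open>t\<close>.\<close>
  define a where "a = t - 1"
  define G where "G = (\<lambda>u. integral {a..u} g)"
  have G: "(G has_real_derivative g u) (at u)" if "u > a" for u
  proof -
    have "(G has_real_derivative g u) (at u within {a..u+1})"
      unfolding G_def using that by (intro integral_has_real_derivative[OF cg]) auto
    thus ?thesis using that at_within_interior[of u "{a..u+1}"] by simp
  qed
  have eq: "av h j f (y(j := u)) = (1/h) * (G (u + h) - G u)" if "u > a" for u
  proof -
    have i: "g integrable_on {u..v}" for u v by (rule integrable_continuous_real[OF cg])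
    have "integral {0..h} (\<lambda>s. g (u + s)) = integral {u..u+h} g"
      using integral_shift_Icc_real[of 0 h g u] by (simp add: o_def add.commute)
    moreover have "integral {a..u} g + integral {u..u+h} g = integral {a..u+h} g"
      using that assms(3) by (intro Henstock_Kurzweil_Integration.integral_combine i) auto
    ultimately show ?thesis by (simp add: av_def g_def G_def)
  qed
  have "((\<lambda>u. (1/h) * (G (u + h) - G u)) has_real_derivative (1/h) * (g (t + h) - g t)) (at t)"
    using assms(3) by (auto intro!: derivative_eq_intros DERIV_chain2[OF G] G simp: a_def)
  hence "((\<lambda>u. av h j f (y(j := u))) has_real_derivative (1/h) * (g (t + h) - g t)) (at t)"
    by (rule has_field_derivative_transform_within_open[where S = "{a<..}"]) (auto simp: eq a_def)
  thus ?thesis by (simp add: slope_def g_def)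
qed

section \<open>Repeated averaging over several coordinates\<close>

definition avl :: "real \<Rightarrow> nat list \<Rightarrow> ((nat \<Rightarrow> real) \<Rightarrow> real) \<Rightarrow> (nat \<Rightarrow> real) \<Rightarrow> real" where
  "avl h js f = foldr (av h) js f"

lemma avl_simps [simp]: "avl h [] f = f" "avl h (j # js) f = av h j (avl h js f)"
  by (simp_all add: avl_def)

lemma lip_avl:
  assumes "lip m L f" "L \<ge> 0" "h > 0"
  shows "lip m L (avl h js f)"
  by (induction js) (auto intro: lip_av assms)

lemma avl_close:
  fixes L :: real
  assumes "lip m L f" "L \<ge> 0" "h > 0"
  shows "\<bar>avl h js f x - f x\<bar> \<le> length js * (L * h)"
proof (induction js arbitrary: x)
  case (Cons j js)
  have "\<bar>av h j (avl h js f) x - avl h js f x\<bar> \<le> L * h"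
    by (rule av_close[OF lip_avl[OF assms] assms(2,3)])
  with Cons[of x] show ?case by (simp add: algebra_simps)
qed auto

lemma avl_slope:
  assumes "lip m L f" "L \<ge> 0" "h > 0"
  shows "avl h js (slope h j f) = slope h j (avl h js f)"
  by (induction js) (use av_slope[OF lip_avl[OF assms] assms(2,3)] in auto)

lemma avl_av:
  assumes "lip m L f" "L \<ge> 0" "h > 0"
  shows "avl h js (av h j f) = av h j (avl h js f)"
proof (induction js)
  case (Cons i js)
  thus ?case using av_commute[OF lip_avl[OF assms] assms(2,3), of i j js] by simp
qed auto

lemma avl_commute:
  assumes "lip m L f" "L \<ge> 0" "h > 0"
  shows "avl h js (avl h is f) = avl h is (avl h js f)"
proof (induction js)
  case (Cons j js)
  thus ?case using avl_av[OF lip_avl[OF assms] assms(2,3), of "is" j js] by simp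
qed auto

lemma avl_remove1:
  assumes "lip m L f" "L \<ge> 0" "h > 0" "j \<in> set js"
  shows "avl h js f = av h j (avl h (remove1 j js) f)"
  using assms(4)
proof (induction js)
  case (Cons i js)
  show ?case
  proof (cases "i = j")
    case False
    with Cons have "avl h js f = av h j (avl h (remove1 j js) f)" by simp
    with False show ?thesis
      using av_commute[OF lip_avl[OF assms(1-3)] assms(2,3), of i j "remove1 j js"] by simp
  qed simp
qed auto

text \<open>The partial derivative of \<open>avl h js f\<close> in a direction \<open>j\<close> of
  the list: one average over \<open>j\<close> is used up and becomes a difference quotient, the
  other averages stay.\<close>

definition dav :: "real \<Rightarrow> nat list \<Rightarrow> nat \<Rightarrow> ((nat \<Rightarrow> real) \<Rightarrow> real) \<Rightarrow> (nat \<Rightarrow> real) \<Rightarrow> real" where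
  "dav h js j f = slope h j (avl h (remove1 j js) f)"

lemma lip_dav: "lip m L f \<Longrightarrow> L \<ge> 0 \<Longrightarrow> h > 0 \<Longrightarrow> lip m (2 * L / h) (dav h js j f)"
  unfolding dav_def by (intro lip_slope lip_avl)

lemma dav_bounded: "lip m L f \<Longrightarrow> L \<ge> 0 \<Longrightarrow> h > 0 \<Longrightarrow> \<bar>dav h js j f x\<bar> \<le> L"
  unfolding dav_def by (intro slope_bounded lip_avl)

lemma avl_deriv:
  assumes "lip m L f" "L \<ge> 0" "h > 0" "j \<in> set js"
  shows "((\<lambda>t. avl h js f (y(j := t))) has_real_derivative dav h js j f (y(j := t))) (at t)"
  unfolding avl_remove1[OF assms] dav_def by (rule av_deriv[OF lip_avl[OF assms(1-3)] assms(2,3)])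

lemma avl_dav:
  assumes "lip m L f" "L \<ge> 0" "h > 0"
  shows "dav h js j (avl h is f) = avl h is (dav h js j f)"
  unfolding dav_def avl_commute[OF assms, of "remove1 j js" "is"]
  by (rule avl_slope[OF lip_avl[OF assms] assms(2,3), symmetric])

text \<open>Moving one coordinate at a time reduces the claim to the mean value theorem on segments,
  so Lipschitz partial derivatives suffice and a total derivative never appears.\<close>

lemma taylor1_partial:
  assumes g: "lip m L g" and D: "\<And>j. j < m \<Longrightarrow> lip m C (D j)" and C: "C \<ge> 0"
    and der: "\<And>j y t. j < m \<Longrightarrow> ((\<lambda>t. g (y(j := t))) has_real_derivative D j (y(j := t))) (at t)"
  shows "\<bar>g y - g x - (\<Sum>j<m. D j x * (y j - x j))\<bar> \<le> C * (ldist m x y)\<^sup>2"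
proof -
  \<comment> \<open>Interpolates from \<open>x\<close> to \<open>y\<close>: the coordinates below
    \<open>i\<close> are already those of \<open>y\<close>.\<close>
  define z where "z = (\<lambda>i j. if j < i then y j else x j)"
  have gz0: "g (z 0) = g x" by (simp add: z_def)
  have gzm: "g (z m) = g y"
    using lipD[OF g, of "z m" y] by (simp add: z_def ldist_def)
  have step: "\<bar>g (z (Suc i)) - g (z i) - D i x * (y i - x i)\<bar> \<le> C * ldist m x y * \<bar>y i - x i\<bar>"
    if i: "i < m" for i
  proof -
    have zz: "z (Suc i) = (z i)(i := y i)" "z i = (z i)(i := x i)"
      by (auto simp: z_def fun_eq_iff less_Suc_eq)
    have dist: "ldist m ((z i)(i := t)) x \<le> ldist m x y" if "t \<in> closed_segment (x i) (y i)" for t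
      unfolding ldist_def using that
      by (intro sum_mono) (auto simp: z_def closed_segment_eq_real_ivl split: if_splits)
    have "\<bar>(g ((z i)(i := y i)) - y i * D i x) - (g ((z i)(i := x i)) - x i * D i x)\<bar>
       \<le> (C * ldist m x y) * \<bar>y i - x i\<bar>"
    proof -
      have "norm ((g ((z i)(i := y i)) - y i * D i x) - (g ((z i)(i := x i)) - x i * D i x))
         \<le> (C * ldist m x y) * norm (y i - x i)"
      proof (rule field_differentiable_bound[where S = "closed_segment (x i) (y i)" and
            f' = "\<lambda>t. D i ((z i)(i := t)) - D i x"])
        fix t assume t: "t \<in> closed_segment (x i) (y i)"
        show "((\<lambda>t. g ((z i)(i := t)) - t * D i x) has_field_derivative D i ((z i)(i := t)) - D i x)
            (at t within closed_segment (x i) (y i))"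
          by (rule DERIV_subset[of _ _ _ UNIV]) (auto intro!: derivative_eq_intros der[OF i])
        have "\<bar>D i ((z i)(i := t)) - D i x\<bar> \<le> C * ldist m ((z i)(i := t)) x"
          by (rule lipD[OF D[OF i]])
        also have "\<dots> \<le> C * ldist m x y"
          by (intro mult_left_mono dist[OF t] C)
        finally show "norm (D i ((z i)(i := t)) - D i x) \<le> C * ldist m x y" by simp
      qed auto
      thus ?thesis by simp
    qed
    moreover have "g (z (Suc i)) = g ((z i)(i := y i))" "g (z i) = g ((z i)(i := x i))"
      using zz by metis+
    ultimately show ?thesis by (simp add: algebra_simps)
  qed
  have "(\<Sum>i<m. g (z (Suc i)) - g (z i)) = g y - g x"
    using sum_lessThan_telescope[of "\<lambda>i. g (z i)" m] gz0 gzm by simp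
  hence "\<bar>g y - g x - (\<Sum>j<m. D j x * (y j - x j))\<bar>
     = \<bar>\<Sum>i<m. g (z (Suc i)) - g (z i) - D i x * (y i - x i)\<bar>"
    by (simp add: sum_subtractf)
  also have "\<dots> \<le> (\<Sum>i<m. C * ldist m x y * \<bar>y i - x i\<bar>)"
    by (rule order_trans[OF sum_abs sum_mono]) (use step in auto)
  also have "\<dots> = C * (ldist m x y)\<^sup>2"
    by (simp add: sum_distrib_left[symmetric] power2_eq_square ldist_def abs_minus_commute)
  finally show ?thesis .
qed

text \<open>Along the segment from \<open>x\<close> to \<open>y\<close> the first-order bound for
  \<open>g\<close> identifies the derivative of \<open>g\<close>, and the first-order bound for each
  \<open>D j\<close> controls how far that derivative is from its linearization; the mean value
  theorem then gains one more order.\<close>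

lemma taylor2_partial:
  assumes g: "lip m L g" and D: "\<And>j. j < m \<Longrightarrow> lip m C (D j)" and C: "C \<ge> 0" and C': "C' \<ge> 0"
    and H: "\<And>i j. i < m \<Longrightarrow> j < m \<Longrightarrow> lip m C' (H i j)"
    and der: "\<And>j y t. j < m \<Longrightarrow> ((\<lambda>t. g (y(j := t))) has_real_derivative D j (y(j := t))) (at t)"
    and der2: "\<And>i j y t. i < m \<Longrightarrow> j < m \<Longrightarrow>
      ((\<lambda>t. D j (y(i := t))) has_real_derivative H i j (y(i := t))) (at t)"
  shows "\<bar>g y - g x - (\<Sum>j<m. D j x * (y j - x j))
     - (\<Sum>j<m. \<Sum>i<m. H i j x / 2 * (y i - x i) * (y j - x j))\<bar> \<le> C' * (ldist m x y)^3"
proof -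
  define d where "d = (\<lambda>j. y j - x j)"
  define p where "p = (\<lambda>t::real. \<lambda>j. x j + t * d j)"
  define Q where "Q = (\<Sum>j<m. \<Sum>i<m. H i j x * d i * d j)"
  have ld: "ldist m (p s) (p t) = \<bar>s - t\<bar> * ldist m x y" for s t
  proof -
    have "\<bar>p s j - p t j\<bar> = \<bar>s - t\<bar> * \<bar>x j - y j\<bar>" for j
    proof -
      have "p s j - p t j = (s - t) * (y j - x j)" by (simp add: p_def d_def algebra_simps)
      thus ?thesis by (simp add: abs_mult abs_minus_commute)
    qed
    thus ?thesis by (simp add: ldist_def sum_distrib_left)
  qed
  have p0: "p 0 = x" and p1: "p 1 = y" by (auto simp: p_def d_def)
  have der_p: "((\<lambda>t. g (p t)) has_real_derivative (\<Sum>j<m. D j (p t) * d j)) (at t)" for t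
  proof -
    have bnd: "\<bar>g (p s) - g (p t) - (s - t) * (\<Sum>j<m. D j (p t) * d j)\<bar>
       \<le> C * (ldist m x y)\<^sup>2 * (s - t)\<^sup>2" for s
      using taylor1_partial[OF g D C der, of "p s" "p t"] ld[of t s]
      by (simp add: p_def sum_distrib_left algebra_simps power_mult_distrib power2_commute)
    have "((\<lambda>s. (g (p s) - g (p t)) / (s - t) - (\<Sum>j<m. D j (p t) * d j)) \<longlongrightarrow> 0) (at t)"
    proof (rule Lim_null_comparison)
      show "eventually (\<lambda>s. norm ((g (p s) - g (p t)) / (s - t) - (\<Sum>j<m. D j (p t) * d j))
          \<le> C * (ldist m x y)\<^sup>2 * \<bar>s - t\<bar>) (at t)"
        unfolding eventually_at_filter
      proof (intro always_eventually allI impI)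
        fix s assume "s \<noteq> t"
        hence "(g (p s) - g (p t)) / (s - t) - (\<Sum>j<m. D j (p t) * d j)
          = (g (p s) - g (p t) - (s - t) * (\<Sum>j<m. D j (p t) * d j)) / (s - t)"
          by (simp add: field_simps)
        also have "\<bar>\<dots>\<bar> \<le> (C * (ldist m x y)\<^sup>2 * (s - t)\<^sup>2) / \<bar>s - t\<bar>"
          unfolding abs_divide by (intro divide_right_mono bnd) auto
        also have "\<dots> = C * (ldist m x y)\<^sup>2 * \<bar>s - t\<bar>"
          using \<open>s \<noteq> t\<close> by (simp add: power2_eq_square field_simps abs_if)
        finally show "norm ((g (p s) - g (p t)) / (s - t) - (\<Sum>j<m. D j (p t) * d j))
          \<le> C * (ldist m x y)\<^sup>2 * \<bar>s - t\<bar>" by simp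
      qed
      have "((\<lambda>s. C * (ldist m x y)\<^sup>2 * \<bar>s - t\<bar>) \<longlongrightarrow> C * (ldist m x y)\<^sup>2 * \<bar>t - t\<bar>) (at t)"
        by (intro tendsto_intros)
      thus "((\<lambda>s. C * (ldist m x y)\<^sup>2 * \<bar>s - t\<bar>) \<longlongrightarrow> 0) (at t)" by simp
    qed
    thus ?thesis unfolding has_field_derivative_iff using LIM_zero_iff by blast
  qed
  \<comment> \<open>\<open>g\<close> on the segment minus the linear and quadratic terms, so that
    \<open>k 1 - k 0\<close> is the remainder to be bounded.\<close>
  define k where "k = (\<lambda>t. g (p t) - t * (\<Sum>j<m. D j x * d j) - t\<^sup>2 / 2 * Q)"
  have "norm (k 1 - k 0) \<le> C' * (ldist m x y)^3 * norm (1 - 0 :: real)"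
  proof (rule field_differentiable_bound[where S = "{0..1}" and
        f' = "\<lambda>t. (\<Sum>j<m. D j (p t) * d j) - (\<Sum>j<m. D j x * d j) - t * Q"])
    fix t :: real assume t: "t \<in> {0..1}"
    show "(k has_field_derivative (\<Sum>j<m. D j (p t) * d j) - (\<Sum>j<m. D j x * d j) - t * Q)
        (at t within {0..1})"
      unfolding k_def
      by (rule DERIV_subset[of _ _ _ UNIV]) (auto intro!: derivative_eq_intros der_p)
    have "(\<Sum>j<m. D j (p t) * d j) - (\<Sum>j<m. D j x * d j) - t * Q
      = (\<Sum>j<m. (D j (p t) - D j x - (\<Sum>i<m. H i j x * (p t i - x i))) * d j)"
    proof -
      have "(\<Sum>j<m. D j (p t) * d j) - (\<Sum>j<m. D j x * d j) - t * Q
         = (\<Sum>j<m. D j (p t) * d j - D j x * d j - t * (\<Sum>i<m. H i j x * d i * d j))"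
        by (simp only: Q_def sum_subtractf sum_distrib_left[of t])
      also have "\<dots> = (\<Sum>j<m. (D j (p t) - D j x - (\<Sum>i<m. H i j x * (p t i - x i))) * d j)"
      proof (rule sum.cong[OF refl])
        fix j
        have "t * (\<Sum>i<m. H i j x * d i * d j) = (\<Sum>i<m. H i j x * (p t i - x i)) * d j"
          unfolding sum_distrib_left sum_distrib_right by (rule sum.cong) (auto simp: p_def)
        thus "D j (p t) * d j - D j x * d j - t * (\<Sum>i<m. H i j x * d i * d j)
          = (D j (p t) - D j x - (\<Sum>i<m. H i j x * (p t i - x i))) * d j"
          by (simp add: left_diff_distrib)
      qed
      finally show ?thesis .
    qed
    also have "\<bar>\<dots>\<bar> \<le> (\<Sum>j<m. C' * (ldist m x y)\<^sup>2 * \<bar>d j\<bar>)"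
    proof (rule order_trans[OF sum_abs sum_mono])
      fix j assume "j \<in> {..<m}"
      hence j: "j < m" by simp
      have "\<bar>D j (p t) - D j x - (\<Sum>i<m. H i j x * (p t i - x i))\<bar> \<le> C' * (ldist m x (p t))\<^sup>2"
        by (rule taylor1_partial[OF D[OF j] H[OF _ j] C' der2[OF _ j]])
      also have "\<dots> \<le> C' * (ldist m x y)\<^sup>2"
      proof -
        have "ldist m x (p t) = t * ldist m x y" using ld[of 0 t] t by (simp add: p0)
        thus ?thesis using t C'
          by (intro mult_left_mono power_mono) (auto simp: mult_left_le_one_le)
      qed
      finally show "\<bar>(D j (p t) - D j x - (\<Sum>i<m. H i j x * (p t i - x i))) * d j\<bar>
          \<le> C' * (ldist m x y)\<^sup>2 * \<bar>d j\<bar>"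
        by (simp add: abs_mult mult_right_mono)
    qed
    also have "\<dots> = C' * (ldist m x y)^3"
      by (simp add: sum_distrib_left[symmetric] power2_eq_square power3_eq_cube ldist_def d_def abs_minus_commute)
    finally show "norm ((\<Sum>j<m. D j (p t) * d j) - (\<Sum>j<m. D j x * d j) - t * Q) \<le> C' * (ldist m x y)^3"
      by simp
  qed auto
  moreover have "k 1 - k 0 = g y - g x - (\<Sum>j<m. D j x * (y j - x j))
     - (\<Sum>j<m. \<Sum>i<m. H i j x / 2 * (y i - x i) * (y j - x j))"
    by (simp add: k_def p0 p1 Q_def d_def sum_divide_distrib)
  ultimately show ?thesis by simp
qed

text \<open>The quadratic term carries no factor \<open>1/2\<close>: \<open>H i j\<close> is half of the second partial derivative.\<close>

definition smooth :: "nat \<Rightarrow> real \<Rightarrow> ((nat \<Rightarrow> real) \<Rightarrow> real) \<Rightarrow> (nat \<Rightarrow> (nat \<Rightarrow> real) \<Rightarrow> real)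
    \<Rightarrow> (nat \<Rightarrow> nat \<Rightarrow> (nat \<Rightarrow> real) \<Rightarrow> real) \<Rightarrow> bool" where
  "smooth m C g D H \<longleftrightarrow> C \<ge> 0 \<and> lip m C g \<and>
     (\<forall>j<m. lip m C (D j) \<and> (\<forall>x. \<bar>D j x\<bar> \<le> C)) \<and>
     (\<forall>i<m. \<forall>j<m. \<forall>x. \<bar>H i j x\<bar> \<le> C) \<and>
     (\<forall>x y. \<bar>g y - g x - (\<Sum>j<m. D j x * (y j - x j))\<bar> \<le> C * (ldist m x y)\<^sup>2) \<and>
     (\<forall>x y. \<bar>g y - g x - (\<Sum>j<m. D j x * (y j - x j))
        - (\<Sum>j<m. \<Sum>i<m. H i j x * (y i - x i) * (y j - x j))\<bar> \<le> C * (ldist m x y)^3)"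

lemma smooth_mono:
  assumes "smooth m C g D H" "C \<le> C'"
  shows "smooth m C' g D H"
proof -
  have *: "a \<le> C * b \<Longrightarrow> b \<ge> 0 \<Longrightarrow> a \<le> C' * b" for a b
    using mult_right_mono[OF assms(2), of b] by linarith
  note A = assms(1)[unfolded smooth_def]
  show ?thesis
    unfolding smooth_def
  proof (intro conjI allI impI)
    show "C' \<ge> 0" "lip m C' g" using A assms(2) lip_mono by auto
    show "lip m C' (D j)" if "j < m" for j using lip_mono[OF _ assms(2)] A that by auto
    show "\<bar>D j x\<bar> \<le> C'" if "j < m" for j x by (rule order_trans[OF _ assms(2)]) (use A that in auto)
    show "\<bar>H i j x\<bar> \<le> C'" if "i < m" "j < m" for i j x
      by (rule order_trans[OF _ assms(2)]) (use A that in auto)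
    show "\<bar>g y - g x - (\<Sum>j<m. D j x * (y j - x j))\<bar> \<le> C' * (ldist m x y)\<^sup>2" for x y
      by (rule *) (use A in auto)
    show "\<bar>g y - g x - (\<Sum>j<m. D j x * (y j - x j))
        - (\<Sum>j<m. \<Sum>i<m. H i j x * (y i - x i) * (y j - x j))\<bar> \<le> C' * (ldist m x y)^3" for x y
      by (rule *) (use A in auto)
  qed
qed

text \<open>Every coordinate is averaged twice. After one round the partial derivatives exist but
  are mere difference quotients; after two rounds each of them is itself an average and can be
  differentiated again, with Lipschitz constants of order \<open>1 / h\<close> and
  \<open>1 / h^2\<close>.\<close>

theorem smooth_approx:
  assumes f: "lip m L f" and e: "e > 0"
  shows "\<exists>g D H C. smooth m C g D H \<and> (\<forall>x. \<bar>f x - g x\<bar> \<le> e)"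
proof -
  define L' where "L' = max L 1"
  have f: "lip m L' f" and L: "L' \<ge> 0" "L' > 0" using f by (auto simp: L'_def intro: lip_mono)
  \<comment> \<open>There are \<open>2 * m\<close> averages, and each moves the function by at most
    \<open>L' * h\<close>.\<close>
  define h where "h = e / (2 * (real m + 1) * L')"
  have h: "h > 0" using e L by (simp add: h_def)
  define js where "js = [0..<m]"
  define g where "g = avl h js (avl h js f)"
  define D where "D = (\<lambda>j. dav h js j (avl h js f))"
  define H where "H = (\<lambda>i j. dav h js i (dav h js j f))"
  define C where "C = max L' (2 * (2 * L' / h) / h) + 2 * L' / h"
  have lf: "lip m L' (avl h js f)" by (rule lip_avl[OF f L(1) h])
  have lD: "lip m (2 * L' / h) (dav h js j f)" for j by (rule lip_dav[OF f L(1) h])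
  have L2: "2 * L' / h \<ge> 0" using L h by simp
  \<comment> \<open>Pulls one complete round of averages out of the derivative; this is what makes
    \<open>D j\<close> differentiable.\<close>
  have D': "D j = avl h js (dav h js j f)" for j unfolding D_def by (rule avl_dav[OF f L(1) h])
  have g1: "lip m L' g" unfolding g_def by (rule lip_avl[OF lf L(1) h])
  have D1: "lip m (2 * L' / h) (D j)" for j unfolding D_def by (rule lip_dav[OF lf L(1) h])
  have H1: "lip m (2 * (2 * L' / h) / h) (H i j)" for i j
    unfolding H_def by (rule lip_dav[OF lD L2 h])
  have H2: "\<bar>H i j x\<bar> \<le> 2 * L' / h" for i j x
    unfolding H_def by (rule dav_bounded[OF lD L2 h])
  have D2: "\<bar>D j x\<bar> \<le> L'" for j x
    unfolding D_def by (rule dav_bounded[OF lf L(1) h])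
  have dg: "((\<lambda>t. g (y(j := t))) has_real_derivative D j (y(j := t))) (at t)" if "j < m" for j y t
    unfolding g_def D_def using that by (intro avl_deriv[OF lf L(1) h]) (simp add: js_def)
  have dD: "((\<lambda>t. D j (y(i := t))) has_real_derivative H i j (y(i := t))) (at t)" if "i < m" for i j y t
    unfolding D' H_def using that by (intro avl_deriv[OF lD L2 h]) (simp add: js_def)
  have L3: "2 * (2 * L' / h) / h \<ge> 0" using L(1) h by (intro divide_nonneg_nonneg mult_nonneg_nonneg) auto
  have C: "L' \<le> C" "2 * L' / h \<le> C" "2 * (2 * L' / h) / h \<le> C" "C \<ge> 0"
    using L L2 L3 by (auto simp: C_def)
  have mul: "a \<le> c * b \<Longrightarrow> c \<le> C \<Longrightarrow> b \<ge> 0 \<Longrightarrow> a \<le> C * b" for a b c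
    by (meson mult_right_mono order_trans)
  have "smooth m C g D (\<lambda>i j x. H i j x / 2)"
    unfolding smooth_def
  proof (intro conjI allI impI)
    show "C \<ge> 0" by fact
    show "lip m C g" using g1 C lip_mono by blast
    show "lip m C (D j)" for j using D1 C lip_mono by blast
    show "\<bar>D j x\<bar> \<le> C" for j x using D2[of j x] C by linarith
    show "\<bar>H i j x / 2\<bar> \<le> C" for i j x using H2[of i j x] C by (simp add: abs_divide)
    show "\<bar>g y - g x - (\<Sum>j<m. D j x * (y j - x j))\<bar> \<le> C * (ldist m x y)\<^sup>2" for x y
      by (rule mul[OF taylor1_partial[OF g1 D1 L2 dg] C(2)]) auto
    show "\<bar>g y - g x - (\<Sum>j<m. D j x * (y j - x j))
        - (\<Sum>j<m. \<Sum>i<m. H i j x / 2 * (y i - x i) * (y j - x j))\<bar> \<le> C * (ldist m x y)^3" for x y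
      by (rule mul[OF taylor2_partial[OF g1 D1 L2 L3 H1 dg dD] C(3)]) auto
  qed
  moreover have "\<bar>f x - g x\<bar> \<le> e" for x
  proof -
    have "\<bar>g x - avl h js f x\<bar> \<le> m * (L' * h)" "\<bar>avl h js f x - f x\<bar> \<le> m * (L' * h)"
      unfolding g_def using avl_close[OF lf L(1) h, of js x] avl_close[OF f L(1) h, of js x]
      by (simp_all add: js_def)
    hence "\<bar>f x - g x\<bar> \<le> 2 * m * (L' * h)" by linarith
    also have "L' * h = e / (2 * (real m + 1))" using L by (simp add: h_def)
    also have "2 * m * (e / (2 * (real m + 1))) = e * (m / (real m + 1))" by (simp add: field_simps)
    also have "\<dots> \<le> e * 1" using e by (intro mult_left_mono) (auto simp: field_simps)
    finally show ?thesis by simp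
  qed
  ultimately show ?thesis by blast
qed

section \<open>Iterates, their stability, and the adjoint recursion\<close>

definition nrm :: "nat \<Rightarrow> vect \<Rightarrow> real" where
  "nrm n v = L2_set v {1..n}"

definition opn :: "nat \<Rightarrow> matr \<Rightarrow> real \<Rightarrow> bool" where
  "opn n B K \<longleftrightarrow> (\<forall>v. nrm n (mat_vec n B v) \<le> K * nrm n v)"

lemma nrm_nonneg [simp]: "nrm n v \<ge> 0"
  by (simp add: nrm_def)

lemma nrm_mono: "(\<And>i. i \<in> {1..n} \<Longrightarrow> \<bar>f i\<bar> \<le> \<bar>g i\<bar>) \<Longrightarrow> nrm n f \<le> nrm n g"
  unfolding nrm_def L2_set_def by (intro real_sqrt_le_mono sum_mono) (simp add: abs_le_square_iff)

lemma nrm_cong: "(\<And>i. i \<in> {1..n} \<Longrightarrow> f i = g i) \<Longrightarrow> nrm n f = nrm n g"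
  unfolding nrm_def by (rule L2_set_cong) auto

lemma nrm_abs [simp]: "nrm n (\<lambda>i. \<bar>f i\<bar>) = nrm n f"
  by (simp add: nrm_def L2_set_def)

lemma nrm_0 [simp]: "nrm n (\<lambda>_. 0) = 0"
  by (simp add: nrm_def L2_set_def)

lemma nrm_add: "nrm n (\<lambda>i. f i + g i) \<le> nrm n f + nrm n g"
  unfolding nrm_def by (rule L2_set_triangle_ineq)

lemma nrm_minus: "nrm n (\<lambda>i. - f i) = nrm n f"
  by (simp add: nrm_def L2_set_def)

lemma nrm_minus_commute: "nrm n (\<lambda>i. f i - g i) = nrm n (\<lambda>i. g i - f i)"
  by (simp add: nrm_def L2_set_def power2_commute)

lemma nrm_diff: "nrm n (\<lambda>i. f i - g i) \<le> nrm n f + nrm n g"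
  using nrm_add[of n f "\<lambda>i. - g i"] by (simp add: nrm_minus)

lemma nrm_cmult: "nrm n (\<lambda>i. c * f i) = \<bar>c\<bar> * nrm n f"
  by (simp add: nrm_def L2_set_def power_mult_distrib real_sqrt_mult flip: sum_distrib_left)

lemma nrm_sum: "nrm n (\<lambda>i. \<Sum>j\<in>S. f j i) \<le> (\<Sum>j\<in>S. nrm n (f j))"
proof (induction S rule: infinite_finite_induct)
  case (insert x F)
  have "nrm n (\<lambda>i. \<Sum>j\<in>insert x F. f j i) = nrm n (\<lambda>i. f x i + (\<Sum>j\<in>F. f j i))"
    using insert by simp
  also have "\<dots> \<le> nrm n (f x) + nrm n (\<lambda>i. \<Sum>j\<in>F. f j i)" by (rule nrm_add)
  finally show ?case using insert by simp
qed auto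

lemma nrm_const: "nrm n (\<lambda>_. c) = \<bar>c\<bar> * sqrt (real n)"
  by (simp add: nrm_def L2_set_def real_sqrt_mult mult.commute)

lemma nrm_bound:
  assumes "\<And>i. i \<in> {1..n} \<Longrightarrow> \<bar>f i\<bar> \<le> c" "c \<ge> 0"
  shows "nrm n f \<le> c * sqrt (real n)"
  using nrm_mono[of n f "\<lambda>_. c"] assms by (simp add: nrm_const)

lemma nrm_mult_le:
  assumes "\<And>i. i \<in> {1..n} \<Longrightarrow> \<bar>p i\<bar> \<le> c" "c \<ge> 0"
  shows "nrm n (\<lambda>i. p i * f i) \<le> c * nrm n f"
proof -
  have "nrm n (\<lambda>i. p i * f i) \<le> nrm n (\<lambda>i. c * f i)"
    using assms by (intro nrm_mono) (auto simp: abs_mult intro!: mult_right_mono)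
  thus ?thesis using assms(2) by (simp add: nrm_cmult)
qed

lemma nrm_power2: "(nrm n f)\<^sup>2 = (\<Sum>i\<in>{1..n}. (f i)\<^sup>2)"
  by (simp add: nrm_def L2_set_def sum_nonneg)

lemma nrm_le_l1: "nrm n f \<le> (\<Sum>i\<in>{1..n}. \<bar>f i\<bar>)"
  unfolding nrm_def by (rule L2_set_le_sum_abs)

lemma abs_le_nrm: "i \<in> {1..n} \<Longrightarrow> \<bar>f i\<bar> \<le> nrm n f"
  using member_le_L2_set[of "{1..n}" i "\<lambda>i. \<bar>f i\<bar>"] unfolding nrm_def by (simp add: L2_set_def)

lemma l1_le_nrm: "(\<Sum>i\<in>{1..n}. \<bar>f i\<bar>) \<le> sqrt (real n) * nrm n f"
  using L2_set_mult_ineq[of "\<lambda>_. 1" f "{1..n}"] nrm_const[of n 1] by (simp add: nrm_def)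

lemma sum_mult_le_nrm: "(\<Sum>i\<in>{1..n}. \<bar>f i\<bar> * \<bar>g i\<bar>) \<le> nrm n f * nrm n g"
  unfolding nrm_def by (rule L2_set_mult_ineq)

lemma nrm_square_le: "nrm n (\<lambda>i. (f i)\<^sup>2) \<le> (nrm n f)\<^sup>2"
  using nrm_le_l1[of n "\<lambda>i. (f i)\<^sup>2"] by (simp add: nrm_power2)

lemma sum_cube_le: "(\<Sum>i\<in>{1..n}. \<bar>f i\<bar>^3) \<le> (nrm n f)^3"
proof -
  have "(\<Sum>i\<in>{1..n}. \<bar>f i\<bar>^3) \<le> (\<Sum>i\<in>{1..n}. nrm n f * (f i)\<^sup>2)"
  proof (rule sum_mono)
    fix i assume "i \<in> {1..n}"
    hence "\<bar>f i\<bar> * (f i)\<^sup>2 \<le> nrm n f * (f i)\<^sup>2" by (intro mult_right_mono abs_le_nrm) auto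
    thus "\<bar>f i\<bar>^3 \<le> nrm n f * (f i)\<^sup>2" by (simp add: power3_eq_cube power2_eq_square mult.assoc)
  qed
  also have "\<dots> = (nrm n f)^3"
    by (simp only: sum_distrib_left[symmetric] nrm_power2[symmetric])
       (simp add: power3_eq_cube power2_eq_square)
  finally show ?thesis .
qed

lemma mat_vec_diff: "mat_vec n B (\<lambda>i. v i - w i) i = mat_vec n B v i - mat_vec n B w i"
  by (simp add: mat_vec_def right_diff_distrib sum_subtractf)

lemma mat_vec_cmult: "mat_vec n B (\<lambda>i. c * v i) i = c * mat_vec n B v i"
  by (simp add: mat_vec_def sum_distrib_left mult_ac)

lemma mat_vec_0 [simp]: "mat_vec n B (\<lambda>_. 0) i = 0"
  by (simp add: mat_vec_def)

lemma mat_vec_cong: "(\<And>j. j \<in> {1..n} \<Longrightarrow> v j = w j) \<Longrightarrow> mat_vec n B v i = mat_vec n B w i"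
  by (simp add: mat_vec_def)

lemma mat_vec_add_mat:
  "mat_vec n (\<lambda>i j. B i j + s * E i j) v i = mat_vec n B v i + s * mat_vec n E v i"
  by (simp add: mat_vec_def sum.distrib sum_distrib_left algebra_simps)

lemma opnD: "opn n B K \<Longrightarrow> nrm n (mat_vec n B v) \<le> K * nrm n v"
  by (simp add: opn_def)

lemma opnD_diff:
  "opn n B K \<Longrightarrow> nrm n (\<lambda>i. mat_vec n B v i - mat_vec n B w i) \<le> K * nrm n (\<lambda>i. v i - w i)"
  using opnD[of n B K "\<lambda>i. v i - w i"] by (simp add: mat_vec_diff[abs_def])

lemma opn_mono: "opn n B K \<Longrightarrow> K \<le> K' \<Longrightarrow> opn n B K'"
  unfolding opn_def by (meson mult_right_mono nrm_nonneg order_trans)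

text \<open>The sequence \<open>U\<close> is arbitrary, so the same tuple can be formed for orbits,
  approximate orbits and linearizations.\<close>

definition arg :: "nat \<Rightarrow> matr \<Rightarrow> (nat \<Rightarrow> vect) \<Rightarrow> nat \<Rightarrow> nat \<Rightarrow> nat \<Rightarrow> real" where
  "arg n B U l i = (\<lambda>j. if j = 0 then mat_vec n B (U l) i else U (l - j) i)"

fun orb :: "nat \<Rightarrow> (nat \<Rightarrow> (nat \<Rightarrow> real) \<Rightarrow> real) \<Rightarrow> matr \<Rightarrow> vect \<Rightarrow> nat \<Rightarrow> vect" where
  "orb n F B u 0 = u"
| "orb n F B u (Suc l) =
     (\<lambda>i. F l (\<lambda>j. if j = 0 then mat_vec n B (orb n F B u l) i else orb n F B u (l - j) i))"

lemma orb_Suc: "orb n F B u (Suc l) i = F l (arg n B (orb n F B u) l i)"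
  by (simp add: arg_def)

declare orb.simps(2) [simp del]

lemma nrm_ldist:
  assumes "nrm n (\<lambda>i. a i 0 - b i 0) \<le> x0"
    and "\<And>j. j < l \<Longrightarrow> nrm n (\<lambda>i. a i (Suc j) - b i (Suc j)) \<le> x"
  shows "nrm n (\<lambda>i. ldist (Suc l) (a i) (b i)) \<le> x0 + real l * x"
proof -
  have "nrm n (\<lambda>i. ldist (Suc l) (a i) (b i)) \<le> (\<Sum>j<Suc l. nrm n (\<lambda>i. \<bar>a i j - b i j\<bar>))"
    unfolding ldist_def by (rule nrm_sum)
  also have "\<dots> = nrm n (\<lambda>i. a i 0 - b i 0) + (\<Sum>j<l. nrm n (\<lambda>i. a i (Suc j) - b i (Suc j)))"
    by (simp only: nrm_abs sum.lessThan_Suc_shift)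
  also have "\<dots> \<le> x0 + (\<Sum>j<l. x)"
    by (intro add_mono sum_mono assms) auto
  finally show ?thesis by simp
qed

lemma nrm_ldist_arg:
  assumes "nrm n (\<lambda>i. mat_vec n B (U l) i - mat_vec n B' (V l) i) \<le> x0"
    and "\<And>r. r \<le> l \<Longrightarrow> nrm n (\<lambda>i. U r i - V r i) \<le> x"
  shows "nrm n (\<lambda>i. ldist (Suc l) (arg n B U l i) (arg n B' V l i)) \<le> x0 + real l * x"
  by (rule nrm_ldist) (use assms in \<open>auto simp: arg_def\<close>)

text \<open>Discrete Gronwall argument for an exact orbit \<open>U\<close> and an approximate orbit
  \<open>V\<close> with defect \<open>\<tau>\<close>. One step multiplies the error by at most
  \<open>1 + L * (K + k)\<close>: the matrix contributes \<open>K\<close>, each of the at most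
  \<open>k\<close> older iterates contributes 1, and the summand 1 absorbs the fresh defect. The
  functions may depend on the coordinate \<open>i\<close>, which admits affine recursions with
  varying coefficients.\<close>

lemma stability:
  assumes L: "L \<ge> 0" and K: "K \<ge> 0" and B: "opn n B K" and \<tau>: "\<tau> \<ge> 0"
    and lip: "\<And>l i. l < k \<Longrightarrow> i \<in> {1..n} \<Longrightarrow> lip (Suc l) L (F l i)"
    and U: "\<And>l i. l < k \<Longrightarrow> i \<in> {1..n} \<Longrightarrow> U (Suc l) i = F l i (arg n B U l i)"
    and V: "\<And>l. l < k \<Longrightarrow> nrm n (\<lambda>i. V (Suc l) i - F l i (arg n B V l i)) \<le> \<tau>"
    and init: "nrm n (\<lambda>i. U 0 i - V 0 i) \<le> \<tau>"
    and l: "l \<le> k"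
  shows "nrm n (\<lambda>i. U l i - V l i) \<le> (1 + L * (K + real k)) ^ l * \<tau>"
  using l
proof (induction l rule: less_induct)
  case (less l)
  define R where "R = 1 + L * (K + real k)"
  have R: "R \<ge> 1" using L K by (simp add: R_def)
  show ?case
  proof (cases l)
    case 0
    thus ?thesis using init by simp
  next
    case (Suc m)
    have IH: "nrm n (\<lambda>i. U r i - V r i) \<le> R ^ m * \<tau>" if "r \<le> m" for r
    proof -
      have "nrm n (\<lambda>i. U r i - V r i) \<le> R ^ r * \<tau>" using less(1)[of r] that Suc less(2) by (simp add: R_def)
      also have "\<dots> \<le> R ^ m * \<tau>" using that R \<tau> by (intro mult_right_mono power_increasing) auto
      finally show ?thesis .
    qed
    have "nrm n (\<lambda>i. mat_vec n B (U m) i - mat_vec n B (V m) i) \<le> K * (R ^ m * \<tau>)"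
      using opnD_diff[OF B, of "U m" "V m"] mult_left_mono[OF IH[OF order_refl] K] by linarith
    from nrm_ldist_arg[where B = B and B' = B and l = m and U = U and V = V, OF this IH]
    have "nrm n (\<lambda>i. ldist (Suc m) (arg n B U m i) (arg n B V m i)) \<le> K * (R ^ m * \<tau>) + real m * (R ^ m * \<tau>)"
      by simp
    also have "\<dots> \<le> (K + real k) * (R ^ m * \<tau>)"
    proof -
      have "real m * (R ^ m * \<tau>) \<le> real k * (R ^ m * \<tau>)"
        using Suc less(2) R \<tau> by (intro mult_right_mono) auto
      thus ?thesis by (simp only: distrib_right)
    qed
    finally have A: "nrm n (\<lambda>i. L * ldist (Suc m) (arg n B U m i) (arg n B V m i))
        \<le> L * ((K + real k) * (R ^ m * \<tau>))"
      using L by (simp add: nrm_cmult mult_left_mono)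
    have "nrm n (\<lambda>i. U l i - V l i)
       = nrm n (\<lambda>i. (F m i (arg n B U m i) - F m i (arg n B V m i)) - (V (Suc m) i - F m i (arg n B V m i)))"
      using U Suc less(2) by (intro nrm_cong) auto
    also have "\<dots> \<le> nrm n (\<lambda>i. F m i (arg n B U m i) - F m i (arg n B V m i)) + \<tau>"
      using nrm_diff[of n "\<lambda>i. F m i (arg n B U m i) - F m i (arg n B V m i)"
          "\<lambda>i. V (Suc m) i - F m i (arg n B V m i)"] V[of m] Suc less(2) by simp
    also have "nrm n (\<lambda>i. F m i (arg n B U m i) - F m i (arg n B V m i))
       \<le> nrm n (\<lambda>i. L * ldist (Suc m) (arg n B U m i) (arg n B V m i))"
    proof (rule nrm_mono)
      fix i assume "i \<in> {1..n}"
      hence "\<bar>F m i (arg n B U m i) - F m i (arg n B V m i)\<bar> \<le> L * ldist (Suc m) (arg n B U m i) (arg n B V m i)"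
        using lip[of m i] Suc less(2) by (auto intro: lipD)
      thus "\<bar>F m i (arg n B U m i) - F m i (arg n B V m i)\<bar> \<le> \<bar>L * ldist (Suc m) (arg n B U m i) (arg n B V m i)\<bar>"
        by linarith
    qed
    also note A
    also have "L * ((K + real k) * (R ^ m * \<tau>)) + \<tau> \<le> R ^ l * \<tau>"
    proof -
      have "R ^ l * \<tau> = R ^ m * \<tau> + L * ((K + real k) * (R ^ m * \<tau>))"
        by (simp add: Suc R_def algebra_simps)
      moreover have "\<tau> \<le> R ^ m * \<tau>" using R \<tau> by (simp add: mult_le_cancel_right1)
      ultimately show ?thesis by linarith
    qed
    finally show ?thesis by (simp add: R_def)
  qed
qed

text \<open>\<open>adj\<close> is the reverse-mode derivative of \<open>\<Sum>\<^sub>i u\<^sup>k\<^sub>i\<close> with respect to the iterate \<open>u\<^sup>l\<close>;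
  \<open>P l j i\<close> stands for the derivative of \<open>F l\<close> in its argument \<open>j\<close> at coordinate \<open>i\<close>.\<close>

function adj :: "nat \<Rightarrow> matr \<Rightarrow> (nat \<Rightarrow> nat \<Rightarrow> nat \<Rightarrow> real) \<Rightarrow> nat \<Rightarrow> nat \<Rightarrow> vect" where
  "adj n B P k l = (if k \<le> l then (\<lambda>_. 1) else
     (\<lambda>m. mat_vec n B (\<lambda>i. P l 0 i * adj n B P k (Suc l) i) m
        + (\<Sum>r\<in>{Suc (Suc l)..k}. P (r - 1) (r - 1 - l) m * adj n B P k r m)))"
  by auto
termination by (relation "Wellfounded.measure (\<lambda>(n, B, P, k, l). k - l)") auto

declare adj.simps [simp del]

lemma adj_top: "adj n B P k k = (\<lambda>_. 1)"
  by (simp add: adj.simps)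

lemma adj_step: "l < k \<Longrightarrow> adj n B P k l m = mat_vec n B (\<lambda>i. P l 0 i * adj n B P k (Suc l) i) m
        + (\<Sum>r\<in>{Suc (Suc l)..k}. P (r - 1) (r - 1 - l) m * adj n B P k r m)"
  by (subst adj.simps) simp

section \<open>Duality between the linear recursion and its adjoint\<close>

lemma mat_vec_sym:
  assumes "\<And>i j. i \<in> {1..n} \<Longrightarrow> j \<in> {1..n} \<Longrightarrow> B i j = B j i"
  shows "(\<Sum>i\<in>{1..n}. v i * mat_vec n B w i) = (\<Sum>i\<in>{1..n}. mat_vec n B v i * w i)"
proof -
  have "(\<Sum>i\<in>{1..n}. v i * mat_vec n B w i) = (\<Sum>i\<in>{1..n}. \<Sum>j\<in>{1..n}. v i * B i j * w j)"
    by (simp add: mat_vec_def sum_distrib_left mult_ac)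
  also have "\<dots> = (\<Sum>j\<in>{1..n}. \<Sum>i\<in>{1..n}. v i * B i j * w j)"
    by (rule sum.swap)
  also have "\<dots> = (\<Sum>i\<in>{1..n}. mat_vec n B v i * w i)"
    unfolding mat_vec_def sum_distrib_right
    by (intro sum.cong refl) (use assms in \<open>auto simp: mult_ac\<close>)
  finally show ?thesis .
qed

text \<open>Both sides run over the pairs \<open>j < l < k\<close>, with \<open>r = l + 1\<close> on
  the right.\<close>

lemma sum_triangle_swap:
  fixes g :: "nat \<Rightarrow> nat \<Rightarrow> real"
  shows "(\<Sum>l<k. \<Sum>j<l. g l j) = (\<Sum>j<k. \<Sum>r\<in>{Suc (Suc j)..k}. g (r - 1) j)"
proof (induction k)
  case (Suc k)
  have "(\<Sum>j<k. \<Sum>r\<in>{Suc (Suc j)..Suc k}. g (r - 1) j)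
      = (\<Sum>j<k. g k j + (\<Sum>r\<in>{Suc (Suc j)..k}. g (r - 1) j))"
    by (intro sum.cong refl) (simp add: atLeastAtMostSuc_conv)
  thus ?case using Suc by (simp add: sum.distrib)
qed simp

text \<open>\<open>adj\<close> is the transposed linear recursion. Paired with the linear terms of
  level \<open>l + 1\<close> and summed over the levels it gives the pairings at level
  \<open>l\<close>, so the sum telescopes between \<open>d 0 = 0\<close> and the all-ones vector at
  level \<open>k\<close>. What survives is the defect of \<open>d\<close> in the linear recursion;
  since \<open>d\<close> is arbitrary, exact nonlinear differences are covered.\<close>

lemma adjoint_identity:
  assumes sym: "\<And>i j. i \<in> {1..n} \<Longrightarrow> j \<in> {1..n} \<Longrightarrow> B i j = B j i"
    and d0: "\<And>i. i \<in> {1..n} \<Longrightarrow> d 0 i = 0"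
  shows "(\<Sum>i\<in>{1..n}. d k i) = (\<Sum>l<k. \<Sum>i\<in>{1..n}. adj n B P k (Suc l) i *
     (d (Suc l) i - (P l 0 i * mat_vec n B (d l) i + (\<Sum>j<l. P l (Suc j) i * d (l - Suc j) i))))"
proof -
  define b where "b = adj n B P k"
  define ip :: "vect \<Rightarrow> vect \<Rightarrow> real" where "ip = (\<lambda>v w. \<Sum>i\<in>{1..n}. v i * w i)"
  define T where "T = (\<lambda>l i. P l 0 i * mat_vec n B (d l) i + (\<Sum>j<l. P l (Suc j) i * d (l - Suc j) i))"
  have T: "ip (b (Suc l)) (T l) = ip (mat_vec n B (\<lambda>i. P l 0 i * b (Suc l) i)) (d l)
      + (\<Sum>j<l. \<Sum>i\<in>{1..n}. P l (l - j) i * b (Suc l) i * d j i)" for l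
  proof -
    \<comment> \<open>Reverses the memory index: slot \<open>Suc j\<close> of step \<open>l\<close>
      holds iterate \<open>l - Suc j\<close>.\<close>
    have "(\<Sum>j<l. P l (Suc j) i * d (l - Suc j) i) = (\<Sum>j<l. P l (l - j) i * d j i)" for i
    proof -
      have "(\<Sum>j<l. P l (Suc j) i * d (l - Suc j) i) = (\<Sum>j<l. P l (l - (l - Suc j)) i * d (l - Suc j) i)"
        by (intro sum.cong refl) (auto simp: Suc_leI)
      also have "\<dots> = (\<Sum>j<l. P l (l - j) i * d j i)"
        by (rule sum.nat_diff_reindex[of "\<lambda>j. P l (l - j) i * d j i"])
      finally show ?thesis .
    qed
    hence "ip (b (Suc l)) (T l) = (\<Sum>i\<in>{1..n}. (P l 0 i * b (Suc l) i) * mat_vec n B (d l) i)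
       + (\<Sum>i\<in>{1..n}. \<Sum>j<l. P l (l - j) i * b (Suc l) i * d j i)"
      by (simp add: ip_def T_def distrib_left sum.distrib sum_distrib_left mult_ac)
    also have "(\<Sum>i\<in>{1..n}. (P l 0 i * b (Suc l) i) * mat_vec n B (d l) i)
       = ip (mat_vec n B (\<lambda>i. P l 0 i * b (Suc l) i)) (d l)"
      unfolding ip_def by (rule mat_vec_sym[OF sym])
    also have "(\<Sum>i\<in>{1..n}. \<Sum>j<l. P l (l - j) i * b (Suc l) i * d j i)
       = (\<Sum>j<l. \<Sum>i\<in>{1..n}. P l (l - j) i * b (Suc l) i * d j i)" by (rule sum.swap)
    finally show ?thesis .
  qed
  have b: "ip (b l) (d l) = ip (mat_vec n B (\<lambda>i. P l 0 i * b (Suc l) i)) (d l)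
     + (\<Sum>r\<in>{Suc (Suc l)..k}. \<Sum>i\<in>{1..n}. P (r - 1) (r - 1 - l) i * b r i * d l i)" if "l < k" for l
  proof -
    have "ip (b l) (d l) = ip (mat_vec n B (\<lambda>i. P l 0 i * b (Suc l) i)) (d l)
     + (\<Sum>i\<in>{1..n}. \<Sum>r\<in>{Suc (Suc l)..k}. P (r - 1) (r - 1 - l) i * b r i * d l i)"
      by (simp add: ip_def b_def adj_step[OF that] distrib_right sum.distrib sum_distrib_right)
    also have "(\<Sum>i\<in>{1..n}. \<Sum>r\<in>{Suc (Suc l)..k}. P (r - 1) (r - 1 - l) i * b r i * d l i)
      = (\<Sum>r\<in>{Suc (Suc l)..k}. \<Sum>i\<in>{1..n}. P (r - 1) (r - 1 - l) i * b r i * d l i)"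
      by (rule sum.swap)
    finally show ?thesis .
  qed
  have "(\<Sum>l<k. ip (b (Suc l)) (T l)) = (\<Sum>l<k. ip (mat_vec n B (\<lambda>i. P l 0 i * b (Suc l) i)) (d l))
     + (\<Sum>l<k. \<Sum>j<l. \<Sum>i\<in>{1..n}. P l (l - j) i * b (Suc l) i * d j i)"
    by (simp add: T sum.distrib)
  also have "(\<Sum>l<k. \<Sum>j<l. \<Sum>i\<in>{1..n}. P l (l - j) i * b (Suc l) i * d j i)
     = (\<Sum>j<k. \<Sum>r\<in>{Suc (Suc j)..k}. \<Sum>i\<in>{1..n}. P (r - 1) (r - 1 - j) i * b (Suc (r - 1)) i * d j i)"
    by (rule sum_triangle_swap)
  also have "\<dots> = (\<Sum>j<k. \<Sum>r\<in>{Suc (Suc j)..k}. \<Sum>i\<in>{1..n}. P (r - 1) (r - 1 - j) i * b r i * d j i)"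
    by (intro sum.cong refl) auto
  finally have TT: "(\<Sum>l<k. ip (b (Suc l)) (T l)) = (\<Sum>l<k. ip (b l) (d l))"
    by (simp add: b sum.distrib)
  have "(\<Sum>l<k. \<Sum>i\<in>{1..n}. b (Suc l) i * (d (Suc l) i - T l i))
     = (\<Sum>l<k. ip (b (Suc l)) (d (Suc l)) - ip (b (Suc l)) (T l))"
    by (simp add: ip_def right_diff_distrib sum_subtractf)
  also have "\<dots> = (\<Sum>l<k. ip (b (Suc l)) (d (Suc l)) - ip (b l) (d l))"
    by (simp add: sum_subtractf TT)
  also have "\<dots> = ip (b k) (d k) - ip (b 0) (d 0)"
    by (rule sum_lessThan_telescope)
  also have "\<dots> = (\<Sum>i\<in>{1..n}. d k i)"
    using d0 by (simp add: ip_def b_def adj_top)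
  finally show ?thesis by (simp add: b_def T_def)
qed

text \<open>The argument of \<open>stability\<close> run backwards, starting from the all-ones
  vector of norm \<open>sqrt n\<close>.\<close>

lemma adj_nrm:
  assumes L: "L \<ge> 0" and K: "K \<ge> 0" and B: "opn n B K"
    and P: "\<And>l j i. l < k \<Longrightarrow> j \<le> l \<Longrightarrow> i \<in> {1..n} \<Longrightarrow> \<bar>P l j i\<bar> \<le> L"
    and l: "l \<le> k"
  shows "nrm n (adj n B P k l) \<le> (1 + L * (K + real k)) ^ (k - l) * sqrt (real n)"
  using l
proof (induction "k - l" arbitrary: l rule: less_induct)
  case less
  define R where "R = 1 + L * (K + real k)"
  have R: "R \<ge> 1" using L K by (simp add: R_def)
  show ?case
  proof (cases "l = k")
    case True
    thus ?thesis by (simp add: adj_top nrm_const)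
  next
    case False
    hence lk: "l < k" using less by simp
    define X where "X = R ^ (k - Suc l) * sqrt (real n)"
    have X: "X \<ge> 0" using R by (simp add: X_def)
    have IH: "nrm n (adj n B P k r) \<le> X" if "l < r" "r \<le> k" for r
    proof -
      have "nrm n (adj n B P k r) \<le> R ^ (k - r) * sqrt (real n)"
        using less(1)[of r] that by (simp add: R_def)
      also have "\<dots> \<le> X" unfolding X_def using R that
        by (intro mult_right_mono power_increasing) auto
      finally show ?thesis .
    qed
    have PX: "nrm n (\<lambda>i. P r j i * adj n B P k (Suc r) i) \<le> L * X" if "l \<le> r" "r < k" "j \<le> r" for r j
      using nrm_mult_le[of n "P r j" L "adj n B P k (Suc r)"] P[of r j] that L
        mult_left_mono[OF IH[of "Suc r"] L] by auto
    have "nrm n (adj n B P k l) \<le> nrm n (mat_vec n B (\<lambda>i. P l 0 i * adj n B P k (Suc l) i))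
       + nrm n (\<lambda>m. \<Sum>r\<in>{Suc (Suc l)..k}. P (r - 1) (r - 1 - l) m * adj n B P k r m)"
      unfolding adj_step[OF lk, abs_def] by (rule nrm_add)
    also have "\<dots> \<le> K * (L * X) + (\<Sum>r\<in>{Suc (Suc l)..k}. L * X)"
    proof (rule add_mono)
      show "nrm n (mat_vec n B (\<lambda>i. P l 0 i * adj n B P k (Suc l) i)) \<le> K * (L * X)"
        using opnD[OF B] mult_left_mono[OF PX[of l 0] K] lk by (meson le0 order_refl order_trans)
      show "nrm n (\<lambda>m. \<Sum>r\<in>{Suc (Suc l)..k}. P (r - 1) (r - 1 - l) m * adj n B P k r m)
         \<le> (\<Sum>r\<in>{Suc (Suc l)..k}. L * X)"
      proof (rule order_trans[OF nrm_sum sum_mono])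
        fix r assume r: "r \<in> {Suc (Suc l)..k}"
        show "nrm n (\<lambda>m. P (r - 1) (r - 1 - l) m * adj n B P k r m) \<le> L * X"
        proof -
          have "l \<le> r - 1" "r - 1 < k" "r - 1 - l \<le> r - 1" "Suc (r - 1) = r" using r by auto
          with PX[OF this(1-3)] show ?thesis by simp
        qed
      qed
    qed
    also have "(\<Sum>r\<in>{Suc (Suc l)..k}. L * X) \<le> real k * (L * X)"
      using L X by (simp add: mult_right_mono)
    also have "K * (L * X) + real k * (L * X) \<le> R * X"
      using X by (simp add: R_def algebra_simps)
    also have "R * X = R ^ (k - l) * sqrt (real n)"
      using lk by (simp add: X_def Suc_diff_Suc flip: power_Suc)
    finally show ?thesis by (simp add: R_def)
  qed
qed

section \<open>Perturbation of a single entry\<close>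

text \<open>First-order variation of an orbit with source \<open>e\<close>. It starts at zero
  because the initial vector is not perturbed.\<close>

fun lin :: "nat \<Rightarrow> matr \<Rightarrow> (nat \<Rightarrow> nat \<Rightarrow> nat \<Rightarrow> real) \<Rightarrow> (nat \<Rightarrow> vect) \<Rightarrow> nat \<Rightarrow> vect" where
  "lin n B P e 0 = (\<lambda>i. 0)"
| "lin n B P e (Suc l) = (\<lambda>i. e l i + (P l 0 i * mat_vec n B (lin n B P e l) i
     + (\<Sum>j<l. P l (Suc j) i * lin n B P e (l - Suc j) i)))"

declare lin.simps(2) [simp del]

lemma sum_arg: "(\<Sum>j<Suc l. p j * arg n B U l i j)
    = p 0 * mat_vec n B (U l) i + (\<Sum>j<l. p (Suc j) * U (l - Suc j) i)"
  by (simp add: sum.lessThan_Suc_shift arg_def del: sum.lessThan_Suc)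

lemma lin_Suc: "lin n B P e (Suc l) i
    = e l i + (\<Sum>j<Suc l. P l j i * arg n B (lin n B P e) l i j)"
  by (simp only: sum_arg lin.simps)

text \<open>Lets \<open>stability\<close> be applied to linear recursions, read as iterations of
  affine functions.\<close>

lemma lip_affine:
  assumes "\<And>j. j < m \<Longrightarrow> \<bar>p j\<bar> \<le> L"
  shows "lip m L (\<lambda>a. c + (\<Sum>j<m. p j * a j))"
  unfolding lip_def
proof (intro allI)
  fix x y
  have "\<bar>(c + (\<Sum>j<m. p j * x j)) - (c + (\<Sum>j<m. p j * y j))\<bar> = \<bar>\<Sum>j<m. p j * (x j - y j)\<bar>"
    by (simp add: sum_subtractf right_diff_distrib)
  also have "\<dots> \<le> (\<Sum>j<m. L * \<bar>x j - y j\<bar>)"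
    by (rule order_trans[OF sum_abs sum_mono]) (use assms in \<open>auto simp: abs_mult intro!: mult_right_mono\<close>)
  finally show "\<bar>(c + (\<Sum>j<m. p j * x j)) - (c + (\<Sum>j<m. p j * y j))\<bar> \<le> L * ldist m x y"
    by (simp add: ldist_def sum_distrib_left)
qed

lemma quadratic_diff:
  assumes "\<And>i j. i < m \<Longrightarrow> j < m \<Longrightarrow> \<bar>h i j\<bar> \<le> L"
  shows "\<bar>(\<Sum>j<m. \<Sum>i<m. h i j * x i * x j) - (\<Sum>j<m. \<Sum>i<m. h i j * y i * y j)\<bar>
    \<le> L * (ldist m x y * (ldist m x (\<lambda>_. 0) + ldist m y (\<lambda>_. 0)))"
proof -
  have "\<bar>(\<Sum>j<m. \<Sum>i<m. h i j * x i * x j) - (\<Sum>j<m. \<Sum>i<m. h i j * y i * y j)\<bar>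
     = \<bar>\<Sum>j<m. \<Sum>i<m. h i j * (x i * x j - y i * y j)\<bar>"
    by (simp add: sum_subtractf right_diff_distrib mult.assoc)
  also have "\<dots> \<le> (\<Sum>j<m. \<Sum>i<m. L * (\<bar>x i - y i\<bar> * \<bar>x j\<bar> + \<bar>y i\<bar> * \<bar>x j - y j\<bar>))"
  proof (rule order_trans[OF sum_abs sum_mono], rule order_trans[OF sum_abs sum_mono])
    fix j i assume "j \<in> {..<m}" "i \<in> {..<m}"
    hence "\<bar>h i j\<bar> \<le> L" using assms by auto
    moreover have "x i * x j - y i * y j = (x i - y i) * x j + y i * (x j - y j)"
      by (simp add: algebra_simps)
    hence "\<bar>x i * x j - y i * y j\<bar> \<le> \<bar>x i - y i\<bar> * \<bar>x j\<bar> + \<bar>y i\<bar> * \<bar>x j - y j\<bar>"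
      by (metis abs_mult abs_triangle_ineq)
    ultimately show "\<bar>h i j * (x i * x j - y i * y j)\<bar> \<le> L * (\<bar>x i - y i\<bar> * \<bar>x j\<bar> + \<bar>y i\<bar> * \<bar>x j - y j\<bar>)"
      unfolding abs_mult by (intro mult_mono) auto
  qed
  also have "\<dots> = L * ((\<Sum>j<m. \<Sum>i<m. \<bar>x i - y i\<bar> * \<bar>x j\<bar>) + (\<Sum>j<m. \<Sum>i<m. \<bar>y i\<bar> * \<bar>x j - y j\<bar>))"
    by (simp only: sum_distrib_left[symmetric] sum.distrib[symmetric])
  also have "(\<Sum>j<m. \<Sum>i<m. \<bar>x i - y i\<bar> * \<bar>x j\<bar>) = ldist m x (\<lambda>_. 0) * ldist m x y"
    by (simp add: ldist_def sum_product mult.commute)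
  also have "(\<Sum>j<m. \<Sum>i<m. \<bar>y i\<bar> * \<bar>x j - y j\<bar>) = ldist m x y * ldist m y (\<lambda>_. 0)"
    unfolding ldist_def sum_product by (intro sum.cong refl) (auto simp: mult.commute)
  finally show ?thesis by (simp only: distrib_left mult.commute)
qed

lemma pert_opn:
  assumes B: "opn n B K" and E: "\<And>v. nrm n (mat_vec n E v) \<le> 2 * nrm n v" and s: "\<bar>s\<bar> \<le> 1"
  shows "opn n (\<lambda>i j. B i j + s * E i j) (K + 2)"
  unfolding opn_def
proof
  fix v
  have "nrm n (mat_vec n (\<lambda>i j. B i j + s * E i j) v) \<le> nrm n (mat_vec n B v) + nrm n (\<lambda>i. s * mat_vec n E v i)"
    unfolding mat_vec_add_mat[abs_def] by (rule nrm_add)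
  also have "\<dots> \<le> K * nrm n v + 1 * (2 * nrm n v)"
    unfolding nrm_cmult by (intro add_mono opnD[OF B] mult_mono s E) auto
  finally show "nrm n (mat_vec n (\<lambda>i j. B i j + s * E i j) v) \<le> (K + 2) * nrm n v"
    by (simp add: algebra_simps)
qed

text \<open>One entry of the matrix is perturbed by \<open>s\<close>; \<open>E\<close> is the corresponding symmetric elementary matrix.
  The coefficients \<open>\<beta>\<close> and \<open>\<gamma>\<close> of \<open>s\<close> and \<open>s\<^sup>2\<close> are written as pairings with the adjoint \<open>b\<close>; this is
  why bounds on single coordinates of \<open>u\<close> and \<open>b\<close> suffice to keep them free of powers of \<open>n\<close>.\<close>

locale entry_perturbation =
  fixes k n :: nat and L K Q :: real
    and F :: "nat \<Rightarrow> (nat \<Rightarrow> real) \<Rightarrow> real" and D :: "nat \<Rightarrow> nat \<Rightarrow> (nat \<Rightarrow> real) \<Rightarrow> real"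
    and H :: "nat \<Rightarrow> nat \<Rightarrow> nat \<Rightarrow> (nat \<Rightarrow> real) \<Rightarrow> real"
    and B E :: matr and u :: vect and p q :: nat
  assumes L: "L \<ge> 1" and K: "K \<ge> 1" and Q: "Q \<ge> 1"
    and F: "\<And>l. l < k \<Longrightarrow> smooth (Suc l) L (F l) (D l) (H l)"
    and B: "opn n B K"
    and sym: "\<And>i j. i \<in> {1..n} \<Longrightarrow> j \<in> {1..n} \<Longrightarrow> B i j = B j i"
    and E: "\<And>v. (\<Sum>i\<in>{1..n}. \<bar>mat_vec n E v i\<bar>) \<le> \<bar>v p\<bar> + \<bar>v q\<bar>"
    and pq: "p \<in> {1..n}" "q \<in> {1..n}"
    and uQ: "\<And>l i. l < k \<Longrightarrow> i \<in> {1..n} \<Longrightarrow> \<bar>orb n F B u l i\<bar> \<le> Q"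
    and bQ: "\<And>l i. l < k \<Longrightarrow> i \<in> {1..n} \<Longrightarrow>
      \<bar>adj n B (\<lambda>l j i. D l j (arg n B (orb n F B u) l i)) k (Suc l) i\<bar> \<le> Q"
begin

text \<open>\<open>K + 2\<close> bounds the operator norm after adding \<open>s * E\<close> with
  \<open>\<bar>s\<bar> \<le> 1\<close>. The constants that follow are chosen so that
  \<open>dd\<close> bounds first-order changes of the iterates and \<open>a * Q\<close> those of the
  argument tuples; higher orders are absorbed into powers of \<open>a\<close>.\<close>

definition "W = 1 + L * (K + 2 + real k)"
definition "R = W ^ k"
definition "a = 4 * R * W\<^sup>2"
definition "dd = 2 * R * W * Q"
definition "c = 5 * W\<^sup>2 * a ^ 5"
definition "U = orb n F B u"
definition "P = (\<lambda>l j i. D l j (arg n B U l i))"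
definition "b = adj n B P k"
definition "e1 = (\<lambda>l i. P l 0 i * mat_vec n E (U l) i)"
text \<open>Derivative of the iterates with respect to \<open>s\<close> at \<open>s = 0\<close>. The
  next definition is that of the argument tuples, whose component 0 also sees the change of the
  matrix.\<close>

definition "ud = lin n B P e1"
definition "dl = (\<lambda>l i j. if j = 0 then mat_vec n B (ud l) i + mat_vec n E (U l) i else ud (l - j) i)"
definition "\<beta> = (\<Sum>l<k. \<Sum>i\<in>{1..n}. b (Suc l) i * e1 l i)"
text \<open>Each bracket is the second-order part of the local defect: the quadratic form of
  \<open>H l\<close> at the first-order change of the arguments, and the mixed term in which the
  matrix perturbation acts on the first-order change of the iterate.\<close>

definition "\<gamma> = (\<Sum>l<k. \<Sum>i\<in>{1..n}. b (Suc l) i *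
   ((\<Sum>y<Suc l. \<Sum>x<Suc l. H l x y (arg n B U l i) * dl l i x * dl l i y) + P l 0 i * mat_vec n E (ud l) i))"

lemma W: "W \<ge> 1" "L \<le> W" "K + 2 + real k \<le> W" "real k \<le> W"
proof -
  have "K + 2 + real k \<le> L * (K + 2 + real k)" "L * 1 \<le> L * (K + 2 + real k)"
    using L K by (auto simp: mult_le_cancel_right1 intro!: mult_left_mono)
  thus "W \<ge> 1" "L \<le> W" "K + 2 + real k \<le> W" "real k \<le> W" using L K unfolding W_def by linarith+
qed

lemma R: "R \<ge> 1" using W by (simp add: R_def)

lemma WR: "W ^ l \<le> R" if "l \<le> k"
  unfolding R_def using W that by (intro power_increasing) auto

lemma RW: "R * W \<ge> 1"
  using mult_mono[OF R W(1)] R W by simp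

lemma a: "a \<ge> 1" "W \<le> a" "3 * R * W \<le> a" "dd \<le> a * Q" "2 * W * dd = a * Q"
proof -
  have "R * W \<le> R * W * W" using W RW by (simp add: mult_le_cancel_left1)
  hence *: "R * W \<le> R * W\<^sup>2" by (simp add: power2_eq_square)
  have "W \<le> R * W" using W R by (simp add: mult_le_cancel_right1)
  have a: "a = 4 * (R * W\<^sup>2)" by (simp add: a_def)
  show "W \<le> a" "a \<ge> 1" "3 * R * W \<le> a" using * \<open>W \<le> R * W\<close> W(1) unfolding a mult.assoc by linarith+
  have "2 * R * W \<le> a" using * RW unfolding a mult.assoc by linarith
  thus "dd \<le> a * Q" unfolding dd_def using Q by (intro mult_right_mono) auto
  show "2 * W * dd = a * Q" by (simp add: dd_def a_def power2_eq_square)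
qed

lemma dd: "dd \<ge> 0"
  using R W Q by (simp add: dd_def)

lemma E1: "nrm n (mat_vec n E v) \<le> 2 * nrm n v" "(\<Sum>i\<in>{1..n}. \<bar>mat_vec n E v i\<bar>) \<le> 2 * nrm n v"
  using E[of v] abs_le_nrm[OF pq(1), of v] abs_le_nrm[OF pq(2), of v] nrm_le_l1[of n "mat_vec n E v"]
  by linarith+

lemma EU: "(\<Sum>i\<in>{1..n}. \<bar>mat_vec n E (U l) i\<bar>) \<le> 2 * Q" "nrm n (mat_vec n E (U l)) \<le> 2 * Q" if "l < k"
  using E[of "U l"] uQ[OF that pq(1)] uQ[OF that pq(2)] nrm_le_l1[of n "mat_vec n E (U l)"]
  by (auto simp: U_def)

lemma PL: "\<bar>P l j i\<bar> \<le> L" if "l < k" "j < Suc l"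
  using F[OF that(1)] that(2) by (simp add: smooth_def P_def)

lemma HL: "\<bar>H l x y z\<bar> \<le> L" if "l < k" "x < Suc l" "y < Suc l"
  using F[OF that(1)] that by (simp add: smooth_def)

lemma bQ': "\<bar>b (Suc l) i\<bar> \<le> Q" if "l < k" "i \<in> {1..n}"
  using bQ[OF that] by (simp add: b_def P_def[abs_def] U_def)

lemma BK: "opn n B (K + 2)"
  using opn_mono[OF B] by simp

lemma nrm_P: "nrm n (\<lambda>i. P l 0 i * f i) \<le> L * nrm n f" if "l < k"
  using PL[OF that, of 0] L by (intro nrm_mult_le) auto

text \<open>Comparison with the zero sequence. Its defect is the source \<open>e1\<close>, which
  sees only the coordinates \<open>p\<close> and \<open>q\<close> of the iterates; there the bound
  \<open>Q\<close> enters and a factor \<open>sqrt n\<close> is avoided.\<close>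

lemma nrm_ud: "nrm n (ud l) \<le> dd" if l: "l \<le> k"
proof -
  have "nrm n (\<lambda>i. ud l i - (\<lambda>_ _. 0) l i) \<le> (1 + L * (K + 2 + real k)) ^ l * (2 * L * Q)"
  proof (rule stability[OF _ _ BK, where F = "\<lambda>l i a. e1 l i + (\<Sum>j<Suc l. P l j i * a j)"])
    fix l i assume "l < k" "i \<in> {1..n}"
    thus "lip (Suc l) L (\<lambda>a. e1 l i + (\<Sum>j<Suc l. P l j i * a j))"
      using PL by (intro lip_affine) auto
    show "ud (Suc l) i = e1 l i + (\<Sum>j<Suc l. P l j i * arg n B ud l i j)"
      unfolding ud_def by (rule lin_Suc)
  next
    fix l assume l: "l < k"
    have "nrm n (e1 l) \<le> L * (2 * Q)"
      unfolding e1_def using nrm_P[OF l] EU(2)[OF l] L by (meson mult_left_mono order_trans zero_le_one)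
    thus "nrm n (\<lambda>i. (\<lambda>_ _. 0) (Suc l) i - (e1 l i + (\<Sum>j<Suc l. P l j i * arg n B (\<lambda>_ _. 0) l i j))) \<le> 2 * L * Q"
      by (simp only: sum_arg) (simp add: nrm_minus mult_ac)
  qed (use L K Q l in \<open>auto simp: ud_def\<close>)
  also have "\<dots> \<le> R * (2 * W * Q)"
    using WR[OF l] W L Q R by (intro mult_mono) (auto simp: W_def)
  finally show ?thesis by (simp add: dd_def mult_ac)
qed

lemma nrm_dl: "nrm n (\<lambda>i. ldist (Suc l) (dl l i) (\<lambda>_. 0)) \<le> a * Q" if l: "l < k"
proof -
  have "nrm n (\<lambda>i. mat_vec n B (ud l) i + mat_vec n E (U l) i) \<le> K * dd + 2 * Q"
    using nrm_add[of n "mat_vec n B (ud l)" "mat_vec n E (U l)"] opnD[OF B, of "ud l"]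
      mult_left_mono[OF nrm_ud[of l], of K] EU(2)[OF l] K l by linarith
  hence "nrm n (\<lambda>i. ldist (Suc l) (dl l i) (\<lambda>_. 0)) \<le> (K * dd + 2 * Q) + real l * dd"
    by (intro nrm_ldist) (use l nrm_ud in \<open>auto simp: dl_def\<close>)
  also have "\<dots> \<le> (K * dd + 2 * dd) + real k * dd"
  proof -
    have "Q \<le> dd" unfolding dd_def using RW Q by (simp add: mult_le_cancel_right1)
    thus ?thesis using l Q by (intro add_mono mult_right_mono) auto
  qed
  also have "\<dots> = (K + 2 + real k) * dd" by (simp add: algebra_simps)
  also have "\<dots> \<le> 2 * W * dd"
    using W R Q by (intro mult_right_mono) (auto simp: dd_def)
  finally show ?thesis using a by simp
qed

end

section \<open>The orbit of the perturbed matrix, order by order in \<open>s\<close>\<close>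

locale entry_perturbation_at = entry_perturbation +
  fixes s :: real
  assumes s: "\<bar>s\<bar> \<le> 1"
begin

definition "Bs = (\<lambda>i j. B i j + s * E i j)"
definition "Us = orb n F Bs u"
definition "d = (\<lambda>l i. Us l i - U l i)"
definition "t = \<bar>s\<bar>"

lemma t: "0 \<le> t" "t \<le> 1" using s by (auto simp: t_def)

lemma Bs_op: "opn n Bs (K + 2)"
  unfolding Bs_def by (rule pert_opn[OF B E1(1) s])

lemma Bs_vec: "mat_vec n Bs v i = mat_vec n B v i + s * mat_vec n E v i"
  unfolding Bs_def by (rule mat_vec_add_mat)

text \<open>The unperturbed orbit is an approximate orbit of the perturbed matrix, with a defect of
  \<open>\<bar>s\<bar>\<close> times two coordinates of the iterate.\<close>

lemma nrm_d: "nrm n (d l) \<le> dd * t" if l: "l \<le> k"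
proof -
  have "nrm n (\<lambda>i. Us l i - U l i) \<le> (1 + L * (K + 2 + real k)) ^ l * (L * (t * (2 * Q)))"
  proof (rule stability[OF _ _ Bs_op, where F = "\<lambda>l i. F l"])
    fix l i assume "l < k" "i \<in> {1..n}"
    thus "lip (Suc l) L (F l)" using F by (simp add: smooth_def)
    show "Us (Suc l) i = F l (arg n Bs Us l i)" unfolding Us_def by (rule orb_Suc)
  next
    fix l assume l: "l < k"
    have "\<bar>U (Suc l) i - F l (arg n Bs U l i)\<bar> \<le> L * \<bar>s * mat_vec n E (U l) i\<bar>" for i
    proof -
      have "\<bar>F l (arg n B U l i) - F l (arg n Bs U l i)\<bar> \<le> L * ldist (Suc l) (arg n B U l i) (arg n Bs U l i)"
        using F[OF l] by (intro lipD) (simp add: smooth_def)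
      also have "ldist (Suc l) (arg n B U l i) (arg n Bs U l i) = \<bar>s * mat_vec n E (U l) i\<bar>"
        by (simp add: ldist_def sum.lessThan_Suc_shift arg_def Bs_vec del: sum.lessThan_Suc)
      finally show ?thesis by (simp add: U_def orb_Suc)
    qed
    hence "nrm n (\<lambda>i. U (Suc l) i - F l (arg n Bs U l i)) \<le> nrm n (\<lambda>i. L * \<bar>s * mat_vec n E (U l) i\<bar>)"
      using L by (intro nrm_mono) (auto simp: abs_mult)
    also have "\<dots> = L * (t * nrm n (mat_vec n E (U l)))"
      using L by (simp add: nrm_cmult t_def)
    also have "\<dots> \<le> L * (t * (2 * Q))"
      using EU(2)[OF l] L t by (intro mult_left_mono) auto
    finally show "nrm n (\<lambda>i. U (Suc l) i - F l (arg n Bs U l i)) \<le> L * (t * (2 * Q))" .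
  qed (use L K Q l t in \<open>auto simp: Us_def U_def\<close>)
  also have "\<dots> \<le> R * (W * (t * (2 * Q)))"
    using WR[OF l] W L Q t R by (intro mult_mono mult_right_mono) (auto simp: W_def)
  finally show ?thesis by (simp add: dd_def d_def mult_ac)
qed

definition "A = (\<lambda>l i. ldist (Suc l) (arg n B U l i) (arg n Bs Us l i))"
definition "dA = (\<lambda>l i j. arg n Bs Us l i j - arg n B U l i j)"

lemma A_dA: "A l i = ldist (Suc l) (dA l i) (\<lambda>_. 0)"
  by (simp add: A_def dA_def ldist_def abs_minus_commute)

lemma dA0: "dA l i 0 = mat_vec n B (d l) i + s * mat_vec n E (Us l) i"
  by (simp add: dA_def arg_def Bs_vec d_def[abs_def] mat_vec_diff)

lemma dA_Suc: "dA l i (Suc j) = d (l - Suc j) i"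
  by (simp add: dA_def arg_def d_def)

lemma nrm_A: "nrm n (A l) \<le> a * Q * t" if l: "l < k"
proof -
  have "nrm n (\<lambda>i. dA l i 0) = nrm n (\<lambda>i. mat_vec n Bs (d l) i + s * mat_vec n E (U l) i)"
    by (rule nrm_cong) (simp add: dA_def arg_def Bs_vec d_def[abs_def] mat_vec_diff algebra_simps)
  also have "\<dots> \<le> nrm n (mat_vec n Bs (d l)) + t * nrm n (mat_vec n E (U l))"
    using nrm_add[of n "mat_vec n Bs (d l)" "\<lambda>i. s * mat_vec n E (U l) i"] by (simp add: nrm_cmult t_def)
  also have "\<dots> \<le> (K + 2) * (dd * t) + t * (2 * Q)"
    using opnD[OF Bs_op, of "d l"] mult_left_mono[OF nrm_d[of l], of "K + 2"] K l
      mult_left_mono[OF EU(2)[OF l] t(1)] by (simp add: algebra_simps)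
  finally have "nrm n (A l) \<le> ((K + 2) * (dd * t) + t * (2 * Q)) + real l * (dd * t)"
    unfolding A_dA[abs_def] by (intro nrm_ldist) (use l nrm_d in \<open>auto simp: dA_Suc\<close>)
  also have "\<dots> \<le> ((K + 2) * (dd * t) + W * (dd * t)) + real k * (dd * t)"
  proof -
    have "2 * Q \<le> dd" unfolding dd_def using RW Q by (simp add: mult_le_cancel_right1)
    moreover have "dd \<le> W * dd" using mult_right_mono[OF W(1) dd] by simp
    ultimately have "t * (2 * Q) \<le> t * (W * dd)" using t by (intro mult_left_mono) auto
    moreover have "real l * (dd * t) \<le> real k * (dd * t)"
      using l t R W Q by (intro mult_right_mono) (auto simp: dd_def)
    ultimately show ?thesis by (simp add: mult_ac)
  qed
  also have "\<dots> = (K + 2 + real k + W) * (dd * t)" by (simp add: algebra_simps)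
  also have "\<dots> \<le> (2 * W) * (dd * t)"
    using W R Q t by (intro mult_right_mono) (auto simp: dd_def)
  finally show ?thesis using a(5) by (simp add: mult.assoc[symmetric])
qed

definition "rem2 = (\<lambda>l i. F l (arg n Bs Us l i) - F l (arg n B U l i) - (\<Sum>j<Suc l. P l j i * dA l i j))"

lemma rem2_bound: "\<bar>rem2 l i\<bar> \<le> L * (A l i)\<^sup>2" if "l < k"
  using F[OF that] by (simp add: smooth_def rem2_def A_def P_def dA_def)

text \<open>The exact difference solves the linearized recursion up to two sources, the Taylor
  remainder and the matrix perturbation applied to the perturbed iterate. Their sum is the defect
  that gets paired with the adjoint.\<close>

lemma d_step: "d (Suc l) i - (P l 0 i * mat_vec n B (d l) i + (\<Sum>j<l. P l (Suc j) i * d (l - Suc j) i))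
    = rem2 l i + s * (P l 0 i * mat_vec n E (Us l) i)"
proof -
  have "(\<Sum>j<Suc l. P l j i * dA l i j) = P l 0 i * dA l i 0 + (\<Sum>j<l. P l (Suc j) i * d (l - Suc j) i)"
    by (simp only: sum.lessThan_Suc_shift dA_Suc)
  thus ?thesis
    by (simp add: rem2_def dA0 d_def Us_def U_def orb_Suc algebra_simps)
qed

lemma EUs: "mat_vec n E (Us l) i = mat_vec n E (U l) i + mat_vec n E (d l) i"
  by (simp add: d_def[abs_def] mat_vec_diff)

text \<open>\<open>s * ud\<close> solves the linear recursion with source \<open>s * e1\<close>, and
  \<open>d\<close> solves it up to second-order terms, so \<open>stability\<close> bounds their
  distance quadratically in \<open>s\<close>.\<close>

lemma nrm_d_ud: "nrm n (\<lambda>i. d l i - s * ud l i) \<le> a ^ 3 * Q\<^sup>2 * t\<^sup>2" if l: "l \<le> k"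
proof -
  \<comment> \<open>The first summand comes from the Taylor remainder, the second from
    \<open>s * E\<close> applied to the change \<open>d\<close> of the iterate.\<close>
  define \<tau> where "\<tau> = L * (a * Q * t)\<^sup>2 + t * (L * (2 * (dd * t)))"
  have ddp: "dd \<ge> 0" using R W Q by (simp add: dd_def)
  have \<tau>: "\<tau> \<ge> 0" using L t ddp by (simp add: \<tau>_def)
  have "nrm n (\<lambda>i. s * ud l i - d l i) \<le> (1 + L * (K + 2 + real k)) ^ l * \<tau>"
  proof (rule stability[OF _ _ BK, where F = "\<lambda>l i a. s * e1 l i + (\<Sum>j<Suc l. P l j i * a j)"])
    fix l i assume "l < k" "i \<in> {1..n}"
    thus "lip (Suc l) L (\<lambda>a. s * e1 l i + (\<Sum>j<Suc l. P l j i * a j))"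
      using PL by (intro lip_affine) auto
    show "s * ud (Suc l) i = s * e1 l i + (\<Sum>j<Suc l. P l j i * arg n B (\<lambda>l i. s * ud l i) l i j)"
      unfolding sum_arg by (simp add: ud_def lin.simps(2) mat_vec_cmult sum_distrib_left algebra_simps)
  next
    fix l assume l: "l < k"
    have "nrm n (\<lambda>i. d (Suc l) i - (s * e1 l i + (\<Sum>j<Suc l. P l j i * arg n B d l i j)))
       = nrm n (\<lambda>i. rem2 l i + s * (P l 0 i * mat_vec n E (d l) i))"
    proof (rule nrm_cong)
      fix i
      show "d (Suc l) i - (s * e1 l i + (\<Sum>j<Suc l. P l j i * arg n B d l i j))
         = rem2 l i + s * (P l 0 i * mat_vec n E (d l) i)"
        using d_step[of l i] unfolding sum_arg e1_def EUs by (simp add: algebra_simps)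
    qed
    also have "\<dots> \<le> nrm n (rem2 l) + t * nrm n (\<lambda>i. P l 0 i * mat_vec n E (d l) i)"
      using nrm_add[of n "rem2 l" "\<lambda>i. s * (P l 0 i * mat_vec n E (d l) i)"] by (simp only: nrm_cmult t_def)
    also have "nrm n (rem2 l) \<le> L * (a * Q * t)\<^sup>2"
    proof -
      have "nrm n (rem2 l) \<le> nrm n (\<lambda>i. L * (A l i)\<^sup>2)"
        using rem2_bound[OF l] L by (intro nrm_mono) auto
      also have "\<dots> = L * nrm n (\<lambda>i. (A l i)\<^sup>2)" using L by (simp add: nrm_cmult)
      also have "\<dots> \<le> L * (a * Q * t)\<^sup>2"
        using L by (intro mult_left_mono order_trans[OF nrm_square_le] power_mono nrm_A[OF l]) auto
      finally show ?thesis .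
    qed
    also have "nrm n (\<lambda>i. P l 0 i * mat_vec n E (d l) i) \<le> L * (2 * (dd * t))"
      using nrm_P[OF l, of "mat_vec n E (d l)"] E1(1)[of "d l"] nrm_d[of l] l L
      by (meson less_imp_le mult_left_mono order_trans zero_le_numeral zero_le_one)
    finally show "nrm n (\<lambda>i. d (Suc l) i - (s * e1 l i + (\<Sum>j<Suc l. P l j i * arg n B d l i j))) \<le> \<tau>"
      using t by (simp add: \<tau>_def mult_left_mono)
  qed (use L K Q l \<tau> in \<open>auto simp: ud_def d_def Us_def U_def\<close>)
  also have "\<dots> \<le> R * \<tau>"
    using WR[OF l] \<tau> by (intro mult_right_mono) (auto simp: W_def)
  also have "\<dots> \<le> R * (3 * W * (a * Q * t)\<^sup>2)"
  proof -
    have "dd \<le> (a * Q)\<^sup>2"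
    proof -
      have "1 \<le> a * Q" using mult_mono[OF a(1) Q] a Q by simp
      hence "a * Q \<le> (a * Q)\<^sup>2" by (simp add: power2_eq_square mult_le_cancel_left1)
      thus ?thesis using a(4) by linarith
    qed
    hence "t * (L * (2 * (dd * t))) \<le> t * (W * (2 * ((a * Q)\<^sup>2 * t)))"
      using t W L ddp by (intro mult_left_mono mult_mono mult_right_mono) auto
    moreover have "L * (a * Q * t)\<^sup>2 \<le> W * (a * Q * t)\<^sup>2" using W by (intro mult_right_mono) auto
    ultimately have "\<tau> \<le> 3 * W * (a * Q * t)\<^sup>2"
      unfolding \<tau>_def by (simp add: power2_eq_square mult_ac)
    thus ?thesis using R by (intro mult_left_mono) auto
  qed
  also have "\<dots> = (3 * R * W) * (a * Q * t)\<^sup>2" by simp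
  also have "\<dots> \<le> a * (a * Q * t)\<^sup>2" using a by (intro mult_right_mono) auto
  also have "\<dots> = a ^ 3 * Q\<^sup>2 * t\<^sup>2" by (simp add: power2_eq_square power3_eq_cube)
  finally show ?thesis by (simp add: nrm_minus_commute)
qed

lemma nrm_dA_dl: "nrm n (\<lambda>i. ldist (Suc l) (dA l i) (\<lambda>j. s * dl l i j)) \<le> a ^ 4 * Q\<^sup>2 * t\<^sup>2" if l: "l < k"
proof -
  define X where "X = a ^ 3 * Q\<^sup>2 * t\<^sup>2"
  have X: "X \<ge> 0" using a by (simp add: X_def)
  have "nrm n (\<lambda>i. dA l i 0 - s * dl l i 0)
     = nrm n (\<lambda>i. mat_vec n B (\<lambda>i. d l i - s * ud l i) i + s * mat_vec n E (d l) i)"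
    by (rule nrm_cong) (simp add: dA0 dl_def mat_vec_diff mat_vec_cmult EUs algebra_simps)
  also have "\<dots> \<le> nrm n (mat_vec n B (\<lambda>i. d l i - s * ud l i)) + t * nrm n (mat_vec n E (d l))"
    using nrm_add[of n "mat_vec n B (\<lambda>i. d l i - s * ud l i)" "\<lambda>i. s * mat_vec n E (d l) i"]
    by (simp add: nrm_cmult t_def)
  also have "\<dots> \<le> K * X + 2 * X"
  proof (rule add_mono)
    show "nrm n (mat_vec n B (\<lambda>i. d l i - s * ud l i)) \<le> K * X"
      using opnD[OF B, of "\<lambda>i. d l i - s * ud l i"] mult_left_mono[OF nrm_d_ud[of l], of K] K l
      unfolding X_def by linarith
    have "t * nrm n (mat_vec n E (d l)) \<le> t * (2 * (dd * t))"
      using E1(1)[of "d l"] nrm_d[of l] l t by (intro mult_left_mono) auto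
    also have "\<dots> \<le> t * (2 * ((a ^ 3 * Q\<^sup>2) * t))"
    proof -
      have "a * Q \<le> a ^ 3 * Q\<^sup>2"
        using a Q power_increasing[of 1 3 a] power_increasing[of 1 2 Q] by (intro mult_mono) auto
      hence "dd \<le> a ^ 3 * Q\<^sup>2" using a(4) by linarith
      thus ?thesis using t by (intro mult_left_mono mult_right_mono) auto
    qed
    also have "\<dots> = 2 * X" by (simp add: X_def power2_eq_square)
    finally show "t * nrm n (mat_vec n E (d l)) \<le> 2 * X" .
  qed
  finally have "nrm n (\<lambda>i. ldist (Suc l) (dA l i) (\<lambda>j. s * dl l i j)) \<le> (K * X + 2 * X) + real l * X"
  proof (rule nrm_ldist)
    fix j assume "j < l"
    thus "nrm n (\<lambda>i. dA l i (Suc j) - s * dl l i (Suc j)) \<le> X"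
      using nrm_d_ud[of "l - Suc j"] l by (simp add: dA_Suc dl_def X_def)
  qed
  also have "\<dots> \<le> (K + 2 + real k) * X"
  proof -
    have "real l * X \<le> real k * X" using l X by (intro mult_right_mono) auto
    thus ?thesis by (simp add: algebra_simps)
  qed
  also have "\<dots> \<le> a * X" using W a X by (intro mult_right_mono) auto
  finally show ?thesis by (simp add: X_def power4_eq_xxxx power3_eq_cube mult_ac)
qed

definition "quad = (\<lambda>l i z. \<Sum>y<Suc l. \<Sum>x<Suc l. H l x y (arg n B U l i) * z x * z y)"
text \<open>What is left of the defect once its terms of order \<open>s\<close> and
  \<open>s^2\<close> are split off: the third-order Taylor remainder, the error of inserting
  \<open>s * dl\<close> into the quadratic form, and the error of inserting \<open>s * ud\<close>
  under \<open>E\<close>.\<close>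

definition "rr = (\<lambda>l i. (rem2 l i - quad l i (dA l i)) + (quad l i (dA l i) - quad l i (\<lambda>j. s * dl l i j))
   + s * (P l 0 i * mat_vec n E (\<lambda>i. d l i - s * ud l i) i))"

text \<open>The adjoint is bounded in supremum norm, so the sum norm is needed here. No factor
  \<open>sqrt n\<close> is lost: a sum of cubes is at most the cube of the Euclidean norm, products
  are treated by Cauchy-Schwarz, and the sum norm of \<open>E v\<close> involves two coordinates
  only.\<close>

lemma rr_l1: "(\<Sum>i\<in>{1..n}. \<bar>rr l i\<bar>) \<le> 5 * W * a ^ 5 * Q ^ 3 * t ^ 3" if l: "l < k"
proof -
  have 1: "(\<Sum>i\<in>{1..n}. \<bar>rem2 l i - quad l i (dA l i)\<bar>) \<le> L * (a * Q * t) ^ 3"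
  proof -
    have "\<bar>rem2 l i - quad l i (dA l i)\<bar> \<le> L * \<bar>A l i\<bar> ^ 3" for i
      using F[OF l] by (simp add: smooth_def rem2_def quad_def A_def P_def dA_def del: sum.lessThan_Suc)
    hence "(\<Sum>i\<in>{1..n}. \<bar>rem2 l i - quad l i (dA l i)\<bar>) \<le> L * (\<Sum>i\<in>{1..n}. \<bar>A l i\<bar> ^ 3)"
      unfolding sum_distrib_left by (intro sum_mono) auto
    also have "\<dots> \<le> L * (a * Q * t) ^ 3"
      using L by (intro mult_left_mono order_trans[OF sum_cube_le] power_mono nrm_A[OF l]) auto
    finally show ?thesis .
  qed
  have 2: "(\<Sum>i\<in>{1..n}. \<bar>quad l i (dA l i) - quad l i (\<lambda>j. s * dl l i j)\<bar>)
      \<le> L * ((a ^ 4 * Q\<^sup>2 * t\<^sup>2) * (2 * (a * Q * t)))"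
  proof -
    define f where "f = (\<lambda>i. ldist (Suc l) (dA l i) (\<lambda>j. s * dl l i j))"
    define g where "g = (\<lambda>i. A l i + ldist (Suc l) (\<lambda>j. s * dl l i j) (\<lambda>_. 0))"
    have pos: "f i \<ge> 0" "g i \<ge> 0" for i by (auto simp: f_def g_def A_def)
    have "\<bar>quad l i (dA l i) - quad l i (\<lambda>j. s * dl l i j)\<bar> \<le> L * (\<bar>f i\<bar> * \<bar>g i\<bar>)" for i
      using quadratic_diff[of "Suc l" "\<lambda>x y. H l x y (arg n B U l i)" L "dA l i" "\<lambda>j. s * dl l i j"]
        HL[OF l] pos by (simp add: quad_def f_def g_def A_dA del: sum.lessThan_Suc)
    hence "(\<Sum>i\<in>{1..n}. \<bar>quad l i (dA l i) - quad l i (\<lambda>j. s * dl l i j)\<bar>) \<le> L * (\<Sum>i\<in>{1..n}. \<bar>f i\<bar> * \<bar>g i\<bar>)"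
      unfolding sum_distrib_left by (intro sum_mono) auto
    also have "\<dots> \<le> L * (nrm n f * nrm n g)"
      using L by (intro mult_left_mono sum_mult_le_nrm) auto
    also have "\<dots> \<le> L * ((a ^ 4 * Q\<^sup>2 * t\<^sup>2) * (2 * (a * Q * t)))"
    proof -
      have "nrm n g \<le> nrm n (A l) + nrm n (\<lambda>i. t * ldist (Suc l) (dl l i) (\<lambda>_. 0))"
        unfolding g_def by (rule order_trans[OF nrm_add])
          (simp add: ldist_def sum_distrib_left abs_mult t_def del: sum.lessThan_Suc)
      also have "\<dots> \<le> a * Q * t + t * (a * Q)"
        unfolding nrm_cmult using nrm_A[OF l] nrm_dl[OF l] t by (intro add_mono mult_mono) auto
      finally have "nrm n g \<le> 2 * (a * Q * t)" by (simp add: mult_ac)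
      thus ?thesis using L nrm_dA_dl[OF l] a Q t unfolding f_def
        by (intro mult_left_mono mult_mono) auto
    qed
    finally show ?thesis .
  qed
  have 3: "(\<Sum>i\<in>{1..n}. \<bar>s * (P l 0 i * mat_vec n E (\<lambda>i. d l i - s * ud l i) i)\<bar>)
     \<le> t * (L * (2 * (a ^ 3 * Q\<^sup>2 * t\<^sup>2)))"
  proof -
    have "(\<Sum>i\<in>{1..n}. \<bar>s * (P l 0 i * mat_vec n E (\<lambda>i. d l i - s * ud l i) i)\<bar>)
       \<le> t * (L * (\<Sum>i\<in>{1..n}. \<bar>mat_vec n E (\<lambda>i. d l i - s * ud l i) i\<bar>))"
      unfolding sum_distrib_left t_def abs_mult using PL[OF l, of 0]
      by (intro sum_mono mult_left_mono mult_right_mono) auto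
    also have "\<dots> \<le> t * (L * (2 * (a ^ 3 * Q\<^sup>2 * t\<^sup>2)))"
      using E1(2)[of "\<lambda>i. d l i - s * ud l i"] nrm_d_ud[of l] l t L
      by (intro mult_left_mono) auto
    finally show ?thesis .
  qed
  have "(\<Sum>i\<in>{1..n}. \<bar>rr l i\<bar>) \<le> (\<Sum>i\<in>{1..n}. \<bar>rem2 l i - quad l i (dA l i)\<bar>
       + \<bar>quad l i (dA l i) - quad l i (\<lambda>j. s * dl l i j)\<bar>
       + \<bar>s * (P l 0 i * mat_vec n E (\<lambda>i. d l i - s * ud l i) i)\<bar>)"
    unfolding rr_def by (intro sum_mono) linarith
  also have "\<dots> \<le> L * (a * Q * t) ^ 3 + L * ((a ^ 4 * Q\<^sup>2 * t\<^sup>2) * (2 * (a * Q * t)))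
      + t * (L * (2 * (a ^ 3 * Q\<^sup>2 * t\<^sup>2)))"
    unfolding sum.distrib by (intro add_mono 1 2 3)
  also have "\<dots> = L * t ^ 3 * (a ^ 3 * Q ^ 3 + 2 * (a ^ 5 * Q ^ 3) + 2 * (a ^ 3 * Q\<^sup>2))"
    by (simp add: power_mult_distrib algebra_simps power2_eq_square power3_eq_cube eval_nat_numeral)
  also have "\<dots> \<le> W * t ^ 3 * (a ^ 5 * Q ^ 3 + 2 * (a ^ 5 * Q ^ 3) + 2 * (a ^ 5 * Q ^ 3))"
  proof (rule mult_mono)
    show "L * t ^ 3 \<le> W * t ^ 3" using W t by (intro mult_right_mono) auto
    have "a ^ 3 * Q ^ 3 \<le> a ^ 5 * Q ^ 3" "a ^ 3 * Q\<^sup>2 \<le> a ^ 5 * Q ^ 3"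
      using a Q by (intro mult_mono power_increasing; auto)+
    thus "a ^ 3 * Q ^ 3 + 2 * (a ^ 5 * Q ^ 3) + 2 * (a ^ 3 * Q\<^sup>2)
      \<le> a ^ 5 * Q ^ 3 + 2 * (a ^ 5 * Q ^ 3) + 2 * (a ^ 5 * Q ^ 3)" by linarith
  qed (use W t a Q in auto)
  also have "\<dots> = 5 * W * a ^ 5 * Q ^ 3 * t ^ 3" by (simp add: algebra_simps)
  finally show ?thesis .
qed

text \<open>\<open>adjoint_identity\<close> for the exact difference, with the defect sorted by
  powers of \<open>s\<close>. One factor \<open>Q\<close> comes from the adjoint and three from
  \<open>rr\<close>; the number \<open>k\<close> of levels is absorbed into
  \<open>W\<close>.\<close>

lemma expansion_at: "\<bar>(\<Sum>i\<in>{1..n}. Us k i) - (\<Sum>i\<in>{1..n}. U k i) - \<beta> * s - \<gamma> * s\<^sup>2\<bar> \<le> c * Q ^ 4 * t ^ 3"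
proof -
  have "(\<Sum>i\<in>{1..n}. d k i) = (\<Sum>l<k. \<Sum>i\<in>{1..n}. b (Suc l) i * (rem2 l i + s * (P l 0 i * mat_vec n E (Us l) i)))"
    unfolding b_def d_step[symmetric]
    by (rule adjoint_identity[OF sym]) (auto simp: d_def Us_def U_def)
  also have "\<dots> = (\<Sum>l<k. \<Sum>i\<in>{1..n}. b (Suc l) i * rr l i + s * (b (Suc l) i * e1 l i)
      + s\<^sup>2 * (b (Suc l) i * (quad l i (dl l i) + P l 0 i * mat_vec n E (ud l) i)))"
  proof (intro sum.cong refl)
    fix l i
    have q: "quad l i (\<lambda>j. s * dl l i j) = s\<^sup>2 * quad l i (dl l i)"
      by (simp add: quad_def sum_distrib_left power2_eq_square mult_ac del: sum.lessThan_Suc)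
    show "b (Suc l) i * (rem2 l i + s * (P l 0 i * mat_vec n E (Us l) i))
       = b (Suc l) i * rr l i + s * (b (Suc l) i * e1 l i)
      + s\<^sup>2 * (b (Suc l) i * (quad l i (dl l i) + P l 0 i * mat_vec n E (ud l) i))"
      unfolding rr_def q e1_def EUs mat_vec_diff mat_vec_cmult
      by (simp add: algebra_simps power2_eq_square)
  qed
  also have "\<dots> = (\<Sum>l<k. \<Sum>i\<in>{1..n}. b (Suc l) i * rr l i) + \<beta> * s + \<gamma> * s\<^sup>2"
    by (simp add: \<beta>_def \<gamma>_def quad_def sum.distrib sum_distrib_left sum_distrib_right mult_ac del: sum.lessThan_Suc)
  finally have "(\<Sum>i\<in>{1..n}. Us k i) - (\<Sum>i\<in>{1..n}. U k i) - \<beta> * s - \<gamma> * s\<^sup>2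
     = (\<Sum>l<k. \<Sum>i\<in>{1..n}. b (Suc l) i * rr l i)"
    by (simp add: d_def sum_subtractf)
  moreover have "\<bar>\<Sum>l<k. \<Sum>i\<in>{1..n}. b (Suc l) i * rr l i\<bar> \<le> (\<Sum>l<k. Q * (5 * W * a ^ 5 * Q ^ 3 * t ^ 3))"
  proof (rule order_trans[OF sum_abs sum_mono])
    fix l assume "l \<in> {..<k}"
    hence l: "l < k" by simp
    have "\<bar>\<Sum>i\<in>{1..n}. b (Suc l) i * rr l i\<bar> \<le> (\<Sum>i\<in>{1..n}. Q * \<bar>rr l i\<bar>)"
      by (rule order_trans[OF sum_abs sum_mono])
         (use bQ'[OF l] in \<open>auto simp: abs_mult intro!: mult_right_mono\<close>)
    also have "\<dots> \<le> Q * (5 * W * a ^ 5 * Q ^ 3 * t ^ 3)"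
      unfolding sum_distrib_left[symmetric] using Q by (intro mult_left_mono rr_l1[OF l]) auto
    finally show "\<bar>\<Sum>i\<in>{1..n}. b (Suc l) i * rr l i\<bar> \<le> Q * (5 * W * a ^ 5 * Q ^ 3 * t ^ 3)" .
  qed
  moreover have "(\<Sum>l<k. Q * (5 * W * a ^ 5 * Q ^ 3 * t ^ 3)) = real k * (5 * W * a ^ 5 * Q ^ 4 * t ^ 3)"
    by (simp add: eval_nat_numeral)
  moreover have "real k * (5 * W * a ^ 5 * Q ^ 4 * t ^ 3) \<le> W * (5 * W * a ^ 5 * Q ^ 4 * t ^ 3)"
    using W a Q t by (intro mult_right_mono) auto
  moreover have "W * (5 * W * a ^ 5 * Q ^ 4 * t ^ 3) = c * Q ^ 4 * t ^ 3"
    by (simp add: c_def power2_eq_square mult_ac)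
  ultimately show ?thesis by linarith
qed

end

section \<open>Size of the coefficients of the expansion\<close>

context entry_perturbation
begin

lemma c_ge: "real k * (2 * L * Q\<^sup>2) \<le> c * Q ^ 4" "real k * (Q * (L * (a * Q)\<^sup>2 + L * (2 * dd))) \<le> c * Q ^ 4"
proof -
  have a2: "1 \<le> a ^ 5" using a by simp
  have "real k * (2 * L * Q\<^sup>2) \<le> W * (2 * W * Q ^ 4)"
    using W L Q by (intro mult_mono power_increasing) auto
  also have "\<dots> \<le> (W * (2 * W * Q ^ 4)) * a ^ 5" using mult_left_mono[OF a2, of "W * (2 * W * Q ^ 4)"] W Q by simp
  also have "\<dots> \<le> c * Q ^ 4" using W Q a by (simp add: c_def power2_eq_square mult_ac)
  finally show "real k * (2 * L * Q\<^sup>2) \<le> c * Q ^ 4" .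
  have 1: "a * Q \<le> a\<^sup>2 * Q\<^sup>2" using a Q power_increasing[of 1 2 a] power_increasing[of 1 2 Q] by (intro mult_mono) auto
  have "L * (a * Q)\<^sup>2 + L * (2 * dd) \<le> W * (a\<^sup>2 * Q\<^sup>2) + W * (2 * (a\<^sup>2 * Q\<^sup>2))"
  proof -
    have "dd \<le> a\<^sup>2 * Q\<^sup>2" using 1 a(4) by linarith
    thus ?thesis using W L dd by (intro add_mono mult_mono) (auto simp: power_mult_distrib)
  qed
  also have "\<dots> = 3 * W * a\<^sup>2 * Q\<^sup>2" by simp
  finally have "real k * (Q * (L * (a * Q)\<^sup>2 + L * (2 * dd))) \<le> W * (Q * (3 * W * a\<^sup>2 * Q\<^sup>2))"
    using W L Q R by (intro mult_mono mult_left_mono) (auto simp: dd_def)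
  also have "\<dots> = 3 * W\<^sup>2 * a\<^sup>2 * Q ^ 3" by (simp add: eval_nat_numeral)
  also have "\<dots> \<le> 5 * W\<^sup>2 * a ^ 5 * Q ^ 4"
    using W a Q by (intro mult_mono power_increasing) auto
  finally show "real k * (Q * (L * (a * Q)\<^sup>2 + L * (2 * dd))) \<le> c * Q ^ 4" by (simp add: c_def)
qed

lemma beta_bound: "\<bar>\<beta>\<bar> \<le> c * Q ^ 4"
proof -
  have "\<bar>\<beta>\<bar> \<le> (\<Sum>l<k. 2 * L * Q\<^sup>2)"
    unfolding \<beta>_def
  proof (rule order_trans[OF sum_abs sum_mono])
    fix l assume "l \<in> {..<k}"
    hence l: "l < k" by simp
    have "\<bar>\<Sum>i\<in>{1..n}. b (Suc l) i * e1 l i\<bar> \<le> (\<Sum>i\<in>{1..n}. Q * (L * \<bar>mat_vec n E (U l) i\<bar>))"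
      using bQ'[OF l] PL[OF l, of 0] L Q
      by (intro order_trans[OF sum_abs sum_mono]) (auto simp: e1_def abs_mult intro!: mult_mono)
    also have "\<dots> \<le> Q * (L * (2 * Q))"
      unfolding sum_distrib_left[symmetric] using Q L EU(1)[OF l] by (intro mult_left_mono) auto
    finally show "\<bar>\<Sum>i\<in>{1..n}. b (Suc l) i * e1 l i\<bar> \<le> 2 * L * Q\<^sup>2"
      by (simp add: power2_eq_square mult_ac)
  qed
  thus ?thesis using c_ge(1) by simp
qed

lemma gamma_bound: "\<bar>\<gamma>\<bar> \<le> c * Q ^ 4"
proof -
  have "\<bar>\<gamma>\<bar> \<le> (\<Sum>l<k. Q * (L * (a * Q)\<^sup>2 + L * (2 * dd)))"
    unfolding \<gamma>_def
  proof (rule order_trans[OF sum_abs sum_mono])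
    fix l assume "l \<in> {..<k}"
    hence l: "l < k" by simp
    define qq where "qq = (\<lambda>i. \<Sum>y<Suc l. \<Sum>x<Suc l. H l x y (arg n B U l i) * dl l i x * dl l i y)"
    have qq: "\<bar>qq i\<bar> \<le> L * (ldist (Suc l) (dl l i) (\<lambda>_. 0))\<^sup>2" for i
      using quadratic_diff[of "Suc l" "\<lambda>x y. H l x y (arg n B U l i)" L "dl l i" "\<lambda>_. 0"] HL[OF l]
      by (simp add: qq_def power2_eq_square ldist_def del: sum.lessThan_Suc)
    have "\<bar>\<Sum>i\<in>{1..n}. b (Suc l) i * (qq i + P l 0 i * mat_vec n E (ud l) i)\<bar>
       \<le> (\<Sum>i\<in>{1..n}. Q * (L * (ldist (Suc l) (dl l i) (\<lambda>_. 0))\<^sup>2 + L * \<bar>mat_vec n E (ud l) i\<bar>))"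
    proof (rule order_trans[OF sum_abs sum_mono])
      fix i assume i: "i \<in> {1..n}"
      have "\<bar>P l 0 i * mat_vec n E (ud l) i\<bar> \<le> L * \<bar>mat_vec n E (ud l) i\<bar>"
        unfolding abs_mult using PL[OF l] by (intro mult_right_mono) auto
      hence "\<bar>qq i + P l 0 i * mat_vec n E (ud l) i\<bar>
        \<le> L * (ldist (Suc l) (dl l i) (\<lambda>_. 0))\<^sup>2 + L * \<bar>mat_vec n E (ud l) i\<bar>"
        using qq[of i] by linarith
      thus "\<bar>b (Suc l) i * (qq i + P l 0 i * mat_vec n E (ud l) i)\<bar>
        \<le> Q * (L * (ldist (Suc l) (dl l i) (\<lambda>_. 0))\<^sup>2 + L * \<bar>mat_vec n E (ud l) i\<bar>)"
        unfolding abs_mult using bQ'[OF l i] Q by (intro mult_mono) auto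
    qed
    also have "\<dots> = Q * (L * (nrm n (\<lambda>i. ldist (Suc l) (dl l i) (\<lambda>_. 0)))\<^sup>2
        + L * (\<Sum>i\<in>{1..n}. \<bar>mat_vec n E (ud l) i\<bar>))"
      by (simp only: nrm_power2 sum_distrib_left sum.distrib distrib_left)
    also have "\<dots> \<le> Q * (L * (a * Q)\<^sup>2 + L * (2 * dd))"
      using Q L E1(2)[of "ud l"] nrm_ud[of l] l
      by (intro mult_left_mono add_mono power_mono nrm_dl[OF l]) auto
    finally show "\<bar>\<Sum>i\<in>{1..n}. b (Suc l) i * ((\<Sum>y<Suc l. \<Sum>x<Suc l. H l x y (arg n B U l i) * dl l i x * dl l i y)
        + P l 0 i * mat_vec n E (ud l) i)\<bar> \<le> Q * (L * (a * Q)\<^sup>2 + L * (2 * dd))"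
      unfolding qq_def .
  qed
  thus ?thesis using c_ge(2) by simp
qed

text \<open>The constant \<open>c\<close> depends on \<open>k\<close>, \<open>L\<close> and
  \<open>K\<close> only; the dimension can enter solely through \<open>Q\<close>.\<close>

theorem expansion:
  "\<exists>\<beta> \<gamma>. \<bar>\<beta>\<bar> \<le> c * Q ^ 4 \<and> \<bar>\<gamma>\<bar> \<le> c * Q ^ 4 \<and> (\<forall>s. \<bar>s\<bar> \<le> 1 \<longrightarrow>
     \<bar>(\<Sum>i\<in>{1..n}. orb n F (\<lambda>i j. B i j + s * E i j) u k i) - (\<Sum>i\<in>{1..n}. orb n F B u k i)
       - \<beta> * s - \<gamma> * s\<^sup>2\<bar> \<le> c * Q ^ 4 * \<bar>s\<bar> ^ 3)"
proof (intro exI conjI allI impI)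
  show "\<bar>\<beta>\<bar> \<le> c * Q ^ 4" by (rule beta_bound)
  show "\<bar>\<gamma>\<bar> \<le> c * Q ^ 4" by (rule gamma_bound)
  fix s :: real assume "\<bar>s\<bar> \<le> 1"
  then interpret entry_perturbation_at k n L K Q F D H B E u p q s
    by unfold_locales
  show "\<bar>(\<Sum>i\<in>{1..n}. orb n F (\<lambda>i j. B i j + s * E i j) u k i) - (\<Sum>i\<in>{1..n}. orb n F B u k i)
       - \<beta> * s - \<gamma> * s\<^sup>2\<bar> \<le> c * Q ^ 4 * \<bar>s\<bar> ^ 3"
    using expansion_at by (simp add: Us_def U_def Bs_def t_def)
qed

end

section \<open>Leave-one-out bounds\<close>

text \<open>\<open>stability\<close> against the sequence \<open>u, 0, 0, ...\<close>, whose defect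
  is controlled by \<open>u\<close> and by the values of the functions at zero.\<close>

lemma orb_nrm:
  assumes L: "L \<ge> 0" and K: "K \<ge> 0" and C0: "C0 \<ge> 0" and B: "opn n B K"
    and lip: "\<And>l. l < k \<Longrightarrow> lip (Suc l) L (F l)" and F0: "\<And>l. l < k \<Longrightarrow> \<bar>F l (\<lambda>_. 0)\<bar> \<le> L"
    and u: "nrm n u \<le> C0 * sqrt (real n)" and l: "l \<le> k"
  shows "nrm n (orb n F B u l) \<le> ((1 + L * (K + real k)) ^ (k + 1) * (1 + C0) + C0) * sqrt (real n)"
proof -
  define V :: "nat \<Rightarrow> vect" where "V = (\<lambda>l. if l = 0 then u else (\<lambda>_. 0))"
  define W where "W = 1 + L * (K + real k)"
  define x where "x = C0 * sqrt (real n)"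
  define y where "y = W * (1 + C0) * sqrt (real n)"
  have W: "W \<ge> 1" using L K by (simp add: W_def)
  have Vx: "nrm n (V r) \<le> x" for r using u C0 by (simp add: V_def x_def)
  have "nrm n (\<lambda>i. orb n F B u l i - V l i) \<le> W ^ l * y"
    unfolding W_def
  proof (rule stability[OF L K B, where F = "\<lambda>l i. F l"])
    show "y \<ge> 0" using W C0 by (simp add: y_def)
    show "orb n F B u (Suc l) i = F l (arg n B (orb n F B u) l i)" for l i by (rule orb_Suc)
    fix l assume l: "l < k"
    have "nrm n (\<lambda>i. ldist (Suc l) (arg n B V l i) (arg n B (\<lambda>_ _. 0) l i)) \<le> K * x + real l * x"
      by (rule nrm_ldist_arg)
         (use opnD[OF B, of "V l"] mult_left_mono[OF Vx K, of l] Vx in auto)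
    also have "\<dots> \<le> (K + real k) * x"
    proof -
      have "real l * x \<le> real k * x" using l C0 by (intro mult_right_mono) (auto simp: x_def)
      thus ?thesis by (simp add: distrib_right)
    qed
    finally have 1: "nrm n (\<lambda>i. ldist (Suc l) (arg n B V l i) (arg n B (\<lambda>_ _. 0) l i)) \<le> (K + real k) * x" .
    have "nrm n (\<lambda>i. V (Suc l) i - F l (arg n B V l i))
      \<le> nrm n (\<lambda>i. L + L * ldist (Suc l) (arg n B V l i) (arg n B (\<lambda>_ _. 0) l i))"
    proof (rule nrm_mono)
      fix i
      have "arg n B (\<lambda>_ _. 0) l i = (\<lambda>_. 0)" by (auto simp: arg_def)
      hence "\<bar>F l (arg n B V l i) - F l (\<lambda>_. 0)\<bar> \<le> L * ldist (Suc l) (arg n B V l i) (arg n B (\<lambda>_ _. 0) l i)"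
        using lipD[OF lip[OF l], of "arg n B V l i" "\<lambda>_. 0"] by simp
      thus "\<bar>V (Suc l) i - F l (arg n B V l i)\<bar>
         \<le> \<bar>L + L * ldist (Suc l) (arg n B V l i) (arg n B (\<lambda>_ _. 0) l i)\<bar>"
        using F0[OF l] by (simp add: V_def)
    qed
    also have "\<dots> \<le> nrm n (\<lambda>_. L) + nrm n (\<lambda>i. L * ldist (Suc l) (arg n B V l i) (arg n B (\<lambda>_ _. 0) l i))"
      by (rule nrm_add)
    also have "\<dots> \<le> L * sqrt (real n) + L * ((K + real k) * x)"
      using L 1 by (simp add: nrm_const nrm_cmult mult_left_mono)
    also have "\<dots> \<le> y"
    proof -
      have "L * sqrt (real n) \<le> W * sqrt (real n) \<or> k = 0"
      proof (cases "k = 0")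
        case False
        hence "L * 1 \<le> L * (K + real k)" using K L by (intro mult_left_mono) auto
        thus ?thesis by (auto simp: W_def intro!: mult_right_mono)
      qed simp
      moreover have "L * ((K + real k) * x) \<le> W * x"
        using C0 by (simp add: W_def x_def distrib_right mult.assoc)
      ultimately show ?thesis using l by (simp add: y_def x_def distrib_left distrib_right mult_ac)
    qed
    finally show "nrm n (\<lambda>i. V (Suc l) i - F l (arg n B V l i)) \<le> y" .
  next
    show "nrm n (\<lambda>i. orb n F B u 0 i - V 0 i) \<le> y" using W C0 by (simp add: V_def y_def)
  qed (use lip l in auto)
  also have "W ^ l * y \<le> W ^ k * y"
    using W l C0 by (intro mult_right_mono power_increasing) (auto simp: y_def)
  finally have "nrm n (\<lambda>i. orb n F B u l i - V l i) \<le> W ^ k * y" .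
  moreover have "nrm n (orb n F B u l) \<le> nrm n (\<lambda>i. orb n F B u l i - V l i) + nrm n (V l)"
    using nrm_add[of n "\<lambda>i. orb n F B u l i - V l i" "V l"] by simp
  ultimately have "nrm n (orb n F B u l) \<le> W ^ k * y + x" using Vx[of l] by linarith
  also have "\<dots> = (W ^ (k + 1) * (1 + C0) + C0) * sqrt (real n)"
    by (simp add: y_def x_def algebra_simps)
  finally show ?thesis by (simp only: W_def)
qed

text \<open>Leave-one-out comparison: \<open>B'\<close> arises from \<open>B\<close> by removing the noise in row and column \<open>i0\<close>.
  The functional \<open>T v\<close> is the size of the removed noise row applied to \<open>v\<close>; it is small for
  the vectors below because they depend on \<open>B'\<close> only.\<close>

locale cavity =
  fixes k n :: nat and L K C0 q :: real
    and F :: "nat \<Rightarrow> (nat \<Rightarrow> real) \<Rightarrow> real" and D :: "nat \<Rightarrow> nat \<Rightarrow> (nat \<Rightarrow> real) \<Rightarrow> real"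
    and B B' :: matr and u :: vect and i0 :: nat and T :: "vect \<Rightarrow> real"
  assumes L: "L \<ge> 1" and K: "K \<ge> 1" and C0: "C0 \<ge> 0" and q: "q \<ge> 1" and n: "n \<ge> 1"
    and F: "\<And>l. l < k \<Longrightarrow> lip (Suc l) L (F l)" and F0: "\<And>l. l < k \<Longrightarrow> \<bar>F l (\<lambda>_. 0)\<bar> \<le> L"
    and D: "\<And>l j. l < k \<Longrightarrow> j < Suc l \<Longrightarrow> lip (Suc l) L (D l j)"
    and DL: "\<And>l j x. l < k \<Longrightarrow> j < Suc l \<Longrightarrow> \<bar>D l j x\<bar> \<le> L"
    and B: "opn n B K" and B': "opn n B' K"
    and u: "nrm n u \<le> C0 * sqrt (real n)"
    and i0: "i0 \<in> {1..n}" and ui0: "\<bar>u i0\<bar> \<le> q"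
    and row: "\<And>v. \<bar>mat_vec n B' v i0\<bar> \<le> q * (nrm n v / sqrt (real n))"
    and diff: "\<And>v. nrm n (\<lambda>i. mat_vec n B v i - mat_vec n B' v i) \<le> T v + 2 * K * \<bar>v i0\<bar>"
    and TU: "\<And>l. l < k \<Longrightarrow> T (orb n F B' u l) \<le> q * (nrm n (orb n F B' u l) / sqrt (real n))"
begin

text \<open>All constants depend on \<open>k\<close>, \<open>L\<close>, \<open>K\<close> and
  \<open>C0\<close> only. In units of \<open>sqrt n\<close>, \<open>cN\<close> bounds the iterates
  of \<open>B'\<close>. In units of \<open>q\<close>, \<open>cM\<close> bounds their coordinate
  \<open>i0\<close>, \<open>cT\<close> the vector \<open>(B - B') U'\<close>, \<open>cD\<close> the
  change of the iterates, \<open>cU\<close> coordinate \<open>i0\<close> of the iterates of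
  \<open>B\<close>, and \<open>cP\<close> the change of the derivatives. In units of
  \<open>q * Q\<close>, \<open>cX\<close> bounds the defect of the backward comparison and
  \<open>cB\<close> coordinate \<open>i0\<close> of the adjoint.\<close>

definition "W = 1 + L * (K + real k)"
definition "cN = W ^ (k + 1) * (1 + C0) + C0"
definition "cM = W ^ k * (cN + 1)"
definition "cT = cN + 2 * K * cM"
definition "cD = W ^ k * (L * cT)"
definition "cU = cM + cD"
definition "cP = L * ((K + real k) * cD + cT)"
definition "cX = (K + real k) * cP + L * W ^ k + 2 * K * L"
definition "cB = 1 + L * W ^ k + L * real k + (W + 1) ^ k * cX"
definition "U = orb n F B u"
definition "U' = orb n F B' u"
definition "P = (\<lambda>l j i. D l j (arg n B U l i))"
definition "P' = (\<lambda>l j i. D l j (arg n B' U' l i))"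
definition "b = adj n B P k"
definition "b' = adj n B' P' k"

section \<open>Forward comparison of the two orbits\<close>

lemma W: "W \<ge> 1" "L * (1 + real k) \<le> W"
  using L K mult_left_mono[of "1 + real k" "K + real k" L] mult_nonneg_nonneg[of L "K + real k"]
  unfolding W_def by linarith+

lemma const_nonneg: "cN \<ge> 0" "cM \<ge> 0" "cT \<ge> 0" "cD \<ge> 0" "cP \<ge> 0" "cX \<ge> 0"
proof -
  show N: "cN \<ge> 0" using W C0 by (simp add: cN_def)
  show M: "cM \<ge> 0" using W N by (simp add: cM_def)
  show T: "cT \<ge> 0" using N M K by (simp add: cT_def)
  show D: "cD \<ge> 0" using T W L by (simp add: cD_def)
  show P: "cP \<ge> 0" using D T K L by (simp add: cP_def)
  show "cX \<ge> 0" using P K L W by (simp add: cX_def)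
qed

lemma sqrtn: "sqrt (real n) > 0" using n by simp

lemma nrm_div: "nrm n v \<le> c * sqrt (real n) \<Longrightarrow> q * (nrm n v / sqrt (real n)) \<le> q * c"
  using sqrtn q by (intro mult_left_mono) (auto simp: field_simps)

lemma U'_nrm: "l \<le> k \<Longrightarrow> nrm n (U' l) \<le> cN * sqrt (real n)"
  unfolding U'_def cN_def W_def using L K C0 by (intro orb_nrm B' F F0 u) auto

text \<open>Row \<open>i0\<close> of \<open>B'\<close> contains no noise, so by \<open>row\<close>
  the matrix term contributes at most \<open>q * cN\<close> at coordinate \<open>i0\<close>; what
  remains is a scalar recursion in earlier values at \<open>i0\<close>.\<close>

lemma U'_i0: "l \<le> k \<Longrightarrow> \<bar>U' l i0\<bar> \<le> W ^ l * ((cN + 1) * q)"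
proof (induction l rule: less_induct)
  case (less l)
  define y where "y = (cN + 1) * q"
  have y: "y \<ge> 0" "q \<le> y" "1 + q * cN \<le> y" using const_nonneg q by (auto simp: y_def algebra_simps)
  show ?case
  proof (cases l)
    case 0
    thus ?thesis using ui0 y by (simp add: U'_def y_def)
  next
    case (Suc m)
    have IH: "\<bar>U' r i0\<bar> \<le> W ^ m * y" if "r \<le> m" for r
    proof -
      have "\<bar>U' r i0\<bar> \<le> W ^ r * y" using less Suc that by (simp add: y_def)
      also have "\<dots> \<le> W ^ m * y" using W y that by (intro mult_right_mono power_increasing) auto
      finally show ?thesis .
    qed
    have "ldist (Suc m) (arg n B' U' m i0) (\<lambda>_. 0) = \<bar>mat_vec n B' (U' m) i0\<bar> + (\<Sum>j<m. \<bar>U' (m - Suc j) i0\<bar>)"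
      by (simp add: ldist_def sum.lessThan_Suc_shift arg_def del: sum.lessThan_Suc)
    also have "\<dots> \<le> q * cN + (\<Sum>j<m. W ^ m * y)"
      using row[of "U' m"] nrm_div[OF U'_nrm[of m]] Suc less(2) by (intro add_mono sum_mono IH) auto
    finally have 1: "ldist (Suc m) (arg n B' U' m i0) (\<lambda>_. 0) \<le> q * cN + real m * (W ^ m * y)" by simp
    have "\<bar>U' l i0\<bar> = \<bar>F m (arg n B' U' m i0)\<bar>" by (simp add: Suc U'_def orb_Suc)
    also have "\<dots> \<le> L + L * ldist (Suc m) (arg n B' U' m i0) (\<lambda>_. 0)"
      using lipD[OF F[of m], of "arg n B' U' m i0" "\<lambda>_. 0"] F0[of m] Suc less(2) by simp
    also have "\<dots> \<le> L + L * (q * cN + real m * (W ^ m * y))"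
      using 1 L by (intro add_mono mult_left_mono) auto
    also have "\<dots> = L * ((1 + q * cN) + real m * (W ^ m * y))" by (simp add: algebra_simps)
    also have "\<dots> \<le> L * (W ^ m * y + real k * (W ^ m * y))"
    proof -
      have "1 * y \<le> W ^ m * y" using W y by (intro mult_right_mono) auto
      thus ?thesis using y L Suc less(2) W
        by (intro mult_left_mono add_mono mult_right_mono) auto
    qed
    also have "\<dots> = (L * (1 + real k)) * (W ^ m * y)" by (simp add: algebra_simps)
    also have "\<dots> \<le> W * (W ^ m * y)" using W y by (intro mult_right_mono) auto
    finally show ?thesis by (simp add: Suc y_def)
  qed
qed

lemma U'_i0': "l \<le> k \<Longrightarrow> \<bar>U' l i0\<bar> \<le> cM * q"
proof -
  assume l: "l \<le> k"
  have "\<bar>U' l i0\<bar> \<le> W ^ l * ((cN + 1) * q)" by (rule U'_i0[OF l])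
  also have "\<dots> \<le> W ^ k * ((cN + 1) * q)" using W l const_nonneg q by (intro mult_right_mono power_increasing) auto
  finally show ?thesis by (simp add: cM_def mult_ac)
qed

lemma diff_U': "nrm n (\<lambda>i. mat_vec n B (U' l) i - mat_vec n B' (U' l) i) \<le> cT * q" if l: "l < k"
proof -
  have "nrm n (\<lambda>i. mat_vec n B (U' l) i - mat_vec n B' (U' l) i) \<le> T (U' l) + 2 * K * \<bar>U' l i0\<bar>"
    by (rule diff)
  also have "\<dots> \<le> q * cN + 2 * K * (cM * q)"
    using TU[OF l] nrm_div[OF U'_nrm[of l]] l K unfolding U'_def[symmetric]
    by (intro add_mono mult_left_mono U'_i0') auto
  finally show ?thesis by (simp add: cT_def algebra_simps)
qed

text \<open>\<open>U'\<close> plays the approximate orbit of \<open>B\<close>: its defect involves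
  \<open>(B - B') U'\<close> only, and \<open>U'\<close> is the sequence on which the removed row is
  controlled.\<close>

lemma diff_U: "nrm n (\<lambda>i. U l i - U' l i) \<le> cD * q" if l: "l \<le> k"
proof -
  have "nrm n (\<lambda>i. U l i - U' l i) \<le> (1 + L * (K + real k)) ^ l * (L * (cT * q))"
  proof (rule stability[OF _ _ B, where F = "\<lambda>l i. F l"])
    fix l i assume "l < k" "i \<in> {1..n}"
    thus "lip (Suc l) L (F l)" by (simp add: F)
    show "U (Suc l) i = F l (arg n B U l i)" unfolding U_def by (rule orb_Suc)
  next
    fix l assume l: "l < k"
    have "nrm n (\<lambda>i. U' (Suc l) i - F l (arg n B U' l i))
       \<le> nrm n (\<lambda>i. L * (mat_vec n B (U' l) i - mat_vec n B' (U' l) i))"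
    proof (rule nrm_mono)
      fix i
      have "\<bar>F l (arg n B' U' l i) - F l (arg n B U' l i)\<bar> \<le> L * ldist (Suc l) (arg n B' U' l i) (arg n B U' l i)"
        by (rule lipD[OF F[OF l]])
      also have "ldist (Suc l) (arg n B' U' l i) (arg n B U' l i) = \<bar>mat_vec n B (U' l) i - mat_vec n B' (U' l) i\<bar>"
        by (simp add: ldist_def sum.lessThan_Suc_shift arg_def del: sum.lessThan_Suc)
      finally show "\<bar>U' (Suc l) i - F l (arg n B U' l i)\<bar> \<le> \<bar>L * (mat_vec n B (U' l) i - mat_vec n B' (U' l) i)\<bar>"
        using L by (simp add: U'_def orb_Suc abs_mult)
    qed
    also have "\<dots> \<le> L * (cT * q)" unfolding nrm_cmult using L diff_U'[OF l] by (intro mult_mono) auto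
    finally show "nrm n (\<lambda>i. U' (Suc l) i - F l (arg n B U' l i)) \<le> L * (cT * q)" .
  qed (use L K q const_nonneg l in \<open>auto simp: U_def U'_def\<close>)
  also have "\<dots> \<le> W ^ k * (L * (cT * q))"
    unfolding W_def[symmetric] using W l L const_nonneg q by (intro mult_right_mono power_increasing) auto
  finally show ?thesis by (simp add: cD_def mult_ac)
qed

lemma U_i0: "\<bar>orb n F B u l i0\<bar> \<le> cU * q" if l: "l \<le> k"
proof -
  have "\<bar>U l i0\<bar> \<le> \<bar>U' l i0\<bar> + \<bar>U l i0 - U' l i0\<bar>" by linarith
  also have "\<bar>U l i0 - U' l i0\<bar> \<le> nrm n (\<lambda>i. U l i - U' l i)"
    using abs_le_nrm[OF i0, of "\<lambda>i. U l i - U' l i"] by simp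
  finally show ?thesis using U'_i0'[OF l] diff_U[OF l] by (simp add: cU_def U_def algebra_simps)
qed

lemma diff_P: "nrm n (\<lambda>i. P l j i - P' l j i) \<le> cP * q" if l: "l < k" and j: "j < Suc l"
proof -
  have cDq: "cD * q \<ge> 0" using const_nonneg q by simp
  have "nrm n (\<lambda>i. mat_vec n B (U l) i - mat_vec n B' (U' l) i)
     = nrm n (\<lambda>i. (mat_vec n B (U l) i - mat_vec n B (U' l) i) + (mat_vec n B (U' l) i - mat_vec n B' (U' l) i))"
    by simp
  also have "\<dots> \<le> K * (cD * q) + cT * q"
  proof (rule order_trans[OF nrm_add add_mono])
    have "K * nrm n (\<lambda>i. U l i - U' l i) \<le> K * (cD * q)"
      using diff_U[of l] l K by (intro mult_left_mono) auto
    thus "nrm n (\<lambda>i. mat_vec n B (U l) i - mat_vec n B (U' l) i) \<le> K * (cD * q)"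
      using opnD_diff[OF B, of "U l" "U' l"] by linarith
  qed (rule diff_U'[OF l])
  finally have "nrm n (\<lambda>i. ldist (Suc l) (arg n B U l i) (arg n B' U' l i)) \<le> (K * (cD * q) + cT * q) + real l * (cD * q)"
    by (rule nrm_ldist_arg) (use l in \<open>auto intro: diff_U\<close>)
  also have "\<dots> \<le> (K * (cD * q) + cT * q) + real k * (cD * q)"
    using mult_right_mono[OF _ cDq, of "real l" "real k"] l by simp
  finally have 1: "nrm n (\<lambda>i. ldist (Suc l) (arg n B U l i) (arg n B' U' l i)) \<le> ((K + real k) * cD + cT) * q"
    by (simp add: algebra_simps)
  have "nrm n (\<lambda>i. P l j i - P' l j i) \<le> nrm n (\<lambda>i. L * ldist (Suc l) (arg n B U l i) (arg n B' U' l i))"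
    using lipD[OF D[OF l j]] L by (intro nrm_mono) (auto simp: P_def P'_def abs_mult)
  also have "\<dots> \<le> L * (((K + real k) * cD + cT) * q)"
    unfolding nrm_cmult using L 1 by (intro mult_mono) auto
  finally show ?thesis by (simp add: cP_def mult_ac)
qed

lemma P'L: "l < k \<Longrightarrow> j < Suc l \<Longrightarrow> \<bar>P' l j i\<bar> \<le> L"
  by (simp add: P'_def DL)

lemma PL: "l < k \<Longrightarrow> j < Suc l \<Longrightarrow> \<bar>P l j i\<bar> \<le> L"
  by (simp add: P_def DL)

lemma b'_nrm: "nrm n (b' l) \<le> W ^ k * sqrt (real n)" if "l \<le> k"
proof -
  have "nrm n (b' l) \<le> W ^ (k - l) * sqrt (real n)"
    unfolding b'_def W_def using L K B' P'L that by (intro adj_nrm) auto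
  also have "\<dots> \<le> W ^ k * sqrt (real n)" using W by (intro mult_right_mono power_increasing) auto
  finally show ?thesis .
qed

text \<open>One backward step. At levels above \<open>l0\<close> the adjoint of \<open>B'\<close> is
  assumed bounded by \<open>Q\<close> in every coordinate, and from \<open>l0\<close> on the removed
  row is assumed small on the vectors to which the recursion of \<open>B'\<close> applies its
  matrix. The outcome is a bound at coordinate \<open>i0\<close> for the adjoint of \<open>B\<close>
  from level \<open>l0\<close> on.\<close>

context
  fixes l0 :: nat and Q :: real
  assumes l0: "l0 < k" and Q: "Q \<ge> 1"
    and b'Q: "\<And>r i. l0 < r \<Longrightarrow> r \<le> k \<Longrightarrow> i \<in> {1..n} \<Longrightarrow> \<bar>b' r i\<bar> \<le> Q"
    and Tb: "\<And>l. l0 \<le> l \<Longrightarrow> l < k \<Longrightarrow> T (\<lambda>i. P' l 0 i * b' (Suc l) i)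
       \<le> q * (nrm n (\<lambda>i. P' l 0 i * b' (Suc l) i) / sqrt (real n))"
begin

lemma P'b'_nrm: "nrm n (\<lambda>i. P' l 0 i * b' (Suc l) i) \<le> (L * W ^ k) * sqrt (real n)" if "l < k"
proof -
  have "nrm n (\<lambda>i. P' l 0 i * b' (Suc l) i) \<le> L * nrm n (b' (Suc l))"
    using P'L[OF that, of 0] L by (intro nrm_mult_le) auto
  also have "\<dots> \<le> L * (W ^ k * sqrt (real n))"
    using b'_nrm[of "Suc l"] that L by (intro mult_left_mono) auto
  finally show ?thesis by (simp add: mult_ac)
qed

text \<open>The difference of products is split as \<open>P (b - b') + b' (P - P')\<close>. In the
  second term \<open>P - P'\<close> is known in Euclidean norm only, so its factor must be bounded
  in supremum norm; such a bound is available for \<open>b'\<close>, whereas for \<open>b\<close> it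
  is what is being proved.\<close>

lemma diff_b: "l0 \<le> r \<Longrightarrow> r \<le> k \<Longrightarrow> nrm n (\<lambda>i. b r i - b' r i) \<le> (W + 1) ^ (k - r) * (cX * q * Q)"
proof (induction "k - r" arbitrary: r rule: less_induct)
  case less
  define X where "X = cX * q * Q"
  have X: "X \<ge> 0" using const_nonneg q Q by (simp add: X_def)
  show ?case
  proof (cases "r = k")
    case True
    thus ?thesis using X by (simp add: b_def b'_def adj_top X_def)
  next
    case False
    hence r: "r < k" "l0 \<le> r" using less by auto
    define Y where "Y = (W + 1) ^ (k - Suc r) * X"
    have Y: "Y \<ge> 0" using X W by (simp add: Y_def)
    have IH: "nrm n (\<lambda>i. b m i - b' m i) \<le> Y" if "r < m" "m \<le> k" for m
    proof -
      have "nrm n (\<lambda>i. b m i - b' m i) \<le> (W + 1) ^ (k - m) * X"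
        using less(1)[of m] that r by (simp add: X_def)
      also have "\<dots> \<le> Y" unfolding Y_def using W X that by (intro mult_right_mono power_increasing) auto
      finally show ?thesis .
    qed
    have PB: "nrm n (\<lambda>i. P (m - 1) j i * b m i - P' (m - 1) j i * b' m i) \<le> L * Y + cP * q * Q"
      if "r < m" "m \<le> k" "j < m" for m j
    proof -
      have mk: "m - 1 < k" "j < Suc (m - 1)" using that by auto
      have "nrm n (\<lambda>i. P (m - 1) j i * b m i - P' (m - 1) j i * b' m i)
         = nrm n (\<lambda>i. P (m - 1) j i * (b m i - b' m i) + b' m i * (P (m - 1) j i - P' (m - 1) j i))"
        by (rule nrm_cong) (simp add: algebra_simps)
      also have "\<dots> \<le> nrm n (\<lambda>i. P (m - 1) j i * (b m i - b' m i)) + nrm n (\<lambda>i. b' m i * (P (m - 1) j i - P' (m - 1) j i))"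
        by (rule nrm_add)
      also have "\<dots> \<le> L * nrm n (\<lambda>i. b m i - b' m i) + Q * nrm n (\<lambda>i. P (m - 1) j i - P' (m - 1) j i)"
        using PL[OF mk] b'Q[of m] that r L Q by (intro add_mono nrm_mult_le) auto
      also have "\<dots> \<le> L * Y + Q * (cP * q)"
        using IH[OF that(1,2)] diff_P[OF mk] L Q by (intro add_mono mult_left_mono) auto
      finally show ?thesis by (simp add: mult_ac)
    qed
    define v where "v = (\<lambda>i. P r 0 i * b (Suc r) i)"
    define v' where "v' = (\<lambda>i. P' r 0 i * b' (Suc r) i)"
    have 1: "nrm n (\<lambda>i. mat_vec n B v i - mat_vec n B v' i) \<le> K * (L * Y + cP * q * Q)"
    proof -
      have "K * nrm n (\<lambda>i. v i - v' i) \<le> K * (L * Y + cP * q * Q)"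
        using PB[of "Suc r" 0] r K by (intro mult_left_mono) (auto simp: v_def v'_def)
      thus ?thesis using opnD_diff[OF B, of v v'] by linarith
    qed
    have 2: "nrm n (\<lambda>i. mat_vec n B v' i - mat_vec n B' v' i) \<le> q * (L * W ^ k) + 2 * K * (L * Q)"
    proof -
      have "nrm n (\<lambda>i. mat_vec n B v' i - mat_vec n B' v' i) \<le> T v' + 2 * K * \<bar>v' i0\<bar>" by (rule diff)
      moreover have "T v' \<le> q * (L * W ^ k)"
        using Tb[OF r(2,1)] nrm_div[OF P'b'_nrm[OF r(1)]] unfolding v'_def by linarith
      moreover have "\<bar>v' i0\<bar> \<le> L * Q"
        unfolding v'_def abs_mult using P'L[OF r(1), of 0] b'Q[of "Suc r" i0] r i0 L by (intro mult_mono) auto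
      hence "2 * K * \<bar>v' i0\<bar> \<le> 2 * K * (L * Q)" using K by (intro mult_left_mono) auto
      ultimately show ?thesis by linarith
    qed
    have 3: "nrm n (\<lambda>i. \<Sum>m\<in>{Suc (Suc r)..k}. P (m - 1) (m - 1 - r) i * b m i - P' (m - 1) (m - 1 - r) i * b' m i)
       \<le> real k * (L * Y + cP * q * Q)"
    proof -
      have "nrm n (\<lambda>i. \<Sum>m\<in>{Suc (Suc r)..k}. P (m - 1) (m - 1 - r) i * b m i - P' (m - 1) (m - 1 - r) i * b' m i)
        \<le> (\<Sum>m\<in>{Suc (Suc r)..k}. L * Y + cP * q * Q)"
        by (rule order_trans[OF nrm_sum sum_mono], rule PB) auto
      also have "\<dots> \<le> real k * (L * Y + cP * q * Q)"
        using L Y const_nonneg q Q by (simp add: mult_right_mono)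
      finally show ?thesis .
    qed
    have "nrm n (\<lambda>i. b r i - b' r i) = nrm n (\<lambda>i. ((mat_vec n B v i - mat_vec n B v' i)
        + (mat_vec n B v' i - mat_vec n B' v' i))
        + (\<Sum>m\<in>{Suc (Suc r)..k}. P (m - 1) (m - 1 - r) i * b m i - P' (m - 1) (m - 1 - r) i * b' m i))"
      by (rule nrm_cong) (simp add: b_def b'_def adj_step[OF r(1)] v_def v'_def sum_subtractf)
    also have "\<dots> \<le> (nrm n (\<lambda>i. mat_vec n B v i - mat_vec n B v' i)
        + nrm n (\<lambda>i. mat_vec n B v' i - mat_vec n B' v' i))
        + nrm n (\<lambda>i. \<Sum>m\<in>{Suc (Suc r)..k}. P (m - 1) (m - 1 - r) i * b m i - P' (m - 1) (m - 1 - r) i * b' m i)"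
      by (rule order_trans[OF nrm_add]) (intro add_mono nrm_add order_refl)
    also have "\<dots> \<le> (K * (L * Y + cP * q * Q) + (q * (L * W ^ k) + 2 * K * (L * Q))) + real k * (L * Y + cP * q * Q)"
      by (intro add_mono 1 2 3)
    also have "\<dots> \<le> W * Y + X"
    proof -
      have "q * (L * W ^ k) \<le> (q * (L * W ^ k)) * Q"
        using mult_left_mono[OF Q, of "q * (L * W ^ k)"] Q q L W by simp
      moreover have "2 * K * (L * Q) \<le> (2 * K * (L * Q)) * q"
        using mult_left_mono[OF q, of "2 * K * (L * Q)"] K L Q by simp
      moreover have "W * Y + X = Y + (K + real k) * (L * Y + cP * q * Q) + (q * (L * W ^ k)) * Q + (2 * K * (L * Q)) * q"
        unfolding X_def cX_def W_def[of] by (simp add: algebra_simps)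
      ultimately show ?thesis using Y by (simp add: distrib_right)
    qed
    also have "\<dots> \<le> W * Y + Y"
    proof -
      have "1 * X \<le> Y" unfolding Y_def using W X by (intro mult_right_mono) auto
      thus ?thesis by simp
    qed
    also have "\<dots> = (W + 1) ^ (k - r) * X"
    proof -
      have "k - r = Suc (k - Suc r)" using r by simp
      thus ?thesis by (simp add: Y_def algebra_simps)
    qed
    finally show ?thesis by (simp add: X_def)
  qed
qed

text \<open>Above \<open>l0\<close> the coordinate of \<open>b'\<close> is bounded by assumption; at
  \<open>l0\<close> itself \<open>row\<close> applies because row \<open>i0\<close> of
  \<open>B'\<close> is free of noise. Passing from \<open>b'\<close> to \<open>b\<close> costs their
  Euclidean distance.\<close>

lemma b_i0: "\<bar>b r i0\<bar> \<le> cB * q * Q" if r: "l0 \<le> r" "r \<le> k"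
proof -
  have A: "\<bar>b' r i0\<bar> \<le> (1 + L * W ^ k + L * real k) * q * Q"
  proof (cases "r = l0")
    case False
    hence "\<bar>b' r i0\<bar> \<le> Q" using b'Q[of r i0] r i0 by auto
    also have "\<dots> = 1 * 1 * Q" by simp
    also have "\<dots> \<le> (1 + L * W ^ k + L * real k) * q * Q"
      using W L q Q by (intro mult_right_mono mult_mono) auto
    finally show ?thesis .
  next
    case True
    define v' where "v' = (\<lambda>i. P' r 0 i * b' (Suc r) i)"
    have rk: "r < k" using l0 True by simp
    have "\<bar>mat_vec n B' v' i0\<bar> \<le> q * (L * W ^ k)"
      using row[of v'] nrm_div[OF P'b'_nrm[OF rk]] unfolding v'_def by linarith
    moreover have eq: "b' r i0 = mat_vec n B' v' i0 + (\<Sum>m\<in>{Suc (Suc r)..k}. P' (m - 1) (m - 1 - r) i0 * b' m i0)"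
      by (simp only: b'_def v'_def adj_step[OF rk])
    moreover have "\<bar>\<Sum>m\<in>{Suc (Suc r)..k}. P' (m - 1) (m - 1 - r) i0 * b' m i0\<bar> \<le> (\<Sum>m\<in>{Suc (Suc r)..k}. L * Q)"
    proof (rule order_trans[OF sum_abs sum_mono])
      fix m assume m: "m \<in> {Suc (Suc r)..k}"
      hence "m - 1 < k" "m - 1 - r < Suc (m - 1)" by auto
      thus "\<bar>P' (m - 1) (m - 1 - r) i0 * b' m i0\<bar> \<le> L * Q"
        unfolding abs_mult using P'L b'Q[of m i0] m i0 True L by (intro mult_mono) auto
    qed
    moreover have "(\<Sum>m\<in>{Suc (Suc r)..k}. L * Q) \<le> real k * (L * Q)"
      using L Q by (simp add: mult_right_mono)
    ultimately have "\<bar>b' r i0\<bar> \<le> q * (L * W ^ k) + real k * (L * Q)"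
      unfolding eq by linarith
    also have "\<dots> \<le> (q * (L * W ^ k)) * Q + (real k * (L * Q)) * q"
    proof -
      have "0 \<le> q * (L * W ^ k)" "0 \<le> real k * (L * Q)" using W L q Q by auto
      from mult_left_mono[OF Q this(1)] mult_left_mono[OF q this(2)] show ?thesis by linarith
    qed
    also have "\<dots> \<le> (1 + L * W ^ k + L * real k) * q * Q"
      using q Q by (simp add: algebra_simps)
    finally show ?thesis .
  qed
  have "\<bar>b r i0 - b' r i0\<bar> \<le> nrm n (\<lambda>i. b r i - b' r i)"
    using abs_le_nrm[OF i0, of "\<lambda>i. b r i - b' r i"] by simp
  also have "\<dots> \<le> (W + 1) ^ (k - r) * (cX * q * Q)" by (rule diff_b[OF r])
  also have "\<dots> \<le> (W + 1) ^ k * (cX * q * Q)"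
    using W const_nonneg q Q by (intro mult_right_mono power_increasing) auto
  finally have "\<bar>b r i0\<bar> \<le> (1 + L * W ^ k + L * real k) * q * Q + (W + 1) ^ k * (cX * q * Q)"
    using A by linarith
  thus ?thesis by (simp add: cB_def algebra_simps)
qed

end

end

section \<open>The inequalities of Efron-Stein and Lindeberg\<close>

text \<open>The family is indexed by the whole type, so that products over varying finite index sets
  come from one family.\<close>

locale real_product =
  fixes \<mu> :: "'i \<Rightarrow> real measure"
  assumes prob: "\<And>e. prob_space (\<mu> e)" and sets_\<mu>: "\<And>e. sets (\<mu> e) = sets borel"
begin

sublocale product_prob_space \<mu> UNIV
  by (intro product_prob_spaceI prob)

lemma sets_PiM_borel: "sets (PiM I \<mu>) = sets (PiM I (\<lambda>_. borel))"
  by (rule sets_PiM_cong) (auto simp: sets_\<mu>)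

lemma measurable_PiM_borel: "measurable (PiM I \<mu>) N = measurable (PiM I (\<lambda>_. borel)) N"
  by (rule measurable_cong_sets) (auto simp: sets_PiM_borel)

lemma space_\<mu>: "space (\<mu> e) = UNIV"
  using sets_eq_imp_space_eq[OF sets_\<mu>[of e]] by simp

lemma space_PiM_borel: "space (PiM I \<mu>) = PiE I (\<lambda>_. UNIV)"
  by (simp add: space_PiM space_\<mu>)

lemma prob_PiM: "prob_space (PiM I \<mu>)"
  by (intro prob_space_PiM prob)

lemma integrable_bounded_PiM:
  fixes f :: "('i \<Rightarrow> real) \<Rightarrow> real"
  assumes "f \<in> borel_measurable (PiM I \<mu>)" "\<And>x. x \<in> space (PiM I \<mu>) \<Longrightarrow> \<bar>f x\<bar> \<le> C"
  shows "integrable (PiM I \<mu>) f"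
proof -
  interpret prob_space "PiM I \<mu>" by (rule prob_PiM)
  show ?thesis using assms by (intro integrable_const_bound[of _ C]) auto
qed

definition avg :: "'i \<Rightarrow> (('i \<Rightarrow> real) \<Rightarrow> real) \<Rightarrow> ('i \<Rightarrow> real) \<Rightarrow> real" where
  "avg e f x = (\<integral>t. f (x(e := t)) \<partial>\<mu> e)"

text \<open>The variance in coordinate \<open>e\<close> with all other coordinates frozen; the value
  of \<open>x\<close> at \<open>e\<close> is irrelevant.\<close>

definition cvar :: "'i \<Rightarrow> (('i \<Rightarrow> real) \<Rightarrow> real) \<Rightarrow> ('i \<Rightarrow> real) \<Rightarrow> real" where
  "cvar e f x = avg e (\<lambda>x. (f x)\<^sup>2) x - (avg e f x)\<^sup>2"

lemma avg_measurable:
  assumes "f \<in> borel_measurable (PiM (insert e J) \<mu>)"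
  shows "avg e f \<in> borel_measurable (PiM J \<mu>)"
proof -
  have "(\<lambda>(x, t). f (x(e := t))) \<in> borel_measurable (PiM J \<mu> \<Otimes>\<^sub>M \<mu> e)"
    using measurable_compose[OF measurable_add_dim assms] by (simp add: case_prod_beta')
  thus ?thesis unfolding avg_def[abs_def] by (rule M.borel_measurable_lebesgue_integral)
qed

lemma upd_measurable:
  assumes "f \<in> borel_measurable (PiM (insert e J) \<mu>)" "x \<in> space (PiM J \<mu>)"
  shows "(\<lambda>t. f (x(e := t))) \<in> borel_measurable (\<mu> e)"
  by (rule measurable_compose[OF measurable_fun_upd[where J = J and i = e] assms(1)])
     (use assms(2) in auto)

lemma upd_space: "x \<in> space (PiM J \<mu>) \<Longrightarrow> x(e := t) \<in> space (PiM (insert e J) \<mu>)"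
  by (auto simp: space_PiM_borel PiE_iff extensional_def)

lemma avg_bounded:
  assumes "f \<in> borel_measurable (PiM (insert e J) \<mu>)" "x \<in> space (PiM J \<mu>)"
    and "\<And>x. x \<in> space (PiM (insert e J) \<mu>) \<Longrightarrow> \<bar>f x\<bar> \<le> C"
  shows "\<bar>avg e f x\<bar> \<le> C" "integrable (\<mu> e) (\<lambda>t. f (x(e := t)))"
proof -
  have b: "\<bar>f (x(e := t))\<bar> \<le> C" for t using assms(3) upd_space[OF assms(2)] by blast
  show i: "integrable (\<mu> e) (\<lambda>t. f (x(e := t)))"
    using upd_measurable[OF assms(1,2)] b by (intro M.integrable_const_bound[of _ C]) auto
  have "\<bar>avg e f x\<bar> \<le> (\<integral>t. \<bar>f (x(e := t))\<bar> \<partial>\<mu> e)" unfolding avg_def by (rule integral_abs_bound)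
  also have "\<dots> \<le> (\<integral>t. C \<partial>\<mu> e)" using i b by (intro integral_mono) auto
  finally show "\<bar>avg e f x\<bar> \<le> C" by (simp add: M.prob_space)
qed

lemma integral_insert_avg:
  assumes "finite J" "e \<notin> J" "f \<in> borel_measurable (PiM (insert e J) \<mu>)"
    and "\<And>x. x \<in> space (PiM (insert e J) \<mu>) \<Longrightarrow> \<bar>f x\<bar> \<le> C"
  shows "integral\<^sup>L (PiM (insert e J) \<mu>) f = integral\<^sup>L (PiM J \<mu>) (avg e f)"
  unfolding avg_def[abs_def] by (rule product_integral_insert[OF assms(1,2) integrable_bounded_PiM[OF assms(3,4)]])

lemma cvar_measurable:
  assumes "f \<in> borel_measurable (PiM (insert e J) \<mu>)"
  shows "cvar e f \<in> borel_measurable (PiM J \<mu>)"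
  unfolding cvar_def[abs_def] using assms by (auto intro!: borel_measurable_diff borel_measurable_power avg_measurable)

text \<open>The mean minimizes the mean square distance to a constant; in the application the
  constant is the value of the function with the entry set to zero.\<close>

lemma cvar_le:
  assumes "f \<in> borel_measurable (PiM (insert e J) \<mu>)" "x \<in> space (PiM J \<mu>)"
    and "\<And>x. x \<in> space (PiM (insert e J) \<mu>) \<Longrightarrow> \<bar>f x\<bar> \<le> C"
  shows "cvar e f x \<le> (\<integral>t. (f (x(e := t)) - c)\<^sup>2 \<partial>\<mu> e)"
    and "0 \<le> cvar e f x" and "cvar e f x = (\<integral>t. (f (x(e := t)) - avg e f x)\<^sup>2 \<partial>\<mu> e)"
proof -
  have i: "integrable (\<mu> e) (\<lambda>t. f (x(e := t)))" by (rule avg_bounded(2)[OF assms])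
  have "\<bar>(f y)\<^sup>2\<bar> \<le> C\<^sup>2" if "y \<in> space (PiM (insert e J) \<mu>)" for y
    using power_mono[OF assms(3)[OF that], of 2] by simp
  hence i2: "integrable (\<mu> e) (\<lambda>t. (f (x(e := t)))\<^sup>2)"
    using avg_bounded(2)[of "\<lambda>x. (f x)\<^sup>2" e J x "C\<^sup>2"] assms(1,2) by auto
  have eq: "(\<integral>t. (f (x(e := t)) - c)\<^sup>2 \<partial>\<mu> e) = avg e (\<lambda>x. (f x)\<^sup>2) x - 2 * c * avg e f x + c\<^sup>2" for c
  proof -
    have "(\<integral>t. (f (x(e := t)) - c)\<^sup>2 \<partial>\<mu> e) = (\<integral>t. (f (x(e := t)))\<^sup>2 - 2 * c * f (x(e := t)) + c\<^sup>2 \<partial>\<mu> e)"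
      by (intro Bochner_Integration.integral_cong refl) (simp add: power2_eq_square algebra_simps)
    also have "\<dots> = avg e (\<lambda>x. (f x)\<^sup>2) x - 2 * c * avg e f x + c\<^sup>2"
      using i i2 by (simp add: avg_def M.prob_space)
    finally show ?thesis .
  qed
  show e: "cvar e f x = (\<integral>t. (f (x(e := t)) - avg e f x)\<^sup>2 \<partial>\<mu> e)"
    unfolding eq cvar_def by (simp add: power2_eq_square)
  show "0 \<le> cvar e f x" unfolding e by simp
  have "0 \<le> (avg e f x - c)\<^sup>2" by simp
  thus "cvar e f x \<le> (\<integral>t. (f (x(e := t)) - c)\<^sup>2 \<partial>\<mu> e)"
    unfolding eq cvar_def by (simp add: power2_eq_square algebra_simps)
qed

lemma cvar_bound:
  assumes "f \<in> borel_measurable (PiM (insert e J) \<mu>)" "x \<in> space (PiM J \<mu>)"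
    and "\<And>x. x \<in> space (PiM (insert e J) \<mu>) \<Longrightarrow> \<bar>f x\<bar> \<le> C"
  shows "\<bar>cvar e f x\<bar> \<le> (2 * C)\<^sup>2"
proof -
  have C: "C \<ge> 0" using assms(3)[OF upd_space[OF assms(2)]] by (meson abs_ge_zero order_trans)
  have "\<bar>(f y)\<^sup>2\<bar> \<le> C\<^sup>2" if "y \<in> space (PiM (insert e J) \<mu>)" for y
    using power_mono[OF assms(3)[OF that], of 2] by simp
  hence "\<bar>avg e (\<lambda>x. (f x)\<^sup>2) x\<bar> \<le> C\<^sup>2"
    using assms(1,2) by (intro avg_bounded(1)) auto
  hence "cvar e f x \<le> C\<^sup>2" unfolding cvar_def using zero_le_power2[of "avg e f x"] by linarith
  also have "\<dots> \<le> (2 * C)\<^sup>2" using C by (intro power_mono) auto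
  finally show ?thesis using cvar_le(2)[OF assms] by simp
qed

end

text \<open>Convexity of the variance: the variance in \<open>s\<close> of an average over
  \<open>t\<close> is at most the average of the variances. After centring this is Jensen's
  inequality for the square.\<close>

lemma variance_average_le:
  fixes \<phi> :: "'a \<Rightarrow> 'b \<Rightarrow> real"
  assumes "prob_space M1" "prob_space M2"
    and m: "(\<lambda>(s, t). \<phi> s t) \<in> borel_measurable (M1 \<Otimes>\<^sub>M M2)"
    and C: "\<And>s t. s \<in> space M1 \<Longrightarrow> t \<in> space M2 \<Longrightarrow> \<bar>\<phi> s t\<bar> \<le> C"
  shows "(\<integral>s. (\<integral>t. \<phi> s t \<partial>M2)\<^sup>2 \<partial>M1) - (\<integral>s. (\<integral>t. \<phi> s t \<partial>M2) \<partial>M1)\<^sup>2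
     \<le> (\<integral>t. (\<integral>s. (\<phi> s t)\<^sup>2 \<partial>M1) - (\<integral>s. \<phi> s t \<partial>M1)\<^sup>2 \<partial>M2)"
proof -
  interpret M1: prob_space M1 by fact
  interpret M2: prob_space M2 by fact
  interpret pair_prob_space M1 M2 ..
  obtain s0 t0 where "s0 \<in> space M1" "t0 \<in> space M2" using M1.not_empty M2.not_empty by blast
  from C[OF this] have C0: "C \<ge> 0" by linarith
  have m1 [measurable]: "(\<lambda>p. \<phi> (fst p) (snd p)) \<in> borel_measurable (M1 \<Otimes>\<^sub>M M2)"
    using m by (simp add: case_prod_beta')
  have ms: "(\<lambda>s. \<phi> s t) \<in> borel_measurable M1" if "t \<in> space M2" for t
    using measurable_compose[OF measurable_Pair2'[OF that] m1] by simp
  have mt: "(\<lambda>t. \<phi> s t) \<in> borel_measurable M2" if "s \<in> space M1" for s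
    using measurable_compose[OF measurable_Pair1'[OF that] m1] by simp
  define h where "h = (\<lambda>s. \<integral>t. \<phi> s t \<partial>M2)"
  define g where "g = (\<lambda>t. \<integral>s. \<phi> s t \<partial>M1)"
  have hm [measurable]: "h \<in> borel_measurable M1" unfolding h_def
    by (rule M2.borel_measurable_lebesgue_integral[OF m])
  have m': "(\<lambda>(t, s). \<phi> s t) \<in> borel_measurable (M2 \<Otimes>\<^sub>M M1)"
    using measurable_compose[OF measurable_pair_swap' m] by (simp add: case_prod_beta')
  have gm [measurable]: "g \<in> borel_measurable M2" unfolding g_def
    by (rule M1.borel_measurable_lebesgue_integral[OF m'])
  have gC: "\<bar>g t\<bar> \<le> C" if "t \<in> space M2" for t
  proof -
    have "\<bar>g t\<bar> \<le> (\<integral>s. \<bar>\<phi> s t\<bar> \<partial>M1)" unfolding g_def by (rule integral_abs_bound)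
    also have "\<dots> \<le> (\<integral>s. C \<partial>M1)"
      using that C C0 ms[OF that] by (intro integral_mono M1.integrable_const_bound[of _ C] AE_I2) auto
    finally show ?thesis by (simp add: M1.prob_space)
  qed
  \<comment> \<open>Centred in \<open>s\<close> for each fixed \<open>t\<close>; its average over
    \<open>t\<close> is \<open>h s\<close> minus the mean of \<open>h\<close>.\<close>
  define \<psi> where "\<psi> = (\<lambda>s t. \<phi> s t - g t)"
  have \<psi>m [measurable]: "(\<lambda>p. \<psi> (fst p) (snd p)) \<in> borel_measurable (M1 \<Otimes>\<^sub>M M2)"
    unfolding \<psi>_def by measurable
  have \<psi>m': "(\<lambda>(s, t). (\<psi> s t)\<^sup>2) \<in> borel_measurable (M1 \<Otimes>\<^sub>M M2)"
    unfolding case_prod_beta' by measurable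
  have \<psi>C: "\<bar>\<psi> s t\<bar> \<le> 2 * C" if "s \<in> space M1" "t \<in> space M2" for s t
    using C[OF that] gC[OF that(2)] unfolding \<psi>_def by linarith
  have \<psi>C2: "(\<psi> s t)\<^sup>2 \<le> (2 * C)\<^sup>2" if "s \<in> space M1" "t \<in> space M2" for s t
    using power_mono[OF \<psi>C[OF that], of 2] by simp
  have \<psi>t: "(\<lambda>t. \<psi> s t) \<in> borel_measurable M2" if "s \<in> space M1" for s
    using mt[OF that] unfolding \<psi>_def by simp
  have \<psi>s: "(\<lambda>s. \<psi> s t) \<in> borel_measurable M1" if "t \<in> space M2" for t
    using ms[OF that] unfolding \<psi>_def by simp
  have int\<phi>: "integrable (M1 \<Otimes>\<^sub>M M2) (\<lambda>(s, t). \<phi> s t)"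
    by (intro integrable_const_bound[of _ C] m AE_I2) (auto simp: space_pair_measure C)
  have int\<psi>: "integrable (M1 \<Otimes>\<^sub>M M2) (\<lambda>(s, t). (\<psi> s t)\<^sup>2)"
    using \<psi>C2 by (intro integrable_const_bound[of _ "(2 * C)\<^sup>2"] \<psi>m' AE_I2) (auto simp: space_pair_measure)
  define m0 where "m0 = (\<integral>s. h s \<partial>M1)"
  have m0: "m0 = (\<integral>t. g t \<partial>M2)"
    unfolding m0_def h_def g_def by (rule Fubini_integral[OF int\<phi>, symmetric])
  have h\<psi>: "h s - m0 = (\<integral>t. \<psi> s t \<partial>M2)" if "s \<in> space M1" for s
    unfolding h_def m0 \<psi>_def using mt[OF that] C gC that
    by (intro Bochner_Integration.integral_diff[symmetric] M2.integrable_const_bound[of _ C] AE_I2) auto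
  have hC: "\<bar>h s\<bar> \<le> C" if "s \<in> space M1" for s
  proof -
    have "\<bar>h s\<bar> \<le> (\<integral>t. \<bar>\<phi> s t\<bar> \<partial>M2)" unfolding h_def by (rule integral_abs_bound)
    also have "\<dots> \<le> (\<integral>t. C \<partial>M2)"
      using that C C0 mt[OF that] by (intro integral_mono M2.integrable_const_bound[of _ C] AE_I2) auto
    finally show ?thesis by (simp add: M2.prob_space)
  qed
  have ih: "integrable M1 h" by (intro M1.integrable_const_bound[of _ C] AE_I2) (auto simp: hC)
  have ih2: "integrable M1 (\<lambda>s. (h s)\<^sup>2)"
    using power_mono[OF hC, of _ 2] by (intro M1.integrable_const_bound[of _ "C\<^sup>2"] AE_I2) auto
  have "(\<integral>s. (h s)\<^sup>2 \<partial>M1) - (\<integral>s. h s \<partial>M1)\<^sup>2 = (\<integral>s. (h s - m0)\<^sup>2 \<partial>M1)"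
    using M1.variance_eq[OF ih ih2] by (simp add: m0_def)
  also have "\<dots> = (\<integral>s. (\<integral>t. \<psi> s t \<partial>M2)\<^sup>2 \<partial>M1)"
    by (intro Bochner_Integration.integral_cong) (auto simp: h\<psi>)
  also have "\<dots> \<le> (\<integral>s. (\<integral>t. (\<psi> s t)\<^sup>2 \<partial>M2) \<partial>M1)"
  proof (rule integral_mono)
    have "(\<lambda>s. \<integral>t. \<psi> s t \<partial>M2) \<in> borel_measurable M1"
      by (rule M2.borel_measurable_lebesgue_integral) (use \<psi>m in \<open>simp add: case_prod_beta'\<close>)
    moreover have "\<bar>\<integral>t. \<psi> s t \<partial>M2\<bar> \<le> 2 * C" if "s \<in> space M1" for s
    proof -
      have "\<bar>m0\<bar> \<le> (\<integral>s. \<bar>h s\<bar> \<partial>M1)" unfolding m0_def by (rule integral_abs_bound)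
      also have "\<dots> \<le> (\<integral>s. C \<partial>M1)" using ih hC by (intro integral_mono) auto
      finally have "\<bar>m0\<bar> \<le> C" by (simp add: M1.prob_space)
      thus ?thesis using h\<psi>[OF that] hC[OF that] by linarith
    qed
    ultimately show "integrable M1 (\<lambda>s. (\<integral>t. \<psi> s t \<partial>M2)\<^sup>2)"
      using power_mono[of "\<bar>_\<bar>" "2 * C" 2]
      by (intro M1.integrable_const_bound[of _ "(2 * C)\<^sup>2"] AE_I2) (auto simp del: power_mult_distrib)
    show "integrable M1 (\<lambda>s. \<integral>t. (\<psi> s t)\<^sup>2 \<partial>M2)"
      using integrable_fst[OF int\<psi>] by simp
    fix s assume s: "s \<in> space M1"
    have i1: "integrable M2 (\<psi> s)"
      using \<psi>t[OF s] \<psi>C[OF s] by (intro M2.integrable_const_bound[of _ "2 * C"] AE_I2) auto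
    have i2: "integrable M2 (\<lambda>t. (\<psi> s t)\<^sup>2)"
      using \<psi>t[OF s] \<psi>C2[OF s] by (intro M2.integrable_const_bound[of _ "(2 * C)\<^sup>2"] AE_I2) auto
    show "(\<integral>t. \<psi> s t \<partial>M2)\<^sup>2 \<le> (\<integral>t. (\<psi> s t)\<^sup>2 \<partial>M2)"
      using M2.variance_eq[OF i1 i2] M2.variance_positive[of "\<psi> s"] by simp
  qed
  also have "\<dots> = (\<integral>t. (\<integral>s. (\<psi> s t)\<^sup>2 \<partial>M1) \<partial>M2)"
    by (rule Fubini_integral[OF int\<psi>, symmetric])
  also have "\<dots> = (\<integral>t. (\<integral>s. (\<phi> s t)\<^sup>2 \<partial>M1) - (\<integral>s. \<phi> s t \<partial>M1)\<^sup>2 \<partial>M2)"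
  proof (rule Bochner_Integration.integral_cong[OF refl])
    fix t assume t: "t \<in> space M2"
    have i1: "integrable M1 (\<lambda>s. \<phi> s t)"
      using ms[OF t] C[OF _ t] by (intro M1.integrable_const_bound[of _ C] AE_I2) auto
    have i2: "integrable M1 (\<lambda>s. (\<phi> s t)\<^sup>2)"
      using ms[OF t] power_mono[OF C[OF _ t], of _ 2] by (intro M1.integrable_const_bound[of _ "C\<^sup>2"] AE_I2) auto
    show "(\<integral>s. (\<psi> s t)\<^sup>2 \<partial>M1) = (\<integral>s. (\<phi> s t)\<^sup>2 \<partial>M1) - (\<integral>s. \<phi> s t \<partial>M1)\<^sup>2"
      using M1.variance_eq[OF i1 i2] by (simp add: \<psi>_def g_def)
  qed
  finally show ?thesis by (simp add: h_def)
qed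

section \<open>The Efron-Stein inequality by induction over the coordinates\<close>

context real_product
begin

lemma cvar_avg_le:
  assumes f: "f \<in> borel_measurable (PiM (insert e (insert e' J)) \<mu>)" and ee: "e \<noteq> e'"
    and C: "\<And>x. x \<in> space (PiM (insert e (insert e' J)) \<mu>) \<Longrightarrow> \<bar>f x\<bar> \<le> C"
    and x: "x \<in> space (PiM J \<mu>)"
  shows "cvar e' (avg e f) x \<le> avg e (cvar e' f) x"
proof -
  define \<phi> where "\<phi> = (\<lambda>s t. f (x(e' := s, e := t)))"
  have "(\<lambda>p. x(e' := fst p, e := snd p)) \<in> measurable (\<mu> e' \<Otimes>\<^sub>M \<mu> e) (PiM (insert e (insert e' J)) \<mu>)"
    by (rule measurable_fun_upd[where J = "insert e' J" and i = e])
       (auto intro!: measurable_fun_upd[where J = J and i = e'] measurable_const x)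
  from measurable_compose[OF this f]
  have "(\<lambda>(s, t). \<phi> s t) \<in> borel_measurable (\<mu> e' \<Otimes>\<^sub>M \<mu> e)" by (simp add: \<phi>_def case_prod_beta')
  from variance_average_le[OF prob prob this, of C]
  have "(\<integral>s. (\<integral>t. \<phi> s t \<partial>\<mu> e)\<^sup>2 \<partial>\<mu> e') - (\<integral>s. (\<integral>t. \<phi> s t \<partial>\<mu> e) \<partial>\<mu> e')\<^sup>2
     \<le> (\<integral>t. (\<integral>s. (\<phi> s t)\<^sup>2 \<partial>\<mu> e') - (\<integral>s. \<phi> s t \<partial>\<mu> e')\<^sup>2 \<partial>\<mu> e)"
    using C upd_space[OF upd_space[OF x]] by (auto simp: \<phi>_def)
  thus ?thesis
    using ee by (simp add: cvar_def avg_def \<phi>_def fun_upd_twist)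
qed

text \<open>By the law of total variance, averaging out \<open>e\<close> leaves the variance of
  \<open>avg e f\<close>, to which the induction hypothesis applies; convexity of the variance then
  replaces \<open>avg e f\<close> by \<open>f\<close> in each summand.\<close>

theorem efron_stein:
  assumes "finite I" "f \<in> borel_measurable (PiM I \<mu>)" "\<And>x. x \<in> space (PiM I \<mu>) \<Longrightarrow> \<bar>f x\<bar> \<le> C"
  shows "(\<integral>x. (f x)\<^sup>2 \<partial>PiM I \<mu>) - (\<integral>x. f x \<partial>PiM I \<mu>)\<^sup>2
    \<le> (\<Sum>e\<in>I. \<integral>x. cvar e f x \<partial>PiM (I - {e}) \<mu>)"
  using assms
proof (induction I arbitrary: f rule: finite_induct)
  case empty
  \<comment> \<open>The empty product is the point mass at \<open>\<lambda>_. undefined\<close>, so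
    the variance vanishes.\<close>
  have "(\<integral>x. f x \<partial>PiM {} \<mu>) = f (\<lambda>_. undefined)" for f :: "('i \<Rightarrow> real) \<Rightarrow> real"
    by (simp add: PiM_empty integral_count_space_nat lebesgue_integral_count_space_finite)
  thus ?case by simp
next
  case (insert e J)
  have C2: "\<bar>(f x)\<^sup>2\<bar> \<le> C\<^sup>2" if "x \<in> space (PiM (insert e J) \<mu>)" for x
    using power_mono[OF insert(5)[OF that], of 2] by simp
  have fm2: "(\<lambda>x. (f x)\<^sup>2) \<in> borel_measurable (PiM (insert e J) \<mu>)" using insert(4) by simp
  have am: "avg e f \<in> borel_measurable (PiM J \<mu>)" by (rule avg_measurable[OF insert(4)])
  have aC: "\<bar>avg e f x\<bar> \<le> C" if "x \<in> space (PiM J \<mu>)" for x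
    by (rule avg_bounded(1)[OF insert(4) that insert(5)])
  have i1: "integrable (PiM J \<mu>) (avg e (\<lambda>x. (f x)\<^sup>2))"
    by (rule integrable_bounded_PiM[OF avg_measurable[OF fm2] avg_bounded(1)[OF fm2 _ C2]])
  have i2: "integrable (PiM J \<mu>) (\<lambda>x. (avg e f x)\<^sup>2)"
    using am power_mono[OF aC, of _ 2] by (intro integrable_bounded_PiM[of _ _ "C\<^sup>2"]) auto
  have "(\<integral>x. (f x)\<^sup>2 \<partial>PiM (insert e J) \<mu>) - (\<integral>x. f x \<partial>PiM (insert e J) \<mu>)\<^sup>2
     = (\<integral>x. avg e (\<lambda>x. (f x)\<^sup>2) x \<partial>PiM J \<mu>) - (\<integral>x. avg e f x \<partial>PiM J \<mu>)\<^sup>2"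
    using integral_insert_avg[OF insert(1,2) insert(4,5)] integral_insert_avg[OF insert(1,2) fm2 C2] by simp
  also have "\<dots> = (\<integral>x. cvar e f x \<partial>PiM J \<mu>)
      + ((\<integral>x. (avg e f x)\<^sup>2 \<partial>PiM J \<mu>) - (\<integral>x. avg e f x \<partial>PiM J \<mu>)\<^sup>2)"
    unfolding cvar_def using i1 i2 by simp
  also have "\<dots> \<le> (\<integral>x. cvar e f x \<partial>PiM J \<mu>) + (\<Sum>e'\<in>J. \<integral>x. cvar e' (avg e f) x \<partial>PiM (J - {e'}) \<mu>)"
    by (intro add_mono order_refl insert(3) am aC)
  also have "(\<Sum>e'\<in>J. \<integral>x. cvar e' (avg e f) x \<partial>PiM (J - {e'}) \<mu>)
     \<le> (\<Sum>e'\<in>J. \<integral>x. cvar e' f x \<partial>PiM (insert e J - {e'}) \<mu>)"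
  proof (rule sum_mono)
    fix e' assume e': "e' \<in> J"
    define J' where "J' = J - {e'}"
    have J: "J = insert e' J'" "e \<noteq> e'" "e \<notin> J'" "finite J'" "insert e J - {e'} = insert e J'"
      using e' insert(1,2) by (auto simp: J'_def)
    have swap: "insert e (insert e' J') = insert e' (insert e J')" by auto
    have fm: "f \<in> borel_measurable (PiM (insert e (insert e' J')) \<mu>)"
      "f \<in> borel_measurable (PiM (insert e' (insert e J')) \<mu>)"
      using insert(4) J(1) swap by metis+
    have fC: "\<bar>f x\<bar> \<le> C" if "x \<in> space (PiM (insert e (insert e' J')) \<mu>)" for x
      using insert(5) J(1) that by metis
    have fC': "\<bar>f x\<bar> \<le> C" if "x \<in> space (PiM (insert e' (insert e J')) \<mu>)" for x
      using fC that swap by metis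
    have cb: "\<bar>cvar e' f x\<bar> \<le> (2 * C)\<^sup>2" if "x \<in> space (PiM (insert e J') \<mu>)" for x
      using cvar_bound[OF fm(2) that fC'] by simp
    have "(\<integral>x. cvar e' (avg e f) x \<partial>PiM J' \<mu>) \<le> (\<integral>x. avg e (cvar e' f) x \<partial>PiM J' \<mu>)"
    proof (rule integral_mono)
      have am': "avg e f \<in> borel_measurable (PiM (insert e' J') \<mu>)" using am J(1) by simp
      show "integrable (PiM J' \<mu>) (cvar e' (avg e f))"
        by (rule integrable_bounded_PiM[OF cvar_measurable[OF am'] cvar_bound[OF am']])
           (use aC J(1) in auto)
      show "integrable (PiM J' \<mu>) (avg e (cvar e' f))"
        by (rule integrable_bounded_PiM[OF avg_measurable[OF cvar_measurable[OF fm(2)]]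
              avg_bounded(1)[OF cvar_measurable[OF fm(2)] _ cb]])
      show "cvar e' (avg e f) x \<le> avg e (cvar e' f) x" if "x \<in> space (PiM J' \<mu>)" for x
        by (rule cvar_avg_le[OF fm(1) J(2) fC that])
    qed
    also have "\<dots> = (\<integral>x. cvar e' f x \<partial>PiM (insert e J') \<mu>)"
      by (rule integral_insert_avg[OF J(4,3) cvar_measurable[OF fm(2)] cb, symmetric])
    finally show "(\<integral>x. cvar e' (avg e f) x \<partial>PiM (J - {e'}) \<mu>) \<le> (\<integral>x. cvar e' f x \<partial>PiM (insert e J - {e'}) \<mu>)"
      by (simp only: J'_def[symmetric] J(5))
  qed
  also have "(\<integral>x. cvar e f x \<partial>PiM J \<mu>) + (\<Sum>e'\<in>J. \<integral>x. cvar e' f x \<partial>PiM (insert e J - {e'}) \<mu>)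
     = (\<Sum>e'\<in>insert e J. \<integral>x. cvar e' f x \<partial>PiM (insert e J - {e'}) \<mu>)"
    using insert(1,2) by simp
  finally show ?case by simp
qed

end

text \<open>Coordinates pass from \<open>\<nu>\<close> to \<open>\<mu>\<close> one at a time. The
  step hypothesis asks for a small difference only on average over the other coordinates, under any
  hybrid of the two families, which leaves room for exceptional events.\<close>

theorem lindeberg:
  fixes \<mu> \<nu> :: "'i \<Rightarrow> real measure"
  assumes I: "finite I" and \<mu>: "real_product \<mu>" and \<nu>: "real_product \<nu>"
    and f: "f \<in> borel_measurable (PiM I (\<lambda>_. borel))" and fC: "\<And>x. \<bar>f x\<bar> \<le> C"
    and step: "\<And>S e. e \<in> I \<Longrightarrow>
      (\<integral>x. \<bar>(\<integral>t. f (x(e := t)) \<partial>\<mu> e) - (\<integral>t. f (x(e := t)) \<partial>\<nu> e)\<bar>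
         \<partial>PiM (I - {e}) (\<lambda>i. if i \<in> S then \<mu> i else \<nu> i)) \<le> r"
  shows "\<bar>(\<integral>x. f x \<partial>PiM I \<mu>) - (\<integral>x. f x \<partial>PiM I \<nu>)\<bar> \<le> real (card I) * r"
proof -
  define hyb where "hyb = (\<lambda>S i. if i \<in> S then \<mu> i else \<nu> i)"
  have hyb: "real_product (hyb S)" for S
    using \<mu> \<nu> by (auto simp: hyb_def real_product_def)
  have "\<bar>(\<integral>x. f x \<partial>PiM I (hyb S)) - (\<integral>x. f x \<partial>PiM I \<nu>)\<bar> \<le> real (card S) * r" if "finite S" "S \<subseteq> I" for S
    using that
  proof (induction S rule: finite_induct)
    case empty
    thus ?case by (simp add: hyb_def)
  next
    case (insert e S)
    have e: "e \<in> I" using insert by auto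
    define J where "J = I - {e}"
    have J: "I = insert e J" "e \<notin> J" "finite J" using e I by (auto simp: J_def)
    interpret h: real_product "hyb S" by (rule hyb)
    interpret h': real_product "hyb (insert e S)" by (rule hyb)
    \<comment> \<open>Away from \<open>e\<close> two consecutive hybrids coincide, so the exchange
      can be examined with the other coordinates under one common law.\<close>
    have eqJ: "PiM J (hyb (insert e S)) = PiM J (hyb S)"
      by (rule PiM_cong) (auto simp: hyb_def J_def)
    have fm: "f \<in> borel_measurable (PiM (insert e J) (hyb S))" "f \<in> borel_measurable (PiM (insert e J) (hyb (insert e S)))"
      using f J(1) by (auto simp: h.measurable_PiM_borel h'.measurable_PiM_borel)
    define a where "a = (\<lambda>x. \<integral>t. f (x(e := t)) \<partial>\<mu> e)"
    define b where "b = (\<lambda>x. \<integral>t. f (x(e := t)) \<partial>\<nu> e)"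
    have a: "h'.avg e f = a" and b: "h.avg e f = b"
    proof -
      have "hyb S e = \<nu> e" "hyb (insert e S) e = \<mu> e" using insert(2) by (auto simp: hyb_def)
      thus "h'.avg e f = a" "h.avg e f = b"
        by (simp_all add: h.avg_def h'.avg_def a_def b_def fun_eq_iff)
    qed
    have ia: "integrable (PiM J (hyb S)) a"
      using h'.integrable_bounded_PiM[OF h'.avg_measurable[OF fm(2)] h'.avg_bounded(1)[OF fm(2)]] fC
      unfolding a eqJ by blast
    have ib: "integrable (PiM J (hyb S)) b"
      using h.integrable_bounded_PiM[OF h.avg_measurable[OF fm(1)] h.avg_bounded(1)[OF fm(1)]] fC
      unfolding b by blast
    have "(\<integral>x. f x \<partial>PiM I (hyb (insert e S))) - (\<integral>x. f x \<partial>PiM I (hyb S))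
       = (\<integral>x. a x \<partial>PiM J (hyb S)) - (\<integral>x. b x \<partial>PiM J (hyb S))"
      using h'.integral_insert_avg[OF J(3,2) fm(2) fC] h.integral_insert_avg[OF J(3,2) fm(1) fC]
      unfolding J(1)[symmetric] a b eqJ by simp
    also have "\<dots> = (\<integral>x. a x - b x \<partial>PiM J (hyb S))" using ia ib by simp
    also have "\<bar>\<dots>\<bar> \<le> (\<integral>x. \<bar>a x - b x\<bar> \<partial>PiM J (hyb S))" by (rule integral_abs_bound)
    also have "\<dots> \<le> r" using step[OF e, of S] by (simp add: a_def b_def hyb_def J_def)
    finally have "\<bar>(\<integral>x. f x \<partial>PiM I (hyb (insert e S))) - (\<integral>x. f x \<partial>PiM I (hyb S))\<bar> \<le> r" .
    moreover have "\<bar>(\<integral>x. f x \<partial>PiM I (hyb S)) - (\<integral>x. f x \<partial>PiM I \<nu>)\<bar> \<le> real (card S) * r"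
      using insert by auto
    moreover have "real (card (insert e S)) * r = real (card S) * r + r"
      using insert(1,2) by (simp add: algebra_simps)
    ultimately show ?case by linarith
  qed
  from this[OF I order_refl] show ?thesis
    using PiM_cong[of I I "hyb I" \<mu>] by (simp add: hyb_def)
qed

section \<open>Subgaussian tails and the operator norm\<close>

text \<open>The exceptional set is a measurable cover, so no measurability of \<open>A\<close> has
  to be shown; \<open>opn\<close>, a statement about all vectors, is used this way.\<close>

definition whp :: "'a measure \<Rightarrow> real \<Rightarrow> ('a \<Rightarrow> bool) \<Rightarrow> bool" where
  "whp M \<epsilon> A \<longleftrightarrow> (\<exists>N\<in>sets M. measure M N \<le> \<epsilon> \<and> (\<forall>x\<in>space M - N. A x))"

lemma whp_mono: "whp M \<epsilon> A \<Longrightarrow> (\<And>x. x \<in> space M \<Longrightarrow> A x \<Longrightarrow> A' x) \<Longrightarrow> \<epsilon> \<le> \<epsilon>' \<Longrightarrow> whp M \<epsilon>' A'"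
  unfolding whp_def by (meson DiffD1 order_trans)

lemma whp_conj:
  assumes "prob_space M" "whp M \<epsilon> A" "whp M \<epsilon>' A'"
  shows "whp M (\<epsilon> + \<epsilon>') (\<lambda>x. A x \<and> A' x)"
proof -
  interpret prob_space M by fact
  from assms obtain N N' where N: "N \<in> sets M" "measure M N \<le> \<epsilon>" "\<forall>x\<in>space M - N. A x"
    and N': "N' \<in> sets M" "measure M N' \<le> \<epsilon>'" "\<forall>x\<in>space M - N'. A' x"
    unfolding whp_def by blast
  have "measure M (N \<union> N') \<le> \<epsilon> + \<epsilon>'"
    using measure_Un_le[OF N(1) N'(1)] N N' by linarith
  thus ?thesis unfolding whp_def using N N' by (intro bexI[of _ "N \<union> N'"]) auto
qed

lemma whp_ball:
  assumes "prob_space M" "finite I" "\<And>i. i \<in> I \<Longrightarrow> whp M \<epsilon> (A i)"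
  shows "whp M (real (card I) * \<epsilon>) (\<lambda>x. \<forall>i\<in>I. A i x)"
  using assms(2,3)
proof (induction I rule: finite_induct)
  case empty
  show ?case unfolding whp_def by (intro bexI[of _ "{}"]) auto
next
  case (insert i I)
  have "whp M (\<epsilon> + real (card I) * \<epsilon>) (\<lambda>x. A i x \<and> (\<forall>i\<in>I. A i x))"
    using insert by (intro whp_conj assms(1)) auto
  thus ?case using insert by (auto elim!: whp_mono simp: algebra_simps)
qed

lemma whp_set:
  assumes "{x\<in>space M. \<not> A x} \<in> sets M" "emeasure M {x\<in>space M. \<not> A x} \<le> ennreal \<epsilon>" "\<epsilon> \<ge> 0"
  shows "whp M \<epsilon> A"
  unfolding whp_def using assms
  by (intro bexI[of _ "{x\<in>space M. \<not> A x}"]) (auto simp: measure_def intro: enn2real_leI)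

section \<open>Tails of linear forms in independent subgaussian variables\<close>

locale subgaussian_product = real_product \<mu> for \<mu> :: "'i \<Rightarrow> real measure" +
  fixes \<sigma> :: real
  assumes \<sigma>: "\<sigma> > 0" and sub: "\<And>e. subgaussian (\<mu> e) \<sigma> (\<lambda>x. x)"
begin

lemma component_measurable [measurable]: "e \<in> J \<Longrightarrow> (\<lambda>x. x e) \<in> borel_measurable (PiM J \<mu>)"
  using measurable_component_singleton[of e J \<mu>] measurable_cong_sets[OF refl sets_\<mu>[of e]] by blast

text \<open>The law of the coordinates in \<open>J1\<close> is a marginal of the product over
  \<open>J\<close>, so a bound proved for a reduced matrix holds on the space of all
  entries.\<close>

lemma whp_restrict:
  assumes "whp (PiM J1 \<mu>) \<epsilon> A" "J1 \<subseteq> J" "finite J"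
  shows "whp (PiM J \<mu>) \<epsilon> (\<lambda>x. A (restrict x J1))"
proof -
  from assms obtain N where N: "N \<in> sets (PiM J1 \<mu>)" "measure (PiM J1 \<mu>) N \<le> \<epsilon>"
    "\<forall>x\<in>space (PiM J1 \<mu>) - N. A x"
    unfolding whp_def by blast
  have r: "(\<lambda>f. restrict f J1) \<in> measurable (PiM J \<mu>) (PiM J1 \<mu>)"
    by (rule measurable_restrict_subset[OF assms(2)])
  define N' where "N' = (\<lambda>f. restrict f J1) -` N \<inter> space (PiM J \<mu>)"
  have "measure (PiM J1 \<mu>) N = measure (distr (PiM J \<mu>) (PiM J1 \<mu>) (\<lambda>f. restrict f J1)) N"
    using distr_restrict[OF assms(2,3)] by simp
  also have "\<dots> = measure (PiM J \<mu>) N'"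
    unfolding N'_def by (rule measure_distr[OF r N(1)])
  finally have "measure (PiM J \<mu>) N' \<le> \<epsilon>" using N(2) by simp
  moreover have "N' \<in> sets (PiM J \<mu>)" unfolding N'_def by (rule measurable_sets[OF r N(1)])
  moreover have "A (restrict x J1)" if "x \<in> space (PiM J \<mu>) - N'" for x
    using that N(3) measurable_space[OF r, of x] by (auto simp: N'_def)
  ultimately show ?thesis unfolding whp_def by blast
qed

lemma linear_form_measurable: "finite J \<Longrightarrow> (\<lambda>x. \<Sum>e\<in>J. c e * x e) \<in> borel_measurable (PiM J \<mu>)"
  by (intro borel_measurable_sum borel_measurable_times component_measurable) auto

text \<open>Chernoff's bound: the moment generating function of the linear form is the product of
  those of its summands.\<close>

lemma tail_one_sided:
  assumes J: "finite J" and s: "s > 0" and q: "q \<ge> 0" and c: "(\<Sum>e\<in>J. (c e)\<^sup>2) \<le> s\<^sup>2"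
  shows "emeasure (PiM J \<mu>) {x\<in>space (PiM J \<mu>). q * s < (\<Sum>e\<in>J. c e * x e)} \<le> ennreal (exp (- q\<^sup>2 / (2 * \<sigma>\<^sup>2)))"
proof -
  \<comment> \<open>Minimizes the exponent
    \<open>- l * q * s + l^2 * \<sigma>^2 * s^2 / 2\<close>.\<close>
  define l where "l = q / (\<sigma>\<^sup>2 * s)"
  have l: "l \<ge> 0" using q s by (simp add: l_def)
  note lm [measurable] = linear_form_measurable[OF J, of c]
  have "(\<integral>\<^sup>+x. ennreal (exp (l * (\<Sum>e\<in>J. c e * x e))) \<partial>PiM J \<mu>)
     = (\<integral>\<^sup>+x. (\<Prod>e\<in>J. ennreal (exp (l * c e * x e))) \<partial>PiM J \<mu>)"
    using J by (simp add: sum_distrib_left exp_sum prod_ennreal mult_ac)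
  also have "\<dots> = (\<Prod>e\<in>J. (\<integral>\<^sup>+x. ennreal (exp (l * c e * x)) \<partial>\<mu> e))"
    using J by (intro product_nn_integral_prod) (simp_all add: measurable_cong_sets[OF sets_\<mu> refl])
  also have "\<dots> \<le> (\<Prod>e\<in>J. ennreal (exp ((l * c e)\<^sup>2 * \<sigma>\<^sup>2 / 2)))"
  proof (rule prod_mono_ennreal)
    fix e
    show "(\<integral>\<^sup>+x. ennreal (exp (l * c e * x)) \<partial>\<mu> e) \<le> ennreal (exp ((l * c e)\<^sup>2 * \<sigma>\<^sup>2 / 2))"
      using sub[of e] unfolding subgaussian_def by blast
  qed
  also have "\<dots> = ennreal (exp (\<Sum>e\<in>J. (l * c e)\<^sup>2 * \<sigma>\<^sup>2 / 2))"
    using J by (simp add: exp_sum prod_ennreal)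
  also have "\<dots> \<le> ennreal (exp (l\<^sup>2 * \<sigma>\<^sup>2 / 2 * s\<^sup>2))"
  proof -
    have "(\<Sum>e\<in>J. (l * c e)\<^sup>2 * \<sigma>\<^sup>2 / 2) = l\<^sup>2 * \<sigma>\<^sup>2 / 2 * (\<Sum>e\<in>J. (c e)\<^sup>2)"
      by (simp add: sum_distrib_left power_mult_distrib mult_ac)
    also have "\<dots> \<le> l\<^sup>2 * \<sigma>\<^sup>2 / 2 * s\<^sup>2" by (intro mult_left_mono c) auto
    finally show ?thesis by (intro ennreal_leI) simp
  qed
  finally have mgf: "(\<integral>\<^sup>+x. ennreal (exp (l * (\<Sum>e\<in>J. c e * x e))) \<partial>PiM J \<mu>) \<le> ennreal (exp (l\<^sup>2 * \<sigma>\<^sup>2 / 2 * s\<^sup>2))" .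
  have "emeasure (PiM J \<mu>) {x\<in>space (PiM J \<mu>). q * s < (\<Sum>e\<in>J. c e * x e)}
     \<le> emeasure (PiM J \<mu>) {x\<in>space (PiM J \<mu>). 1 \<le> ennreal (exp (- l * q * s)) * ennreal (exp (l * (\<Sum>e\<in>J. c e * x e)))}"
  proof (rule emeasure_mono)
    show "{x\<in>space (PiM J \<mu>). q * s < (\<Sum>e\<in>J. c e * x e)}
      \<subseteq> {x\<in>space (PiM J \<mu>). 1 \<le> ennreal (exp (- l * q * s)) * ennreal (exp (l * (\<Sum>e\<in>J. c e * x e)))}"
    proof safe
      fix x assume "q * s < (\<Sum>e\<in>J. c e * x e)"
      hence "l * (q * s) \<le> l * (\<Sum>e\<in>J. c e * x e)" using l by (intro mult_left_mono) auto
      hence "1 \<le> exp (- l * q * s + l * (\<Sum>e\<in>J. c e * x e))" by simp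
      hence "ennreal 1 \<le> ennreal (exp (- l * q * s + l * (\<Sum>e\<in>J. c e * x e)))" by (rule ennreal_leI)
      thus "1 \<le> ennreal (exp (- l * q * s)) * ennreal (exp (l * (\<Sum>e\<in>J. c e * x e)))"
        by (simp only: exp_add ennreal_mult[symmetric] exp_ge_zero ennreal_1)
    qed
  qed measurable
  also have "\<dots> \<le> ennreal (exp (- l * q * s)) * (\<integral>\<^sup>+x. ennreal (exp (l * (\<Sum>e\<in>J. c e * x e))) * indicator (space (PiM J \<mu>)) x \<partial>PiM J \<mu>)"
    by (rule nn_integral_Markov_inequality) auto
  also have "\<dots> = ennreal (exp (- l * q * s)) * (\<integral>\<^sup>+x. ennreal (exp (l * (\<Sum>e\<in>J. c e * x e))) \<partial>PiM J \<mu>)"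
    by (intro arg_cong2[where f = "(*)"] refl nn_integral_cong) auto
  also have "\<dots> \<le> ennreal (exp (- l * q * s)) * ennreal (exp (l\<^sup>2 * \<sigma>\<^sup>2 / 2 * s\<^sup>2))"
    by (intro mult_left_mono mgf) auto
  also have "\<dots> = ennreal (exp (- l * q * s + l\<^sup>2 * \<sigma>\<^sup>2 / 2 * s\<^sup>2))"
    by (simp only: exp_add ennreal_mult[symmetric] exp_ge_zero)
  also have "- l * q * s + l\<^sup>2 * \<sigma>\<^sup>2 / 2 * s\<^sup>2 = - q\<^sup>2 / (2 * \<sigma>\<^sup>2)"
    using s \<sigma> by (simp add: l_def field_simps power2_eq_square)
  finally show ?thesis .
qed

lemma tail:
  assumes J: "finite J" and s: "s \<ge> 0" and q: "q \<ge> 0" and c: "(\<Sum>e\<in>J. (c e)\<^sup>2) \<le> s\<^sup>2"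
  shows "emeasure (PiM J \<mu>) {x\<in>space (PiM J \<mu>). q * s < \<bar>\<Sum>e\<in>J. c e * x e\<bar>} \<le> ennreal (2 * exp (- q\<^sup>2 / (2 * \<sigma>\<^sup>2)))"
\<comment> \<open>For \<open>s = 0\<close> all coefficients vanish and the event is empty; the
  optimal exponent makes sense for \<open>s > 0\<close> only.\<close>
proof (cases "s = 0")
  case True
  have "(\<Sum>e\<in>J. (c e)\<^sup>2) = 0" using c True by (intro antisym sum_nonneg) auto
  hence "\<forall>e\<in>J. c e = 0" using J by (simp add: sum_nonneg_eq_0_iff)
  hence E: "{x\<in>space (PiM J \<mu>). q * s < \<bar>\<Sum>e\<in>J. c e * x e\<bar>} = {}" using True by auto
  show ?thesis unfolding E by simp
next
  case False
  hence s: "s > 0" using s by simp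
  note [measurable] = linear_form_measurable[OF J]
  let ?A = "{x\<in>space (PiM J \<mu>). q * s < (\<Sum>e\<in>J. c e * x e)}"
  let ?B = "{x\<in>space (PiM J \<mu>). q * s < (\<Sum>e\<in>J. (- c e) * x e)}"
  have E: "{x\<in>space (PiM J \<mu>). q * s < \<bar>\<Sum>e\<in>J. c e * x e\<bar>} = ?A \<union> ?B"
    by (auto simp: sum_negf)
  have h1: "emeasure (PiM J \<mu>) (?A \<union> ?B) \<le> emeasure (PiM J \<mu>) ?A + emeasure (PiM J \<mu>) ?B"
    by (rule emeasure_subadditive) (intro borel_measurable_less linear_form_measurable[OF J] borel_measurable_const)+
  have h2: "emeasure (PiM J \<mu>) ?A + emeasure (PiM J \<mu>) ?B
     \<le> ennreal (exp (- q\<^sup>2 / (2 * \<sigma>\<^sup>2))) + ennreal (exp (- q\<^sup>2 / (2 * \<sigma>\<^sup>2)))"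
    using c by (intro add_mono tail_one_sided J s q) auto
  have h3: "ennreal (exp (- q\<^sup>2 / (2 * \<sigma>\<^sup>2))) + ennreal (exp (- q\<^sup>2 / (2 * \<sigma>\<^sup>2)))
     = ennreal (2 * exp (- q\<^sup>2 / (2 * \<sigma>\<^sup>2)))" by (subst ennreal_plus[symmetric]) auto
  show ?thesis unfolding E by (rule order_trans[OF h1 h2[unfolded h3]])
qed

lemma whp_tail_const:
  assumes J: "finite J" and s: "s \<ge> 0" and q: "q \<ge> 0" and c: "(\<Sum>e\<in>J. (c e)\<^sup>2) \<le> s\<^sup>2"
  shows "whp (PiM J \<mu>) (2 * exp (- q\<^sup>2 / (2 * \<sigma>\<^sup>2))) (\<lambda>x. \<bar>\<Sum>e\<in>J. c e * x e\<bar> \<le> q * s)"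
proof (rule whp_set)
  note [measurable] = linear_form_measurable[OF J]
  show "{x\<in>space (PiM J \<mu>). \<not> \<bar>\<Sum>e\<in>J. c e * x e\<bar> \<le> q * s} \<in> sets (PiM J \<mu>)" by measurable
qed (use tail[OF assms] in \<open>auto simp: not_le\<close>)

text \<open>With the coordinates in \<open>J1\<close> frozen the coefficients are constants, and the
  bound for constant coefficients, being uniform, is integrated over \<open>J1\<close>. In this form
  the independence of a row from the vector it is applied to is exploited.\<close>

lemma whp_tail:
  assumes J: "finite J1" "finite J2" "J1 \<inter> J2 = {}" and q: "q \<ge> 0"
    and cm: "\<And>e. e \<in> J2 \<Longrightarrow> (\<lambda>y. c y e) \<in> borel_measurable (PiM J1 \<mu>)"
    and sm: "s \<in> borel_measurable (PiM J1 \<mu>)"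
    and s: "\<And>y. s y \<ge> 0" and c: "\<And>y. (\<Sum>e\<in>J2. (c y e)\<^sup>2) \<le> (s y)\<^sup>2"
  shows "whp (PiM (J1 \<union> J2) \<mu>) (2 * exp (- q\<^sup>2 / (2 * \<sigma>\<^sup>2)))
     (\<lambda>x. \<bar>\<Sum>e\<in>J2. c (restrict x J1) e * x e\<bar> \<le> q * s (restrict x J1))"
proof (rule whp_set)
  let ?M = "PiM (J1 \<union> J2) \<mu>"
  define N where "N = {x\<in>space ?M. \<not> \<bar>\<Sum>e\<in>J2. c (restrict x J1) e * x e\<bar> \<le> q * s (restrict x J1)}"
  have r: "(\<lambda>f. restrict f J1) \<in> measurable ?M (PiM J1 \<mu>)"
    by (rule measurable_restrict_subset) auto
  have m1: "(\<lambda>x. \<Sum>e\<in>J2. c (restrict x J1) e * x e) \<in> borel_measurable ?M"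
    by (intro borel_measurable_sum borel_measurable_times component_measurable measurable_compose[OF r cm]) auto
  have m2: "(\<lambda>x. s (restrict x J1)) \<in> borel_measurable ?M"
    by (rule measurable_compose[OF r sm])
  show N: "N \<in> sets ?M"
    unfolding N_def not_le by (intro borel_measurable_less borel_measurable_abs borel_measurable_times m1 m2) auto
  have "emeasure ?M N = (\<integral>\<^sup>+x. indicator N x \<partial>?M)" using N by simp
  also have "\<dots> = (\<integral>\<^sup>+x. (\<integral>\<^sup>+y. indicator N (merge J1 J2 (x, y)) \<partial>PiM J2 \<mu>) \<partial>PiM J1 \<mu>)"
    by (rule product_nn_integral_fold[OF J(3,1,2)]) (use N in measurable)
  also have "\<dots> \<le> (\<integral>\<^sup>+x. ennreal (2 * exp (- q\<^sup>2 / (2 * \<sigma>\<^sup>2))) \<partial>PiM J1 \<mu>)"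
  proof (rule nn_integral_mono)
    fix x assume x: "x \<in> space (PiM J1 \<mu>)"
    have rx: "restrict (merge J1 J2 (x, y)) J1 = x" for y
      using x by (auto simp: space_PiM_borel merge_def PiE_iff extensional_def restrict_def fun_eq_iff)
    have sp: "merge J1 J2 (x, y) \<in> space ?M" for y
      by (auto simp: space_PiM_borel merge_def PiE_iff extensional_def)
    have "(\<Sum>e\<in>J2. c x e * merge J1 J2 (x, y) e) = (\<Sum>e\<in>J2. c x e * y e)" for y
      using J(3) by (intro sum.cong refl) (auto simp: merge_def)
    hence "(\<integral>\<^sup>+y. indicator N (merge J1 J2 (x, y)) \<partial>PiM J2 \<mu>)
       = (\<integral>\<^sup>+y. indicator {y\<in>space (PiM J2 \<mu>). q * s x < \<bar>\<Sum>e\<in>J2. c x e * y e\<bar>} y \<partial>PiM J2 \<mu>)"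
      by (intro nn_integral_cong) (auto simp: N_def rx sp indicator_def)
    also have "\<dots> = emeasure (PiM J2 \<mu>) {y\<in>space (PiM J2 \<mu>). q * s x < \<bar>\<Sum>e\<in>J2. c x e * y e\<bar>}"
    proof (rule nn_integral_indicator)
      note [measurable] = linear_form_measurable[OF J(2)]
      show "{y\<in>space (PiM J2 \<mu>). q * s x < \<bar>\<Sum>e\<in>J2. c x e * y e\<bar>} \<in> sets (PiM J2 \<mu>)" by measurable
    qed
    also have "\<dots> \<le> ennreal (2 * exp (- q\<^sup>2 / (2 * \<sigma>\<^sup>2)))" by (rule tail[OF J(2) s q c])
    finally show "(\<integral>\<^sup>+y. indicator N (merge J1 J2 (x, y)) \<partial>PiM J2 \<mu>) \<le> ennreal (2 * exp (- q\<^sup>2 / (2 * \<sigma>\<^sup>2)))" .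
  qed
  also have "\<dots> = ennreal (2 * exp (- q\<^sup>2 / (2 * \<sigma>\<^sup>2)))"
    using prob_space.emeasure_space_1[OF prob_PiM[of J1]] by simp
  finally show "emeasure ?M N \<le> ennreal (2 * exp (- q\<^sup>2 / (2 * \<sigma>\<^sup>2)))" .
qed auto

end

text \<open>Divided by \<open>4 * sqrt n\<close>, these integer points form a \<open>1/4\<close>-net of the unit ball.\<close>

definition net :: "nat \<Rightarrow> (nat \<Rightarrow> int) set" where
  "net n = {z \<in> PiE {1..n} (\<lambda>_. {- (16 * int n)..16 * int n}). (\<Sum>i\<in>{1..n}. (z i)\<^sup>2) \<le> 16 * int n}"

lemma finite_net: "finite (net n)"
  unfolding net_def by (rule finite_subset[of _ "PiE {1..n} (\<lambda>_. {- (16 * int n)..16 * int n})"])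
    (auto intro!: finite_PiE)

section \<open>Cardinality and approximation property of the net\<close>

lemma sum_half_powers: "(\<Sum>z\<in>{- int m..int m}. (1/2) ^ nat \<bar>z\<bar> :: real) \<le> 3"
proof -
  have 1: "(\<Sum>z\<in>{- int m..int m}. (1/2) ^ nat \<bar>z\<bar> :: real) = 3 - 2 * (1/2) ^ m"
  proof (induction m)
    case (Suc m)
    have "{- int (Suc m)..int (Suc m)} = insert (- int (Suc m)) (insert (int (Suc m)) {- int m..int m})" by auto
    hence "(\<Sum>z\<in>{- int (Suc m)..int (Suc m)}. (1/2) ^ nat \<bar>z\<bar> :: real)
       = (1/2) ^ nat \<bar>- int (Suc m)\<bar> + ((1/2) ^ nat \<bar>int (Suc m)\<bar> + (\<Sum>z\<in>{- int m..int m}. (1/2) ^ nat \<bar>z\<bar>))"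
      by (simp only:) (subst sum.insert; simp)+
    thus ?case using Suc by (simp add: nat_add_distrib)
  qed simp
  show ?thesis unfolding 1 by simp
qed

text \<open>Exponential counting: integer points of the net satisfy
  \<open>\<Sum>\<bar>z i\<bar> \<le> \<Sum>(z i)^2 \<le> 16 n\<close>, so each has weight at least 1
  under \<open>2^(16 n) * \<Prod>(1/2)^\<bar>z i\<bar>\<close>, and the total weight of the box
  factorizes with factors at most 3.\<close>

lemma card_net: "real (card (net n)) \<le> (3 * 2 ^ 16) ^ n"
proof -
  define X where "X = PiE {1..n} (\<lambda>_. {- (16 * int n)..16 * int n})"
  have X: "finite X" unfolding X_def by (intro finite_PiE) auto
  have "real (card (net n)) = (\<Sum>z\<in>net n. 1)" by simp
  also have "\<dots> \<le> (\<Sum>z\<in>net n. 2 ^ (16 * n) * (\<Prod>i\<in>{1..n}. (1/2) ^ nat \<bar>z i\<bar>))"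
  proof (rule sum_mono)
    fix z assume z: "z \<in> net n"
    have "\<bar>z i\<bar> \<le> (z i)\<^sup>2" for i
    proof (cases "z i = 0")
      case False
      hence "1 * \<bar>z i\<bar> \<le> \<bar>z i\<bar> * \<bar>z i\<bar>" by (intro mult_right_mono) auto
      thus ?thesis by (simp add: power2_eq_square abs_mult_self_eq)
    qed simp
    hence "(\<Sum>i\<in>{1..n}. \<bar>z i\<bar>) \<le> (\<Sum>i\<in>{1..n}. (z i)\<^sup>2)" by (intro sum_mono)
    also have "\<dots> \<le> 16 * int n" using z by (simp add: net_def)
    finally have "int (\<Sum>i\<in>{1..n}. nat \<bar>z i\<bar>) \<le> int (16 * n)" by simp
    hence le: "(\<Sum>i\<in>{1..n}. nat \<bar>z i\<bar>) \<le> 16 * n" by (simp only: of_nat_le_iff)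
    have "(1/2 :: real) ^ (16 * n) \<le> (1/2) ^ (\<Sum>i\<in>{1..n}. nat \<bar>z i\<bar>)"
      by (rule power_decreasing[OF le]) auto
    also have "\<dots> = (\<Prod>i\<in>{1..n}. (1/2) ^ nat \<bar>z i\<bar>)" by (rule power_sum)
    finally have "2 ^ (16 * n) * (1/2 :: real) ^ (16 * n) \<le> 2 ^ (16 * n) * (\<Prod>i\<in>{1..n}. (1/2) ^ nat \<bar>z i\<bar>)"
      by (intro mult_left_mono) auto
    thus "1 \<le> 2 ^ (16 * n) * (\<Prod>i\<in>{1..n}. (1/2 :: real) ^ nat \<bar>z i\<bar>)"
      by (simp add: power_one_over)
  qed
  also have "\<dots> \<le> (\<Sum>z\<in>X. 2 ^ (16 * n) * (\<Prod>i\<in>{1..n}. (1/2) ^ nat \<bar>z i\<bar>))"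
    using X by (intro sum_mono2) (auto simp: net_def X_def prod_nonneg)
  also have "\<dots> = 2 ^ (16 * n) * (\<Sum>z\<in>X. \<Prod>i\<in>{1..n}. (1/2) ^ nat \<bar>z i\<bar>)"
    by (simp add: sum_distrib_left)
  also have "(\<Sum>z\<in>X. \<Prod>i\<in>{1..n}. (1/2 :: real) ^ nat \<bar>z i\<bar>)
     = (\<Prod>i\<in>{1..n}. \<Sum>z\<in>{- (16 * int n)..16 * int n}. (1/2) ^ nat \<bar>z\<bar>)"
    unfolding X_def by (subst prod_sum_PiE) auto
  also have "2 ^ (16 * n) * \<dots> \<le> 2 ^ (16 * n) * (\<Prod>i\<in>{1..n}. 3 :: real)"
    using sum_half_powers[of "16 * n"] by (intro mult_left_mono prod_mono) (auto simp: sum_nonneg)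
  also have "\<dots> = (3 * 2 ^ 16) ^ n" by (simp add: power_mult flip: power_mult_distrib)
  finally show ?thesis .
qed

text \<open>Rounding towards zero never enlarges a coordinate, so the rounded point stays in the
  unit ball; an error of \<open>1 / (4 * sqrt n)\<close> per coordinate amounts to Euclidean norm at
  most 1/4.\<close>

lemma net_approx:
  assumes n: "n \<ge> 1" and v: "nrm n v \<le> 1"
  obtains z where "z \<in> net n" "nrm n (\<lambda>i. v i - real_of_int (z i) / (4 * sqrt (real n))) \<le> 1/4"
    "nrm n (\<lambda>i. real_of_int (z i) / (4 * sqrt (real n))) \<le> 1"
proof -
  define r where "r = 4 * sqrt (real n)"
  have r: "r > 0" "r\<^sup>2 = 16 * real n" using n by (auto simp: r_def power_mult_distrib)
  define tr :: "real \<Rightarrow> int" where "tr = (\<lambda>x. if x \<ge> 0 then \<lfloor>x\<rfloor> else \<lceil>x\<rceil>)"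
  have tr: "\<bar>real_of_int (tr x)\<bar> \<le> \<bar>x\<bar>" "\<bar>x - real_of_int (tr x)\<bar> \<le> 1" for x
  proof -
    have 1: "\<bar>real_of_int \<lfloor>x\<rfloor>\<bar> \<le> \<bar>x\<bar> \<and> \<bar>x - real_of_int \<lfloor>x\<rfloor>\<bar> \<le> 1" if "x \<ge> 0"
    proof -
      have "0 \<le> real_of_int \<lfloor>x\<rfloor>" using that by simp
      thus ?thesis using floor_correct[of x] that by linarith
    qed
    have 2: "\<bar>real_of_int \<lceil>x\<rceil>\<bar> \<le> \<bar>x\<bar> \<and> \<bar>x - real_of_int \<lceil>x\<rceil>\<bar> \<le> 1" if "x < 0"
    proof -
      have "\<lceil>x\<rceil> \<le> 0" using that by (simp add: ceiling_le_iff)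
      hence "real_of_int \<lceil>x\<rceil> \<le> 0" by simp
      thus ?thesis using ceiling_correct[of x] that by linarith
    qed
    show "\<bar>real_of_int (tr x)\<bar> \<le> \<bar>x\<bar>" "\<bar>x - real_of_int (tr x)\<bar> \<le> 1"
      using 1 2 unfolding tr_def by (cases "x \<ge> 0"; simp)+
  qed
  define z where "z = restrict (\<lambda>i. tr (r * v i)) {1..n}"
  have zi: "z i = tr (r * v i)" if "i \<in> {1..n}" for i using that by (simp add: z_def)
  have a: "\<bar>real_of_int (z i) / r\<bar> \<le> \<bar>v i\<bar>" "\<bar>v i - real_of_int (z i) / r\<bar> \<le> 1 / r" if i: "i \<in> {1..n}" for i
  proof -
    show "\<bar>real_of_int (z i) / r\<bar> \<le> \<bar>v i\<bar>"
      using tr(1)[of "r * v i"] r by (simp add: zi[OF i] abs_mult divide_le_eq mult.commute)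
    have "v i - real_of_int (z i) / r = (r * v i - real_of_int (z i)) / r" using r by (simp add: field_simps)
    also have "\<bar>\<dots>\<bar> \<le> 1 / r"
      using tr(2)[of "r * v i"] r by (simp add: zi[OF i] abs_divide divide_right_mono)
    finally show "\<bar>v i - real_of_int (z i) / r\<bar> \<le> 1 / r" .
  qed
  have n1: "nrm n (\<lambda>i. real_of_int (z i) / r) \<le> 1"
    using nrm_mono[of n "\<lambda>i. real_of_int (z i) / r" v] a v by fastforce
  have n2: "nrm n (\<lambda>i. v i - real_of_int (z i) / r) \<le> 1/4"
    using nrm_bound[of n "\<lambda>i. v i - real_of_int (z i) / r" "1 / r"] a(2) r n by (auto simp: r_def)
  have "(\<Sum>i\<in>{1..n}. (real_of_int (z i) / r)\<^sup>2) \<le> 1"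
    using n1 power_mono[OF n1, of 2] by (simp add: nrm_power2)
  hence "(\<Sum>i\<in>{1..n}. (real_of_int (z i))\<^sup>2) \<le> 16 * real n"
    using n by (simp add: power_divide r(2) sum_divide_distrib[symmetric] divide_le_eq)
  hence "real_of_int (\<Sum>i\<in>{1..n}. (z i)\<^sup>2) \<le> real_of_int (16 * int n)" by simp
  hence s: "(\<Sum>i\<in>{1..n}. (z i)\<^sup>2) \<le> 16 * int n" by (simp only: of_int_le_iff)
  have "\<bar>z i\<bar> \<le> 16 * int n" if "i \<in> {1..n}" for i
  proof -
    have "\<bar>z i\<bar> \<le> (z i)\<^sup>2"
    proof (cases "z i = 0")
      case False
      hence "1 * \<bar>z i\<bar> \<le> \<bar>z i\<bar> * \<bar>z i\<bar>" by (intro mult_right_mono) auto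
      thus ?thesis by (simp add: power2_eq_square abs_mult_self_eq)
    qed simp
    also have "\<dots> \<le> (\<Sum>i\<in>{1..n}. (z i)\<^sup>2)" using that by (intro member_le_sum) auto
    finally show ?thesis using s by simp
  qed
  hence "z \<in> net n" using s unfolding net_def
    by (auto simp: PiE_iff z_def abs_le_iff minus_le_iff)
  thus ?thesis using n1 n2 that unfolding r_def by blast
qed

section \<open>The operator norm through the bilinear form on the net\<close>

definition bilin :: "nat \<Rightarrow> matr \<Rightarrow> vect \<Rightarrow> vect \<Rightarrow> real" where
  "bilin n B v w = (\<Sum>i\<in>{1..n}. v i * mat_vec n B w i)"

lemma bilin_diff_left: "bilin n B (\<lambda>i. v i - v' i) w = bilin n B v w - bilin n B v' w"
  by (simp add: bilin_def left_diff_distrib sum_subtractf)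

lemma bilin_diff_right: "bilin n B v (\<lambda>i. w i - w' i) = bilin n B v w - bilin n B v w'"
  by (simp add: bilin_def mat_vec_diff right_diff_distrib sum_subtractf)

lemma bilin_cmult_left: "bilin n B (\<lambda>i. c * v i) w = c * bilin n B v w"
  by (simp add: bilin_def sum_distrib_left mult_ac)

lemma bilin_cmult_right: "bilin n B v (\<lambda>i. c * w i) = c * bilin n B v w"
  by (simp add: bilin_def mat_vec_cmult sum_distrib_left mult_ac)

lemma bilin_bounded: "nrm n v \<le> 1 \<Longrightarrow> nrm n w \<le> 1 \<Longrightarrow> bilin n B v w \<le> (\<Sum>i\<in>{1..n}. \<Sum>j\<in>{1..n}. \<bar>B i j\<bar>)"
proof -
  assume v: "nrm n v \<le> 1" and w: "nrm n w \<le> 1"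
  have "bilin n B v w = (\<Sum>i\<in>{1..n}. \<Sum>j\<in>{1..n}. v i * B i j * w j)"
    by (simp add: bilin_def mat_vec_def sum_distrib_left mult_ac)
  also have "\<dots> \<le> (\<Sum>i\<in>{1..n}. \<Sum>j\<in>{1..n}. \<bar>B i j\<bar>)"
  proof (intro sum_mono)
    fix i j assume ij: "i \<in> {1..n}" "j \<in> {1..n}"
    have "\<bar>v i\<bar> \<le> 1" "\<bar>w j\<bar> \<le> 1" using abs_le_nrm[OF ij(1), of v] abs_le_nrm[OF ij(2), of w] v w by linarith+
    hence "\<bar>v i\<bar> * \<bar>B i j\<bar> * \<bar>w j\<bar> \<le> 1 * \<bar>B i j\<bar> * 1" by (intro mult_mono) auto
    thus "v i * B i j * w j \<le> \<bar>B i j\<bar>" by (simp add: abs_mult[symmetric])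
  qed
  finally show ?thesis .
qed

text \<open>Let \<open>s\<close> be the supremum of the form over the unit balls. Replacing each
  vector by a net point costs \<open>s / 4\<close>, so \<open>s \<le> K / 2 + s / 2\<close>. The
  threshold \<open>8 * n * K\<close> is \<open>K / 2\<close> times the squared scale
  \<open>16 * n\<close> of the net.\<close>

lemma opn_from_net:
  assumes n: "n \<ge> 1" and K: "K \<ge> 0"
    and net: "\<And>z z'. z \<in> net n \<Longrightarrow> z' \<in> net n \<Longrightarrow>
      bilin n B (\<lambda>i. real_of_int (z i)) (\<lambda>i. real_of_int (z' i)) \<le> 8 * real n * K"
  shows "opn n B K"
proof -
  define S where "S = {bilin n B v w |v w. nrm n v \<le> 1 \<and> nrm n w \<le> 1}"
  have bdd: "bdd_above S" unfolding S_def by (rule bdd_aboveI) (use bilin_bounded in blast)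
  have ne: "S \<noteq> {}" unfolding S_def by (auto intro!: exI[of _ "\<lambda>_. 0"])
  define s where "s = Sup S"
  have s: "bilin n B v w \<le> s" if "nrm n v \<le> 1" "nrm n w \<le> 1" for v w
    unfolding s_def using bdd that by (intro cSup_upper) (auto simp: S_def)
  have s4: "bilin n B v w \<le> s / 4" if "nrm n v \<le> 1/4" "nrm n w \<le> 1" for v w
    using s[of "\<lambda>i. 4 * v i" w] that by (simp add: nrm_cmult bilin_cmult_left)
  have s4': "bilin n B v w \<le> s / 4" if "nrm n v \<le> 1" "nrm n w \<le> 1/4" for v w
    using s[of v "\<lambda>i. 4 * w i"] that by (simp add: nrm_cmult bilin_cmult_right)
  have "bilin n B v w \<le> K / 2 + s / 2" if v: "nrm n v \<le> 1" and w: "nrm n w \<le> 1" for v w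
  proof -
    define r where "r = 1 / (4 * sqrt (real n))"
    from net_approx[OF n v] obtain z where z: "z \<in> net n" "nrm n (\<lambda>i. v i - r * real_of_int (z i)) \<le> 1/4"
      "nrm n (\<lambda>i. r * real_of_int (z i)) \<le> 1" by (auto simp: r_def)
    from net_approx[OF n w] obtain z' where z': "z' \<in> net n" "nrm n (\<lambda>i. w i - r * real_of_int (z' i)) \<le> 1/4"
      "nrm n (\<lambda>i. r * real_of_int (z' i)) \<le> 1" by (auto simp: r_def)
    have rr: "r * r * (16 * real n) = 1" using n by (simp add: r_def field_simps)
    have "bilin n B v w = bilin n B (\<lambda>i. v i - r * real_of_int (z i)) w
       + bilin n B (\<lambda>i. r * real_of_int (z i)) (\<lambda>i. w i - r * real_of_int (z' i))
       + bilin n B (\<lambda>i. r * real_of_int (z i)) (\<lambda>i. r * real_of_int (z' i))"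
      by (simp add: bilin_diff_left bilin_diff_right)
    also have "bilin n B (\<lambda>i. r * real_of_int (z i)) (\<lambda>i. r * real_of_int (z' i))
       = r * r * bilin n B (\<lambda>i. real_of_int (z i)) (\<lambda>i. real_of_int (z' i))"
      by (simp only: bilin_cmult_left bilin_cmult_right mult.assoc)
    also have "\<dots> \<le> r * r * (8 * real n * K)"
      by (intro mult_left_mono net z z') (auto simp: r_def)
    also have "\<dots> = (r * r * (16 * real n)) * (K / 2)" by simp
    finally show ?thesis using s4[OF z(2) w] s4'[OF z(3) z'(2)] unfolding rr by linarith
  qed
  hence "s \<le> K / 2 + s / 2" unfolding s_def[of] using ne by (intro cSup_least) (auto simp: S_def s_def)
  hence sK: "s \<le> K" by simp
  show ?thesis
    unfolding opn_def
  proof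
    fix v
    define w where "w = mat_vec n B v"
    show "nrm n (mat_vec n B v) \<le> K * nrm n v"
    proof (cases "nrm n v = 0 \<or> nrm n w = 0")
      case True
      thus ?thesis
      proof
        assume v0: "nrm n v = 0"
        have "v j = 0" if "j \<in> {1..n}" for j using abs_le_nrm[OF that, of v] v0 by simp
        hence "mat_vec n B v = (\<lambda>_. 0)" by (simp add: mat_vec_def fun_eq_iff)
        thus ?thesis using v0 by simp
      next
        assume "nrm n w = 0"
        thus ?thesis using K by (simp add: w_def)
      qed
    next
      case False
      hence p: "nrm n v > 0" "nrm n w > 0" by (auto simp: less_le)
      \<comment> \<open>Testing the form with the normalized image of \<open>v\<close> recovers the
        norm of that image.\<close>
      have "bilin n B (\<lambda>i. (1 / nrm n w) * w i) (\<lambda>i. (1 / nrm n v) * v i) \<le> s"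
        by (rule s; unfold nrm_cmult; use p in simp)
      hence "(1 / nrm n w) * ((1 / nrm n v) * bilin n B w v) \<le> K"
        using sK by (simp only: bilin_cmult_left bilin_cmult_right)
      moreover have "bilin n B w v = (nrm n w)\<^sup>2"
        unfolding bilin_def nrm_power2 by (simp add: w_def power2_eq_square)
      ultimately show ?thesis using p by (simp add: w_def power2_eq_square field_simps)
    qed
  qed
qed

section \<open>Uniform bounds with high probability\<close>

text \<open>A function that depends in a Lipschitz way on finitely many coordinates is continuous
  for the product topology.\<close>

lemma lip_measurable:
  assumes f: "lip m L f" and g: "\<And>j. j < m \<Longrightarrow> (\<lambda>x. g x j) \<in> borel_measurable M"
  shows "(\<lambda>x. f (g x)) \<in> borel_measurable M"
proof -
  \<comment> \<open>Zero from \<open>m\<close> on, so that all coordinates are measurable;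
    \<open>f\<close> does not see the change.\<close>
  define h where "h = (\<lambda>x j. if j < m then g x j else (0::real))"
  have eq: "f (g x) = f (h x)" for x
    using lipD[OF f, of "g x" "h x"] by (simp add: ldist_def h_def)
  have "continuous_on UNIV f"
    unfolding continuous_on_eq_continuous_at[OF open_UNIV] isCont_def
  proof (intro ballI)
    fix x :: "nat \<Rightarrow> real"
    have c: "((\<lambda>y. y j) \<longlongrightarrow> x j) (at x)" for j
      using continuous_on_product_coordinates by (metis continuous_on_def UNIV_I)
    have "((\<lambda>y. L * ldist m y x) \<longlongrightarrow> L * ldist m x x) (at x)"
      unfolding ldist_def by (intro tendsto_intros c)
    hence "((\<lambda>y. L * ldist m y x) \<longlongrightarrow> 0) (at x)" by (simp add: ldist_def)
    hence "((\<lambda>y. f y - f x) \<longlongrightarrow> 0) (at x)"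
      by (rule Lim_null_comparison[rotated]) (use lipD[OF f] in auto)
    thus "(f \<longlongrightarrow> f x) (at x)" by (simp add: LIM_zero_iff)
  qed
  hence fm: "f \<in> borel_measurable borel" by (rule borel_measurable_continuous_onI)
  have hm: "h \<in> measurable M borel"
  proof (rule measurable_coordinatewise_then_product)
    show "(\<lambda>x. h x j) \<in> borel_measurable M" for j by (cases "j < m") (auto simp: h_def g)
  qed
  show ?thesis using measurable_compose[OF hm fm] by (simp add: eq)
qed

section \<open>Symmetric matrices in terms of their upper triangular entries\<close>

definition ee :: "nat \<times> nat \<Rightarrow> matr" where
  "ee e i j = (if (min i j, max i j) = e then 1 else 0)"

text \<open>\<open>J\<close> is the set of upper triangular positions that are kept. All others
  carry zero, which is how single entries as well as rows and columns get removed.\<close>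

definition symx :: "(nat \<times> nat) set \<Rightarrow> (nat \<times> nat \<Rightarrow> real) \<Rightarrow> matr" where
  "symx J x i j = (if (min i j, max i j) \<in> J then x (min i j, max i j) else 0)"

lemma symx_sym: "symx J x i j = symx J x j i"
  by (simp add: symx_def min.commute max.commute)

lemma symx_sum: "finite J \<Longrightarrow> symx J x i j = (\<Sum>e\<in>J. x e * ee e i j)"
  by (simp add: symx_def ee_def if_distrib[of "\<lambda>t. _ * t"] sum.delta cong: if_cong)

lemma finite_upper_tri: "finite (upper_tri n)"
  by (rule finite_subset[of _ "{1..n} \<times> {1..n}"]) (auto simp: upper_tri_def)

lemma mat_vec_ee:
  assumes "(a, b) \<in> upper_tri n"
  shows "mat_vec n (ee (a, b)) v i = (if i = a then v b else 0) + (if i = b \<and> a \<noteq> b then v a else 0)"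
proof -
  have ab: "a \<in> {1..n}" "b \<in> {1..n}" "a \<le> b" using assms by (auto simp: upper_tri_def)
  have "mat_vec n (ee (a, b)) v i = (\<Sum>j\<in>{1..n}. (if i = a then (if j = b then v j else 0) else 0)
      + (if i = b \<and> a \<noteq> b then (if j = a then v j else 0) else 0))"
    unfolding mat_vec_def
  proof (rule sum.cong[OF refl])
    fix j
    show "ee (a, b) i j * v j = (if i = a then (if j = b then v j else 0) else 0)
      + (if i = b \<and> a \<noteq> b then (if j = a then v j else 0) else 0)"
      using ab(3) by (auto simp: ee_def min_def max_def)
  qed
  also have "\<dots> = (if i = a then v b else 0) + (if i = b \<and> a \<noteq> b then v a else 0)"
    using ab by (auto simp: sum.distrib)
  finally show ?thesis .
qed

lemma mat_vec_ee_l1: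
  assumes e: "(a, b) \<in> upper_tri n"
  shows "(\<Sum>i\<in>{1..n}. \<bar>mat_vec n (ee (a, b)) v i\<bar>) \<le> \<bar>v a\<bar> + \<bar>v b\<bar>"
proof -
  have ab: "a \<in> {1..n}" "b \<in> {1..n}" using e by (auto simp: upper_tri_def)
  have "(\<Sum>i\<in>{1..n}. \<bar>mat_vec n (ee (a, b)) v i\<bar>)
     \<le> (\<Sum>i\<in>{1..n}. (if i = a then \<bar>v b\<bar> else 0) + (if i = b then \<bar>v a\<bar> else 0))"
    unfolding mat_vec_ee[OF e] by (intro sum_mono) auto
  also have "\<dots> = \<bar>v a\<bar> + \<bar>v b\<bar>" using ab by (simp add: sum.distrib)
  finally show ?thesis .
qed

lemma mat_vec_symx:
  assumes "finite J"
  shows "mat_vec n (symx J x) v i = (\<Sum>e\<in>J. mat_vec n (ee e) v i * x e)"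
proof -
  have "mat_vec n (symx J x) v i = (\<Sum>j\<in>{1..n}. \<Sum>e\<in>J. ee e i j * v j * x e)"
    by (simp add: mat_vec_def symx_sum[OF assms] sum_distrib_left sum_distrib_right mult_ac)
  also have "\<dots> = (\<Sum>e\<in>J. \<Sum>j\<in>{1..n}. ee e i j * v j * x e)" by (rule sum.swap)
  finally show ?thesis by (simp add: mat_vec_def sum_distrib_right)
qed

lemma mat_vec_X_hat:
  "mat_vec n (X_hat n Z X) v i = mat_vec n X v i / sqrt (real n) + mat_vec n Z v i / real n"
  by (simp add: mat_vec_def X_hat_def sum.distrib sum_divide_distrib add_divide_distrib distrib_right)

lemma mat_vec_divide: "mat_vec n (\<lambda>i j. B i j / c) v i = mat_vec n B v i / c"
  by (simp add: mat_vec_def sum_divide_distrib)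

lemma bilin_ee:
  assumes e: "(a, b) \<in> upper_tri n"
  shows "bilin n (ee (a, b)) v w = v a * w b + (if a \<noteq> b then v b * w a else 0)"
proof -
  have ab: "a \<in> {1..n}" "b \<in> {1..n}" using e by (auto simp: upper_tri_def)
  have "bilin n (ee (a, b)) v w = (\<Sum>i\<in>{1..n}. (if i = a then v i * w b else 0)
     + (if i = b then (if a \<noteq> b then v i * w a else 0) else 0))"
    unfolding bilin_def mat_vec_ee[OF e] by (intro sum.cong refl) (auto simp: distrib_left)
  also have "\<dots> = v a * w b + (if a \<noteq> b then v b * w a else 0)"
    using ab by (simp only: sum.distrib) simp
  finally show ?thesis .
qed

lemma bilin_symx:
  assumes "finite J"
  shows "bilin n (\<lambda>i j. symx J x i j / c) v w = (\<Sum>e\<in>J. (bilin n (ee e) v w / c) * x e)"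
proof -
  have "bilin n (\<lambda>i j. symx J x i j / c) v w = (\<Sum>i\<in>{1..n}. \<Sum>e\<in>J. v i * mat_vec n (ee e) w i / c * x e)"
    by (simp add: bilin_def mat_vec_divide mat_vec_symx[OF assms] sum_distrib_left sum_divide_distrib mult_ac)
  also have "\<dots> = (\<Sum>e\<in>J. \<Sum>i\<in>{1..n}. v i * mat_vec n (ee e) w i / c * x e)" by (rule sum.swap)
  finally show ?thesis by (simp add: bilin_def sum_distrib_right sum_divide_distrib)
qed

text \<open>This is the variance proxy of the bilinear form, read as a linear form in the entries.
  An off-diagonal entry occurs twice, with coefficients \<open>v a * w b\<close> and
  \<open>v b * w a\<close>, whence the factor 4.\<close>

lemma bilin_ee_squares:
  assumes J: "J \<subseteq> upper_tri n"
  shows "(\<Sum>e\<in>J. (bilin n (ee e) v w)\<^sup>2) \<le> 4 * ((nrm n v)\<^sup>2 * (nrm n w)\<^sup>2)"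
proof -
  have J2: "J \<subseteq> {1..n} \<times> {1..n}" using J by (auto simp: upper_tri_def)
  have "(\<Sum>e\<in>J. (bilin n (ee e) v w)\<^sup>2)
     \<le> (\<Sum>(a, b)\<in>J. 2 * ((v a)\<^sup>2 * (w b)\<^sup>2) + 2 * ((v b)\<^sup>2 * (w a)\<^sup>2))"
  proof (rule sum_mono)
    fix e assume e: "e \<in> J"
    obtain a b where ab: "e = (a, b)" by force
    have "(bilin n (ee e) v w)\<^sup>2 \<le> 2 * (v a * w b)\<^sup>2 + 2 * (v b * w a)\<^sup>2"
    proof (cases "a = b")
      case False
      have "(x + y)\<^sup>2 \<le> 2 * x\<^sup>2 + 2 * y\<^sup>2" for x y :: real
        using zero_le_power2[of "x - y"] by (simp add: power2_eq_square algebra_simps)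
      thus ?thesis using False e J by (auto simp: ab bilin_ee)
    qed (use e J in \<open>auto simp: ab bilin_ee\<close>)
    thus "(bilin n (ee e) v w)\<^sup>2 \<le> (case e of (a, b) \<Rightarrow> 2 * ((v a)\<^sup>2 * (w b)\<^sup>2) + 2 * ((v b)\<^sup>2 * (w a)\<^sup>2))"
      by (simp add: ab power_mult_distrib)
  qed
  also have "\<dots> \<le> (\<Sum>(a, b)\<in>{1..n} \<times> {1..n}. 2 * ((v a)\<^sup>2 * (w b)\<^sup>2) + 2 * ((v b)\<^sup>2 * (w a)\<^sup>2))"
    by (rule sum_mono2[OF _ J2]) auto
  also have "\<dots> = (\<Sum>a\<in>{1..n}. \<Sum>b\<in>{1..n}. 2 * ((v a)\<^sup>2 * (w b)\<^sup>2) + 2 * ((v b)\<^sup>2 * (w a)\<^sup>2))"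
    by (rule sum.cartesian_product[symmetric])
  also have "\<dots> = 2 * (\<Sum>a\<in>{1..n}. \<Sum>b\<in>{1..n}. (v a)\<^sup>2 * (w b)\<^sup>2) + 2 * (\<Sum>a\<in>{1..n}. \<Sum>b\<in>{1..n}. (w a)\<^sup>2 * (v b)\<^sup>2)"
    by (simp add: sum.distrib sum_distrib_left mult_ac)
  also have "\<dots> = 4 * ((nrm n v)\<^sup>2 * (nrm n w)\<^sup>2)"
    by (simp only: sum_product[symmetric] nrm_power2[symmetric]) simp
  finally show ?thesis .
qed

text \<open>Different positions in row \<open>i0\<close> have different second indices, so the
  coefficients of the linear form are distinct coordinates of \<open>v\<close>.\<close>

lemma row_squares:
  assumes J: "J \<subseteq> upper_tri n" and i0: "\<And>a b. (a, b) \<in> J \<Longrightarrow> a = i0 \<or> b = i0"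
  shows "(\<Sum>e\<in>J. (mat_vec n (ee e) v i0)\<^sup>2) \<le> (nrm n v)\<^sup>2"
proof -
  define oth where "oth = (\<lambda>(a, b). if a = i0 then b else a)"
  have inj: "inj_on oth J"
  proof (rule inj_onI)
    fix e e' assume e: "e \<in> J" "e' \<in> J" "oth e = oth e'"
    obtain a b a' b' where ab: "e = (a, b)" "e' = (a', b')" by force
    have "a \<le> b" "a' \<le> b'" using e J by (auto simp: ab upper_tri_def)
    thus "e = e'" using e(3) i0[of a b] i0[of a' b'] e(1,2) unfolding ab oth_def by (auto split: if_splits)
  qed
  have "(\<Sum>e\<in>J. (mat_vec n (ee e) v i0)\<^sup>2) = (\<Sum>e\<in>J. (v (oth e))\<^sup>2)"
  proof (rule sum.cong[OF refl])
    fix e assume e: "e \<in> J"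
    obtain a b where ab: "e = (a, b)" by force
    show "(mat_vec n (ee e) v i0)\<^sup>2 = (v (oth e))\<^sup>2"
      using e J i0[of a b] by (auto simp: ab mat_vec_ee oth_def subset_iff)
  qed
  also have "\<dots> = (\<Sum>i\<in>oth ` J. (v i)\<^sup>2)" using sum.reindex[OF inj, of "\<lambda>i. (v i)\<^sup>2"] by simp
  also have "\<dots> \<le> (\<Sum>i\<in>{1..n}. (v i)\<^sup>2)"
    using J by (intro sum_mono2) (auto simp: oth_def upper_tri_def)
  finally show ?thesis by (simp add: nrm_power2)
qed

lemma net_nrm: "z \<in> net n \<Longrightarrow> (nrm n (\<lambda>i. real_of_int (z i)))\<^sup>2 \<le> 16 * real n"
proof -
  assume "z \<in> net n"
  hence "real_of_int (\<Sum>i\<in>{1..n}. (z i)\<^sup>2) \<le> real_of_int (16 * int n)"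
    unfolding of_int_le_iff by (simp add: net_def)
  thus ?thesis by (simp add: nrm_power2)
qed

locale matrix_law = subgaussian_product \<mu> \<sigma> for \<mu> :: "nat \<times> nat \<Rightarrow> real measure" and \<sigma> :: real
begin

text \<open>Union bound over pairs of net points, each pair giving a linear form in the entries with
  a subgaussian tail.\<close>

lemma whp_opn:
  assumes J: "J \<subseteq> upper_tri n" and n: "n \<ge> 1"
  shows "whp (PiM J \<mu>) (2 * exp (- real n)) (\<lambda>x. opn n (\<lambda>i j. symx J x i j / sqrt (real n)) (40 * \<sigma>))"
proof -
  have fJ: "finite J" using finite_subset[OF J finite_upper_tri] .
  \<comment> \<open>Tail level and variance proxy: \<open>s^2\<close> is
    \<open>4 * (16 * n)^2 / n\<close>, and \<open>p * s\<close> is the threshold of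
    \<open>opn_from_net\<close> for \<open>40 * \<sigma>\<close>. The failure probability
    \<open>2 * exp (- 50 * n)\<close> of one pair beats the number of pairs, at most
    \<open>exp (36 * n)\<close>.\<close>
  define p where "p = 10 * \<sigma> * sqrt (real n)"
  define s where "s = 32 * sqrt (real n)"
  have p0: "p \<ge> 0" "s \<ge> 0" using \<sigma> by (auto simp: p_def s_def)
  have ps: "p * s = 8 * real n * (40 * \<sigma>)" by (simp add: p_def s_def)
  have pe: "- p\<^sup>2 / (2 * \<sigma>\<^sup>2) = - 50 * real n"
    using \<sigma> by (simp add: p_def power_mult_distrib field_simps)
  have "whp (PiM J \<mu>) (2 * exp (- p\<^sup>2 / (2 * \<sigma>\<^sup>2)))
     (\<lambda>x. \<bar>\<Sum>e\<in>J. bilin n (ee e) (\<lambda>i. real_of_int (z i)) (\<lambda>i. real_of_int (z' i)) / sqrt (real n) * x e\<bar> \<le> p * s)"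
    if z: "z \<in> net n" "z' \<in> net n" for z z'
  proof (rule whp_tail_const[OF fJ p0(2,1)])
    have "(\<Sum>e\<in>J. (bilin n (ee e) (\<lambda>i. real_of_int (z i)) (\<lambda>i. real_of_int (z' i)) / sqrt (real n))\<^sup>2)
       = (\<Sum>e\<in>J. (bilin n (ee e) (\<lambda>i. real_of_int (z i)) (\<lambda>i. real_of_int (z' i)))\<^sup>2) / real n"
      by (simp add: power_divide sum_divide_distrib)
    also have "\<dots> \<le> (4 * ((16 * real n) * (16 * real n))) / real n"
      by (intro divide_right_mono order_trans[OF bilin_ee_squares[OF J]] mult_left_mono mult_mono net_nrm z) auto
    also have "\<dots> = s\<^sup>2" using n by (simp add: s_def power_mult_distrib)
    finally show "(\<Sum>e\<in>J. (bilin n (ee e) (\<lambda>i. real_of_int (z i)) (\<lambda>i. real_of_int (z' i)) / sqrt (real n))\<^sup>2) \<le> s\<^sup>2" .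
  qed
  hence "whp (PiM J \<mu>) (real (card (net n \<times> net n)) * (2 * exp (- 50 * real n)))
     (\<lambda>x. \<forall>zz\<in>net n \<times> net n. \<bar>\<Sum>e\<in>J. bilin n (ee e) (\<lambda>i. real_of_int (fst zz i)) (\<lambda>i. real_of_int (snd zz i)) / sqrt (real n) * x e\<bar> \<le> p * s)"
    unfolding pe by (intro whp_ball prob_PiM finite_cartesian_product finite_net) auto
  thus ?thesis
  proof (rule whp_mono)
    fix x assume h: "\<forall>zz\<in>net n \<times> net n. \<bar>\<Sum>e\<in>J. bilin n (ee e) (\<lambda>i. real_of_int (fst zz i)) (\<lambda>i. real_of_int (snd zz i)) / sqrt (real n) * x e\<bar> \<le> p * s"
    show "opn n (\<lambda>i j. symx J x i j / sqrt (real n)) (40 * \<sigma>)"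
    proof (rule opn_from_net[OF n])
      fix z z' assume "z \<in> net n" "z' \<in> net n"
      thus "bilin n (\<lambda>i j. symx J x i j / sqrt (real n)) (\<lambda>i. real_of_int (z i)) (\<lambda>i. real_of_int (z' i)) \<le> 8 * real n * (40 * \<sigma>)"
        using h unfolding bilin_symx[OF fJ] ps by force
    qed (use \<sigma> in simp)
  next
    have "real (card (net n)) \<le> (3 * 2 ^ 16) ^ n" by (rule card_net)
    also have "\<dots> \<le> exp 18 ^ n"
    proof (intro power_mono)
      have "(2 :: real) ^ 18 \<le> exp 1 ^ 18" using exp_ge_add_one_self[of 1] by (intro power_mono) auto
      thus "3 * 2 ^ 16 \<le> (exp 18 :: real)" by (simp add: exp_of_nat_mult[symmetric])
    qed auto
    also have "\<dots> = exp (18 * real n)" by (simp add: exp_of_nat_mult[symmetric] mult.commute)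
    finally have c: "real (card (net n)) \<le> exp (18 * real n)" .
    have "real (card (net n \<times> net n)) * (2 * exp (- 50 * real n))
       \<le> (exp (18 * real n) * exp (18 * real n)) * (2 * exp (- 50 * real n))"
      unfolding card_cartesian_product of_nat_mult by (intro mult_right_mono mult_mono c) auto
    also have "\<dots> = 2 * exp (- 14 * real n)" by (simp add: exp_add[symmetric])
    also have "\<dots> \<le> 2 * exp (- real n)" by simp
    finally show "real (card (net n \<times> net n)) * (2 * exp (- 50 * real n)) \<le> 2 * exp (- real n)" .
  qed
qed

end

lemma whp_ball1:
  assumes "prob_space M" "finite I" "\<And>i. i \<in> I \<Longrightarrow> whp M \<epsilon> (A i)" "real (card I) \<le> c" "\<epsilon> \<ge> 0"
  shows "whp M (c * \<epsilon>) (\<lambda>x. \<forall>i\<in>I. A i x)"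
  by (rule whp_mono[OF whp_ball[OF assms(1-3)]]) (use assms in \<open>auto intro: mult_right_mono\<close>)

text \<open>\<open>u\<close> and \<open>Z\<close> are deterministic here: the estimates are
  conditional on the initialization, and the only randomness is that of the entries with laws
  \<open>\<mu>\<close>.\<close>

locale amp_law = matrix_law \<mu> \<sigma> for \<mu> :: "nat \<times> nat \<Rightarrow> real measure" and \<sigma> :: real +
  fixes k n :: nat and L KZ C0 q :: real
    and F :: "nat \<Rightarrow> (nat \<Rightarrow> real) \<Rightarrow> real" and D :: "nat \<Rightarrow> nat \<Rightarrow> (nat \<Rightarrow> real) \<Rightarrow> real"
    and H :: "nat \<Rightarrow> nat \<Rightarrow> nat \<Rightarrow> (nat \<Rightarrow> real) \<Rightarrow> real" and Z :: matr and u :: vect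
  assumes n: "n \<ge> 1" and L: "L \<ge> 1" and KZ: "KZ \<ge> 1" and C0: "C0 \<ge> 0" and q: "q \<ge> 1"
    and F: "\<And>l. l < k \<Longrightarrow> smooth (Suc l) L (F l) (D l) (H l)"
    and F0: "\<And>l. l < k \<Longrightarrow> \<bar>F l (\<lambda>_. 0)\<bar> \<le> L"
    and Zop: "opn n (\<lambda>i j. Z i j / real n) KZ"
    and Zq: "\<And>i j. i \<in> {1..n} \<Longrightarrow> j \<in> {1..n} \<Longrightarrow> \<bar>Z i j\<bar> \<le> q"
    and Zsym: "\<And>i j. i \<in> {1..n} \<Longrightarrow> j \<in> {1..n} \<Longrightarrow> Z i j = Z j i"
    and u: "nrm n u \<le> C0 * sqrt (real n)"
    and uq: "\<And>i. i \<in> {1..n} \<Longrightarrow> \<bar>u i\<bar> \<le> q"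
begin

definition "K = 40 * \<sigma> + KZ"
definition "BB J x = X_hat n Z (symx J x)"
definition "PP B = (\<lambda>l j i. D l j (arg n B (orb n F B u) l i))"
text \<open>The cavity constants are free of \<open>n\<close> and \<open>q\<close>, so
  \<open>cc\<close> is a fixed number and powers of \<open>cc * q\<close> are polylogarithmic as
  soon as \<open>q\<close> is.\<close>

definition "cc = max 1 (max (cavity.cU k L K C0) (cavity.cB k L K C0))"

text \<open>In the backward recursion for the adjoint every level costs a factor \<open>cc * q\<close>; \<open>good t\<close> covers
  the last \<open>t + 1\<close> levels.\<close>

definition "Qt t = (cc * q) ^ (t + 1)"
definition "good t B \<longleftrightarrow> opn n B K \<and> (\<forall>l\<le>k. \<forall>i\<in>{1..n}. \<bar>orb n F B u l i\<bar> \<le> Qt t) \<and>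
   (\<forall>r. k - t \<le> r \<longrightarrow> r \<le> k \<longrightarrow> (\<forall>i\<in>{1..n}. \<bar>adj n B (PP B) k r i\<bar> \<le> Qt t))"
text \<open>Failure probability of one operator norm bound; the next one is that of a single row
  tail at level \<open>q\<close>.\<close>

definition "eo = 2 * exp (- real n)"
definition "eq = 2 * exp (- q\<^sup>2 / (2 * \<sigma>\<^sup>2))"

lemma K: "K \<ge> 1"
  using KZ \<sigma> by (simp add: K_def)

lemma cc: "cc \<ge> 1" "cavity.cU k L K C0 \<le> cc" "cavity.cB k L K C0 \<le> cc"
  by (auto simp: cc_def)

lemma Qt: "Qt t \<ge> 1" "Qt t \<le> Qt (Suc t)" "Qt (Suc t) = cc * q * Qt t" "cc * q \<le> Qt t"
proof -
  have 1: "1 \<le> cc * q" using mult_mono[OF cc(1) q] cc q by simp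
  show "Qt t \<ge> 1" unfolding Qt_def using 1 by (rule one_le_power)
  show "Qt t \<le> Qt (Suc t)" unfolding Qt_def using 1 by (intro power_increasing) auto
  show "Qt (Suc t) = cc * q * Qt t" by (simp add: Qt_def)
  show "cc * q \<le> Qt t" unfolding Qt_def using 1 power_increasing[of 1 "t + 1" "cc * q"] by simp
qed

lemma BB_sym: "i \<in> {1..n} \<Longrightarrow> j \<in> {1..n} \<Longrightarrow> BB J x i j = BB J x j i"
  using Zsym[of i j] symx_sym[of J x i j] by (simp add: BB_def X_hat_def)

lemma mat_vec_BB: "mat_vec n (BB J x) v i = mat_vec n (symx J x) v i / sqrt (real n) + mat_vec n Z v i / real n"
  by (simp add: BB_def mat_vec_X_hat)

lemma opn_BB:
  assumes "opn n (\<lambda>i j. symx J x i j / sqrt (real n)) (40 * \<sigma>)"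
  shows "opn n (BB J x) K"
  unfolding opn_def
proof
  fix v
  have "nrm n (mat_vec n (BB J x) v) \<le> nrm n (mat_vec n (\<lambda>i j. symx J x i j / sqrt (real n)) v)
     + nrm n (mat_vec n (\<lambda>i j. Z i j / real n) v)"
    unfolding mat_vec_BB[abs_def] mat_vec_divide[abs_def] by (rule nrm_add)
  also have "\<dots> \<le> 40 * \<sigma> * nrm n v + KZ * nrm n v"
    by (intro add_mono opnD assms Zop)
  finally show "nrm n (mat_vec n (BB J x) v) \<le> K * nrm n v" by (simp add: K_def distrib_right)
qed

lemma whp_opn_BB: "J \<subseteq> upper_tri n \<Longrightarrow> whp (PiM J \<mu>) eo (\<lambda>x. opn n (BB J x) K)"
  using whp_opn[OF _ n, of J] by (auto simp: eo_def intro: opn_BB elim!: whp_mono)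

section \<open>Measurability of the iterates and the adjoint vectors\<close>

lemma symx_measurable: "(\<lambda>x. symx J x i j) \<in> borel_measurable (PiM J \<mu>)"
  unfolding symx_def by (cases "(min i j, max i j) \<in> J") (auto intro: component_measurable)

lemma mat_vec_measurable:
  assumes "\<And>j. j \<in> {1..n} \<Longrightarrow> (\<lambda>x. v x j) \<in> borel_measurable (PiM J \<mu>)"
  shows "(\<lambda>x. mat_vec n (BB J x) (v x) i) \<in> borel_measurable (PiM J \<mu>)"
  unfolding mat_vec_def BB_def X_hat_def
  by (intro borel_measurable_sum borel_measurable_times borel_measurable_add borel_measurable_divide
      symx_measurable borel_measurable_const assms)

lemma F_lip: "l < k \<Longrightarrow> lip (Suc l) L (F l)"
  using F by (simp add: smooth_def)

lemma D_lip: "l < k \<Longrightarrow> j < Suc l \<Longrightarrow> lip (Suc l) L (D l j)"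
  using F by (simp add: smooth_def)

lemma D_le: "l < k \<Longrightarrow> j < Suc l \<Longrightarrow> \<bar>D l j y\<bar> \<le> L"
  using F by (simp add: smooth_def)

lemma arg_measurable:
  assumes "\<And>r j. r \<le> l \<Longrightarrow> (\<lambda>x. U x r j) \<in> borel_measurable (PiM J \<mu>)" "m < Suc l"
  shows "(\<lambda>x. arg n (BB J x) (U x) l i m) \<in> borel_measurable (PiM J \<mu>)"
  unfolding arg_def using assms by (cases "m = 0") (auto intro!: mat_vec_measurable)

lemma orb_measurable: "l \<le> k \<Longrightarrow> (\<lambda>x. orb n F (BB J x) u l i) \<in> borel_measurable (PiM J \<mu>)"
proof (induction l arbitrary: i rule: less_induct)
  case (less l)
  show ?case
  proof (cases l)
    case (Suc m)
    show ?thesis unfolding Suc orb_Suc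
      by (rule lip_measurable[OF F_lip]) (use less Suc in \<open>auto intro!: arg_measurable\<close>)
  qed simp
qed

lemma PP_measurable:
  assumes "l < k" "j < Suc l"
  shows "(\<lambda>x. PP (BB J x) l j i) \<in> borel_measurable (PiM J \<mu>)"
  unfolding PP_def by (rule lip_measurable[OF D_lip[OF assms]]) (use assms in \<open>auto intro!: arg_measurable orb_measurable\<close>)

lemma adj_measurable: "l \<le> k \<Longrightarrow> (\<lambda>x. adj n (BB J x) (PP (BB J x)) k l i) \<in> borel_measurable (PiM J \<mu>)"
proof (induction "k - l" arbitrary: l i rule: less_induct)
  case less
  show ?case
  proof (cases "l = k")
    case True
    thus ?thesis by (simp add: adj_top)
  next
    case False
    hence l: "l < k" using less by simp
    have IH: "(\<lambda>x. adj n (BB J x) (PP (BB J x)) k r i) \<in> borel_measurable (PiM J \<mu>)" if "l < r" "r \<le> k" for r i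
      using less(1)[of r i] that by simp
    show ?thesis unfolding adj_step[OF l]
    proof (intro borel_measurable_add mat_vec_measurable borel_measurable_sum borel_measurable_times)
      show "(\<lambda>x. PP (BB J x) l 0 j) \<in> borel_measurable (PiM J \<mu>)" for j by (rule PP_measurable) (use l in auto)
      show "(\<lambda>x. adj n (BB J x) (PP (BB J x)) k (Suc l) j) \<in> borel_measurable (PiM J \<mu>)" for j
        using IH[of "Suc l"] l by simp
      fix r assume r: "r \<in> {Suc (Suc l)..k}"
      have "r - 1 < k" "r - 1 - l < Suc (r - 1)" using r by auto
      thus "(\<lambda>x. PP (BB J x) (r - 1) (r - 1 - l) i) \<in> borel_measurable (PiM J \<mu>)" by (rule PP_measurable)
      show "(\<lambda>x. adj n (BB J x) (PP (BB J x)) k r i) \<in> borel_measurable (PiM J \<mu>)"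
        using IH[of r] r by simp
    qed
  qed
qed

section \<open>Removing a row and its column\<close>

definition "rw J i = {(a, b) \<in> J. a = i \<or> b = i}"
definition "TT J x i v = \<bar>mat_vec n (symx J x) v i\<bar> / sqrt (real n)"

lemma rw: "rw J i \<subseteq> J" "J = (J - rw J i) \<union> rw J i" "(J - rw J i) \<inter> rw J i = {}"
  by (auto simp: rw_def)

lemma symx_row: "i \<noteq> i0 \<Longrightarrow> j \<noteq> i0 \<Longrightarrow> symx (J - rw J i0) x i j = symx J x i j"
  by (auto simp: symx_def rw_def min_def max_def)

lemma symx_row0: "symx (J - rw J i0) x i0 j = 0"
  by (auto simp: symx_def rw_def min_def max_def)

text \<open>Records that the matrix built on the positions \<open>J1\<close> reads no other
  coordinates; this is the source of independence from a removed row.\<close>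

lemma BB_restrict: "BB J1 (restrict x J1) = BB J1 x"
  by (simp add: BB_def symx_def[abs_def] X_hat_def cong: if_cong)

text \<open>The matrices differ in row and column \<open>i0\<close> only. The row is paid for by
  \<open>TT\<close>; in every other row only column \<open>i0\<close> matters, so \<open>v\<close>
  may be replaced by its restriction \<open>w\<close> to \<open>i0\<close>, and the two operator
  norms give \<open>2 * K\<close>.\<close>

lemma cavity_diff:
  assumes B: "opn n (BB J x) K" and B': "opn n (BB (J - rw J i0) x) K" and i0: "i0 \<in> {1..n}"
  shows "nrm n (\<lambda>i. mat_vec n (BB J x) v i - mat_vec n (BB (J - rw J i0) x) v i)
     \<le> TT J x i0 v + 2 * K * \<bar>v i0\<bar>"
proof -
  define w where "w = (\<lambda>j. if j = i0 then v i0 else 0)"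
  let ?B = "BB J x" and ?B' = "BB (J - rw J i0) x"
  have w: "nrm n w = \<bar>v i0\<bar>"
  proof -
    have "(\<Sum>i\<in>{1..n}. (w i)\<^sup>2) = (\<Sum>i\<in>{1..n}. if i = i0 then (v i0)\<^sup>2 else 0)"
      by (intro sum.cong) (auto simp: w_def)
    thus ?thesis using i0 by (simp add: nrm_def L2_set_def)
  qed
  define t where "t = (\<lambda>i. if i = i0 then mat_vec n (symx J x) v i0 / sqrt (real n) else 0)"
  have t: "nrm n t = TT J x i0 v"
  proof -
    have "(\<Sum>i\<in>{1..n}. (t i)\<^sup>2) = (\<Sum>i\<in>{1..n}. if i = i0 then (mat_vec n (symx J x) v i0 / sqrt (real n))\<^sup>2 else 0)"
      by (intro sum.cong) (auto simp: t_def)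
    hence "nrm n t = \<bar>mat_vec n (symx J x) v i0 / sqrt (real n)\<bar>"
      using i0 by (simp add: nrm_def L2_set_def)
    thus ?thesis by (simp add: TT_def abs_divide)
  qed
  have "nrm n (\<lambda>i. mat_vec n ?B v i - mat_vec n ?B' v i)
     \<le> nrm n (\<lambda>i. \<bar>t i\<bar> + \<bar>mat_vec n ?B w i - mat_vec n ?B' w i\<bar>)"
  proof (rule nrm_mono)
    fix i assume i: "i \<in> {1..n}"
    have "\<bar>mat_vec n ?B v i - mat_vec n ?B' v i\<bar> \<le> \<bar>t i\<bar> + \<bar>mat_vec n ?B w i - mat_vec n ?B' w i\<bar>"
    proof (cases "i = i0")
      case True
      have "mat_vec n (symx (J - rw J i0) x) v i0 = 0" by (simp add: mat_vec_def symx_row0)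
      thus ?thesis using True by (simp add: mat_vec_BB t_def)
    next
      case False
      have "mat_vec n (symx J x) v i - mat_vec n (symx (J - rw J i0) x) v i
         = mat_vec n (symx J x) w i - mat_vec n (symx (J - rw J i0) x) w i"
        unfolding mat_vec_def sum_subtractf[symmetric]
      proof (rule sum.cong[OF refl])
        fix j
        show "symx J x i j * v j - symx (J - rw J i0) x i j * v j
           = symx J x i j * w j - symx (J - rw J i0) x i j * w j"
          using False symx_row[of i i0 j J x] by (auto simp: w_def)
      qed
      hence "mat_vec n ?B v i - mat_vec n ?B' v i = mat_vec n ?B w i - mat_vec n ?B' w i"
        by (simp add: mat_vec_BB diff_divide_distrib[symmetric])
      thus ?thesis by simp
    qed
    thus "\<bar>mat_vec n ?B v i - mat_vec n ?B' v i\<bar> \<le> \<bar>\<bar>t i\<bar> + \<bar>mat_vec n ?B w i - mat_vec n ?B' w i\<bar>\<bar>" by simp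
  qed
  also have "\<dots> \<le> nrm n t + nrm n (\<lambda>i. mat_vec n ?B w i - mat_vec n ?B' w i)"
    using nrm_add[of n "\<lambda>i. \<bar>t i\<bar>" "\<lambda>i. \<bar>mat_vec n ?B w i - mat_vec n ?B' w i\<bar>"] by simp
  also have "\<dots> \<le> TT J x i0 v + (K * nrm n w + K * nrm n w)"
    unfolding t by (intro add_mono order_refl order_trans[OF nrm_diff] opnD B B')
  finally show ?thesis unfolding w by linarith
qed

text \<open>After the removal only the entries of \<open>Z\<close>, at most \<open>q / n\<close>
  after scaling, remain in row \<open>i0\<close>; Cauchy-Schwarz does the rest.\<close>

lemma cavity_row: "\<bar>mat_vec n (BB (J - rw J i0) x) v i0\<bar> \<le> q * (nrm n v / sqrt (real n))" if i0: "i0 \<in> {1..n}"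
proof -
  have 0: "mat_vec n (symx (J - rw J i0) x) v i0 = 0" by (simp add: mat_vec_def symx_row0)
  have "\<bar>mat_vec n (BB (J - rw J i0) x) v i0\<bar> = \<bar>\<Sum>j\<in>{1..n}. Z i0 j * v j\<bar> / real n"
    unfolding mat_vec_BB 0 by (simp add: mat_vec_def abs_divide)
  also have "\<dots> \<le> (q * (sqrt (real n) * nrm n v)) / real n"
  proof (rule divide_right_mono)
    have "\<bar>\<Sum>j\<in>{1..n}. Z i0 j * v j\<bar> \<le> (\<Sum>j\<in>{1..n}. q * \<bar>v j\<bar>)"
      by (rule order_trans[OF sum_abs sum_mono]) (use Zq i0 in \<open>auto simp: abs_mult intro!: mult_right_mono\<close>)
    also have "\<dots> \<le> q * (sqrt (real n) * nrm n v)"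
      unfolding sum_distrib_left[symmetric] using q by (intro mult_left_mono l1_le_nrm) auto
    finally show "\<bar>\<Sum>j\<in>{1..n}. Z i0 j * v j\<bar> \<le> q * (sqrt (real n) * nrm n v)" .
  qed simp
  also have "\<dots> = q * (nrm n v / sqrt (real n))"
    using n by (simp add: field_simps)
  finally show ?thesis .
qed

lemma cavity_intro:
  assumes B: "opn n (BB J x) K" and B': "opn n (BB (J - rw J i0) x) K" and i0: "i0 \<in> {1..n}"
    and T: "\<And>l. l < k \<Longrightarrow> TT J x i0 (orb n F (BB (J - rw J i0) x) u l)
       \<le> q * (nrm n (orb n F (BB (J - rw J i0) x) u l) / sqrt (real n))"
  shows "cavity k n L K C0 q F D (BB J x) (BB (J - rw J i0) x) u i0 (TT J x i0)"
  by (unfold_locales; (rule L K C0 q n u B B' i0 uq[OF i0] cavity_diff[OF B B' i0] cavity_row[OF i0]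
      T D_lip D_le F_lip F0; assumption?))

text \<open>The hypothesis \<open>vr\<close> says that \<open>v\<close> depends on the entries
  outside row and column \<open>i0\<close> only, so the row applied to \<open>v\<close> is a linear
  form whose coefficients are independent of its variables.\<close>

lemma whp_row_tail:
  assumes J: "J \<subseteq> upper_tri n"
    and v: "\<And>j. j \<in> {1..n} \<Longrightarrow> (\<lambda>x. v x j) \<in> borel_measurable (PiM (J - rw J i0) \<mu>)"
    and vr: "\<And>x. v (restrict x (J - rw J i0)) = v x"
  shows "whp (PiM J \<mu>) eq (\<lambda>x. TT J x i0 (v x) \<le> q * (nrm n (v x) / sqrt (real n)))"
proof -
  define J1 where "J1 = J - rw J i0"
  define J2 where "J2 = rw J i0"
  have fin: "finite J" using finite_subset[OF J finite_upper_tri] .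
  have J12: "J = J1 \<union> J2" "J1 \<inter> J2 = {}" "finite J1" "finite J2"
    using rw[of J i0] fin by (auto simp: J1_def J2_def intro: finite_subset)
  have J2: "J2 \<subseteq> upper_tri n" using J rw(1)[of J i0] by (auto simp: J2_def)
  have cm: "(\<lambda>y. mat_vec n (ee e) (v y) i0) \<in> borel_measurable (PiM J1 \<mu>)" for e
    unfolding mat_vec_def J1_def by (intro borel_measurable_sum borel_measurable_times borel_measurable_const v)
  have sm: "(\<lambda>y. nrm n (v y)) \<in> borel_measurable (PiM J1 \<mu>)"
    unfolding nrm_def L2_set_def J1_def using v by (intro borel_measurable_sqrt[THEN measurable_compose[rotated]] borel_measurable_sum borel_measurable_power) auto
  have "whp (PiM (J1 \<union> J2) \<mu>) (2 * exp (- q\<^sup>2 / (2 * \<sigma>\<^sup>2)))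
     (\<lambda>x. \<bar>\<Sum>e\<in>J2. mat_vec n (ee e) (v (restrict x J1)) i0 * x e\<bar> \<le> q * nrm n (v (restrict x J1)))"
  proof (rule whp_tail[OF J12(3,4,2)])
    show "q \<ge> 0" using q by simp
    show "(\<Sum>e\<in>J2. (mat_vec n (ee e) (v y) i0)\<^sup>2) \<le> (nrm n (v y))\<^sup>2" for y
      by (rule row_squares[OF J2]) (auto simp: J2_def rw_def)
  qed (auto intro: cm sm)
  thus ?thesis unfolding J12(1)[symmetric]
  proof (rule whp_mono)
    fix x
    assume h: "\<bar>\<Sum>e\<in>J2. mat_vec n (ee e) (v (restrict x J1)) i0 * x e\<bar> \<le> q * nrm n (v (restrict x J1))"
    have vx: "v (restrict x J1) = v x" unfolding J1_def by (rule vr)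
    have "mat_vec n (symx J x) (v x) i0 = (\<Sum>e\<in>J. mat_vec n (ee e) (v x) i0 * x e)"
      by (rule mat_vec_symx[OF fin])
    also have "\<dots> = (\<Sum>e\<in>J2. mat_vec n (ee e) (v x) i0 * x e)"
    proof (rule sum.mono_neutral_right[OF fin])
      show "J2 \<subseteq> J" using J12 by auto
      show "\<forall>e\<in>J - J2. mat_vec n (ee e) (v x) i0 * x e = 0"
      proof
        fix e assume e: "e \<in> J - J2"
        obtain a b where ab: "e = (a, b)" by force
        have "a \<noteq> i0" "b \<noteq> i0" "(a, b) \<in> upper_tri n" using e J by (auto simp: ab J2_def rw_def)
        thus "mat_vec n (ee e) (v x) i0 * x e = 0" by (simp add: ab mat_vec_ee)
      qed
    qed
    finally have "\<bar>mat_vec n (symx J x) (v x) i0\<bar> \<le> q * nrm n (v x)" using h by (simp add: vx)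
    thus "TT J x i0 (v x) \<le> q * (nrm n (v x) / sqrt (real n))"
      using n by (simp add: TT_def divide_right_mono)
  qed (simp add: eq_def)
qed

section \<open>Failure probabilities and the induction over the levels\<close>

lemma eo_eq: "eo \<ge> 0" "eq \<ge> 0"
  by (auto simp: eo_def eq_def)

definition "w0 = eo + real k * eq"

lemma w0: "w0 \<ge> 0"
  using eo_eq by (simp add: w0_def)

lemma whp_cavity:
  assumes J: "J \<subseteq> upper_tri n"
  shows "whp (PiM J \<mu>) (eo + real n * w0) (\<lambda>x. opn n (BB J x) K \<and>
    (\<forall>i0\<in>{1..n}. cavity k n L K C0 q F D (BB J x) (BB (J - rw J i0) x) u i0 (TT J x i0)))"
proof -
  have fin: "finite J" using finite_subset[OF J finite_upper_tri] .
  have "whp (PiM J \<mu>) (real n * w0) (\<lambda>x. \<forall>i0\<in>{1..n}. opn n (BB (J - rw J i0) x) K \<and>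
      (\<forall>l\<in>{..<k}. TT J x i0 (orb n F (BB (J - rw J i0) x) u l)
       \<le> q * (nrm n (orb n F (BB (J - rw J i0) x) u l) / sqrt (real n))))"
  proof (rule whp_ball1[OF prob_PiM])
    fix i0 assume i0: "i0 \<in> {1..n}"
    let ?J1 = "J - rw J i0"
    have 0: "whp (PiM ?J1 \<mu>) eo (\<lambda>x. opn n (BB ?J1 x) K)" using J by (intro whp_opn_BB) auto
    have 1: "whp (PiM J \<mu>) eo (\<lambda>x. opn n (BB ?J1 x) K)"
      using whp_restrict[OF 0, of J] fin by (simp add: BB_restrict)
    have 2: "whp (PiM J \<mu>) (real k * eq) (\<lambda>x. \<forall>l\<in>{..<k}. TT J x i0 (orb n F (BB ?J1 x) u l)
       \<le> q * (nrm n (orb n F (BB ?J1 x) u l) / sqrt (real n)))"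
    proof (rule whp_ball1[OF prob_PiM])
      fix l assume "l \<in> {..<k}"
      thus "whp (PiM J \<mu>) eq (\<lambda>x. TT J x i0 (orb n F (BB ?J1 x) u l)
         \<le> q * (nrm n (orb n F (BB ?J1 x) u l) / sqrt (real n)))"
        by (intro whp_row_tail[OF J]) (auto intro: orb_measurable simp: BB_restrict)
    qed (auto simp: eo_eq)
    show "whp (PiM J \<mu>) w0 (\<lambda>x. opn n (BB ?J1 x) K \<and> (\<forall>l\<in>{..<k}. TT J x i0 (orb n F (BB ?J1 x) u l)
       \<le> q * (nrm n (orb n F (BB ?J1 x) u l) / sqrt (real n))))"
      unfolding w0_def by (rule whp_conj[OF prob_PiM 1 2])
  qed (auto simp: w0)
  from whp_conj[OF prob_PiM whp_opn_BB[OF J] this]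
  show ?thesis by (rule whp_mono) (auto intro!: cavity_intro)
qed

text \<open>Mirrors the induction step: the cavity estimates for all rows, the previous level for
  each of the \<open>n\<close> reduced matrices together with \<open>k\<close> row tails, and the
  previous level for the matrix itself.\<close>

fun err :: "nat \<Rightarrow> real" where
  "err 0 = eo + real n * w0"
| "err (Suc t) = (eo + real n * w0) + (real n * (err t + real k * eq) + err t)"

lemma err_nonneg: "err t \<ge> 0"
  by (induction t) (auto simp: w0 eo_eq)

text \<open>Induction over \<open>t\<close> for all \<open>J\<close> at once, since level
  \<open>Suc t\<close> for \<open>J\<close> uses level \<open>t\<close> for the \<open>n\<close>
  sets with a row removed. Going down to level \<open>k - t\<close> with \<open>t < k\<close> is
  enough, because the expansion pairs with the adjoint at levels \<open>1, ..., k\<close> only; the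
  alternative \<open>t = 0\<close> admits \<open>k = 0\<close>.\<close>

lemma whp_good:
  assumes "J \<subseteq> upper_tri n" "t < k \<or> t = 0"
  shows "whp (PiM J \<mu>) (err t) (\<lambda>x. good t (BB J x))"
  using assms
proof (induction t arbitrary: J)
  case 0
  show ?case
    unfolding err.simps
  proof (rule whp_mono[OF whp_cavity[OF 0(1)]])
    fix x
    assume h: "opn n (BB J x) K \<and>
      (\<forall>i0\<in>{1..n}. cavity k n L K C0 q F D (BB J x) (BB (J - rw J i0) x) u i0 (TT J x i0))"
    have "\<bar>orb n F (BB J x) u l i\<bar> \<le> Qt 0" if "l \<le> k" "i \<in> {1..n}" for l i
    proof -
      interpret cavity k n L K C0 q F D "BB J x" "BB (J - rw J i) x" u i "TT J x i"
        using h that(2) by blast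
      have "\<bar>orb n F (BB J x) u l i\<bar> \<le> cU * q" by (rule U_i0[OF that(1)])
      also have "\<dots> \<le> cc * q" using cc(2) q by (intro mult_right_mono) auto
      finally show ?thesis by (simp add: Qt_def)
    qed
    moreover have "\<bar>adj n (BB J x) (PP (BB J x)) k r i\<bar> \<le> Qt 0" if "k - 0 \<le> r" "r \<le> k" for r i
      using that Qt(1)[of 0] by (simp add: adj_top)
    ultimately show "good 0 (BB J x)" using h unfolding good_def by blast
  qed simp
next
  case (Suc t)
  have fin: "finite J" using finite_subset[OF Suc(2) finite_upper_tri] .
  have tk: "t < k" using Suc(3) by auto
  \<comment> \<open>The one level that is new in this step; the levels above it are covered by the
    induction hypothesis for the reduced matrices.\<close>
  define l0 where "l0 = k - Suc t"
  have l0: "l0 < k" "k - t = Suc l0" using Suc(3) by (auto simp: l0_def)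
  let ?v = "\<lambda>i0 x l. \<lambda>i. PP (BB (J - rw J i0) x) l 0 i * adj n (BB (J - rw J i0) x) (PP (BB (J - rw J i0) x)) k (Suc l) i"
  have "whp (PiM J \<mu>) (real n * (err t + real k * eq)) (\<lambda>x. \<forall>i0\<in>{1..n}. good t (BB (J - rw J i0) x) \<and>
      (\<forall>l\<in>{..<k}. TT J x i0 (?v i0 x l) \<le> q * (nrm n (?v i0 x l) / sqrt (real n))))"
  proof (rule whp_ball1[OF prob_PiM])
    fix i0 assume i0: "i0 \<in> {1..n}"
    let ?J1 = "J - rw J i0"
    have 0: "whp (PiM ?J1 \<mu>) (err t) (\<lambda>x. good t (BB ?J1 x))" using Suc(2) tk by (intro Suc(1)) auto
    have 1: "whp (PiM J \<mu>) (err t) (\<lambda>x. good t (BB ?J1 x))"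
      using whp_restrict[OF 0, of J] fin by (simp add: BB_restrict)
    have 2: "whp (PiM J \<mu>) (real k * eq) (\<lambda>x. \<forall>l\<in>{..<k}. TT J x i0 (?v i0 x l)
       \<le> q * (nrm n (?v i0 x l) / sqrt (real n)))"
    proof (rule whp_ball1[OF prob_PiM])
      fix l assume "l \<in> {..<k}"
      thus "whp (PiM J \<mu>) eq (\<lambda>x. TT J x i0 (?v i0 x l) \<le> q * (nrm n (?v i0 x l) / sqrt (real n)))"
        by (intro whp_row_tail[OF Suc(2)] borel_measurable_times PP_measurable adj_measurable)
           (auto simp: BB_restrict)
    qed (auto simp: eo_eq)
    show "whp (PiM J \<mu>) (err t + real k * eq) (\<lambda>x. good t (BB ?J1 x) \<and>
      (\<forall>l\<in>{..<k}. TT J x i0 (?v i0 x l) \<le> q * (nrm n (?v i0 x l) / sqrt (real n))))"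
      by (rule whp_conj[OF prob_PiM 1 2])
  qed (auto simp: err_nonneg eo_eq)
  from whp_conj[OF prob_PiM whp_cavity[OF Suc(2)] whp_conj[OF prob_PiM this Suc(1)[OF Suc(2)]]]
  show ?case unfolding err.simps
  proof (rule whp_mono)
    fix x
    assume h: "(opn n (BB J x) K \<and>
      (\<forall>i0\<in>{1..n}. cavity k n L K C0 q F D (BB J x) (BB (J - rw J i0) x) u i0 (TT J x i0))) \<and>
      (\<forall>i0\<in>{1..n}. good t (BB (J - rw J i0) x) \<and>
      (\<forall>l\<in>{..<k}. TT J x i0 (?v i0 x l) \<le> q * (nrm n (?v i0 x l) / sqrt (real n)))) \<and> good t (BB J x)"
    have "\<bar>orb n F (BB J x) u l i\<bar> \<le> Qt (Suc t)" if "l \<le> k" "i \<in> {1..n}" for l i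
      using h that Qt(2)[of t] unfolding good_def by (meson order_trans)
    moreover have "\<bar>adj n (BB J x) (PP (BB J x)) k r i\<bar> \<le> Qt (Suc t)"
      if r: "k - Suc t \<le> r" "r \<le> k" and i: "i \<in> {1..n}" for r i
    proof -
      interpret cavity k n L K C0 q F D "BB J x" "BB (J - rw J i) x" u i "TT J x i"
        using h i by blast
      have g: "good t (BB (J - rw J i) x)" using h i by blast
      have PPeq: "P' = PP (BB (J - rw J i) x)" "P = PP (BB J x)"
        by (auto simp: P'_def U'_def P_def U_def PP_def)
      have "\<bar>b r i\<bar> \<le> cB * q * Qt t"
      proof (rule b_i0[OF l0(1) Qt(1)])
        fix r j assume "l0 < r" "r \<le> k" "j \<in> {1..n}"
        thus "\<bar>b' r j\<bar> \<le> Qt t" using g l0 unfolding b'_def PPeq good_def by auto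
      next
        fix l assume "l < k"
        thus "TT J x i (\<lambda>i. P' l 0 i * b' (Suc l) i) \<le> q * (nrm n (\<lambda>i. P' l 0 i * b' (Suc l) i) / sqrt (real n))"
          using h i unfolding b'_def PPeq by blast
      qed (use r in \<open>auto simp: l0_def\<close>)
      also have "\<dots> \<le> cc * q * Qt t" using cc(3) q Qt(1)[of t] by (intro mult_right_mono) auto
      finally show ?thesis by (simp add: b_def PPeq Qt(3))
    qed
    ultimately show "good (Suc t) (BB J x)" using h unfolding good_def by blast
  qed (use tk in auto)
qed

lemma err_le: "err t \<le> (3 * real n) ^ (t + 1) * w0"
proof (induction t)
  case 0
  have "eo \<le> w0" using eo_eq by (simp add: w0_def)
  also have "\<dots> \<le> real n * w0" using n w0 by (simp add: mult_le_cancel_right1)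
  finally have "eo \<le> real n * w0" .
  moreover have "(3 * real n) ^ (0 + 1) * w0 = 3 * (real n * w0)" by simp
  moreover have "real n * w0 \<ge> 0" using w0 by simp
  ultimately show ?case unfolding err.simps by linarith
next
  case (Suc t)
  define X where "X = (3 * real n) ^ (t + 1) * w0"
  have n1: "real n \<ge> 1" using n by simp
  have X: "3 * real n * w0 \<le> X"
    unfolding X_def using n1 w0 power_increasing[of 1 "t + 1" "3 * real n"] by (intro mult_right_mono) auto
  have e: "eo \<le> w0" "real k * eq \<le> w0" using eo_eq by (auto simp: w0_def)
  have w: "w0 \<le> real n * w0" using n1 w0 by (simp add: mult_le_cancel_right1)
  have X0: "X \<ge> 0" using n1 w0 by (simp add: X_def)
  have "real n * (err t + real k * eq) \<le> real n * (X + w0)"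
    using Suc e by (intro mult_left_mono add_mono) (auto simp: X_def)
  hence "err (Suc t) \<le> (w0 + real n * w0) + (real n * (X + w0) + X)"
    using e Suc by (simp add: X_def)
  also have "\<dots> \<le> X + real n * X + X"
    using X w by (simp add: distrib_left)
  also have "\<dots> \<le> (3 * real n) * X" using mult_right_mono[OF n1 X0] by (simp add: algebra_simps)
  finally show ?case by (simp add: X_def mult_ac)
qed

end

section \<open>Comparison of two laws of the matrix\<close>

lemma whp_integral_le:
  fixes g :: "'a \<Rightarrow> real"
  assumes M: "prob_space M" and A: "whp M \<epsilon> A" and g: "g \<in> borel_measurable M"
    and g0: "\<And>x. x \<in> space M \<Longrightarrow> 0 \<le> g x" and gC: "\<And>x. x \<in> space M \<Longrightarrow> g x \<le> C"
    and gr: "\<And>x. x \<in> space M \<Longrightarrow> A x \<Longrightarrow> g x \<le> r" and r: "r \<ge> 0"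
  shows "(\<integral>x. g x \<partial>M) \<le> r + C * \<epsilon>"
proof -
  interpret prob_space M by fact
  obtain N where N: "N \<in> sets M" "measure M N \<le> \<epsilon>" "\<forall>x\<in>space M - N. A x"
    using A unfolding whp_def by blast
  obtain x0 where "x0 \<in> space M" using not_empty by blast
  hence C: "C \<ge> 0" using g0 gC by (meson order_trans)
  have iN: "integrable M (indicator N :: 'a \<Rightarrow> real)"
    by (intro integrable_real_indicator N(1)) (simp add: less_top[symmetric])
  have "(\<integral>x. g x \<partial>M) \<le> (\<integral>x. r + C * indicator N x \<partial>M)"
  proof (rule integral_mono)
    show "integrable M g" using g g0 gC by (intro integrable_const_bound[of _ C] AE_I2) auto
    show "integrable M (\<lambda>x. r + C * indicator N x)" using iN by auto
    show "g x \<le> r + C * indicator N x" if "x \<in> space M" for x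
      using that N(3) g0[of x] gC[of x] gr[of x] r C by (cases "x \<in> N") auto
  qed
  also have "\<dots> = r + C * measure M N"
    using N(1) iN by (simp add: prob_space)
  also have "\<dots> \<le> r + C * \<epsilon>" using N(2) C by (intro add_mono mult_left_mono) auto
  finally show ?thesis .
qed

lemma sin_taylor: "\<bar>sin a - sin b - cos b * (a - b)\<bar> \<le> (a - b)\<^sup>2" for a b :: real
proof -
  have "norm ((sin a - a * cos b) - (sin b - b * cos b)) \<le> \<bar>a - b\<bar> * norm (a - b)"
  proof (rule field_differentiable_bound[where S = "closed_segment a b" and f' = "\<lambda>x. cos x - cos b"])
    fix x assume x: "x \<in> closed_segment a b"
    show "((\<lambda>x. sin x - x * cos b) has_field_derivative cos x - cos b) (at x within closed_segment a b)"
      by (auto intro!: derivative_eq_intros)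
    have "norm (cos x - cos b) \<le> 1 * norm (x - b)"
      by (rule field_differentiable_bound[where S = UNIV and f' = "\<lambda>x. - sin x"])
         (auto intro!: derivative_eq_intros)
    also have "\<dots> \<le> \<bar>a - b\<bar>" using x by (auto simp: closed_segment_eq_real_ivl split: if_splits)
    finally show "norm (cos x - cos b) \<le> \<bar>a - b\<bar>" .
  qed auto
  thus ?thesis by (simp add: algebra_simps power2_eq_square abs_mult_self_eq)
qed

lemma sin_lipschitz: "\<bar>sin a - sin b\<bar> \<le> \<bar>a - b\<bar>" for a b :: real
proof -
  have "norm (sin a - sin b) \<le> 1 * norm (a - b)"
    by (rule field_differentiable_bound[where S = UNIV and f' = cos]) (auto intro!: derivative_eq_intros)
  thus ?thesis by simp
qed

section \<open>Moments of subgaussian entries\<close>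

context subgaussian_product
begin

text \<open>Comes from \<open>t^6 \<le> 720 * (exp t + exp (- t))\<close> with
  \<open>720 = 6!\<close>. As \<open>1 + t^6\<close> dominates all lower powers, this single moment
  serves every order of the expansion.\<close>

definition "m6 = 1 + 1440 * exp (\<sigma>\<^sup>2 / 2)"

lemma exp_integrable: "integrable (\<mu> e) (\<lambda>t. exp (l * t))" "(\<integral>t. exp (l * t) \<partial>\<mu> e) \<le> exp (l\<^sup>2 * \<sigma>\<^sup>2 / 2)"
proof -
  have m: "(\<lambda>t. exp (l * t)) \<in> borel_measurable (\<mu> e)"
    by (simp add: measurable_cong_sets[OF sets_\<mu> refl])
  have b: "(\<integral>\<^sup>+t. ennreal (exp (l * t)) \<partial>\<mu> e) \<le> ennreal (exp (l\<^sup>2 * \<sigma>\<^sup>2 / 2))"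
    using sub[of e] unfolding subgaussian_def by blast
  show i: "integrable (\<mu> e) (\<lambda>t. exp (l * t))"
    using m le_less_trans[OF b ennreal_less_top] by (intro integrableI_nonneg) auto
  show "(\<integral>t. exp (l * t) \<partial>\<mu> e) \<le> exp (l\<^sup>2 * \<sigma>\<^sup>2 / 2)"
    using b nn_integral_eq_integral[OF i] by simp
qed

lemma sixth_moment: "integrable (\<mu> e) (\<lambda>t. 1 + t ^ 6)" "(\<integral>t. 1 + t ^ 6 \<partial>\<mu> e) \<le> m6"
proof -
  have bnd: "t ^ 6 \<le> 720 * (exp (1 * t) + exp (- 1 * t))" for t :: real
  proof -
    have *: "x ^ 6 \<le> 720 * exp x" if "x \<ge> 0" for x :: real
    proof -
      have "x ^ 6 / fact 6 \<le> (\<Sum>n. x ^ n / fact n)"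
      proof -
        have "(\<Sum>n\<in>{6}. x ^ n /\<^sub>R fact n) \<le> (\<Sum>n. x ^ n /\<^sub>R fact n)"
          by (rule sum_le_suminf[OF summable_exp_generic]) (use that in auto)
        thus ?thesis by (simp add: field_simps)
      qed
      also have "\<dots> = exp x" by (simp add: exp_def field_simps)
      finally show ?thesis by (simp add: fact_numeral)
    qed
    show ?thesis
    proof (cases "t \<ge> 0")
      case True
      have "t ^ 6 \<le> 720 * exp t" by (rule *[OF True])
      also have "\<dots> \<le> 720 * (exp (1 * t) + exp (- 1 * t))" by simp
      finally show ?thesis .
    next
      case False
      have "t ^ 6 = (- t) ^ 6" by simp
      also have "\<dots> \<le> 720 * exp (- t)" using False by (intro *) auto
      also have "\<dots> \<le> 720 * (exp (1 * t) + exp (- 1 * t))" by simp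
      finally show ?thesis .
    qed
  qed
  have m: "(\<lambda>t. 1 + t ^ 6) \<in> borel_measurable (\<mu> e)"
    by (simp add: measurable_cong_sets[OF sets_\<mu> refl])
  have i2: "integrable (\<mu> e) (\<lambda>t. 1 + 720 * (exp (1 * t) + exp (- 1 * t)))"
    using exp_integrable(1)[of e 1] exp_integrable(1)[of e "- 1"] by auto
  show i: "integrable (\<mu> e) (\<lambda>t. 1 + t ^ 6)"
    by (rule Bochner_Integration.integrable_bound[OF i2 m]) (use bnd in \<open>auto intro!: AE_I2\<close>)
  have "(\<integral>t. 1 + t ^ 6 \<partial>\<mu> e) \<le> (\<integral>t. 1 + 720 * (exp (1 * t) + exp (- 1 * t)) \<partial>\<mu> e)"
    by (rule integral_mono[OF i i2]) (use bnd in auto)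
  also have "\<dots> = 1 + 720 * ((\<integral>t. exp (1 * t) \<partial>\<mu> e) + (\<integral>t. exp (- 1 * t) \<partial>\<mu> e))"
    using exp_integrable(1)[of e 1] exp_integrable(1)[of e "- 1"] by (simp add: M.prob_space)
  also have "\<dots> \<le> m6"
    using exp_integrable(2)[of e 1] exp_integrable(2)[of e "- 1"] by (simp add: m6_def)
  finally show "(\<integral>t. 1 + t ^ 6 \<partial>\<mu> e) \<le> m6" .
qed

lemma low_moments: "integrable (\<mu> e) (\<lambda>t. t)" "integrable (\<mu> e) (\<lambda>t. t\<^sup>2)"
proof -
  have p: "\<bar>t\<bar> ^ j \<le> 1 + t ^ 6" if "j \<le> 6" for t :: real and j
  proof (cases "\<bar>t\<bar> \<le> 1")
    case True
    hence "\<bar>t\<bar> ^ j \<le> 1" by (intro power_le_one) auto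
    also have "\<dots> \<le> 1 + t ^ 6" by simp
    finally show ?thesis .
  next
    case False
    hence "\<bar>t\<bar> ^ j \<le> \<bar>t\<bar> ^ 6" using that by (intro power_increasing) auto
    thus ?thesis by (simp add: power_even_abs)
  qed
  show "integrable (\<mu> e) (\<lambda>t. t)" "integrable (\<mu> e) (\<lambda>t. t\<^sup>2)"
    by (rule Bochner_Integration.integrable_bound[OF sixth_moment(1)];
        use p[of 1] p[of 2] in \<open>auto simp: measurable_cong_sets[OF sets_\<mu> refl] intro!: AE_I2\<close>)+
qed

end

lemma scaled_powers:
  fixes t :: real
  assumes n: "n \<ge> (1::real)"
  shows "(t / sqrt n)\<^sup>2 \<le> (1 + t ^ 6) / n" "\<bar>t / sqrt n\<bar> ^ 3 \<le> (1 + t ^ 6) / (n * sqrt n)"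
    "(t / sqrt n) ^ 6 \<le> (1 + t ^ 6) / n ^ 3"
proof -
  have p: "\<bar>t\<bar> ^ j \<le> 1 + t ^ 6" if "j \<le> 6" for j
  proof (cases "\<bar>t\<bar> \<le> 1")
    case True
    hence "\<bar>t\<bar> ^ j \<le> 1" by (intro power_le_one) auto
    also have "\<dots> \<le> 1 + t ^ 6" by simp
    finally show ?thesis .
  next
    case False
    hence "\<bar>t\<bar> ^ j \<le> \<bar>t\<bar> ^ 6" using that by (intro power_increasing) auto
    thus ?thesis by (simp add: power_even_abs)
  qed
  have s: "sqrt n ^ 2 = n" "sqrt n ^ 3 = n * sqrt n" "sqrt n ^ 6 = n ^ 3"
  proof -
    show 1: "sqrt n ^ 2 = n" using n by simp
    show "sqrt n ^ 3 = n * sqrt n" using 1 by (simp add: power3_eq_cube power2_eq_square)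
    have "sqrt n ^ 6 = (sqrt n ^ 2) ^ 3" by (simp only: power_mult[symmetric]) simp
    thus "sqrt n ^ 6 = n ^ 3" by (simp only: 1)
  qed
  show "(t / sqrt n)\<^sup>2 \<le> (1 + t ^ 6) / n"
    unfolding power_divide s using p[of 2] n by (intro divide_right_mono) auto
  show "\<bar>t / sqrt n\<bar> ^ 3 \<le> (1 + t ^ 6) / (n * sqrt n)"
    unfolding abs_divide power_divide using p[of 3] n s by (simp add: divide_right_mono)
  show "(t / sqrt n) ^ 6 \<le> (1 + t ^ 6) / n ^ 3"
    unfolding power_divide s using p[of 6] n by (intro divide_right_mono) auto
qed

section \<open>Dependence of the mean on one entry, and its concentration\<close>

context amp_law
begin

text \<open>Bound on the coefficients of the mean as a function of one rescaled entry: the bound for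
  the sum of coordinates, divided by \<open>n\<close>. The index \<open>k - 1\<close> reaches the
  adjoint levels down to 1; the absolute value gives nonnegativity outside the locale of the
  constant.\<close>

definition "Mn = \<bar>entry_perturbation.c k L K\<bar> * Qt (k - 1) ^ 4 / real n"

text \<open>The expansion is used for \<open>\<bar>t\<bar> \<le> sqrt n\<close> only; the last summand covers the other \<open>t\<close>, where \<open>1 \<le> t ^ 6 / n ^ 3\<close>.\<close>

definition "\<rho> = 9 * Mn\<^sup>2 / real n + 2 * Mn / (real n * sqrt (real n)) + 4 / real n ^ 3"
definition "mean x = (\<Sum>i\<in>{1..n}. orb n F (BB (upper_tri n) x) u k i) / real n"
definition "test x = sin (mean x)"

lemma mean_measurable: "mean \<in> borel_measurable (PiM (upper_tri n) \<mu>)"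
  unfolding mean_def[abs_def] by (intro borel_measurable_divide borel_measurable_sum orb_measurable) auto

lemma test_measurable: "test \<in> borel_measurable (PiM (upper_tri n) \<mu>)"
  unfolding test_def[abs_def] by (rule measurable_compose[OF mean_measurable borel_measurable_sin]) 

lemma test_bounded: "\<bar>test x\<bar> \<le> 1"
  by (simp add: test_def)

lemma BB_upd:
  assumes e: "e \<in> upper_tri n"
  shows "BB (upper_tri n) (x(e := t)) = (\<lambda>i j. BB (upper_tri n - {e}) x i j + (t / sqrt (real n)) * ee e i j)"
  using e by (auto simp: fun_eq_iff BB_def X_hat_def symx_def ee_def)

lemma Mn_nonneg: "Mn \<ge> 0" and \<rho>_nonneg: "\<rho> \<ge> 0"
  using Qt(1)[of "k - 1"] by (auto simp: \<rho>_def Mn_def)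

text \<open>The expansion is made around the matrix with entry \<open>e\<close> set to zero, so the
  quadratic polynomial depends on the other entries only and not on the law of entry
  \<open>e\<close>. This reduces the comparison of two laws to a comparison of moments.\<close>

lemma entry_bounds:
  assumes e: "e \<in> upper_tri n" and g: "good (k - 1) (BB (upper_tri n - {e}) x)"
  shows "\<exists>c0 c1 c2. \<forall>t. \<bar>test (x(e := t)) - (c0 + c1 * t + c2 * t\<^sup>2)\<bar> \<le> (1 + t ^ 6) * \<rho>"
    and "(test (x(e := t)) - test (x(e := 0)))\<^sup>2 \<le> (1 + t ^ 6) * \<rho>"
proof -
  obtain p r where pr: "e = (p, r)" by force
  have prn: "p \<in> {1..n}" "r \<in> {1..n}" using e by (auto simp: pr upper_tri_def)
  let ?B = "BB (upper_tri n - {e}) x"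
  interpret entry_perturbation k n L K "Qt (k - 1)" F D H ?B "ee e" u p r
  proof unfold_locales
    show "(\<Sum>i\<in>{1..n}. \<bar>mat_vec n (ee e) v i\<bar>) \<le> \<bar>v p\<bar> + \<bar>v r\<bar>" for v
      unfolding pr by (rule mat_vec_ee_l1) (use e pr in simp)
    show "\<bar>adj n ?B (\<lambda>l j i. D l j (arg n ?B (orb n F ?B u) l i)) k (Suc l) i\<bar> \<le> Qt (k - 1)"
      if "l < k" "i \<in> {1..n}" for l i
    proof -
      have "k - (k - 1) \<le> Suc l" "Suc l \<le> k" using that by auto
      thus ?thesis using g that(2) unfolding good_def PP_def by blast
    qed
  qed (use g L K F Qt(1) prn BB_sym in \<open>auto simp: good_def\<close>)
  define S where "S = (\<lambda>s. (\<Sum>i\<in>{1..n}. orb n F (\<lambda>i j. ?B i j + s * ee e i j) u k i) / real n)"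
  have mS: "mean (x(e := t)) = S (t / sqrt (real n))" for t
    unfolding mean_def S_def BB_upd[OF e] ..
  have S0: "S 0 = (\<Sum>i\<in>{1..n}. orb n F ?B u k i) / real n" by (simp add: S_def)
  have "c \<ge> 0" using W a by (simp add: c_def)
  hence Mc: "Mn = c * Qt (k - 1) ^ 4 / real n" by (simp add: Mn_def)
  note Mn = Mn_nonneg
  obtain \<beta>' \<gamma>' where bg: "\<bar>\<beta>'\<bar> \<le> c * Qt (k - 1) ^ 4" "\<bar>\<gamma>'\<bar> \<le> c * Qt (k - 1) ^ 4"
    and ex: "\<And>s. \<bar>s\<bar> \<le> 1 \<Longrightarrow>
     \<bar>(\<Sum>i\<in>{1..n}. orb n F (\<lambda>i j. ?B i j + s * ee e i j) u k i) - (\<Sum>i\<in>{1..n}. orb n F ?B u k i)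
       - \<beta>' * s - \<gamma>' * s\<^sup>2\<bar> \<le> c * Qt (k - 1) ^ 4 * \<bar>s\<bar> ^ 3"
    using expansion by blast
  define \<beta>1 where "\<beta>1 = \<beta>' / real n"
  define \<gamma>1 where "\<gamma>1 = \<gamma>' / real n"
  have b1: "\<bar>\<beta>1\<bar> \<le> Mn" and g1: "\<bar>\<gamma>1\<bar> \<le> Mn"
    using bg n by (auto simp: \<beta>1_def \<gamma>1_def Mc abs_divide intro!: divide_right_mono)
  have exS: "\<bar>S s - S 0 - \<beta>1 * s - \<gamma>1 * s\<^sup>2\<bar> \<le> Mn * \<bar>s\<bar> ^ 3" if "\<bar>s\<bar> \<le> 1" for s
  proof -
    have "S s - S 0 - \<beta>1 * s - \<gamma>1 * s\<^sup>2
      = ((\<Sum>i\<in>{1..n}. orb n F (\<lambda>i j. ?B i j + s * ee e i j) u k i) - (\<Sum>i\<in>{1..n}. orb n F ?B u k i)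
       - \<beta>' * s - \<gamma>' * s\<^sup>2) / real n"
      unfolding S0 by (simp add: S_def \<beta>1_def \<gamma>1_def diff_divide_distrib)
    also have "\<bar>\<dots>\<bar> \<le> (c * Qt (k - 1) ^ 4 * \<bar>s\<bar> ^ 3) / real n"
      unfolding abs_divide using ex[OF that] by (simp add: divide_right_mono)
    finally show ?thesis by (simp add: Mc)
  qed
  have lin_S: "\<bar>S s - S 0\<bar> \<le> 3 * Mn * \<bar>s\<bar>" if "\<bar>s\<bar> \<le> 1" for s
  proof -
    have "\<bar>\<beta>1 * s\<bar> \<le> Mn * \<bar>s\<bar>" unfolding abs_mult using b1 by (intro mult_right_mono) auto
    moreover have "\<bar>\<gamma>1 * s\<^sup>2\<bar> \<le> Mn * \<bar>s\<bar>"
      unfolding abs_mult using g1 Mn power_decreasing[of 1 2 "\<bar>s\<bar>"] that by (intro mult_mono) auto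
    moreover have "Mn * \<bar>s\<bar> ^ 3 \<le> Mn * \<bar>s\<bar>"
      using Mn power_decreasing[of 1 3 "\<bar>s\<bar>"] that by (intro mult_left_mono) auto
    ultimately show ?thesis using exS[OF that] by linarith
  qed
  have n1: "real n \<ge> 1" using n by simp
  note sp = scaled_powers[OF n1]
  have comb: "9 * Mn\<^sup>2 * s\<^sup>2 + 2 * Mn * \<bar>s\<bar> ^ 3 + 4 * s ^ 6 \<le> (1 + t ^ 6) * \<rho>" if "s = t / sqrt (real n)" for s t
  proof -
    have "9 * Mn\<^sup>2 * s\<^sup>2 + 2 * Mn * \<bar>s\<bar> ^ 3 + 4 * s ^ 6
      \<le> 9 * Mn\<^sup>2 * ((1 + t ^ 6) / real n) + 2 * Mn * ((1 + t ^ 6) / (real n * sqrt (real n))) + 4 * ((1 + t ^ 6) / real n ^ 3)"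
      unfolding that using Mn by (intro add_mono mult_left_mono sp) auto
    also have "\<dots> = (1 + t ^ 6) * \<rho>" by (simp add: \<rho>_def distrib_left mult_ac)
    finally show ?thesis .
  qed
  show "\<exists>c0 c1 c2. \<forall>t. \<bar>test (x(e := t)) - (c0 + c1 * t + c2 * t\<^sup>2)\<bar> \<le> (1 + t ^ 6) * \<rho>"
  proof (intro exI allI)
    fix t
    define s where "s = t / sqrt (real n)"
    have "test (x(e := t)) - (sin (S 0) + (cos (S 0) * \<beta>1 / sqrt (real n)) * t + (cos (S 0) * \<gamma>1 / real n) * t\<^sup>2)
       = sin (S s) - sin (S 0) - cos (S 0) * (\<beta>1 * s + \<gamma>1 * s\<^sup>2)"
      by (simp add: test_def mS s_def power_divide algebra_simps)
    \<comment> \<open>The summands stem from the quadratic error of the sine, from the cubic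
      remainder of the mean (for large \<open>s\<close> from the polynomial itself), and from the
      range \<open>\<bar>s\<bar> > 1\<close>, where bounded terms are at most a multiple of
      \<open>s^6\<close>.\<close>
    also have "\<bar>\<dots>\<bar> \<le> 9 * Mn\<^sup>2 * s\<^sup>2 + 2 * Mn * \<bar>s\<bar> ^ 3 + 4 * s ^ 6"
    proof (cases "\<bar>s\<bar> \<le> 1")
      case True
      have "sin (S s) - sin (S 0) - cos (S 0) * (\<beta>1 * s + \<gamma>1 * s\<^sup>2)
        = (sin (S s) - sin (S 0) - cos (S 0) * (S s - S 0)) + cos (S 0) * (S s - S 0 - \<beta>1 * s - \<gamma>1 * s\<^sup>2)"
        by (simp add: algebra_simps)
      moreover have "\<bar>sin (S s) - sin (S 0) - cos (S 0) * (S s - S 0)\<bar> \<le> (3 * Mn * \<bar>s\<bar>)\<^sup>2"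
        by (rule order_trans[OF sin_taylor]) (use lin_S[OF True] in \<open>metis abs_ge_zero power2_abs power_mono\<close>)
      moreover have "\<bar>cos (S 0) * (S s - S 0 - \<beta>1 * s - \<gamma>1 * s\<^sup>2)\<bar> \<le> 1 * (Mn * \<bar>s\<bar> ^ 3)"
        unfolding abs_mult by (intro mult_mono exS True) auto
      moreover have "(3 * Mn * \<bar>s\<bar>)\<^sup>2 = 9 * Mn\<^sup>2 * s\<^sup>2" by (simp add: power_mult_distrib)
      moreover have "0 \<le> Mn * \<bar>s\<bar> ^ 3" "0 \<le> s ^ 6" using Mn by auto
      ultimately show ?thesis by linarith
    next
      case False
      have s1: "1 \<le> \<bar>s\<bar> ^ 6" "\<bar>s\<bar> \<le> \<bar>s\<bar> ^ 3" "\<bar>s\<bar> ^ 2 \<le> \<bar>s\<bar> ^ 3"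
        using False power_increasing[of 1 3 "\<bar>s\<bar>"] power_increasing[of 2 3 "\<bar>s\<bar>"] one_le_power[of "\<bar>s\<bar>" 6] by auto
      have "\<bar>\<beta>1 * s\<bar> \<le> Mn * \<bar>s\<bar> ^ 3" unfolding abs_mult using b1 s1 by (intro mult_mono) auto
      moreover have "\<bar>\<gamma>1 * s\<^sup>2\<bar> \<le> Mn * \<bar>s\<bar> ^ 3" unfolding abs_mult using g1 s1 by (intro mult_mono) auto
      ultimately have "\<bar>\<beta>1 * s + \<gamma>1 * s\<^sup>2\<bar> \<le> 2 * (Mn * \<bar>s\<bar> ^ 3)" by linarith
      hence "\<bar>cos (S 0) * (\<beta>1 * s + \<gamma>1 * s\<^sup>2)\<bar> \<le> 1 * (2 * (Mn * \<bar>s\<bar> ^ 3))"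
        unfolding abs_mult by (intro mult_mono) auto
      moreover have "\<bar>sin (S s)\<bar> \<le> 1" "\<bar>sin (S 0)\<bar> \<le> 1" by auto
      moreover have "1 \<le> s ^ 6" using s1(1) by (simp add: power_even_abs)
      moreover have "0 \<le> Mn\<^sup>2 * s\<^sup>2" by simp
      ultimately show ?thesis by linarith
    qed
    also have "\<dots> \<le> (1 + t ^ 6) * \<rho>" by (rule comb[OF s_def])
    finally show "\<bar>test (x(e := t)) - (sin (S 0) + (cos (S 0) * \<beta>1 / sqrt (real n)) * t + (cos (S 0) * \<gamma>1 / real n) * t\<^sup>2)\<bar>
      \<le> (1 + t ^ 6) * \<rho>" .
  qed
  define s where "s = t / sqrt (real n)"
  have "(test (x(e := t)) - test (x(e := 0)))\<^sup>2 = (sin (S s) - sin (S 0))\<^sup>2"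
    by (simp add: test_def mS s_def)
  also have "\<dots> \<le> 9 * Mn\<^sup>2 * s\<^sup>2 + 2 * Mn * \<bar>s\<bar> ^ 3 + 4 * s ^ 6"
  proof (cases "\<bar>s\<bar> \<le> 1")
    case True
    have "\<bar>sin (S s) - sin (S 0)\<bar> \<le> 3 * Mn * \<bar>s\<bar>" using sin_lipschitz[of "S s" "S 0"] lin_S[OF True] by linarith
    hence "(sin (S s) - sin (S 0))\<^sup>2 \<le> (3 * Mn * \<bar>s\<bar>)\<^sup>2" by (metis abs_ge_zero power2_abs power_mono)
    moreover have "(3 * Mn * \<bar>s\<bar>)\<^sup>2 = 9 * Mn\<^sup>2 * s\<^sup>2" by (simp add: power_mult_distrib)
    moreover have "0 \<le> Mn * \<bar>s\<bar> ^ 3" "0 \<le> s ^ 6" using Mn by auto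
    ultimately show ?thesis by linarith
  next
    case False
    have "\<bar>sin (S s) - sin (S 0)\<bar> \<le> 2" using abs_sin_le_one[of "S s"] abs_sin_le_one[of "S 0"] by linarith
    hence "(sin (S s) - sin (S 0))\<^sup>2 \<le> 2\<^sup>2" by (metis abs_ge_zero power2_abs power_mono)
    moreover have "1 \<le> s ^ 6" using False one_le_power[of "\<bar>s\<bar>" 6] by (simp add: power_even_abs)
    moreover have "0 \<le> Mn\<^sup>2 * s\<^sup>2" "0 \<le> Mn * \<bar>s\<bar> ^ 3" using Mn by auto
    moreover have "(2 :: real)\<^sup>2 = 4" by simp
    ultimately show ?thesis by linarith
  qed
  also have "\<dots> \<le> (1 + t ^ 6) * \<rho>" by (rule comb[OF s_def])
  finally show "(test (x(e := t)) - test (x(e := 0)))\<^sup>2 \<le> (1 + t ^ 6) * \<rho>" .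
qed

lemma card_upper_tri: "real (card (upper_tri n)) \<le> (real n)\<^sup>2"
proof -
  have "card (upper_tri n) \<le> card ({1..n} \<times> {1..n})"
    by (rule card_mono) (auto simp: upper_tri_def)
  also have "\<dots> = n * n" by simp
  finally have "real (card (upper_tri n)) \<le> real (n * n)" by (simp only: of_nat_le_iff)
  thus ?thesis by (simp add: power2_eq_square)
qed

lemma whp_good_entry: "whp (PiM (upper_tri n - {e}) \<mu>) (err (k - 1)) (\<lambda>x. good (k - 1) (BB (upper_tri n - {e}) x))"
  by (rule whp_good) auto

lemma sixth_\<rho>: "(\<integral>t. (1 + t ^ 6) * \<rho> \<partial>\<mu> e) \<le> m6 * \<rho>" "integrable (\<mu> e) (\<lambda>t. (1 + t ^ 6) * \<rho>)"
  using sixth_moment[of e] \<rho>_nonneg by (auto intro: mult_right_mono)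

lemma test_upd:
  assumes "e \<in> upper_tri n" "x \<in> space (PiM (upper_tri n - {e}) \<mu>)"
  shows "(\<lambda>t. test (x(e := t))) \<in> borel_measurable (\<mu> e)" "integrable (\<mu> e) (\<lambda>t. test (x(e := t)))"
proof -
  have I: "insert e (upper_tri n - {e}) = upper_tri n" using assms(1) by auto
  show 1: "(\<lambda>t. test (x(e := t))) \<in> borel_measurable (\<mu> e)"
    by (rule upd_measurable[OF _ assms(2)]) (simp only: I test_measurable)
  show "integrable (\<mu> e) (\<lambda>t. test (x(e := t)))"
    by (rule M.integrable_const_bound[where B = 1]) (use 1 test_bounded in auto)
qed

lemma avg_test_approx:
  assumes e: "e \<in> upper_tri n" and x: "x \<in> space (PiM (upper_tri n - {e}) \<mu>)"
    and c: "\<forall>t. \<bar>test (x(e := t)) - (c0 + c1 * t + c2 * t\<^sup>2)\<bar> \<le> (1 + t ^ 6) * \<rho>"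
  shows "\<bar>(\<integral>t. test (x(e := t)) \<partial>\<mu> e) - (c0 + c1 * (\<integral>t. t \<partial>\<mu> e) + c2 * (\<integral>t. t\<^sup>2 \<partial>\<mu> e))\<bar> \<le> m6 * \<rho>"
proof -
  have i: "integrable (\<mu> e) (\<lambda>t. c0 + c1 * t + c2 * t\<^sup>2)" using low_moments[of e] by auto
  have eq: "(\<integral>t. test (x(e := t)) \<partial>\<mu> e) - (c0 + c1 * (\<integral>t. t \<partial>\<mu> e) + c2 * (\<integral>t. t\<^sup>2 \<partial>\<mu> e))
     = (\<integral>t. test (x(e := t)) - (c0 + c1 * t + c2 * t\<^sup>2) \<partial>\<mu> e)"
  proof -
    have "(\<integral>t. c0 + c1 * t + c2 * t\<^sup>2 \<partial>\<mu> e) = c0 + c1 * (\<integral>t. t \<partial>\<mu> e) + c2 * (\<integral>t. t\<^sup>2 \<partial>\<mu> e)"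
      using low_moments[of e] by (simp add: M.prob_space)
    thus ?thesis using Bochner_Integration.integral_diff[OF test_upd(2)[OF e x] i] by argo
  qed
  have "\<bar>\<integral>t. test (x(e := t)) - (c0 + c1 * t + c2 * t\<^sup>2) \<partial>\<mu> e\<bar> \<le> (\<integral>t. \<bar>test (x(e := t)) - (c0 + c1 * t + c2 * t\<^sup>2)\<bar> \<partial>\<mu> e)" by (rule integral_abs_bound)
  also have "\<dots> \<le> (\<integral>t. (1 + t ^ 6) * \<rho> \<partial>\<mu> e)"
    by (rule integral_mono) (use test_upd[OF e x] i c sixth_\<rho> in auto)
  also have "\<dots> \<le> m6 * \<rho>" by (rule sixth_\<rho>)
  finally show ?thesis unfolding eq .
qed

text \<open>Efron-Stein: a conditional variance is at most the mean square deviation from the value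
  at entry zero when the remaining entries are good, and at most 4 in any case.\<close>

lemma variance_test:
  "(\<integral>x. (test x)\<^sup>2 \<partial>PiM (upper_tri n) \<mu>) - (\<integral>x. test x \<partial>PiM (upper_tri n) \<mu>)\<^sup>2
     \<le> (real n)\<^sup>2 * (m6 * \<rho> + 4 * err (k - 1))"
proof -
  have m6: "m6 \<ge> 0" by (simp add: m6_def)
  have "(\<integral>x. (test x)\<^sup>2 \<partial>PiM (upper_tri n) \<mu>) - (\<integral>x. test x \<partial>PiM (upper_tri n) \<mu>)\<^sup>2
    \<le> (\<Sum>e\<in>upper_tri n. \<integral>x. cvar e test x \<partial>PiM (upper_tri n - {e}) \<mu>)"
    by (rule efron_stein[OF finite_upper_tri test_measurable test_bounded])
  also have "\<dots> \<le> (\<Sum>e\<in>upper_tri n. m6 * \<rho> + 4 * err (k - 1))"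
  proof (rule sum_mono)
    fix e assume e: "e \<in> upper_tri n"
    let ?J = "upper_tri n - {e}"
    have I: "insert e ?J = upper_tri n" using e by auto
    have tm: "test \<in> borel_measurable (PiM (insert e ?J) \<mu>)" unfolding I by (rule test_measurable)
    show "(\<integral>x. cvar e test x \<partial>PiM ?J \<mu>) \<le> m6 * \<rho> + 4 * err (k - 1)"
    proof (rule whp_integral_le[OF prob_PiM whp_good_entry cvar_measurable[OF tm]])
      fix x assume x: "x \<in> space (PiM ?J \<mu>)"
      show "0 \<le> cvar e test x" by (rule cvar_le(2)[OF tm x test_bounded])
      show "cvar e test x \<le> 4" using cvar_bound[OF tm x test_bounded] by simp
      assume g: "good (k - 1) (BB ?J x)"
      have "cvar e test x \<le> (\<integral>t. (test (x(e := t)) - test (x(e := 0)))\<^sup>2 \<partial>\<mu> e)"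
        by (rule cvar_le(1)[OF tm x test_bounded])
      also have "\<dots> \<le> (\<integral>t. (1 + t ^ 6) * \<rho> \<partial>\<mu> e)"
      proof (rule integral_mono[OF _ sixth_\<rho>(2)])
        have "(test (x(e := t)) - test (x(e := 0)))\<^sup>2 \<le> 2\<^sup>2" for t
        proof -
          have "\<bar>test (x(e := t)) - test (x(e := 0))\<bar> \<le> 2"
            using test_bounded[of "x(e := t)"] test_bounded[of "x(e := 0)"] by linarith
          thus ?thesis by (metis abs_ge_zero power2_abs power_mono)
        qed
        thus "integrable (\<mu> e) (\<lambda>t. (test (x(e := t)) - test (x(e := 0)))\<^sup>2)"
          using test_upd(1)[OF e x] by (intro M.integrable_const_bound[where B = "2\<^sup>2"]) auto
        show "(test (x(e := t)) - test (x(e := 0)))\<^sup>2 \<le> (1 + t ^ 6) * \<rho>" for t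
          by (rule entry_bounds(2)[OF e g])
      qed
      also have "\<dots> \<le> m6 * \<rho>" by (rule sixth_\<rho>)
      finally show "cvar e test x \<le> m6 * \<rho>" .
    qed (use m6 \<rho>_nonneg in simp)
  qed
  also have "\<dots> \<le> (real n)\<^sup>2 * (m6 * \<rho> + 4 * err (k - 1))"
    using m6 \<rho>_nonneg err_nonneg card_upper_tri by (simp add: mult_right_mono)
  finally show ?thesis .
qed

end

locale amp_two_laws = A: amp_law \<mu> \<sigma> k n L KZ C0 q F D H Z u + G: amp_law \<nu> \<sigma> k n L KZ C0 q F D H Z u
  for \<mu> \<nu> :: "nat \<times> nat \<Rightarrow> real measure" and \<sigma> k n L KZ C0 q F D H Z u +
  assumes m1: "\<And>e. e \<in> upper_tri n \<Longrightarrow> (\<integral>t. t \<partial>\<mu> e) = (\<integral>t. t \<partial>\<nu> e)"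
    and m2: "\<And>e. e \<in> upper_tri n \<Longrightarrow> (\<integral>t. t\<^sup>2 \<partial>\<mu> e) = (\<integral>t. t\<^sup>2 \<partial>\<nu> e)"
begin

text \<open>During the replacement the good event for the remaining entries is measured under hybrid
  laws, so these have to satisfy the same assumptions.\<close>

lemma hybrid: "amp_law (\<lambda>i. if i \<in> S then \<mu> i else \<nu> i) \<sigma> k n L KZ C0 q F D H Z u"
proof -
  interpret h: real_product "\<lambda>i. if i \<in> S then \<mu> i else \<nu> i"
    using A.real_product_axioms G.real_product_axioms by (auto simp: real_product_def)
  have "subgaussian (if i \<in> S then \<mu> i else \<nu> i) \<sigma> (\<lambda>x. x)" for i using A.sub G.sub by simp
  then interpret h: subgaussian_product "\<lambda>i. if i \<in> S then \<mu> i else \<nu> i" \<sigma>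
    by (intro subgaussian_product.intro h.real_product_axioms subgaussian_product_axioms.intro A.\<sigma>)
  show ?thesis
    by (intro amp_law.intro matrix_law.intro h.subgaussian_product_axioms A.amp_law_axioms[unfolded amp_law_def, THEN conjunct2])
qed

text \<open>On the good event one and the same quadratic polynomial approximates the test function
  for both laws of the exchanged entry, and equal first and second moments make its averages
  agree.\<close>

lemma mean_difference:
  "\<bar>(\<integral>x. A.test x \<partial>PiM (upper_tri n) \<mu>) - (\<integral>x. A.test x \<partial>PiM (upper_tri n) \<nu>)\<bar>
     \<le> (real n)\<^sup>2 * (2 * (A.m6 * A.\<rho>) + 2 * A.err (k - 1))"
proof -
  have m6: "A.m6 \<ge> 0" by (simp add: A.m6_def)
  have "\<bar>(\<integral>x. A.test x \<partial>PiM (upper_tri n) \<mu>) - (\<integral>x. A.test x \<partial>PiM (upper_tri n) \<nu>)\<bar>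
    \<le> real (card (upper_tri n)) * (2 * (A.m6 * A.\<rho>) + 2 * A.err (k - 1))"
  proof (rule lindeberg[OF finite_upper_tri A.real_product_axioms G.real_product_axioms _ A.test_bounded])
    show "A.test \<in> borel_measurable (PiM (upper_tri n) (\<lambda>_. borel))"
      using A.test_measurable by (simp add: A.measurable_PiM_borel)
    fix S e assume e: "e \<in> upper_tri n"
    let ?J = "upper_tri n - {e}"
    interpret h: amp_law "\<lambda>i. if i \<in> S then \<mu> i else \<nu> i" \<sigma> k n L KZ C0 q F D H Z u by (rule hybrid)
    have I: "insert e ?J = upper_tri n" using e by auto
    have am: "(\<lambda>x. \<integral>t. A.test (x(e := t)) \<partial>\<mu> e) \<in> borel_measurable (PiM ?J (\<lambda>_. borel))"
      using A.avg_measurable[of A.test e ?J] A.test_measurable unfolding I A.avg_def[abs_def] A.measurable_PiM_borel by blast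
    have gm: "(\<lambda>x. \<integral>t. A.test (x(e := t)) \<partial>\<nu> e) \<in> borel_measurable (PiM ?J (\<lambda>_. borel))"
      using G.avg_measurable[of A.test e ?J] A.test_measurable unfolding I G.avg_def[abs_def] A.measurable_PiM_borel G.measurable_PiM_borel by blast
    have sp: "space (PiM ?J (\<lambda>i. if i \<in> S then \<mu> i else \<nu> i)) = space (PiM ?J \<mu>)"
      "space (PiM ?J (\<lambda>i. if i \<in> S then \<mu> i else \<nu> i)) = space (PiM ?J \<nu>)"
      by (simp_all add: h.space_PiM_borel A.space_PiM_borel G.space_PiM_borel)
    show "(\<integral>x. \<bar>(\<integral>t. A.test (x(e := t)) \<partial>\<mu> e) - (\<integral>t. A.test (x(e := t)) \<partial>\<nu> e)\<bar>
         \<partial>PiM ?J (\<lambda>i. if i \<in> S then \<mu> i else \<nu> i)) \<le> 2 * (A.m6 * A.\<rho>) + 2 * A.err (k - 1)"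
    proof (rule whp_integral_le[OF h.prob_PiM h.whp_good_entry])
      show "(\<lambda>x. \<bar>(\<integral>t. A.test (x(e := t)) \<partial>\<mu> e) - (\<integral>t. A.test (x(e := t)) \<partial>\<nu> e)\<bar>)
        \<in> borel_measurable (PiM ?J (\<lambda>i. if i \<in> S then \<mu> i else \<nu> i))"
        unfolding h.measurable_PiM_borel using am gm by (intro borel_measurable_abs borel_measurable_diff)
    next
      fix x assume x: "x \<in> space (PiM ?J (\<lambda>i. if i \<in> S then \<mu> i else \<nu> i))"
      have xA: "x \<in> space (PiM ?J \<mu>)" and xG: "x \<in> space (PiM ?J \<nu>)" using x sp by auto
      have tA: "A.test \<in> borel_measurable (PiM (insert e ?J) \<mu>)" unfolding I by (rule A.test_measurable)
      have tG: "A.test \<in> borel_measurable (PiM (insert e ?J) \<nu>)" unfolding I by (rule G.test_measurable)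
      have "\<bar>\<integral>t. A.test (x(e := t)) \<partial>\<mu> e\<bar> \<le> 1" "\<bar>\<integral>t. A.test (x(e := t)) \<partial>\<nu> e\<bar> \<le> 1"
        using A.avg_bounded(1)[OF tA xA A.test_bounded] G.avg_bounded(1)[OF tG xG A.test_bounded]
        by (auto simp: A.avg_def G.avg_def)
      thus "\<bar>(\<integral>t. A.test (x(e := t)) \<partial>\<mu> e) - (\<integral>t. A.test (x(e := t)) \<partial>\<nu> e)\<bar> \<le> 2" by linarith
      assume g: "A.good (k - 1) (A.BB ?J x)"
      from A.entry_bounds(1)[OF e g] obtain c0 c1 c2 where
        c: "\<forall>t. \<bar>A.test (x(e := t)) - (c0 + c1 * t + c2 * t\<^sup>2)\<bar> \<le> (1 + t ^ 6) * A.\<rho>" by blast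
      show "\<bar>(\<integral>t. A.test (x(e := t)) \<partial>\<mu> e) - (\<integral>t. A.test (x(e := t)) \<partial>\<nu> e)\<bar> \<le> 2 * (A.m6 * A.\<rho>)"
        using A.avg_test_approx[OF e xA c] G.avg_test_approx[OF e xG c] m1[OF e] m2[OF e] by simp
    qed (use m6 A.\<rho>_nonneg in auto)
  qed
  also have "\<dots> \<le> (real n)\<^sup>2 * (2 * (A.m6 * A.\<rho>) + 2 * A.err (k - 1))"
    using m6 A.\<rho>_nonneg A.err_nonneg by (intro mult_right_mono A.card_upper_tri) auto
  finally show ?thesis .
qed

text \<open>Variance of the test function under \<open>\<mu>\<close> plus the squared difference of
  its two means.\<close>

definition "\<kappa> = (real n)\<^sup>2 * (A.m6 * A.\<rho> + 4 * A.err (k - 1))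
  + ((real n)\<^sup>2 * (2 * (A.m6 * A.\<rho>) + 2 * A.err (k - 1)))\<^sup>2"

text \<open>The centre is the mean under \<open>\<nu>\<close> although the integral is taken under
  \<open>\<mu>\<close>. With \<open>\<nu>\<close> the law of \<open>G\<close>, the same centre
  serves both matrices.\<close>

theorem universality_L2:
  "(\<integral>x. (A.test x - (\<integral>y. A.test y \<partial>PiM (upper_tri n) \<nu>))\<^sup>2 \<partial>PiM (upper_tri n) \<mu>) \<le> \<kappa>"
proof -
  let ?P = "PiM (upper_tri n) \<mu>"
  interpret P: prob_space ?P by (rule A.prob_PiM)
  define m where "m = (\<integral>y. A.test y \<partial>PiM (upper_tri n) \<nu>)"
  define mA where "mA = (\<integral>y. A.test y \<partial>?P)"
  have i1: "integrable ?P A.test"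
    by (rule A.integrable_bounded_PiM[OF A.test_measurable A.test_bounded])
  have i2: "integrable ?P (\<lambda>x. (A.test x)\<^sup>2)"
    using A.test_measurable A.test_bounded
    by (intro A.integrable_bounded_PiM[of _ _ 1]) (auto simp: abs_square_le_1)
  have "(\<integral>x. (A.test x - m)\<^sup>2 \<partial>?P) = (\<integral>x. (A.test x)\<^sup>2 - 2 * m * A.test x + m\<^sup>2 \<partial>?P)"
    by (intro Bochner_Integration.integral_cong) (auto simp: power2_eq_square algebra_simps)
  also have "\<dots> = ((\<integral>x. (A.test x)\<^sup>2 \<partial>?P) - mA\<^sup>2) + (mA - m)\<^sup>2"
    using i1 i2 by (simp add: mA_def P.prob_space power2_eq_square algebra_simps)
  also have "\<dots> \<le> \<kappa>"
    unfolding \<kappa>_def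
  proof (rule add_mono)
    show "(\<integral>x. (A.test x)\<^sup>2 \<partial>?P) - mA\<^sup>2 \<le> (real n)\<^sup>2 * (A.m6 * A.\<rho> + 4 * A.err (k - 1))"
      unfolding mA_def by (rule A.variance_test)
    have "\<bar>mA - m\<bar> \<le> (real n)\<^sup>2 * (2 * (A.m6 * A.\<rho>) + 2 * A.err (k - 1))"
      unfolding mA_def m_def by (rule mean_difference)
    thus "(mA - m)\<^sup>2 \<le> ((real n)\<^sup>2 * (2 * (A.m6 * A.\<rho>) + 2 * A.err (k - 1)))\<^sup>2"
      by (metis abs_ge_zero power2_abs power_mono)
  qed
  finally show ?thesis by (simp add: m_def)
qed

end

section \<open>Asymptotics of the error and reduction to means of iterates\<close>

text \<open>The error bound of the comparison for the truncation level \<open>q = (ln n)\<^sup>2\<close>, as a function of \<open>n\<close> alone.\<close>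

definition kappa_bound :: "real \<Rightarrow> nat \<Rightarrow> real \<Rightarrow> real \<Rightarrow> real \<Rightarrow> nat \<Rightarrow> real" where
  "kappa_bound \<sigma> k c1 c2 m6 n =
    (let Q = (c1 * (ln (real n))\<^sup>2) ^ (k - 1 + 1); R = c2 * Q ^ 4 / real n;
         \<rho> = 9 * R\<^sup>2 / real n + 2 * R / (real n * sqrt (real n)) + 4 / real n ^ 3;
         e = (3 * real n) ^ (k - 1 + 1) * (2 * exp (- real n) + real k * (2 * exp (- ((ln (real n))\<^sup>2)\<^sup>2 / (2 * \<sigma>\<^sup>2))))
     in (real n)\<^sup>2 * (m6 * \<rho> + 4 * e) + ((real n)\<^sup>2 * (2 * (m6 * \<rho>) + 2 * e))\<^sup>2)"

lemma log_power_div_n: "(\<lambda>n::nat. ln (real n) ^ p / real n) \<longlonglongrightarrow> 0"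
  by real_asymp

lemma log_power_div_sqrt: "(\<lambda>n::nat. ln (real n) ^ p / sqrt (real n)) \<longlonglongrightarrow> 0"
  by real_asymp

lemma power_exp_minus: "(\<lambda>n::nat. real n ^ p * exp (- real n)) \<longlonglongrightarrow> 0"
  by real_asymp

lemma power_exp_minus_log4:
  fixes c :: real
  assumes "c > 0"
  shows "(\<lambda>n::nat. real n ^ p * exp (- (c * ln (real n) ^ 4))) \<longlonglongrightarrow> 0"
  using assms by real_asymp

lemma power_exp_minus_log2:
  fixes c :: real
  assumes "c > 0"
  shows "(\<lambda>n::nat. real n ^ p * exp (- (c * ln (real n) ^ 2))) \<longlonglongrightarrow> 0"
  using assms by real_asymp

text \<open>\<open>n^2 * \<rho> n\<close> consists of terms of order
  \<open>(ln n)^(16 * t) / n\<close>, \<open>(ln n)^(8 * t) / sqrt n\<close> and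
  \<open>1 / n\<close>. The failure probabilities contain \<open>exp (- n)\<close> and, with
  \<open>c = 1 / (2 * \<sigma>^2)\<close>, \<open>exp (- c * (ln n)^4)\<close>, both smaller than
  any power of \<open>n\<close>.\<close>

lemma kappa_bound_tendsto:
  assumes \<sigma>: "\<sigma> > 0"
  shows "kappa_bound \<sigma> k c1 c2 m6 \<longlonglongrightarrow> 0"
proof -
  define t where "t = k - 1 + 1"
  define Q where "Q = (\<lambda>n. (c1 * (ln (real n))\<^sup>2) ^ t)"
  define R where "R = (\<lambda>n. c2 * Q n ^ 4 / real n)"
  define \<rho> where "\<rho> = (\<lambda>n. 9 * (R n)\<^sup>2 / real n + 2 * R n / (real n * sqrt (real n)) + 4 / real n ^ 3)"
  define e where "e = (\<lambda>n. (3 * real n) ^ t * (2 * exp (- real n) + real k * (2 * exp (- ((ln (real n))\<^sup>2)\<^sup>2 / (2 * \<sigma>\<^sup>2)))))"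
  have "(\<lambda>n. 9 * c2\<^sup>2 * c1 ^ (8 * t) * (ln (real n) ^ (16 * t) / real n)
      + 2 * c2 * c1 ^ (4 * t) * (ln (real n) ^ (8 * t) / sqrt (real n)) + 4 * (1 / real n)) \<longlonglongrightarrow>
      9 * c2\<^sup>2 * c1 ^ (8 * t) * 0 + 2 * c2 * c1 ^ (4 * t) * 0 + 4 * 0"
    by (intro tendsto_intros log_power_div_n log_power_div_sqrt lim_1_over_n)
  moreover have "eventually (\<lambda>n. 9 * c2\<^sup>2 * c1 ^ (8 * t) * (ln (real n) ^ (16 * t) / real n)
      + 2 * c2 * c1 ^ (4 * t) * (ln (real n) ^ (8 * t) / sqrt (real n)) + 4 * (1 / real n)
      = (real n)\<^sup>2 * \<rho> n) sequentially"
    using eventually_gt_at_top[of 0]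
  proof eventually_elim
    fix n :: nat assume n: "n > 0"
    define l where "l = ln (real n)"
    have 1: "(Q n ^ 4)\<^sup>2 = c1 ^ (8 * t) * l ^ (16 * t)" "Q n ^ 4 = c1 ^ (4 * t) * l ^ (8 * t)"
      by (simp_all add: Q_def l_def power_mult_distrib power_mult[symmetric] mult_ac)
    have e1: "(real n)\<^sup>2 * (9 * (R n)\<^sup>2 / real n) = 9 * c2\<^sup>2 * (Q n ^ 4)\<^sup>2 / real n"
      using n by (simp add: R_def power_divide power_mult_distrib power2_eq_square)
    have e2: "(real n)\<^sup>2 * (2 * R n / (real n * sqrt (real n))) = 2 * c2 * Q n ^ 4 / sqrt (real n)"
      using n by (simp add: R_def power2_eq_square)
    have e3: "(real n)\<^sup>2 * (4 / real n ^ 3) = 4 * (1 / real n)"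
      using n by (simp add: power2_eq_square power3_eq_cube)
    show "9 * c2\<^sup>2 * c1 ^ (8 * t) * (ln (real n) ^ (16 * t) / real n)
      + 2 * c2 * c1 ^ (4 * t) * (ln (real n) ^ (8 * t) / sqrt (real n)) + 4 * (1 / real n)
      = (real n)\<^sup>2 * \<rho> n"
      unfolding \<rho>_def distrib_left e1 e2 e3 unfolding 1(2)
      by (simp add: l_def power_mult_distrib mult_ac flip: power_mult)
  qed
  ultimately have r: "(\<lambda>n. (real n)\<^sup>2 * \<rho> n) \<longlonglongrightarrow> 0"
    using filterlim_cong[OF refl refl] by fastforce
  have f1: "(\<lambda>n. 3 ^ t * (2 * (real n ^ (t + 2) * exp (- real n))
      + real k * (2 * (real n ^ (t + 2) * exp (- (1 / (2 * \<sigma>\<^sup>2) * ln (real n) ^ 4)))))) \<longlonglongrightarrow> 3 ^ t * (2 * 0 + real k * (2 * 0))"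
    using \<sigma> by (intro tendsto_intros power_exp_minus power_exp_minus_log4) auto
  have f2: "3 ^ t * (2 * (real n ^ (t + 2) * exp (- real n))
      + real k * (2 * (real n ^ (t + 2) * exp (- (1 / (2 * \<sigma>\<^sup>2) * ln (real n) ^ 4))))) = (real n)\<^sup>2 * e n" for n
  proof -
    have "- (1 / (2 * \<sigma>\<^sup>2) * ln (real n) ^ 4) = - ((ln (real n))\<^sup>2)\<^sup>2 / (2 * \<sigma>\<^sup>2)"
      by (simp flip: power_mult)
    thus ?thesis by (simp add: e_def power_add power_mult_distrib power2_eq_square algebra_simps)
  qed
  have ee: "(\<lambda>n. (real n)\<^sup>2 * e n) \<longlonglongrightarrow> 0" using f1 unfolding f2 by simp
  have g1: "(\<lambda>n. (m6 * ((real n)\<^sup>2 * \<rho> n) + 4 * ((real n)\<^sup>2 * e n))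
     + (2 * (m6 * ((real n)\<^sup>2 * \<rho> n)) + 2 * ((real n)\<^sup>2 * e n))\<^sup>2) \<longlonglongrightarrow> (m6 * 0 + 4 * 0) + (2 * (m6 * 0) + 2 * 0)\<^sup>2"
    by (intro tendsto_intros r ee)
  have g2: "kappa_bound \<sigma> k c1 c2 m6 n = (m6 * ((real n)\<^sup>2 * \<rho> n) + 4 * ((real n)\<^sup>2 * e n))
     + (2 * (m6 * ((real n)\<^sup>2 * \<rho> n)) + 2 * ((real n)\<^sup>2 * e n))\<^sup>2" for n
  proof -
    have "kappa_bound \<sigma> k c1 c2 m6 n = (real n)\<^sup>2 * (m6 * \<rho> n + 4 * e n) + ((real n)\<^sup>2 * (2 * (m6 * \<rho> n) + 2 * e n))\<^sup>2"
      by (simp only: kappa_bound_def Let_def \<rho>_def R_def Q_def e_def t_def)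
    thus ?thesis by (simp add: algebra_simps)
  qed
  have "(\<lambda>n. kappa_bound \<sigma> k c1 c2 m6 n) \<longlonglongrightarrow> 0" unfolding g2 using g1 by simp
  thus ?thesis by simp
qed

text \<open>Frees the bound from \<open>u\<close> and \<open>Z\<close>, so that it holds uniformly
  over all good initializations.\<close>

lemma (in amp_two_laws) kappa_le:
  assumes q: "q = (ln (real n))\<^sup>2"
  shows "\<kappa> \<le> kappa_bound \<sigma> k A.cc \<bar>entry_perturbation.c k L A.K\<bar> A.m6 n"
proof -
  define e where "e = (3 * real n) ^ (k - 1 + 1) * A.w0"
  have e: "A.err (k - 1) \<le> e" unfolding e_def by (rule A.err_le)
  have m6: "A.m6 \<ge> 0" by (simp add: A.m6_def)
  have x: "A.m6 * A.\<rho> \<ge> 0" using m6 A.\<rho>_nonneg by simp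
  have "\<kappa> \<le> (real n)\<^sup>2 * (A.m6 * A.\<rho> + 4 * e) + ((real n)\<^sup>2 * (2 * (A.m6 * A.\<rho>) + 2 * e))\<^sup>2"
    unfolding \<kappa>_def using e x m6 A.\<rho>_nonneg A.err_nonneg[of "k - 1"]
    by (intro add_mono mult_left_mono power_mono) auto
  also have "\<dots> = kappa_bound \<sigma> k A.cc \<bar>entry_perturbation.c k L A.K\<bar> A.m6 n"
    unfolding kappa_bound_def Let_def e_def A.\<rho>_def A.Mn_def A.Qt_def A.w0_def A.eo_def A.eq_def
    unfolding q by (rule refl)
  finally show ?thesis .
qed

section \<open>From averages over several iterates to the mean of one iterate\<close>

lemma orb_cong:
  assumes B: "\<And>i j. i \<in> {1..n} \<Longrightarrow> j \<in> {1..n} \<Longrightarrow> B i j = B' i j"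
    and u: "\<And>i. i \<in> {1..n} \<Longrightarrow> u i = u' i" and F: "\<And>r. r < l \<Longrightarrow> F r = F' r" and i: "i \<in> {1..n}"
  shows "orb n F B u l i = orb n F' B' u' l i"
  using F i
proof (induction l arbitrary: i rule: less_induct)
  case (less l)
  show ?case
  proof (cases l)
    case 0
    thus ?thesis using u less by simp
  next
    case (Suc m)
    have IH: "orb n F B u r j = orb n F' B' u' r j" if "r \<le> m" "j \<in> {1..n}" for r j
      using less(1)[of r j] less(2) Suc that by auto
    have "mat_vec n B (orb n F B u m) i = mat_vec n B' (orb n F' B' u' m) i"
      unfolding mat_vec_def using B less(3) IH by (intro sum.cong) auto
    hence "arg n B (orb n F B u) m i = arg n B' (orb n F' B' u') m i"
      using IH less(3) by (auto simp: arg_def fun_eq_iff)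
    thus ?thesis unfolding Suc orb_Suc using less(2)[of m] Suc by simp
  qed
qed

lemma gen_amp_eq_orb: "gen_amp n F Z (\<lambda>_. u) l X = orb n F (X_hat n Z X) u l"
proof (induction l rule: less_induct)
  case (less l)
  show ?case
  proof (cases l)
    case (Suc m)
    have "gen_amp n F Z (\<lambda>_. u) r X = orb n F (X_hat n Z X) u r" if "r \<le> m" for r
      using less[of r] that Suc by simp
    hence "gen_amp n F Z (\<lambda>_. u) m X = orb n F (X_hat n Z X) u m"
      "\<And>j. gen_amp n F Z (\<lambda>_. u) (m - j) X = orb n F (X_hat n Z X) u (m - j)" by auto
    thus ?thesis unfolding Suc orb.simps(2) gen_amp.simps(2) by (simp only:)
  qed simp
qed

text \<open>The appended function skips argument 0, the matrix product, and reads the iterates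
  \<open>k, ..., 0\<close> from its arguments \<open>1, ..., k + 1\<close>. Hence it takes the place
  of \<open>F (Suc k)\<close> and the iterate in question has number \<open>k + 2\<close>.\<close>

lemma amp_avg_eq_orb:
  "amp_avg n F Z (\<lambda>_. u) \<phi> k X
    = (\<Sum>i\<in>{1..n}. orb n (F(Suc k := (\<lambda>a. \<phi> (\<lambda>j. a (Suc j))))) (X_hat n Z X) u (Suc (Suc k)) i) / real n"
proof -
  let ?F = "F(Suc k := (\<lambda>a. \<phi> (\<lambda>j. a (Suc j))))"
  have "orb n ?F (X_hat n Z X) u (Suc (Suc k)) i = \<phi> (\<lambda>j. gen_amp n F Z (\<lambda>_. u) (k - j) X i)"
    if "i \<in> {1..n}" for i
  proof -
    have "orb n ?F (X_hat n Z X) u r i = gen_amp n F Z (\<lambda>_. u) r X i" if "r \<le> k" for r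
      unfolding gen_amp_eq_orb using that \<open>i \<in> {1..n}\<close> by (intro orb_cong) auto
    thus ?thesis by (simp add: orb_Suc arg_def)
  qed
  thus ?thesis by (simp add: amp_avg_def)
qed

lemma orb_borel_measurable:
  assumes F: "\<And>r. r < l \<Longrightarrow> lip (Suc r) L (F r)"
    and B: "\<And>i j. i \<in> {1..n} \<Longrightarrow> j \<in> {1..n} \<Longrightarrow> (\<lambda>x. B x i j) \<in> borel_measurable M"
    and u: "\<And>i. i \<in> {1..n} \<Longrightarrow> (\<lambda>x. u x i) \<in> borel_measurable M" and i: "i \<in> {1..n}"
  shows "(\<lambda>x. orb n F (B x) (u x) l i) \<in> borel_measurable M"
  using F i
proof (induction l arbitrary: i rule: less_induct)
  case (less l)
  show ?case
  proof (cases l)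
    case 0
    thus ?thesis using u less by simp
  next
    case (Suc m)
    have IH: "(\<lambda>x. orb n F (B x) (u x) r j) \<in> borel_measurable M" if "r \<le> m" "j \<in> {1..n}" for r j
      using less(1)[of r j] less(2) Suc that by auto
    have "(\<lambda>x. mat_vec n (B x) (orb n F (B x) (u x) m) i) \<in> borel_measurable M"
      unfolding mat_vec_def using B less(3) IH by (intro borel_measurable_sum borel_measurable_times) auto
    hence am: "(\<lambda>x. arg n (B x) (orb n F (B x) (u x)) m i j) \<in> borel_measurable M" if "j < Suc m" for j
      unfolding arg_def using IH less(3) that by (cases "j = 0") auto
    have "lip (Suc m) L (F m)" using less(2) Suc by simp
    from lip_measurable[OF this am] show ?thesis unfolding Suc orb_Suc .
  qed
qed

lemma mean_diff_le_nrm: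
  assumes "n \<ge> 1"
  shows "\<bar>(\<Sum>i\<in>{1..n}. v i) / real n - (\<Sum>i\<in>{1..n}. w i) / real n\<bar> \<le> nrm n (\<lambda>i. v i - w i) / sqrt (real n)"
proof -
  have "\<bar>(\<Sum>i\<in>{1..n}. v i) / real n - (\<Sum>i\<in>{1..n}. w i) / real n\<bar> = \<bar>\<Sum>i\<in>{1..n}. v i - w i\<bar> / real n"
    by (simp add: sum_subtractf diff_divide_distrib[symmetric] abs_divide)
  also have "\<dots> \<le> (sqrt (real n) * nrm n (\<lambda>i. v i - w i)) / real n"
    by (intro divide_right_mono order_trans[OF sum_abs] l1_le_nrm) auto
  also have "\<dots> = nrm n (\<lambda>i. v i - w i) / sqrt (real n)"
    using assms by (simp add: field_simps)
  finally show ?thesis .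
qed

text \<open>The Frobenius norm dominates the operator norm. The entries of \<open>Z\<close> may
  depend on each other in any way, but after division by \<open>n\<close> their Frobenius norm is of
  order 1.\<close>

lemma frobenius_opn:
  assumes n: "n \<ge> 1" and KZ: "KZ \<ge> 0" and Z: "(\<Sum>i\<in>{1..n}. \<Sum>j\<in>{1..n}. (Z i j)\<^sup>2) \<le> (KZ * real n)\<^sup>2"
  shows "opn n (\<lambda>i j. Z i j / real n) KZ"
  unfolding opn_def
proof
  fix v
  have "(nrm n (mat_vec n Z v))\<^sup>2 = (\<Sum>i\<in>{1..n}. (\<Sum>j\<in>{1..n}. Z i j * v j)\<^sup>2)"
    by (simp add: nrm_power2 mat_vec_def)
  also have "\<dots> \<le> (\<Sum>i\<in>{1..n}. (\<Sum>j\<in>{1..n}. (Z i j)\<^sup>2) * (\<Sum>j\<in>{1..n}. (v j)\<^sup>2))"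
    by (intro sum_mono Cauchy_Schwarz_ineq_sum)
  also have "\<dots> = (\<Sum>i\<in>{1..n}. \<Sum>j\<in>{1..n}. (Z i j)\<^sup>2) * (nrm n v)\<^sup>2"
    by (simp only: sum_distrib_right nrm_power2)
  also have "\<dots> \<le> (KZ * real n)\<^sup>2 * (nrm n v)\<^sup>2" by (intro mult_right_mono Z) auto
  finally have "(nrm n (mat_vec n Z v))\<^sup>2 \<le> (KZ * real n * nrm n v)\<^sup>2" by (simp add: power_mult_distrib)
  hence "nrm n (mat_vec n Z v) \<le> KZ * real n * nrm n v"
    by (rule power2_le_imp_le) (use KZ in auto)
  hence "nrm n (\<lambda>i. (1 / real n) * mat_vec n Z v i) \<le> KZ * nrm n v"
    unfolding nrm_cmult using n by (simp add: field_simps)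
  thus "nrm n (mat_vec n (\<lambda>i j. Z i j / real n) v) \<le> KZ * nrm n v"
    by (simp add: mat_vec_divide[abs_def])
qed

text \<open>Mean value theorem with \<open>cos \<ge> cos 1\<close> on \<open>[-1, 1]\<close>. It
  turns closeness of the sines back into closeness of the means.\<close>

lemma sin_inverse_bound:
  fixes a b :: real
  assumes "\<bar>a\<bar> \<le> 1" "\<bar>b\<bar> \<le> 1"
  shows "cos 1 * \<bar>a - b\<bar> \<le> \<bar>sin a - sin b\<bar>"
proof -
  have *: "cos 1 * (y - x) \<le> sin y - sin x" if "x \<le> y" "\<bar>x\<bar> \<le> 1" "\<bar>y\<bar> \<le> 1" for x y :: real
  proof (cases "x = y")
    case False
    hence "x < y" using that by simp
    from MVT2[OF this, of sin cos] obtain z where z: "x < z" "z < y" "sin y - sin x = (y - x) * cos z"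
      by (auto intro: DERIV_sin)
    have "cos 1 \<le> cos \<bar>z\<bar>"
      using z that pi_gt3 by (intro cos_monotone_0_pi_le) auto
    hence "cos 1 \<le> cos z" by simp
    thus ?thesis using z \<open>x < y\<close> by (simp add: mult.commute mult_left_mono)
  qed simp
  show ?thesis
    using *[of a b] *[of b a] assms by (cases "a \<le> b") (auto simp: abs_if split: if_splits)
qed

lemma cos_one_pos: "cos (1::real) > 0"
  using pi_gt3 by (intro cos_gt_zero) auto

text \<open>Conditioning without conditional expectations: independence makes the joint law a
  product, whose sections at \<open>w\<close> are problems with a fixed initialization. The map
  \<open>h\<close> selects the part of \<open>X\<close> that is used.\<close>

lemma joint_law:
  assumes P: "prob_space P" and ind: "indep_elems P S X T Y" and h: "h \<in> measurable S S'"
    and E: "E \<in> sets (S' \<Otimes>\<^sub>M T)"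
  shows "emeasure P {\<omega>\<in>space P. (h (X \<omega>), Y \<omega>) \<in> E}
    = (\<integral>\<^sup>+w. emeasure (distr P S' (\<lambda>\<omega>. h (X \<omega>))) ((\<lambda>x. (x, w)) -` E) \<partial>distr P T Y)"
proof -
  interpret prob_space P by fact
  have X [measurable]: "X \<in> measurable P S" and Y [measurable]: "Y \<in> measurable P T"
    and I: "indep_set {X -` B \<inter> space P | B. B \<in> sets S} {Y -` B \<inter> space P | B. B \<in> sets T}"
    using ind by (auto simp: indep_elems_def)
  note h [measurable]
  let ?N = "distr P S' (\<lambda>\<omega>. h (X \<omega>))" and ?D = "distr P T Y"
  have hX: "(\<lambda>\<omega>. h (X \<omega>)) \<in> measurable P S'" by measurable
  interpret N: prob_space ?N by (rule prob_space_distr[OF hX])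
  interpret D: prob_space ?D by (rule prob_space_distr[OF Y])
  have "?N \<Otimes>\<^sub>M ?D = distr P (S' \<Otimes>\<^sub>M T) (\<lambda>\<omega>. (h (X \<omega>), Y \<omega>))"
  proof (rule pair_measure_eqI)
    fix A B assume "A \<in> sets ?N" "B \<in> sets ?D"
    hence A [measurable]: "A \<in> sets S'" and B [measurable]: "B \<in> sets T" by auto
    have hA: "h -` A \<inter> space S \<in> sets S" by measurable
    have eqA: "X -` (h -` A \<inter> space S) \<inter> space P = (\<lambda>\<omega>. h (X \<omega>)) -` A \<inter> space P"
      using measurable_space[OF X] by auto
    have "prob ((X -` (h -` A \<inter> space S) \<inter> space P) \<inter> (Y -` B \<inter> space P))
       = prob (X -` (h -` A \<inter> space S) \<inter> space P) * prob (Y -` B \<inter> space P)"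
    proof (rule indep_setD[OF I])
      show "X -` (h -` A \<inter> space S) \<inter> space P \<in> {X -` B \<inter> space P | B. B \<in> sets S}" using hA by blast
      show "Y -` B \<inter> space P \<in> {Y -` B \<inter> space P | B. B \<in> sets T}" using B by blast
    qed
    hence "emeasure P (((\<lambda>\<omega>. h (X \<omega>)) -` A \<inter> space P) \<inter> (Y -` B \<inter> space P))
       = emeasure P ((\<lambda>\<omega>. h (X \<omega>)) -` A \<inter> space P) * emeasure P (Y -` B \<inter> space P)"
      unfolding eqA by (simp add: emeasure_eq_measure ennreal_mult)
    moreover have "(\<lambda>\<omega>. (h (X \<omega>), Y \<omega>)) -` (A \<times> B) \<inter> space P
      = ((\<lambda>\<omega>. h (X \<omega>)) -` A \<inter> space P) \<inter> (Y -` B \<inter> space P)" by auto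
    ultimately show "emeasure ?N A * emeasure ?D B = emeasure (distr P (S' \<Otimes>\<^sub>M T) (\<lambda>\<omega>. (h (X \<omega>), Y \<omega>))) (A \<times> B)"
      by (simp add: emeasure_distr)
  qed (auto intro: N.sigma_finite_measure_axioms D.sigma_finite_measure_axioms)
  hence eq: "distr P (S' \<Otimes>\<^sub>M T) (\<lambda>\<omega>. (h (X \<omega>), Y \<omega>)) = ?N \<Otimes>\<^sub>M ?D" by simp
  interpret ND: pair_sigma_finite ?N ?D ..
  have "emeasure P {\<omega>\<in>space P. (h (X \<omega>), Y \<omega>) \<in> E} = emeasure (distr P (S' \<Otimes>\<^sub>M T) (\<lambda>\<omega>. (h (X \<omega>), Y \<omega>))) E"
    using E by (subst emeasure_distr) (auto intro!: arg_cong[where f = "emeasure P"])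
  also have "\<dots> = (\<integral>\<^sup>+w. emeasure ?N ((\<lambda>x. (x, w)) -` E) \<partial>?D)"
    unfolding eq by (rule ND.emeasure_pair_measure_alt2) (use E in \<open>simp cong: sets_pair_measure_cong\<close>)
  finally show ?thesis .
qed

lemma smooth_lip: "smooth m C g D H \<Longrightarrow> lip m C g"
  by (simp add: smooth_def)

lemma lipschitz_fun_imp_lip: "lipschitz_fun m f \<Longrightarrow> \<exists>L\<ge>0. lip m L f"
proof -
  assume "lipschitz_fun m f"
  then obtain L where L: "L \<ge> 0" "\<And>x y. \<bar>f x - f y\<bar> \<le> L * L2_set (\<lambda>j. x j - y j) {..<m}"
    unfolding lipschitz_fun_def by blast
  have "lip m L f"
    unfolding lip_def ldist_def
  proof (intro allI)
    fix x y
    show "\<bar>f x - f y\<bar> \<le> L * (\<Sum>j<m. \<bar>x j - y j\<bar>)"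
      by (rule order_trans[OF L(2) mult_left_mono[OF L2_set_le_sum_abs L(1)]])
  qed
  thus ?thesis using L(1) by blast
qed

section \<open>Conditioning on the initialization\<close>

lemma whp_distr:
  assumes "whp (distr P S f) \<epsilon> A" "f \<in> measurable P S"
  shows "whp P \<epsilon> (\<lambda>\<omega>. A (f \<omega>))"
proof -
  obtain N where N: "N \<in> sets S" "measure (distr P S f) N \<le> \<epsilon>" "\<forall>x\<in>space S - N. A x"
    using assms(1) unfolding whp_def by auto
  show ?thesis unfolding whp_def
  proof (intro bexI[of _ "f -` N \<inter> space P"] conjI ballI)
    show "measure P (f -` N \<inter> space P) \<le> \<epsilon>" using N measure_distr[OF assms(2) N(1)] by simp
    show "f -` N \<inter> space P \<in> sets P" by (rule measurable_sets[OF assms(2) N(1)])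
  qed (use N(3) measurable_space[OF assms(2)] in auto)
qed

lemma whp_markov:
  assumes f: "f \<in> borel_measurable P" "(\<integral>\<^sup>+\<omega>. ennreal (f \<omega>) \<partial>P) \<le> ennreal c" and c: "c \<ge> 0" and a: "a > 0"
  shows "whp P (c / a) (\<lambda>\<omega>. f \<omega> < a)"
proof (rule whp_set)
  note f(1) [measurable]
  show "{\<omega>\<in>space P. \<not> f \<omega> < a} \<in> sets P" by measurable
  have "emeasure P {\<omega>\<in>space P. \<not> f \<omega> < a} \<le> emeasure P {\<omega>\<in>space P. 1 \<le> ennreal (1 / a) * ennreal (f \<omega>)}"
  proof (rule emeasure_mono)
    show "{\<omega>\<in>space P. \<not> f \<omega> < a} \<subseteq> {\<omega>\<in>space P. 1 \<le> ennreal (1 / a) * ennreal (f \<omega>)}"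
    proof safe
      fix \<omega> assume "\<not> f \<omega> < a"
      hence "1 \<le> 1 / a * f \<omega>" using a by (simp add: field_simps)
      hence "ennreal 1 \<le> ennreal (1 / a * f \<omega>)" by (rule ennreal_leI)
      also have "ennreal (1 / a * f \<omega>) = ennreal (1 / a) * ennreal (f \<omega>)" using a by (intro ennreal_mult') simp
      finally show "1 \<le> ennreal (1 / a) * ennreal (f \<omega>)" by simp
    qed
  qed measurable
  also have "\<dots> \<le> ennreal (1 / a) * (\<integral>\<^sup>+\<omega>. ennreal (f \<omega>) * indicator (space P) \<omega> \<partial>P)"
    by (rule nn_integral_Markov_inequality) auto
  also have "(\<integral>\<^sup>+\<omega>. ennreal (f \<omega>) * indicator (space P) \<omega> \<partial>P) = (\<integral>\<^sup>+\<omega>. ennreal (f \<omega>) \<partial>P)"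
    by (rule nn_integral_cong) auto
  also have "ennreal (1 / a) * \<dots> \<le> ennreal (1 / a) * ennreal c" by (rule mult_left_mono[OF f(2)]) simp
  also have "\<dots> = ennreal (c / a)" using a c by (simp add: ennreal_mult'[symmetric])
  finally show "emeasure P {\<omega>\<in>space P. \<not> f \<omega> < a} \<le> ennreal (c / a)" .
qed (use c a in auto)

lemma whp_measure_le:
  assumes "whp P \<epsilon> A" "prob_space P"
  shows "measure P {\<omega>\<in>space P. \<not> A \<omega>} \<le> \<epsilon>"
proof -
  interpret prob_space P by fact
  obtain N where N: "N \<in> sets P" "measure P N \<le> \<epsilon>" "\<forall>x\<in>space P - N. A x"
    using assms(1) unfolding whp_def by blast
  have "{\<omega>\<in>space P. \<not> A \<omega>} \<subseteq> N" using N(3) by auto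
  hence "measure P {\<omega>\<in>space P. \<not> A \<omega>} \<le> measure P N" by (rule finite_measure_mono[OF _ N(1)])
  thus ?thesis using N(2) by simp
qed

text \<open>Off the upper triangle a point mass at zero keeps the family a subgaussian probability
  law at every index.\<close>

definition entry_law :: "'a measure \<Rightarrow> nat \<Rightarrow> ('a \<Rightarrow> matr) \<Rightarrow> nat \<times> nat \<Rightarrow> real measure" where
  "entry_law P n X e = (if e \<in> upper_tri n then distr P borel (\<lambda>\<omega>. X \<omega> (fst e) (snd e)) else return borel 0)"

definition upper :: "nat \<Rightarrow> matr \<Rightarrow> nat \<times> nat \<Rightarrow> real" where
  "upper n X = restrict (\<lambda>(i, j). X i j) (upper_tri n)"

abbreviation upper_space :: "nat \<Rightarrow> (nat \<times> nat \<Rightarrow> real) measure" where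
  "upper_space n \<equiv> PiM (upper_tri n) (\<lambda>_. borel)"

lemma upper_tri_subset: "upper_tri n \<subseteq> {1..n} \<times> {1..n}"
  by (auto simp: upper_tri_def)

lemma upper_mat_elem: "upper n X = restrict (mat_elem n X) (upper_tri n)"
  by (auto simp: upper_def mat_elem_def upper_tri_def fun_eq_iff)

lemma restrict_upper_measurable: "(\<lambda>z. restrict z (upper_tri n)) \<in> measurable (mat_space n) (upper_space n)"
  by (rule measurable_restrict_subset[OF upper_tri_subset])

lemma symx_upper:
  assumes "X \<in> sym_mats n" "i \<in> {1..n}" "j \<in> {1..n}"
  shows "symx (upper_tri n) (upper n X) i j = X i j"
proof -
  have "(min i j, max i j) \<in> upper_tri n" using assms by (auto simp: upper_tri_def)
  moreover have "X (min i j) (max i j) = X i j"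
    using assms by (auto simp: sym_mats_def min_def max_def)
  ultimately show ?thesis by (simp add: symx_def upper_def)
qed

locale noise =
  fixes P :: "'a measure" and n :: nat and X :: "'a \<Rightarrow> matr" and \<sigma> :: real
  assumes P: "prob_space P" and n: "n \<ge> 1" and \<sigma>: "\<sigma> > 0"
    and Xr: "random_sym_mat P n X" and Xi: "indep_upper_tri P n X"
    and Xs: "\<And>i j. (i, j) \<in> upper_tri n \<Longrightarrow> subgaussian P \<sigma> (\<lambda>\<omega>. X \<omega> i j)"
begin

lemma entry_measurable: "e \<in> upper_tri n \<Longrightarrow> (\<lambda>\<omega>. X \<omega> (fst e) (snd e)) \<in> borel_measurable P"
  using Xr upper_tri_subset[of n] unfolding random_sym_mat_def by (cases e) auto

sublocale law: matrix_law "entry_law P n X" \<sigma>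
proof (intro matrix_law.intro subgaussian_product.intro real_product.intro subgaussian_product_axioms.intro \<sigma>)
  fix e
  show "prob_space (entry_law P n X e)"
    using prob_space.prob_space_distr[OF P entry_measurable] prob_space_return[of 0 "borel :: real measure"]
    by (simp add: entry_law_def)
  show "sets (entry_law P n X e) = sets borel" by (simp add: entry_law_def)
  show "subgaussian (entry_law P n X e) \<sigma> (\<lambda>x. x)"
  proof (cases "e \<in> upper_tri n")
    case True
    hence "subgaussian P \<sigma> (\<lambda>\<omega>. X \<omega> (fst e) (snd e))" using Xs[of "fst e" "snd e"] by simp
    thus ?thesis using entry_measurable[OF True] True
      by (simp add: subgaussian_def entry_law_def nn_integral_distr)
  next
    case False
    thus ?thesis by (auto simp: subgaussian_def entry_law_def nn_integral_return ennreal_1[symmetric] simp del: ennreal_1 intro!: ennreal_leI)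
  qed
qed

lemma upper_measurable: "(\<lambda>\<omega>. upper n (X \<omega>)) \<in> measurable P (upper_space n)"
  unfolding upper_def case_prod_beta by (rule measurable_restrict) (rule entry_measurable)

lemma upper_distr: "distr P (upper_space n) (\<lambda>\<omega>. upper n (X \<omega>)) = PiM (upper_tri n) (entry_law P n X)"
proof -
  interpret prob_space P by (rule P)
  \<comment> \<open>The characterization of independence by the product law is for nonempty index
    sets.\<close>
  have ne: "upper_tri n \<noteq> {}" using n by (auto simp: upper_tri_def)
  have "distr P (upper_space n) (\<lambda>\<omega>. \<lambda>e\<in>upper_tri n. (case e of (i, j) \<Rightarrow> \<lambda>\<omega>. X \<omega> i j) \<omega>)
     = PiM (upper_tri n) (\<lambda>e. distr P borel (case e of (i, j) \<Rightarrow> \<lambda>\<omega>. X \<omega> i j))"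
    using Xi unfolding indep_upper_tri_def
    by (subst (asm) indep_vars_iff_distr_eq_PiM'[OF ne]) (use entry_measurable in \<open>auto simp: case_prod_beta'\<close>)
  also have "\<dots> = PiM (upper_tri n) (entry_law P n X)"
    by (rule PiM_cong) (auto simp: entry_law_def case_prod_beta')
  also have "(\<lambda>\<omega>. \<lambda>e\<in>upper_tri n. (case e of (i, j) \<Rightarrow> \<lambda>\<omega>. X \<omega> i j) \<omega>) = (\<lambda>\<omega>. upper n (X \<omega>))"
    by (auto simp: upper_def fun_eq_iff)
  finally show ?thesis .
qed

lemma whp_noise_opn: "whp P (2 * exp (- real n)) (\<lambda>\<omega>. opn n (\<lambda>i j. X \<omega> i j / sqrt (real n)) (40 * \<sigma>))"
proof -
  have "whp (distr P (upper_space n) (\<lambda>\<omega>. upper n (X \<omega>))) (2 * exp (- real n))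
     (\<lambda>x. opn n (\<lambda>i j. symx (upper_tri n) x i j / sqrt (real n)) (40 * \<sigma>))"
    unfolding upper_distr by (rule law.whp_opn[OF order_refl n])
  from whp_distr[OF this upper_measurable]
  show ?thesis
  proof (rule whp_mono)
    fix \<omega> assume \<omega>: "\<omega> \<in> space P"
      and h: "opn n (\<lambda>i j. symx (upper_tri n) (upper n (X \<omega>)) i j / sqrt (real n)) (40 * \<sigma>)"
    have "X \<omega> \<in> sym_mats n" using Xr \<omega> by (simp add: random_sym_mat_def)
    hence "mat_vec n (\<lambda>i j. symx (upper_tri n) (upper n (X \<omega>)) i j / sqrt (real n)) v i
       = mat_vec n (\<lambda>i j. X \<omega> i j / sqrt (real n)) v i" if "i \<in> {1..n}" for v i
      using that by (simp add: mat_vec_def symx_upper)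
    hence "nrm n (mat_vec n (\<lambda>i j. symx (upper_tri n) (upper n (X \<omega>)) i j / sqrt (real n)) v)
       = nrm n (mat_vec n (\<lambda>i j. X \<omega> i j / sqrt (real n)) v)" for v
      by (rule nrm_cong)
    thus "opn n (\<lambda>i j. X \<omega> i j / sqrt (real n)) (40 * \<sigma>)" using h by (simp add: opn_def)
  qed simp
qed

end

section \<open>Good initializations and the test function as a function of noise and
  initialization\<close>

abbreviation init_space :: "nat \<Rightarrow> ((nat \<Rightarrow> real) \<times> (nat \<times> nat \<Rightarrow> real)) measure" where
  "init_space n \<equiv> vec_space n \<Otimes>\<^sub>M mat_space n"

text \<open>The deterministic conditions under which the conditional estimates apply. The bound on
  the squares of \<open>z\<close> yields the operator norm; symmetry is included because
  \<open>z\<close> ranges over the whole product space.\<close>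

definition good_init :: "nat \<Rightarrow> real \<Rightarrow> real \<Rightarrow> real \<Rightarrow> vect \<Rightarrow> (nat \<times> nat \<Rightarrow> real) \<Rightarrow> bool" where
  "good_init n C0 KZ q u z \<longleftrightarrow> nrm n u \<le> C0 * sqrt (real n) \<and>
     (\<Sum>i\<in>{1..n}. \<Sum>j\<in>{1..n}. (z (i, j))\<^sup>2) \<le> (KZ * real n)\<^sup>2 \<and>
     (\<forall>i\<in>{1..n}. \<forall>j\<in>{1..n}. \<bar>z (i, j)\<bar> \<le> q \<and> z (i, j) = z (j, i)) \<and> (\<forall>i\<in>{1..n}. \<bar>u i\<bar> \<le> q)"

text \<open>Having noise and initialization as separate arguments allows joint measurability and
  integration over one of them.\<close>

definition state :: "nat \<Rightarrow> (nat \<Rightarrow> (nat \<Rightarrow> real) \<Rightarrow> real) \<Rightarrow> nat \<Rightarrow>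
    (nat \<times> nat \<Rightarrow> real) \<Rightarrow> vect \<times> (nat \<times> nat \<Rightarrow> real) \<Rightarrow> real" where
  "state n F k x w = sin ((\<Sum>i\<in>{1..n}. orb n F (X_hat n (\<lambda>i j. snd w (i, j)) (symx (upper_tri n) x)) (fst w) k i) / real n)"

lemma init_components:
  "i \<in> {1..n} \<Longrightarrow> (\<lambda>w. fst w i) \<in> borel_measurable (init_space n)"
  "i \<in> {1..n} \<Longrightarrow> j \<in> {1..n} \<Longrightarrow> (\<lambda>w. snd w (i, j)) \<in> borel_measurable (init_space n)"
  by (rule measurable_compose[OF measurable_fst measurable_component_singleton]; simp)
     (rule measurable_compose[OF measurable_snd measurable_component_singleton]; simp)

lemma good_init_measurable: "{w \<in> space (init_space n). good_init n C0 KZ q (fst w) (snd w)} \<in> sets (init_space n)"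
proof -
  let ?W = "init_space n"
  have a: "{w \<in> space ?W. sqrt (\<Sum>i\<in>{1..n}. (fst w i)\<^sup>2) \<le> C0 * sqrt (real n)} \<in> sets ?W"
    by (intro borel_measurable_le measurable_compose[OF _ borel_measurable_sqrt] borel_measurable_sum
        borel_measurable_power borel_measurable_const init_components)
  have b: "{w \<in> space ?W. (\<Sum>i\<in>{1..n}. \<Sum>j\<in>{1..n}. (snd w (i, j))\<^sup>2) \<le> (KZ * real n)\<^sup>2} \<in> sets ?W"
    by (intro borel_measurable_le borel_measurable_sum borel_measurable_power borel_measurable_const init_components)
  have c: "{w \<in> space ?W. \<forall>i\<in>{1..n}. \<forall>j\<in>{1..n}. \<bar>snd w (i, j)\<bar> \<le> q \<and> snd w (i, j) = snd w (j, i)} \<in> sets ?W"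
    by (intro sets.sets_Collect_finite_All' sets.sets_Collect_finite_All sets.sets_Collect_conj borel_measurable_le
        borel_measurable_eq borel_measurable_abs borel_measurable_const init_components finite_atLeastAtMost)
  have d: "{w \<in> space ?W. \<forall>i\<in>{1..n}. \<bar>fst w i\<bar> \<le> q} \<in> sets ?W"
    by (intro sets.sets_Collect_finite_All borel_measurable_le
        borel_measurable_abs borel_measurable_const init_components finite_atLeastAtMost)
  show ?thesis unfolding good_init_def nrm_def L2_set_def
    by (intro sets.sets_Collect_conj a b c d)
qed

lemma state_measurable:
  assumes F: "\<And>l. l < k \<Longrightarrow> lip (Suc l) L (F l)"
  shows "(\<lambda>(x, w). state n F k x w) \<in> borel_measurable (upper_space n \<Otimes>\<^sub>M init_space n)"
proof -
  let ?M = "upper_space n \<Otimes>\<^sub>M init_space n"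
  have x: "(\<lambda>p. symx (upper_tri n) (fst p) i j) \<in> borel_measurable ?M" for i j
    unfolding symx_def
    by (cases "(min i j, max i j) \<in> upper_tri n")
       (auto intro: measurable_compose[OF measurable_fst measurable_component_singleton])
  have "(\<lambda>p. orb n F (X_hat n (\<lambda>i j. snd (snd p) (i, j)) (symx (upper_tri n) (fst p))) (fst (snd p)) k i) \<in> borel_measurable ?M"
    if "i \<in> {1..n}" for i
  proof (rule orb_borel_measurable[where B = "\<lambda>p. X_hat n (\<lambda>i j. snd (snd p) (i, j)) (symx (upper_tri n) (fst p))"
        and u = "\<lambda>p. fst (snd p)", OF F _ _ that])
    show "(\<lambda>p. X_hat n (\<lambda>i j. snd (snd p) (i, j)) (symx (upper_tri n) (fst p)) i j) \<in> borel_measurable ?M"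
      if "i \<in> {1..n}" "j \<in> {1..n}" for i j
      unfolding X_hat_def using x measurable_compose[OF measurable_snd init_components(2)[OF that]]
      by (intro borel_measurable_add borel_measurable_divide borel_measurable_const)
    show "(\<lambda>p. fst (snd p) i) \<in> borel_measurable ?M" if "i \<in> {1..n}" for i
      by (rule measurable_compose[OF measurable_snd init_components(1)[OF that]])
  qed
  thus ?thesis unfolding state_def case_prod_beta'
    by (intro measurable_compose[OF _ borel_measurable_sin] borel_measurable_divide borel_measurable_sum borel_measurable_const)
qed

text \<open>Chebyshev's inequality for each fixed good initialization, integrated over the law of
  the initialization by means of \<open>joint_law\<close>.\<close>

lemma (in noise) deviation:
  assumes ind: "indep_of_pair P n X u Z"
    and F: "\<And>l. l < k \<Longrightarrow> lip (Suc l) L (F l)" and \<theta>: "\<theta> > 0" and \<kappa>: "\<kappa> \<ge> 0"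
    and \<nu>: "real_product \<nu>"
    and bound: "\<And>w. good_init n C0 KZ q (fst w) (snd w) \<Longrightarrow>
      (\<integral>x. (state n F k x w - (\<integral>y. state n F k y w \<partial>PiM (upper_tri n) \<nu>))\<^sup>2 \<partial>PiM (upper_tri n) (entry_law P n X)) \<le> \<kappa>"
  shows "whp P (\<kappa> / \<theta>\<^sup>2) (\<lambda>\<omega>. good_init n C0 KZ q (vec_elem n (u \<omega>)) (mat_elem n (Z \<omega>)) \<longrightarrow>
    \<bar>state n F k (upper n (X \<omega>)) (vec_elem n (u \<omega>), mat_elem n (Z \<omega>))
      - (\<integral>y. state n F k y (vec_elem n (u \<omega>), mat_elem n (Z \<omega>)) \<partial>PiM (upper_tri n) \<nu>)\<bar> \<le> \<theta>)"
proof -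
  interpret \<nu>: real_product \<nu> by (rule \<nu>)
  interpret N: prob_space "PiM (upper_tri n) \<nu>" by (rule \<nu>.prob_PiM)
  interpret Lw: prob_space "PiM (upper_tri n) (entry_law P n X)" by (rule law.prob_PiM)
  define W where "W = init_space n"
  define wel where "wel = (\<lambda>\<omega>. (vec_elem n (u \<omega>), mat_elem n (Z \<omega>)))"
  define m where "m = (\<lambda>w. \<integral>y. state n F k y w \<partial>PiM (upper_tri n) \<nu>)"
  have sm: "(\<lambda>(x, w). state n F k x w) \<in> borel_measurable (upper_space n \<Otimes>\<^sub>M W)"
    unfolding W_def by (rule state_measurable[OF F])
  have mm: "m \<in> borel_measurable W"
    unfolding m_def
  proof (rule N.borel_measurable_lebesgue_integral)
    have "(\<lambda>(w, x). state n F k x w) \<in> borel_measurable (W \<Otimes>\<^sub>M upper_space n)"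
      using measurable_compose[OF measurable_pair_swap' sm] by (simp add: case_prod_beta')
    thus "(\<lambda>(w, x). state n F k x w) \<in> borel_measurable (W \<Otimes>\<^sub>M PiM (upper_tri n) \<nu>)"
      by (subst measurable_cong_sets[OF sets_pair_measure_cong[OF refl \<nu>.sets_PiM_borel] refl])
  qed
  \<comment> \<open>The condition on the initialization is part of the bad set, so its sections over
    all other initializations are empty.\<close>
  define E where "E = {p \<in> space (upper_space n \<Otimes>\<^sub>M W). good_init n C0 KZ q (fst (snd p)) (snd (snd p))
     \<and> \<theta> < \<bar>state n F k (fst p) (snd p) - m (snd p)\<bar>}"
  have E: "E \<in> sets (upper_space n \<Otimes>\<^sub>M W)"
  proof -
    have "E = (snd -` {w \<in> space W. good_init n C0 KZ q (fst w) (snd w)} \<inter> space (upper_space n \<Otimes>\<^sub>M W))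
       \<inter> {p \<in> space (upper_space n \<Otimes>\<^sub>M W). \<theta> < \<bar>state n F k (fst p) (snd p) - m (snd p)\<bar>}"
      by (auto simp: E_def space_pair_measure)
    moreover have "snd -` {w \<in> space W. good_init n C0 KZ q (fst w) (snd w)} \<inter> space (upper_space n \<Otimes>\<^sub>M W)
       \<in> sets (upper_space n \<Otimes>\<^sub>M W)"
      unfolding W_def by (rule measurable_sets[OF measurable_snd good_init_measurable])
    moreover have "{p \<in> space (upper_space n \<Otimes>\<^sub>M W). \<theta> < \<bar>state n F k (fst p) (snd p) - m (snd p)\<bar>}
       \<in> sets (upper_space n \<Otimes>\<^sub>M W)"
      using sm mm by (intro borel_measurable_less borel_measurable_const borel_measurable_abs borel_measurable_diff)
        (auto simp: case_prod_beta' intro: measurable_compose[OF measurable_snd])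
    ultimately show ?thesis by auto
  qed
  have ind': "indep_elems P (mat_space n) (\<lambda>\<omega>. mat_elem n (X \<omega>)) W wel"
    using ind by (simp add: indep_of_pair_def W_def wel_def)
  have xm: "(\<lambda>\<omega>. mat_elem n (X \<omega>)) \<in> measurable P (mat_space n)" and wm: "wel \<in> measurable P W"
    using ind' by (auto simp: indep_elems_def)
  interpret Dw: prob_space "distr P W wel" by (rule prob_space.prob_space_distr[OF P wm])
  have "emeasure P {\<omega>\<in>space P. (restrict (mat_elem n (X \<omega>)) (upper_tri n), wel \<omega>) \<in> E}
    = (\<integral>\<^sup>+w. emeasure (distr P (upper_space n) (\<lambda>\<omega>. restrict (mat_elem n (X \<omega>)) (upper_tri n))) ((\<lambda>x. (x, w)) -` E) \<partial>distr P W wel)"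
    by (rule joint_law[OF P ind' restrict_upper_measurable E])
  also have "\<dots> = (\<integral>\<^sup>+w. emeasure (PiM (upper_tri n) (entry_law P n X)) ((\<lambda>x. (x, w)) -` E) \<partial>distr P W wel)"
    by (simp only: upper_mat_elem[symmetric] upper_distr)
  also have "\<dots> \<le> (\<integral>\<^sup>+w. ennreal (\<kappa> / \<theta>\<^sup>2) \<partial>distr P W wel)"
  proof (rule nn_integral_mono)
    fix w assume "w \<in> space (distr P W wel)"
    hence w: "w \<in> space W" by simp
    show "emeasure (PiM (upper_tri n) (entry_law P n X)) ((\<lambda>x. (x, w)) -` E) \<le> ennreal (\<kappa> / \<theta>\<^sup>2)"
    proof (cases "good_init n C0 KZ q (fst w) (snd w)")
      case False
      hence "(\<lambda>x. (x, w)) -` E = {}" by (auto simp: E_def)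
      thus ?thesis by simp
    next
      case True
      let ?Q = "PiM (upper_tri n) (entry_law P n X)"
      have sx: "(\<lambda>x. state n F k x w) \<in> borel_measurable ?Q"
        unfolding law.measurable_PiM_borel
        using measurable_compose[OF measurable_Pair2'[OF w] sm] by simp
      have si: "\<bar>state n F k x w\<bar> \<le> 1" for x by (simp add: state_def)
      have mw: "\<bar>m w\<bar> \<le> 1"
      proof -
        have sn: "(\<lambda>x. state n F k x w) \<in> borel_measurable (PiM (upper_tri n) \<nu>)"
          unfolding \<nu>.measurable_PiM_borel
          using measurable_compose[OF measurable_Pair2'[OF w] sm] by simp
        have "\<bar>m w\<bar> \<le> (\<integral>y. \<bar>state n F k y w\<bar> \<partial>PiM (upper_tri n) \<nu>)" unfolding m_def by (rule integral_abs_bound)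
        also have "\<dots> \<le> (\<integral>y. 1 \<partial>PiM (upper_tri n) \<nu>)"
          using si sn by (intro integral_mono N.integrable_const_bound[of _ 1] AE_I2) auto
        finally show ?thesis by (simp add: N.prob_space)
      qed
      have i: "integrable ?Q (\<lambda>x. (state n F k x w - m w)\<^sup>2)"
      proof (rule law.integrable_bounded_PiM[where C = "2\<^sup>2"])
        show "\<bar>(state n F k x w - m w)\<^sup>2\<bar> \<le> 2\<^sup>2" for x
        proof -
          have "\<bar>state n F k x w - m w\<bar> \<le> 2" using si[of x] mw by linarith
          thus ?thesis by (metis abs_ge_zero abs_power2 power2_abs power_mono)
        qed
      qed (use sx in simp)
      have "emeasure ?Q ((\<lambda>x. (x, w)) -` E) \<le> emeasure ?Q {x \<in> space ?Q. \<theta>\<^sup>2 \<le> (state n F k x w - m w)\<^sup>2}"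
      proof (rule emeasure_mono)
        show "(\<lambda>x. (x, w)) -` E \<subseteq> {x \<in> space ?Q. \<theta>\<^sup>2 \<le> (state n F k x w - m w)\<^sup>2}"
        proof (rule subsetI)
          fix x assume "x \<in> (\<lambda>x. (x, w)) -` E"
          hence x: "x \<in> space (upper_space n)" "\<theta> < \<bar>state n F k x w - m w\<bar>"
            by (auto simp: E_def space_pair_measure)
          hence "x \<in> space ?Q" using sets_eq_imp_space_eq[OF law.sets_PiM_borel] by simp
          moreover have "\<theta>\<^sup>2 \<le> \<bar>state n F k x w - m w\<bar>\<^sup>2" using x \<theta> by (intro power_mono) auto
          ultimately show "x \<in> {x \<in> space ?Q. \<theta>\<^sup>2 \<le> (state n F k x w - m w)\<^sup>2}" by simp
        qed
      qed (use sx in measurable)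
      also have "\<dots> \<le> ennreal (1 / \<theta>\<^sup>2 * (\<integral>x. (state n F k x w - m w)\<^sup>2 \<partial>?Q))"
        by (rule integral_Markov_inequality[OF i]) (use \<theta> in auto)
      also have "\<dots> \<le> ennreal (\<kappa> / \<theta>\<^sup>2)"
        using bound[OF True] \<theta> unfolding m_def by (intro ennreal_leI) (simp add: divide_right_mono)
      finally show ?thesis .
    qed
  qed
  also have "\<dots> = ennreal (\<kappa> / \<theta>\<^sup>2)" using Dw.emeasure_space_1 by simp
  finally have fin: "emeasure P {\<omega>\<in>space P. (upper n (X \<omega>), wel \<omega>) \<in> E} \<le> ennreal (\<kappa> / \<theta>\<^sup>2)"
    by (simp only: upper_mat_elem)
  have "whp P (\<kappa> / \<theta>\<^sup>2) (\<lambda>\<omega>. (upper n (X \<omega>), wel \<omega>) \<notin> E)"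
  proof (rule whp_set)
    have "(\<lambda>\<omega>. (upper n (X \<omega>), wel \<omega>)) \<in> measurable P (upper_space n \<Otimes>\<^sub>M W)"
      by (intro measurable_Pair upper_measurable wm)
    from measurable_sets[OF this E]
    have "(\<lambda>\<omega>. (upper n (X \<omega>), wel \<omega>)) -` E \<inter> space P \<in> sets P" .
    moreover have "(\<lambda>\<omega>. (upper n (X \<omega>), wel \<omega>)) -` E \<inter> space P = {\<omega>\<in>space P. \<not> (upper n (X \<omega>), wel \<omega>) \<notin> E}" by auto
    ultimately show "{\<omega>\<in>space P. \<not> (upper n (X \<omega>), wel \<omega>) \<notin> E} \<in> sets P" by simp
  qed (use fin \<kappa> in auto)
  thus ?thesis
  proof (rule whp_mono)
    fix \<omega> assume \<omega>: "\<omega> \<in> space P" and nE: "(upper n (X \<omega>), wel \<omega>) \<notin> E"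
    have "(upper n (X \<omega>), wel \<omega>) \<in> space (upper_space n \<Otimes>\<^sub>M W)"
      using measurable_space[OF upper_measurable \<omega>] measurable_space[OF wm \<omega>] by (simp add: space_pair_measure)
    thus "good_init n C0 KZ q (vec_elem n (u \<omega>)) (mat_elem n (Z \<omega>)) \<longrightarrow>
    \<bar>state n F k (upper n (X \<omega>)) (vec_elem n (u \<omega>), mat_elem n (Z \<omega>))
      - (\<integral>y. state n F k y (vec_elem n (u \<omega>), mat_elem n (Z \<omega>)) \<partial>PiM (upper_tri n) \<nu>)\<bar> \<le> \<theta>"
      using nE by (auto simp: E_def wel_def m_def)
  qed simp
qed

lemma square_le_exp:
  fixes z \<sigma> :: real
  assumes "\<sigma> > 0"
  shows "z\<^sup>2 \<le> 2 * \<sigma>\<^sup>2 * exp (\<bar>z\<bar> / \<sigma>)"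
proof -
  define x where "x = \<bar>z\<bar> / \<sigma>"
  have x: "x \<ge> 0" using assms by (simp add: x_def)
  have "x\<^sup>2 / 2 \<le> exp x" using exp_lower_Taylor_quadratic[OF x] x by linarith
  hence "\<sigma>\<^sup>2 * x\<^sup>2 \<le> \<sigma>\<^sup>2 * (2 * exp x)" by (intro mult_left_mono) auto
  moreover have "\<sigma>\<^sup>2 * x\<^sup>2 = z\<^sup>2" using assms by (simp add: x_def power_divide)
  ultimately show ?thesis by (simp add: x_def mult_ac)
qed

text \<open>Markov's inequality throughout. The first two summands do not decrease with
  \<open>n\<close> but become small for large \<open>C0\<close> and \<open>KZ\<close>; the other two
  are union bounds, for which \<open>exp (q / \<sigma>)\<close> has to outgrow
  \<open>n^2\<close>.\<close>

lemma whp_good_init: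
  assumes P: "prob_space P" and n: "n \<ge> 1" and \<sigma>: "\<sigma> > 0" and C: "C \<ge> 0" and KZ: "KZ > 0" and C0: "C0 \<ge> 0"
    and ur: "random_vec P n u" and Zr: "random_sym_mat P n Z"
    and un: "(\<integral>\<^sup>+\<omega>. ennreal (exp ((L2_set (u \<omega>) {1..n})\<^sup>2 / (\<sigma> * real n))) \<partial>P) \<le> ennreal C"
    and ue: "\<And>i. i \<in> {1..n} \<Longrightarrow> (\<integral>\<^sup>+\<omega>. ennreal (exp (\<bar>u \<omega> i\<bar> / \<sigma>)) \<partial>P) \<le> ennreal C"
    and Ze: "\<And>i j. i \<in> {1..n} \<Longrightarrow> j \<in> {1..n} \<Longrightarrow> (\<integral>\<^sup>+\<omega>. ennreal (exp (\<bar>Z \<omega> i j\<bar> / \<sigma>)) \<partial>P) \<le> ennreal C"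
  shows "whp P (C / exp (C0\<^sup>2 / \<sigma>) + (2 * \<sigma>\<^sup>2 * C / KZ\<^sup>2 + (real n * (real n * (C / exp (q / \<sigma>))) + real n * (C / exp (q / \<sigma>)))))
    (\<lambda>\<omega>. good_init n C0 KZ q (vec_elem n (u \<omega>)) (mat_elem n (Z \<omega>)))"
proof -
  have um [measurable]: "i \<in> {1..n} \<Longrightarrow> (\<lambda>\<omega>. u \<omega> i) \<in> borel_measurable P" for i
    using ur by (simp add: random_vec_def)
  have Zm [measurable]: "i \<in> {1..n} \<Longrightarrow> j \<in> {1..n} \<Longrightarrow> (\<lambda>\<omega>. Z \<omega> i j) \<in> borel_measurable P" for i j
    using Zr by (simp add: random_sym_mat_def)
  have 1: "whp P (C / exp (C0\<^sup>2 / \<sigma>)) (\<lambda>\<omega>. exp ((L2_set (u \<omega>) {1..n})\<^sup>2 / (\<sigma> * real n)) < exp (C0\<^sup>2 / \<sigma>))"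
  proof (rule whp_markov[OF _ un C])
    have "(\<lambda>\<omega>. L2_set (u \<omega>) {1..n}) \<in> borel_measurable P"
      unfolding L2_set_def by (intro measurable_compose[OF _ borel_measurable_sqrt] borel_measurable_sum borel_measurable_power um)
    thus "(\<lambda>\<omega>. exp ((L2_set (u \<omega>) {1..n})\<^sup>2 / (\<sigma> * real n))) \<in> borel_measurable P"
      by (intro measurable_compose[OF _ borel_measurable_exp] borel_measurable_divide borel_measurable_power) auto
  qed simp
  have 2: "whp P (real n * (C / exp (q / \<sigma>))) (\<lambda>\<omega>. \<forall>i\<in>{1..n}. exp (\<bar>u \<omega> i\<bar> / \<sigma>) < exp (q / \<sigma>))"
  proof (rule whp_ball1[OF P])
    fix i assume i: "i \<in> {1..n}"
    show "whp P (C / exp (q / \<sigma>)) (\<lambda>\<omega>. exp (\<bar>u \<omega> i\<bar> / \<sigma>) < exp (q / \<sigma>))"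
      by (rule whp_markov[OF _ ue[OF i] C])
         (auto intro!: measurable_compose[OF _ borel_measurable_exp] borel_measurable_divide borel_measurable_abs um[OF i])
  qed (use C in auto)
  have 3: "whp P (real n * (real n * (C / exp (q / \<sigma>)))) (\<lambda>\<omega>. \<forall>i\<in>{1..n}. \<forall>j\<in>{1..n}. exp (\<bar>Z \<omega> i j\<bar> / \<sigma>) < exp (q / \<sigma>))"
  proof (rule whp_ball1[OF P], simp_all only: finite_atLeastAtMost, rule whp_ball1[OF P])
    fix i j assume ij: "i \<in> {1..n}" "j \<in> {1..n}"
    show "whp P (C / exp (q / \<sigma>)) (\<lambda>\<omega>. exp (\<bar>Z \<omega> i j\<bar> / \<sigma>) < exp (q / \<sigma>))"
      by (rule whp_markov[OF _ Ze[OF ij] C])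
         (auto intro!: measurable_compose[OF _ borel_measurable_exp] borel_measurable_divide borel_measurable_abs Zm[OF ij])
  qed (use C in auto)
  have 4: "whp P (2 * \<sigma>\<^sup>2 * C / KZ\<^sup>2) (\<lambda>\<omega>. (\<Sum>i\<in>{1..n}. \<Sum>j\<in>{1..n}. (Z \<omega> i j)\<^sup>2) < (KZ * real n)\<^sup>2)"
  proof -
    have "(\<integral>\<^sup>+\<omega>. ennreal (\<Sum>i\<in>{1..n}. \<Sum>j\<in>{1..n}. (Z \<omega> i j)\<^sup>2) \<partial>P)
       = (\<integral>\<^sup>+\<omega>. (\<Sum>i\<in>{1..n}. \<Sum>j\<in>{1..n}. ennreal ((Z \<omega> i j)\<^sup>2)) \<partial>P)"
      by (intro nn_integral_cong) (simp add: sum_nonneg)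
    also have "\<dots> = (\<Sum>i\<in>{1..n}. \<Sum>j\<in>{1..n}. (\<integral>\<^sup>+\<omega>. ennreal ((Z \<omega> i j)\<^sup>2) \<partial>P))"
      by (subst nn_integral_sum, measurable, intro sum.cong refl, subst nn_integral_sum, measurable)
    also have "\<dots> \<le> (\<Sum>i\<in>{1..n}. \<Sum>j\<in>{1..n}. ennreal (2 * \<sigma>\<^sup>2 * C))"
    proof (intro sum_mono)
      fix i j assume ij: "i \<in> {1..n}" "j \<in> {1..n}"
      have "(\<integral>\<^sup>+\<omega>. ennreal ((Z \<omega> i j)\<^sup>2) \<partial>P) \<le> (\<integral>\<^sup>+\<omega>. ennreal (2 * \<sigma>\<^sup>2) * ennreal (exp (\<bar>Z \<omega> i j\<bar> / \<sigma>)) \<partial>P)"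
        using square_le_exp[OF \<sigma>] by (intro nn_integral_mono) (simp add: ennreal_mult'[symmetric] ennreal_leI)
      also have "\<dots> = ennreal (2 * \<sigma>\<^sup>2) * (\<integral>\<^sup>+\<omega>. ennreal (exp (\<bar>Z \<omega> i j\<bar> / \<sigma>)) \<partial>P)"
        using Zm[OF ij] by (intro nn_integral_cmult) auto
      also have "\<dots> \<le> ennreal (2 * \<sigma>\<^sup>2) * ennreal C" by (intro mult_left_mono Ze ij) auto
      finally show "(\<integral>\<^sup>+\<omega>. ennreal ((Z \<omega> i j)\<^sup>2) \<partial>P) \<le> ennreal (2 * \<sigma>\<^sup>2 * C)"
        by (simp add: ennreal_mult')
    qed
    also have "\<dots> = ennreal (real n * (real n * (2 * \<sigma>\<^sup>2 * C)))"
      using C by (simp add: ennreal_mult ennreal_of_nat_eq_real_of_nat)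
    finally have "(\<integral>\<^sup>+\<omega>. ennreal (\<Sum>i\<in>{1..n}. \<Sum>j\<in>{1..n}. (Z \<omega> i j)\<^sup>2) \<partial>P) \<le> ennreal (real n * (real n * (2 * \<sigma>\<^sup>2 * C)))" .
    from whp_markov[OF _ this, of "(KZ * real n)\<^sup>2"]
    have "whp P ((real n * (real n * (2 * \<sigma>\<^sup>2 * C))) / (KZ * real n)\<^sup>2) (\<lambda>\<omega>. (\<Sum>i\<in>{1..n}. \<Sum>j\<in>{1..n}. (Z \<omega> i j)\<^sup>2) < (KZ * real n)\<^sup>2)"
      using C KZ n by (simp add: borel_measurable_sum borel_measurable_power Zm)
    moreover have "(real n * (real n * (2 * \<sigma>\<^sup>2 * C))) / (KZ * real n)\<^sup>2 = 2 * \<sigma>\<^sup>2 * C / KZ\<^sup>2"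
      using n KZ by (simp add: power2_eq_square)
    ultimately show ?thesis by simp
  qed
  from whp_conj[OF P 1 whp_conj[OF P 4 whp_conj[OF P 3 2]]]
  show ?thesis
  proof (rule whp_mono)
    fix \<omega> assume \<omega>: "\<omega> \<in> space P"
      and h: "exp ((L2_set (u \<omega>) {1..n})\<^sup>2 / (\<sigma> * real n)) < exp (C0\<^sup>2 / \<sigma>) \<and>
        (\<Sum>i\<in>{1..n}. \<Sum>j\<in>{1..n}. (Z \<omega> i j)\<^sup>2) < (KZ * real n)\<^sup>2 \<and>
        (\<forall>i\<in>{1..n}. \<forall>j\<in>{1..n}. exp (\<bar>Z \<omega> i j\<bar> / \<sigma>) < exp (q / \<sigma>)) \<and>
        (\<forall>i\<in>{1..n}. exp (\<bar>u \<omega> i\<bar> / \<sigma>) < exp (q / \<sigma>))"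
    have "(nrm n (u \<omega>))\<^sup>2 \<le> C0\<^sup>2 * real n"
      using h \<sigma> n by (simp add: nrm_def field_simps)
    hence "(nrm n (u \<omega>))\<^sup>2 \<le> (C0 * sqrt (real n))\<^sup>2" by (simp add: power_mult_distrib)
    hence a: "nrm n (u \<omega>) \<le> C0 * sqrt (real n)" by (rule power2_le_imp_le) (use C0 in auto)
    have "nrm n (vec_elem n (u \<omega>)) = nrm n (u \<omega>)" by (rule nrm_cong) (simp add: vec_elem_def)
    moreover have "Z \<omega> i j = Z \<omega> j i" if "i \<in> {1..n}" "j \<in> {1..n}" for i j
      using Zr \<omega> that by (auto simp: random_sym_mat_def sym_mats_def)
    ultimately show "good_init n C0 KZ q (vec_elem n (u \<omega>)) (mat_elem n (Z \<omega>))"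
      using h a \<sigma> unfolding good_init_def
      by (auto simp: vec_elem_def mat_elem_def divide_less_cancel less_imp_le)
  qed simp
qed

section \<open>Properties of the given noise, and smoothing of all levels with one constant\<close>

lemma subgaussian_mono:
  assumes "subgaussian P \<sigma> X" "0 < \<sigma>" "\<sigma> \<le> \<sigma>'"
  shows "subgaussian P \<sigma>' X"
  unfolding subgaussian_def
proof
  fix l
  have "\<sigma>\<^sup>2 \<le> \<sigma>'\<^sup>2" using assms by (intro power_mono) auto
  hence "l\<^sup>2 * \<sigma>\<^sup>2 / 2 \<le> l\<^sup>2 * \<sigma>'\<^sup>2 / 2" by (intro divide_right_mono mult_left_mono) auto
  hence "ennreal (exp (l\<^sup>2 * \<sigma>\<^sup>2 / 2)) \<le> ennreal (exp (l\<^sup>2 * \<sigma>'\<^sup>2 / 2))" by (intro ennreal_leI) simp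
  thus "(\<integral>\<^sup>+\<omega>. ennreal (exp (l * X \<omega>)) \<partial>P) \<le> ennreal (exp (l\<^sup>2 * \<sigma>'\<^sup>2 / 2))"
    using assms(1) unfolding subgaussian_def by (meson order_trans)
qed

text \<open>Completing the square identifies the integrand with the normal density of mean
  \<open>l\<close>, up to the factor \<open>exp (l^2 / 2)\<close>.\<close>

lemma subgaussian_std_normal:
  assumes "distributed P lborel X std_normal_density"
  shows "subgaussian P 1 X"
  unfolding subgaussian_def
proof
  fix l :: real
  have "(\<integral>\<^sup>+\<omega>. ennreal (exp (l * X \<omega>)) \<partial>P) = (\<integral>\<^sup>+x. ennreal (std_normal_density x) * ennreal (exp (l * x)) \<partial>lborel)"
    by (rule distributed_nn_integral[OF assms, symmetric]) simp
  also have "\<dots> = (\<integral>\<^sup>+x. ennreal (exp (l\<^sup>2 / 2)) * ennreal (normal_density l 1 x) \<partial>lborel)"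
  proof (rule nn_integral_cong)
    fix x :: real
    have "- x\<^sup>2 / 2 + l * x = l\<^sup>2 / 2 + - (x - l)\<^sup>2 / 2" by (simp add: power2_eq_square field_simps)
    hence "exp (- x\<^sup>2 / 2) * exp (l * x) = exp (l\<^sup>2 / 2) * exp (- (x - l)\<^sup>2 / 2)" by (simp flip: exp_add)
    hence "std_normal_density x * exp (l * x) = exp (l\<^sup>2 / 2) * normal_density l 1 x"
      by (simp add: normal_density_def)
    thus "ennreal (std_normal_density x) * ennreal (exp (l * x)) = ennreal (exp (l\<^sup>2 / 2)) * ennreal (normal_density l 1 x)"
      by (simp add: ennreal_mult[symmetric])
  qed
  also have "\<dots> = ennreal (exp (l\<^sup>2 / 2)) * (\<integral>\<^sup>+x. ennreal (normal_density l 1 x) \<partial>lborel)"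
    by (rule nn_integral_cmult) auto
  also have "(\<integral>\<^sup>+x. ennreal (normal_density l 1 x) \<partial>lborel) = 1"
    using prob_space.emeasure_space_1[OF prob_space_normal_density[of 1 l]] by (simp add: emeasure_density)
  finally show "(\<integral>\<^sup>+\<omega>. ennreal (exp (l * X \<omega>)) \<partial>P) \<le> ennreal (exp (l\<^sup>2 * 1\<^sup>2 / 2))" by simp
qed

lemma entry_law_moments:
  assumes P: "prob_space P" and e: "(i, j) \<in> upper_tri n" and X: "random_sym_mat P n X"
    and mean: "prob_space.expectation P (\<lambda>\<omega>. X \<omega> i j) = 0"
    and var: "prob_space.variance P (\<lambda>\<omega>. X \<omega> i j) = 1"
  shows "(\<integral>t. t \<partial>entry_law P n X (i, j)) = 0" "(\<integral>t. t\<^sup>2 \<partial>entry_law P n X (i, j)) = 1"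
proof -
  have m: "(\<lambda>\<omega>. X \<omega> i j) \<in> borel_measurable P"
    using X e upper_tri_subset[of n] by (auto simp: random_sym_mat_def)
  show "(\<integral>t. t \<partial>entry_law P n X (i, j)) = 0" "(\<integral>t. t\<^sup>2 \<partial>entry_law P n X (i, j)) = 1"
    using e m mean var by (simp_all add: entry_law_def integral_distr)
qed

lemma smooth_approx_sequence:
  assumes F: "\<And>l. l < k \<Longrightarrow> lip (Suc l) L0 (F l)" and \<delta>: "\<delta> > 0"
  obtains F' D H L where "L \<ge> 1" "\<And>l. l < k \<Longrightarrow> smooth (Suc l) L (F' l) (D l) (H l)"
    "\<And>l. l < k \<Longrightarrow> \<bar>F' l (\<lambda>_. 0)\<bar> \<le> L" "\<And>l x. l < k \<Longrightarrow> \<bar>F l x - F' l x\<bar> \<le> \<delta>"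
proof -
  have "\<forall>l. \<exists>g D H C. l < k \<longrightarrow> smooth (Suc l) C g D H \<and> (\<forall>x. \<bar>F l x - g x\<bar> \<le> \<delta>)"
    using smooth_approx[OF F \<delta>] by blast
  then obtain F' D H Cs where s: "\<And>l. l < k \<Longrightarrow> smooth (Suc l) (Cs l) (F' l) (D l) (H l)"
    "\<And>l x. l < k \<Longrightarrow> \<bar>F l x - F' l x\<bar> \<le> \<delta>" by metis
  define L where "L = 1 + (\<Sum>l<k. \<bar>Cs l\<bar> + \<bar>F' l (\<lambda>_. 0)\<bar>)"
  have le: "\<bar>Cs l\<bar> + \<bar>F' l (\<lambda>_. 0)\<bar> \<le> (\<Sum>l<k. \<bar>Cs l\<bar> + \<bar>F' l (\<lambda>_. 0)\<bar>)" if "l < k" for l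
    using that by (intro member_le_sum) auto
  show ?thesis
  proof (rule that)
    show "L \<ge> 1" by (simp add: L_def sum_nonneg)
    show "smooth (Suc l) L (F' l) (D l) (H l)" if "l < k" for l
      by (rule smooth_mono[OF s(1)[OF that]]) (use le[OF that] in \<open>simp add: L_def\<close>)
    show "\<bar>F' l (\<lambda>_. 0)\<bar> \<le> L" if "l < k" for l
      using le[OF that] by (simp add: L_def)
  qed (use s in auto)
qed

text \<open>Iterates up to number \<open>k\<close> use only the functions below \<open>k\<close>, so
  the rescaling affects the last iterate alone.\<close>

lemma orb_scale_last:
  "orb n (F(k := (\<lambda>a. F k a / \<beta>))) B u (Suc k) i = orb n F B u (Suc k) i / \<beta>" if i: "i \<in> {1..n}"
proof -
  have "mat_vec n B (orb n (F(k := (\<lambda>a. F k a / \<beta>))) B u k) i = mat_vec n B (orb n F B u k) i"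
    by (intro mat_vec_cong orb_cong) auto
  moreover have "orb n (F(k := (\<lambda>a. F k a / \<beta>))) B u r i = orb n F B u r i" if "r \<le> k" for r
    using that i by (intro orb_cong) auto
  ultimately have "arg n B (orb n (F(k := (\<lambda>a. F k a / \<beta>))) B u) k i = arg n B (orb n F B u) k i"
    by (auto simp: arg_def)
  thus ?thesis by (simp add: orb_Suc)
qed

section \<open>Convergence in probability\<close>

text \<open>The last function is rescaled so that the mean lies in a region where the sine is injective;
  the constants are chosen in the order \<open>\<beta>\<close>, \<open>\<delta>\<close>, so that smoothing moves the mean by less than \<open>\<epsilon>\<close>.\<close>

lemma smoothed_comparison:
  fixes F :: "nat \<Rightarrow> (nat \<Rightarrow> real) \<Rightarrow> real"
  assumes F: "\<And>l. l < Suc k0 \<Longrightarrow> lip (Suc l) L0 (F l)" and L0: "L0 \<ge> 0" and K: "K \<ge> 0" and C0: "C0 \<ge> 0" and \<epsilon>: "\<epsilon> > 0"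
  obtains F' D H L \<theta> where "L \<ge> 1" "\<theta> > 0" "\<And>l. l < Suc k0 \<Longrightarrow> smooth (Suc l) L (F' l) (D l) (H l)"
    "\<And>l. l < Suc k0 \<Longrightarrow> \<bar>F' l (\<lambda>_. 0)\<bar> \<le> L"
    "\<And>n B B' u m. n \<ge> 1 \<Longrightarrow> opn n B K \<Longrightarrow> opn n B' K \<Longrightarrow> nrm n u \<le> C0 * sqrt (real n) \<Longrightarrow>
      \<bar>sin ((\<Sum>i\<in>{1..n}. orb n F' B u (Suc k0) i) / real n) - m\<bar> \<le> \<theta> \<Longrightarrow>
      \<bar>sin ((\<Sum>i\<in>{1..n}. orb n F' B' u (Suc k0) i) / real n) - m\<bar> \<le> \<theta> \<Longrightarrow>
      \<bar>(\<Sum>i\<in>{1..n}. orb n F B u (Suc k0) i) / real n - (\<Sum>i\<in>{1..n}. orb n F B' u (Suc k0) i) / real n\<bar> \<le> \<epsilon>"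
proof -
  define k where "k = Suc k0"
  define L1 where "L1 = L0 + (\<Sum>l<k. \<bar>F l (\<lambda>_. 0)\<bar>)"
  have L1: "L1 \<ge> 0" "L0 \<le> L1" using L0 by (auto simp: L1_def sum_nonneg)
  have F1: "lip (Suc l) L1 (F l)" if "l < k" for l
    by (rule lip_mono[OF F L1(2)]) (use that in \<open>simp add: k_def\<close>)
  have F0: "\<bar>F l (\<lambda>_. 0)\<bar> \<le> L1" if "l < k" for l
    using member_le_sum[of l "{..<k}" "\<lambda>l. \<bar>F l (\<lambda>_. 0)\<bar>"] that L0 by (auto simp: L1_def)
  define R where "R = (1 + L1 * (K + real k)) ^ k"
  have W1: "1 + L1 * (K + real k) \<ge> 1" using L1 K by simp
  have R: "R \<ge> 1" unfolding R_def using W1 by (rule one_le_power)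
  define cN where "cN = (1 + L1 * (K + real k)) ^ (k + 1) * (1 + C0) + C0"
  have cN: "cN \<ge> 0" using W1 C0 by (simp add: cN_def)
  \<comment> \<open>The mean of the last iterate is at most \<open>cN\<close> in absolute value, so
    after rescaling it is at most 1/2.\<close>
  define \<beta> where "\<beta> = 2 * (cN + 1)"
  have \<beta>: "\<beta> \<ge> 1" "\<beta> > 0" "cN / \<beta> \<le> 1 / 2" using cN by (auto simp: \<beta>_def field_simps)
  define Fs where "Fs = F(k0 := (\<lambda>a. F k0 a / \<beta>))"
  have Fs: "lip (Suc l) L1 (Fs l)" if "l < k" for l
  proof (cases "l = k0")
    case True
    show ?thesis unfolding lip_def
    proof (intro allI)
      fix x y
      have "\<bar>F k0 x / \<beta> - F k0 y / \<beta>\<bar> = \<bar>F k0 x - F k0 y\<bar> / \<beta>"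
        using \<beta> by (simp add: diff_divide_distrib[symmetric] abs_divide)
      also have "\<dots> \<le> \<bar>F k0 x - F k0 y\<bar> / 1" using \<beta> by (intro divide_left_mono) auto
      also have "\<dots> \<le> L1 * ldist (Suc k0) x y" using lipD[OF F1[of k0]] by (simp add: k_def)
      finally show "\<bar>Fs l x - Fs l y\<bar> \<le> L1 * ldist (Suc l) x y" using True by (simp add: Fs_def)
    qed
  qed (use F1[OF that] in \<open>simp add: Fs_def\<close>)
  \<comment> \<open>Smoothing moves the mean by at most \<open>R * \<delta>\<close>. The first bound
    keeps the smoothed mean in \<open>[-1, 1]\<close>; by the second, the smoothing errors for two
    matrices use up half of the tolerance \<open>\<epsilon> / \<beta>\<close>.\<close>
  define \<delta> where "\<delta> = min (1/4) (\<epsilon> / (4 * \<beta>)) / R"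
  have \<delta>: "\<delta> > 0" "R * \<delta> \<le> 1/4" "R * \<delta> \<le> \<epsilon> / (4 * \<beta>)" using \<epsilon> \<beta> R by (auto simp: \<delta>_def)
  obtain F' D H L where S: "L \<ge> 1" "\<And>l. l < k \<Longrightarrow> smooth (Suc l) L (F' l) (D l) (H l)"
    "\<And>l. l < k \<Longrightarrow> \<bar>F' l (\<lambda>_. 0)\<bar> \<le> L" "\<And>l x. l < k \<Longrightarrow> \<bar>Fs l x - F' l x\<bar> \<le> \<delta>"
    using smooth_approx_sequence[OF Fs \<delta>(1)] by metis
  \<comment> \<open>Two deviations \<open>\<theta>\<close> of the sine, divided by the slope
    \<open>cos 1\<close>, make up the other half \<open>\<epsilon> / (2 * \<beta>)\<close>.\<close>
  define \<theta> where "\<theta> = cos 1 * \<epsilon> / (4 * \<beta>)"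
  have \<theta>: "\<theta> > 0" using cos_one_pos \<epsilon> \<beta> by (simp add: \<theta>_def)
  define mF where "mF = (\<lambda>G n B u. (\<Sum>i\<in>{1..n}. orb n G B u k i) / real n)"
  have close: "\<bar>mF F n B u / \<beta>\<bar> \<le> 1/2 \<and> \<bar>mF F n B u / \<beta> - mF F' n B u\<bar> \<le> R * \<delta>"
    if n: "n \<ge> 1" and B: "opn n B K" and u: "nrm n u \<le> C0 * sqrt (real n)" for n B and u :: vect
  proof
    have sn: "sqrt (real n) > 0" using n by simp
    have "nrm n (orb n F B u k) \<le> cN * sqrt (real n)"
      unfolding cN_def by (rule orb_nrm[OF L1(1) K C0 B F1 F0 u]) auto
    hence "nrm n (orb n F B u k) / sqrt (real n) \<le> cN" using sn by (simp add: pos_divide_le_eq)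
    hence "\<bar>mF F n B u\<bar> \<le> cN" using mean_diff_le_nrm[OF n, of "orb n F B u k" "\<lambda>_. 0"] by (simp add: mF_def)
    hence "2 * \<bar>mF F n B u\<bar> \<le> \<beta>" by (simp add: \<beta>_def)
    thus "\<bar>mF F n B u / \<beta>\<bar> \<le> 1/2" using \<beta> by (simp add: abs_divide mult.commute)
    have "nrm n (\<lambda>i. orb n Fs B u k i - orb n F' B u k i) \<le> (1 + L1 * (K + real k)) ^ k * (\<delta> * sqrt (real n))"
    proof (rule stability[OF L1(1) K B, where F = "\<lambda>l i. Fs l"])
      show "orb n Fs B u (Suc l) i = Fs l (arg n B (orb n Fs B u) l i)" for l i by (rule orb_Suc)
      show "nrm n (\<lambda>i. orb n F' B u (Suc l) i - Fs l (arg n B (orb n F' B u) l i)) \<le> \<delta> * sqrt (real n)" if "l < k" for l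
        using S(4)[OF that] \<delta> by (intro nrm_bound) (auto simp: orb_Suc abs_minus_commute)
    qed (use Fs \<delta> in auto)
    hence "nrm n (\<lambda>i. orb n Fs B u k i - orb n F' B u k i) / sqrt (real n) \<le> R * \<delta>"
      using sn by (simp add: pos_divide_le_eq R_def mult.assoc)
    hence "\<bar>mF Fs n B u - mF F' n B u\<bar> \<le> R * \<delta>"
      using mean_diff_le_nrm[OF n, of "orb n Fs B u k" "orb n F' B u k"] by (simp add: mF_def)
    moreover have "mF Fs n B u = mF F n B u / \<beta>"
    proof -
      have "(\<Sum>i\<in>{1..n}. orb n Fs B u k i) = (\<Sum>i\<in>{1..n}. orb n F B u k i / \<beta>)"
        unfolding Fs_def k_def by (intro sum.cong refl orb_scale_last)
      thus ?thesis by (simp add: mF_def sum_divide_distrib[symmetric])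
    qed
    ultimately show "\<bar>mF F n B u / \<beta> - mF F' n B u\<bar> \<le> R * \<delta>" by simp
  qed
  show ?thesis
  proof (rule that[OF S(1) \<theta>])
    fix n B B' u m
    assume n: "n \<ge> 1" and B: "opn n B K" "opn n B' K" and u: "nrm n u \<le> C0 * sqrt (real n)"
      and m: "\<bar>sin ((\<Sum>i\<in>{1..n}. orb n F' B u (Suc k0) i) / real n) - m\<bar> \<le> \<theta>"
        "\<bar>sin ((\<Sum>i\<in>{1..n}. orb n F' B' u (Suc k0) i) / real n) - m\<bar> \<le> \<theta>"
    note c = close[OF n B(1) u] close[OF n B(2) u]
    define a where "a = mF F' n B u"
    define a' where "a' = mF F' n B' u"
    have "\<bar>a\<bar> \<le> 1" "\<bar>a'\<bar> \<le> 1" using c \<delta> unfolding a_def a'_def by linarith+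
    hence "cos 1 * \<bar>a - a'\<bar> \<le> \<bar>sin a - sin a'\<bar>" by (rule sin_inverse_bound)
    also have "\<dots> \<le> 2 * \<theta>" using m unfolding a_def a'_def mF_def k_def by linarith
    also have "\<dots> = cos 1 * (\<epsilon> / (2 * \<beta>))" by (simp add: \<theta>_def)
    finally have "\<bar>a - a'\<bar> \<le> \<epsilon> / (2 * \<beta>)" by (rule mult_left_le_imp_le) (rule cos_one_pos)
    moreover have "\<epsilon> / (4 * \<beta>) + \<epsilon> / (4 * \<beta>) = \<epsilon> / (2 * \<beta>)" "\<epsilon> / (2 * \<beta>) + \<epsilon> / (2 * \<beta>) = \<epsilon> / \<beta>"
      using \<beta> by (auto simp: field_simps)
    ultimately have "\<bar>mF F n B u / \<beta> - mF F n B' u / \<beta>\<bar> \<le> \<epsilon> / \<beta>"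
      using c \<delta>(3) unfolding a_def a'_def by linarith
    hence "\<bar>mF F n B u - mF F n B' u\<bar> / \<beta> \<le> \<epsilon> / \<beta>"
      using \<beta> by (simp add: diff_divide_distrib[symmetric] abs_divide)
    hence "\<bar>mF F n B u - mF F n B' u\<bar> \<le> \<epsilon>" using \<beta> by (simp add: divide_le_cancel)
    thus "\<bar>(\<Sum>i\<in>{1..n}. orb n F B u (Suc k0) i) / real n - (\<Sum>i\<in>{1..n}. orb n F B' u (Suc k0) i) / real n\<bar> \<le> \<epsilon>"
      by (simp add: mF_def k_def)
  qed (use S in \<open>auto simp: k_def\<close>)
qed

locale noise_pair = A: noise P n A \<sigma> + G: noise P n G \<sigma>
  for P :: "'a measure" and n :: nat and A G :: "'a \<Rightarrow> matr" and \<sigma> :: real +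
  assumes Am: "\<And>e. e \<in> upper_tri n \<Longrightarrow> (\<integral>t. t \<partial>entry_law P n A e) = 0 \<and> (\<integral>t. t\<^sup>2 \<partial>entry_law P n A e) = 1"
    and Gm: "\<And>e. e \<in> upper_tri n \<Longrightarrow> (\<integral>t. t \<partial>entry_law P n G e) = 0 \<and> (\<integral>t. t\<^sup>2 \<partial>entry_law P n G e) = 1"
begin

definition "kap k KZ C0 L = \<bar>kappa_bound \<sigma> k (amp_law.cc \<sigma> k L KZ C0)
    \<bar>entry_perturbation.c k L (amp_law.K \<sigma> KZ)\<bar> (subgaussian_product.m6 \<sigma>) n\<bar>"

text \<open>For \<open>X = G\<close> both laws coincide and the bound expresses the concentration of
  \<open>G\<close>; for \<open>X = A\<close> it contains the exchange of laws as well.\<close>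

lemma conditional_bound:
  assumes q: "q = (ln (real n))\<^sup>2" "q \<ge> 1" and L: "L \<ge> 1" and KZ: "KZ \<ge> 1" and C0: "C0 \<ge> 0"
    and F: "\<And>l. l < k \<Longrightarrow> smooth (Suc l) L (F l) (D l) (H l)" and F0: "\<And>l. l < k \<Longrightarrow> \<bar>F l (\<lambda>_. 0)\<bar> \<le> L"
    and w: "good_init n C0 KZ q (fst w) (snd w)"
    and X: "X = A \<or> X = G"
  shows "(\<integral>x. (state n F k x w - (\<integral>y. state n F k y w \<partial>PiM (upper_tri n) (entry_law P n G)))\<^sup>2
     \<partial>PiM (upper_tri n) (entry_law P n X)) \<le> kap k KZ C0 L"
proof -
  have ax: "amp_law_axioms k n L KZ C0 q F D H (\<lambda>i j. snd w (i, j)) (fst w)"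
  proof (unfold_locales)
    show "opn n (\<lambda>i j. snd w (i, j) / real n) KZ"
      by (rule frobenius_opn) (use A.n KZ w in \<open>auto simp: good_init_def\<close>)
  qed (use A.n L KZ C0 q F F0 w in \<open>auto simp: good_init_def\<close>)
  have X': "noise P n X \<sigma>" using X A.noise_axioms G.noise_axioms by auto
  interpret X: noise P n X \<sigma> by (rule X')
  interpret amp_two_laws "entry_law P n X" "entry_law P n G" \<sigma> k n L KZ C0 q F D H "\<lambda>i j. snd w (i, j)" "fst w"
    by (intro amp_two_laws.intro amp_law.intro X.law.matrix_law_axioms G.law.matrix_law_axioms ax amp_two_laws_axioms.intro)
       (use X Am Gm in auto)
  have eq: "state n F k x w = A.test x" for x
    by (simp add: state_def A.test_def A.mean_def A.BB_def)
  have "(\<integral>x. (A.test x - (\<integral>y. A.test y \<partial>PiM (upper_tri n) (entry_law P n G)))\<^sup>2 \<partial>PiM (upper_tri n) (entry_law P n X)) \<le> \<kappa>"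
    by (rule universality_L2)
  also have "\<dots> \<le> kap k KZ C0 L" using kappa_le[OF q(1)] unfolding kap_def by linarith
  finally show ?thesis unfolding eq .
qed

lemma orb_upper:
  assumes X: "X \<in> sym_mats n" and i: "i \<in> {1..n}"
  shows "orb n F (X_hat n (\<lambda>i j. mat_elem n Z (i, j)) (symx (upper_tri n) (upper n X))) (vec_elem n u) k i
    = orb n F (X_hat n Z X) u k i"
  by (rule orb_cong[OF _ _ _ i]) (use symx_upper[OF X] in \<open>auto simp: X_hat_def mat_elem_def vec_elem_def\<close>)

lemma opn_X_hat:
  assumes X: "opn n (\<lambda>i j. X i j / sqrt (real n)) (40 * \<sigma>)" and g: "good_init n C0 KZ q (vec_elem n u) (mat_elem n Z)"
    and KZ: "KZ \<ge> 0"
  shows "opn n (X_hat n Z X) (40 * \<sigma> + KZ)"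
  unfolding opn_def
proof
  fix v
  have Z: "opn n (\<lambda>i j. Z i j / real n) KZ"
  proof (rule frobenius_opn[OF A.n KZ])
    have "(\<Sum>i\<in>{1..n}. \<Sum>j\<in>{1..n}. (Z i j)\<^sup>2) = (\<Sum>i\<in>{1..n}. \<Sum>j\<in>{1..n}. (mat_elem n Z (i, j))\<^sup>2)"
      by (intro sum.cong refl) (auto simp: mat_elem_def)
    thus "(\<Sum>i\<in>{1..n}. \<Sum>j\<in>{1..n}. (Z i j)\<^sup>2) \<le> (KZ * real n)\<^sup>2" using g by (simp add: good_init_def)
  qed
  have "nrm n (mat_vec n (X_hat n Z X) v) \<le> nrm n (mat_vec n (\<lambda>i j. X i j / sqrt (real n)) v)
     + nrm n (mat_vec n (\<lambda>i j. Z i j / real n) v)"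
    unfolding mat_vec_X_hat[abs_def] mat_vec_divide[abs_def] by (rule nrm_add)
  also have "\<dots> \<le> 40 * \<sigma> * nrm n v + KZ * nrm n v" by (intro add_mono opnD X Z)
  finally show "nrm n (mat_vec n (X_hat n Z X) v) \<le> (40 * \<sigma> + KZ) * nrm n v" by (simp add: distrib_right)
qed

end

text \<open>Two scales are kept apart: \<open>\<tau>\<close> governs the tails of the
  initialization, \<open>\<sigma>\<close> the noise. For every target probability
  \<open>\<eta>\<close> the constants \<open>C0\<close> and \<open>KZ\<close> and the smoothing are
  fixed before \<open>n\<close> grows, so that all remaining error terms vanish in the
  limit.\<close>

theorem mean_universality:
  fixes M :: "nat \<Rightarrow> 'a measure" and u0 :: "nat \<Rightarrow> 'a \<Rightarrow> vect" and Z A G :: "nat \<Rightarrow> 'a \<Rightarrow> matr"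
    and F :: "nat \<Rightarrow> (nat \<Rightarrow> real) \<Rightarrow> real"
  assumes F: "\<And>l. l < Suc k0 \<Longrightarrow> lip (Suc l) L0 (F l)" and L0: "L0 \<ge> 0"
    and \<tau>: "\<tau> > 0" and C: "C \<ge> 0"
    and AG: "\<And>n. n \<ge> 1 \<Longrightarrow> noise_pair (M n) n (A n) (G n) \<sigma>"
    and Ai: "\<And>n. n \<ge> 1 \<Longrightarrow> indep_of_pair (M n) n (A n) (u0 n) (Z n)"
    and Gi: "\<And>n. n \<ge> 1 \<Longrightarrow> indep_of_pair (M n) n (G n) (u0 n) (Z n)"
    and ur: "\<And>n. n \<ge> 1 \<Longrightarrow> random_vec (M n) n (u0 n)"
    and Zr: "\<And>n. n \<ge> 1 \<Longrightarrow> random_sym_mat (M n) n (Z n)"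
    and un: "\<And>n. n \<ge> 1 \<Longrightarrow> (\<integral>\<^sup>+\<omega>. ennreal (exp ((L2_set (u0 n \<omega>) {1..n})\<^sup>2 / (\<tau> * real n))) \<partial>M n) \<le> ennreal C"
    and ue: "\<And>n i. n \<ge> 1 \<Longrightarrow> i \<in> {1..n} \<Longrightarrow> (\<integral>\<^sup>+\<omega>. ennreal (exp (\<bar>u0 n \<omega> i\<bar> / \<tau>)) \<partial>M n) \<le> ennreal C"
    and Ze: "\<And>n i j. n \<ge> 1 \<Longrightarrow> i \<in> {1..n} \<Longrightarrow> j \<in> {1..n} \<Longrightarrow>
      (\<integral>\<^sup>+\<omega>. ennreal (exp (\<bar>Z n \<omega> i j\<bar> / \<tau>)) \<partial>M n) \<le> ennreal C"
  shows "tendsto_in_prob M (\<lambda>n \<omega>. \<bar>(\<Sum>i\<in>{1..n}. orb n F (X_hat n (Z n \<omega>) (A n \<omega>)) (u0 n \<omega>) (Suc k0) i) / real n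
      - (\<Sum>i\<in>{1..n}. orb n F (X_hat n (Z n \<omega>) (G n \<omega>)) (u0 n \<omega>) (Suc k0) i) / real n\<bar>) 0"
  unfolding tendsto_in_prob_def
proof (intro allI impI)
  fix \<epsilon> :: real assume \<epsilon>: "\<epsilon> > 0"
  define k where "k = Suc k0"
  define Y where "Y = (\<lambda>n \<omega>. \<bar>(\<Sum>i\<in>{1..n}. orb n F (X_hat n (Z n \<omega>) (A n \<omega>)) (u0 n \<omega>) (Suc k0) i) / real n
      - (\<Sum>i\<in>{1..n}. orb n F (X_hat n (Z n \<omega>) (G n \<omega>)) (u0 n \<omega>) (Suc k0) i) / real n\<bar>)"
  have \<sigma>: "\<sigma> > 0" using AG[of 1] by (auto simp: noise_pair_def noise_def)
  have "eventually (\<lambda>n. measure (M n) {\<omega>\<in>space (M n). \<bar>Y n \<omega> - 0\<bar> > \<epsilon>} < \<eta>) sequentially" if \<eta>: "\<eta> > 0" for \<eta>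
  proof -
    \<comment> \<open>Makes \<open>exp (C0^2 / \<tau>)\<close> equal to
      \<open>4 * C / \<eta> + 1\<close>, so the norm bound on the initial vector fails with
      probability at most \<open>\<eta> / 4\<close>.\<close>
    define C0 where "C0 = sqrt (\<tau> * ln (4 * C / \<eta> + 1))"
    \<comment> \<open>Since \<open>KZ^2 \<ge> KZ \<ge> 8 * \<tau>^2 * C / \<eta>\<close>, the
      Frobenius bound on \<open>Z\<close> fails with probability at most
      \<open>\<eta> / 4\<close>.\<close>
    define KZ where "KZ = 1 + 8 * \<tau>\<^sup>2 * C / \<eta>"
    have C\<eta>: "4 * C / \<eta> \<ge> 0" using C \<eta> by simp
    have C0: "C0 \<ge> 0" "C / exp (C0\<^sup>2 / \<tau>) \<le> \<eta> / 4"
    proof -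
      have ln0: "ln (4 * C / \<eta> + 1) \<ge> 0" using C\<eta> by simp
      show "C0 \<ge> 0" using ln0 \<tau> by (simp add: C0_def)
      have "C0\<^sup>2 / \<tau> = ln (4 * C / \<eta> + 1)" using ln0 \<tau> by (simp add: C0_def)
      hence "exp (C0\<^sup>2 / \<tau>) = 4 * C / \<eta> + 1" using C\<eta> by simp
      moreover have "C / (4 * C / \<eta> + 1) \<le> \<eta> / 4"
      proof -
        have "C \<le> \<eta> / 4 * (4 * C / \<eta> + 1)" using \<eta> by (simp add: field_simps)
        thus ?thesis using C\<eta> by (subst pos_divide_le_eq) auto
      qed
      ultimately show "C / exp (C0\<^sup>2 / \<tau>) \<le> \<eta> / 4" by simp
    qed
    have KZ: "KZ \<ge> 1" "2 * \<tau>\<^sup>2 * C / KZ\<^sup>2 \<le> \<eta> / 4"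
    proof -
      show K1: "KZ \<ge> 1" using C \<eta> by (simp add: KZ_def)
      have "8 * \<tau>\<^sup>2 * C / \<eta> \<le> KZ" by (simp add: KZ_def)
      also have "\<dots> \<le> KZ\<^sup>2" using K1 by (simp add: power2_eq_square)
      finally have "2 * \<tau>\<^sup>2 * C \<le> \<eta> / 4 * KZ\<^sup>2" using \<eta> by (simp add: field_simps)
      thus "2 * \<tau>\<^sup>2 * C / KZ\<^sup>2 \<le> \<eta> / 4" using K1 by (subst pos_divide_le_eq) auto
    qed
    have K: "40 * \<sigma> + KZ \<ge> 0" using \<sigma> KZ by simp
    obtain F' D H L \<theta> where S: "L \<ge> 1" "\<theta> > 0" "\<And>l. l < k \<Longrightarrow> smooth (Suc l) L (F' l) (D l) (H l)"
      "\<And>l. l < k \<Longrightarrow> \<bar>F' l (\<lambda>_. 0)\<bar> \<le> L"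
      and cmp: "\<And>n B B' u m. n \<ge> 1 \<Longrightarrow> opn n B (40 * \<sigma> + KZ) \<Longrightarrow> opn n B' (40 * \<sigma> + KZ) \<Longrightarrow> nrm n u \<le> C0 * sqrt (real n) \<Longrightarrow>
        \<bar>sin ((\<Sum>i\<in>{1..n}. orb n F' B u k i) / real n) - m\<bar> \<le> \<theta> \<Longrightarrow>
        \<bar>sin ((\<Sum>i\<in>{1..n}. orb n F' B' u k i) / real n) - m\<bar> \<le> \<theta> \<Longrightarrow>
        \<bar>(\<Sum>i\<in>{1..n}. orb n F B u k i) / real n - (\<Sum>i\<in>{1..n}. orb n F B' u k i) / real n\<bar> \<le> \<epsilon>"
      unfolding k_def by (rule smoothed_comparison[OF F L0 K C0(1) \<epsilon>]) blast+
    define kp where "kp = (\<lambda>n. \<bar>kappa_bound \<sigma> k (amp_law.cc \<sigma> k L KZ C0)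
        \<bar>entry_perturbation.c k L (amp_law.K \<sigma> KZ)\<bar> (subgaussian_product.m6 \<sigma>) n\<bar>)"
    define q where "q = (\<lambda>n::nat. (ln (real n))\<^sup>2)"
    define E where "E = (\<lambda>n. (C / exp (C0\<^sup>2 / \<tau>) + (2 * \<tau>\<^sup>2 * C / KZ\<^sup>2
        + (real n * (real n * (C / exp (q n / \<tau>))) + real n * (C / exp (q n / \<tau>)))))
        + ((2 * exp (- real n) + 2 * exp (- real n)) + (kp n / \<theta>\<^sup>2 + kp n / \<theta>\<^sup>2)))"
    \<comment> \<open>From \<open>n = 3\<close> on \<open>ln n \<ge> 1\<close>, hence
      \<open>q n \<ge> 1\<close>.\<close>
    have bound: "measure (M n) {\<omega>\<in>space (M n). \<bar>Y n \<omega> - 0\<bar> > \<epsilon>} \<le> E n" if n: "n \<ge> 3" for n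
    proof -
      have n1: "n \<ge> 1" using n by simp
      interpret noise_pair "M n" n "A n" "G n" \<sigma> by (rule AG[OF n1])
      have P: "prob_space (M n)" by (rule A.P)
      have q1: "q n \<ge> 1"
      proof -
        have "exp 1 \<le> (3 :: real)" using exp_le by simp
        also have "\<dots> \<le> real n" using n by simp
        finally have "ln (exp 1) \<le> ln (real n)" by (subst ln_le_cancel_iff) (use n in auto)
        hence "1 \<le> ln (real n)" by simp
        thus ?thesis by (simp add: q_def)
      qed
      have kap: "kap k KZ C0 L = kp n" by (simp add: kap_def kp_def)
      have lipF': "lip (Suc l) L (F' l)" if "l < k" for l using S(3)[OF that] by (rule smooth_lip)
      \<comment> \<open>One centre for both matrices, a function of the initialization; the
        dependence between \<open>A\<close> and \<open>G\<close> plays no part in the deviations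
        from it.\<close>
      define m where "m = (\<lambda>\<omega>. \<integral>y. state n F' k y (vec_elem n (u0 n \<omega>), mat_elem n (Z n \<omega>)) \<partial>PiM (upper_tri n) (entry_law (M n) n (G n)))"
      have G0: "whp (M n) (C / exp (C0\<^sup>2 / \<tau>) + (2 * \<tau>\<^sup>2 * C / KZ\<^sup>2
        + (real n * (real n * (C / exp (q n / \<tau>))) + real n * (C / exp (q n / \<tau>)))))
        (\<lambda>\<omega>. good_init n C0 KZ (q n) (vec_elem n (u0 n \<omega>)) (mat_elem n (Z n \<omega>)))"
        using KZ by (intro whp_good_init P n1 \<tau> C C0 ur Zr un ue Ze) auto
      have dev: "whp (M n) (kp n / \<theta>\<^sup>2) (\<lambda>\<omega>. good_init n C0 KZ (q n) (vec_elem n (u0 n \<omega>)) (mat_elem n (Z n \<omega>)) \<longrightarrow>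
         \<bar>state n F' k (upper n (X \<omega>)) (vec_elem n (u0 n \<omega>), mat_elem n (Z n \<omega>)) - m \<omega>\<bar> \<le> \<theta>)"
        if X: "X = A n \<or> X = G n" for X
      proof -
        interpret X: noise "M n" n X \<sigma> using X A.noise_axioms G.noise_axioms by auto
        show ?thesis unfolding m_def
        proof (rule X.deviation[OF _ lipF' S(2) _ G.law.real_product_axioms])
          show "indep_of_pair (M n) n X (u0 n) (Z n)" using X Ai[OF n1] Gi[OF n1] by auto
          show "kp n \<ge> 0" by (simp add: kp_def)
          fix w assume w: "good_init n C0 KZ (q n) (fst w) (snd w)"
          show "(\<integral>x. (state n F' k x w - (\<integral>y. state n F' k y w \<partial>PiM (upper_tri n) (entry_law (M n) n (G n))))\<^sup>2
             \<partial>PiM (upper_tri n) (entry_law (M n) n X)) \<le> kp n"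
            unfolding kap[symmetric]
            by (rule conditional_bound[OF _ q1 S(1) KZ(1) C0(1) S(3,4) w X]) (simp_all add: q_def)
        qed
      qed
      have "whp (M n) (E n) (\<lambda>\<omega>. Y n \<omega> \<le> \<epsilon>)"
        unfolding E_def
      proof (rule whp_mono[OF whp_conj[OF P G0 whp_conj[OF P
              whp_conj[OF P A.whp_noise_opn G.whp_noise_opn] whp_conj[OF P dev[of "A n"] dev[of "G n"]]]]])
        fix \<omega> assume \<omega>: "\<omega> \<in> space (M n)"
          and h: "good_init n C0 KZ (q n) (vec_elem n (u0 n \<omega>)) (mat_elem n (Z n \<omega>)) \<and>
            (opn n (\<lambda>i j. A n \<omega> i j / sqrt (real n)) (40 * \<sigma>) \<and> opn n (\<lambda>i j. G n \<omega> i j / sqrt (real n)) (40 * \<sigma>)) \<and>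
            (good_init n C0 KZ (q n) (vec_elem n (u0 n \<omega>)) (mat_elem n (Z n \<omega>)) \<longrightarrow>
             \<bar>state n F' k (upper n (A n \<omega>)) (vec_elem n (u0 n \<omega>), mat_elem n (Z n \<omega>)) - m \<omega>\<bar> \<le> \<theta>) \<and>
            (good_init n C0 KZ (q n) (vec_elem n (u0 n \<omega>)) (mat_elem n (Z n \<omega>)) \<longrightarrow>
             \<bar>state n F' k (upper n (G n \<omega>)) (vec_elem n (u0 n \<omega>), mat_elem n (Z n \<omega>)) - m \<omega>\<bar> \<le> \<theta>)"
        have st: "state n F' k (upper n X) (vec_elem n (u0 n \<omega>), mat_elem n (Z n \<omega>))
           = sin ((\<Sum>i\<in>{1..n}. orb n F' (X_hat n (Z n \<omega>) X) (u0 n \<omega>) k i) / real n)" if "X \<in> sym_mats n" for X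
        proof -
          have "(\<Sum>i\<in>{1..n}. orb n F' (X_hat n (\<lambda>i j. mat_elem n (Z n \<omega>) (i, j)) (symx (upper_tri n) (upper n X))) (vec_elem n (u0 n \<omega>)) k i)
             = (\<Sum>i\<in>{1..n}. orb n F' (X_hat n (Z n \<omega>) X) (u0 n \<omega>) k i)"
            by (intro sum.cong refl orb_upper that)
          thus ?thesis by (simp add: state_def)
        qed
        have sA: "A n \<omega> \<in> sym_mats n" and sG: "G n \<omega> \<in> sym_mats n"
          using A.Xr G.Xr \<omega> by (auto simp: random_sym_mat_def)
        have "nrm n (vec_elem n (u0 n \<omega>)) = nrm n (u0 n \<omega>)" by (rule nrm_cong) (simp add: vec_elem_def)
        hence nu: "nrm n (u0 n \<omega>) \<le> C0 * sqrt (real n)" using h by (simp add: good_init_def)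
        show "Y n \<omega> \<le> \<epsilon>"
          unfolding Y_def k_def[symmetric]
        proof (rule cmp[OF n1 _ _ nu])
          show "opn n (X_hat n (Z n \<omega>) (A n \<omega>)) (40 * \<sigma> + KZ)" "opn n (X_hat n (Z n \<omega>) (G n \<omega>)) (40 * \<sigma> + KZ)"
            using h KZ by (auto intro!: opn_X_hat)
          show "\<bar>sin ((\<Sum>i\<in>{1..n}. orb n F' (X_hat n (Z n \<omega>) (A n \<omega>)) (u0 n \<omega>) k i) / real n) - m \<omega>\<bar> \<le> \<theta>"
            using h unfolding st[OF sA] by blast
          show "\<bar>sin ((\<Sum>i\<in>{1..n}. orb n F' (X_hat n (Z n \<omega>) (G n \<omega>)) (u0 n \<omega>) k i) / real n) - m \<omega>\<bar> \<le> \<theta>"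
            using h unfolding st[OF sG] by blast
        qed
      qed auto
      from whp_measure_le[OF this P]
      have "measure (M n) {\<omega>\<in>space (M n). \<not> Y n \<omega> \<le> \<epsilon>} \<le> E n" .
      moreover have "\<bar>Y n \<omega> - 0\<bar> = Y n \<omega>" for \<omega> by (simp add: Y_def)
      ultimately show ?thesis by (simp add: not_le)
    qed
    \<comment> \<open>Only the two terms governed by \<open>C0\<close> and \<open>KZ\<close> survive
      in the limit, together at most \<open>\<eta> / 2\<close>.\<close>
    have "E \<longlonglongrightarrow> (C / exp (C0\<^sup>2 / \<tau>) + (2 * \<tau>\<^sup>2 * C / KZ\<^sup>2 + (C * 0 + C * 0))) + ((2 * 0 + 2 * 0) + (0 / \<theta>\<^sup>2 + 0 / \<theta>\<^sup>2))"
    proof -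
      have p: "(\<lambda>n. real n ^ j * exp (- (1 / \<tau> * ln (real n) ^ 2))) \<longlonglongrightarrow> 0" for j
        by (rule power_exp_minus_log2) (use \<tau> in simp)
      have e: "C / exp (q n / \<tau>) = C * exp (- (1 / \<tau> * ln (real n) ^ 2))" for n
        by (simp add: q_def exp_minus field_simps)
      have E': "E = (\<lambda>n. (C / exp (C0\<^sup>2 / \<tau>) + (2 * \<tau>\<^sup>2 * C / KZ\<^sup>2
        + (C * (real n ^ 2 * exp (- (1 / \<tau> * ln (real n) ^ 2))) + C * (real n ^ 1 * exp (- (1 / \<tau> * ln (real n) ^ 2))))))
        + ((2 * (real n ^ 0 * exp (- real n)) + 2 * (real n ^ 0 * exp (- real n))) + (kp n / \<theta>\<^sup>2 + kp n / \<theta>\<^sup>2)))"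
        unfolding E_def e by (simp add: power2_eq_square mult_ac)
      have "kp \<longlonglongrightarrow> 0"
        unfolding kp_def by (rule tendsto_rabs_zero) (rule kappa_bound_tendsto[OF \<sigma>])
      thus ?thesis unfolding E'
        by (intro tendsto_intros p power_exp_minus) (use S(2) in auto)
    qed
    moreover have "(C / exp (C0\<^sup>2 / \<tau>) + (2 * \<tau>\<^sup>2 * C / KZ\<^sup>2 + (C * 0 + C * 0))) + ((2 * 0 + 2 * 0) + (0 / \<theta>\<^sup>2 + 0 / \<theta>\<^sup>2)) < \<eta>"
    proof -
      have "C / exp (C0\<^sup>2 / \<tau>) + 2 * \<tau>\<^sup>2 * C / KZ\<^sup>2 < \<eta>" using C0(2) KZ(2) \<eta> by linarith
      thus ?thesis by simp
    qed
    ultimately have "eventually (\<lambda>n. E n < \<eta>) sequentially" by (rule order_tendstoD(2))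
    thus ?thesis using eventually_ge_at_top[of 3]
    proof eventually_elim
      case (elim n)
      thus ?case using bound[of n] by linarith
    qed
  qed
  hence "(\<lambda>n. measure (M n) {\<omega>\<in>space (M n). \<bar>Y n \<omega> - 0\<bar> > \<epsilon>}) \<longlonglongrightarrow> 0"
    by (intro order_tendstoI) (auto intro!: always_eventually less_le_trans[OF _ measure_nonneg])
  thus "(\<lambda>n. measure (M n) {\<omega>\<in>space (M n). \<epsilon> < \<bar>\<bar>(\<Sum>i\<in>{1..n}. orb n F (X_hat n (Z n \<omega>) (A n \<omega>)) (u0 n \<omega>) (Suc k0) i) / real n
      - (\<Sum>i\<in>{1..n}. orb n F (X_hat n (Z n \<omega>) (G n \<omega>)) (u0 n \<omega>) (Suc k0) i) / real n\<bar> - 0\<bar>}) \<longlonglongrightarrow> 0"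
    unfolding Y_def .
qed

theorem theorem2p1:
  fixes M :: "nat \<Rightarrow> 'a measure"
    and u0 :: "nat \<Rightarrow> 'a \<Rightarrow> vect"
    and Z A G :: "nat \<Rightarrow> 'a \<Rightarrow> matr"
    and F :: "nat \<Rightarrow> (nat \<Rightarrow> real) \<Rightarrow> real"
    and \<phi> :: "(nat \<Rightarrow> real) \<Rightarrow> real"
    and \<sigma> C :: real
    and k :: nat
  assumes sigma: "\<sigma> > 0"
    and prob: "\<And>n. n \<ge> 1 \<Longrightarrow> prob_space (M n)"
    and F_lipschitz: "\<And>l. lipschitz_fun (l + 1) (F l)"
    and u0_random: "\<And>n. n \<ge> 1 \<Longrightarrow> random_vec (M n) n (u0 n)"
    and Z_random: "\<And>n. n \<ge> 1 \<Longrightarrow> random_sym_mat (M n) n (Z n)"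
    and u0_norm: "\<And>n. n \<ge> 1 \<Longrightarrow>
      (\<integral>\<^sup>+\<omega>. ennreal (exp ((L2_set (u0 n \<omega>) {1..n})\<^sup>2 / (\<sigma> * real n))) \<partial>M n) \<le> ennreal C"
    and u0_entries: "\<And>n i. n \<ge> 1 \<Longrightarrow> i \<in> {1..n} \<Longrightarrow>
      (\<integral>\<^sup>+\<omega>. ennreal (exp (\<bar>u0 n \<omega> i\<bar> / \<sigma>)) \<partial>M n) \<le> ennreal C"
    and Z_entries: "\<And>n i j. n \<ge> 1 \<Longrightarrow> i \<in> {1..n} \<Longrightarrow> j \<in> {1..n} \<Longrightarrow>
      (\<integral>\<^sup>+\<omega>. ennreal (exp (\<bar>Z n \<omega> i j\<bar> / \<sigma>)) \<partial>M n) \<le> ennreal C"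
    and A_random: "\<And>n. n \<ge> 1 \<Longrightarrow> random_sym_mat (M n) n (A n)"
    and A_indep: "\<And>n. n \<ge> 1 \<Longrightarrow> indep_upper_tri (M n) n (A n)"
    and A_mean: "\<And>n i j. n \<ge> 1 \<Longrightarrow> (i, j) \<in> upper_tri n \<Longrightarrow>
      integrable (M n) (\<lambda>\<omega>. A n \<omega> i j) \<and> prob_space.expectation (M n) (\<lambda>\<omega>. A n \<omega> i j) = 0"
    and A_variance: "\<And>n i j. n \<ge> 1 \<Longrightarrow> (i, j) \<in> upper_tri n \<Longrightarrow>
      prob_space.variance (M n) (\<lambda>\<omega>. A n \<omega> i j) = 1"
    and A_subgaussian: "\<And>n i j. n \<ge> 1 \<Longrightarrow> (i, j) \<in> upper_tri n \<Longrightarrow>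
      subgaussian (M n) \<sigma> (\<lambda>\<omega>. A n \<omega> i j)"
    and G_random: "\<And>n. n \<ge> 1 \<Longrightarrow> random_sym_mat (M n) n (G n)"
    and G_indep: "\<And>n. n \<ge> 1 \<Longrightarrow> indep_upper_tri (M n) n (G n)"
    and G_normal: "\<And>n i j. n \<ge> 1 \<Longrightarrow> (i, j) \<in> upper_tri n \<Longrightarrow>
      distributed (M n) lborel (\<lambda>\<omega>. G n \<omega> i j) std_normal_density"
    and A_indep_pair: "\<And>n. n \<ge> 1 \<Longrightarrow> indep_of_pair (M n) n (A n) (u0 n) (Z n)"
    and G_indep_pair: "\<And>n. n \<ge> 1 \<Longrightarrow> indep_of_pair (M n) n (G n) (u0 n) (Z n)"
    and phi_lipschitz: "lipschitz_fun (k + 1) \<phi>"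
  shows "tendsto_in_prob M
    (\<lambda>n \<omega>. \<bar>amp_avg n F (Z n \<omega>) (\<lambda>X. u0 n \<omega>) \<phi> k (A n \<omega>)
           - amp_avg n F (Z n \<omega>) (\<lambda>X. u0 n \<omega>) \<phi> k (G n \<omega>)\<bar>) 0"
proof -
  \<comment> \<open>Standard normal entries are 1-subgaussian and those of \<open>A\<close> are
    \<open>\<sigma>\<close>-subgaussian; the maximum serves both, while the tail bounds of the
    initialization keep \<open>\<sigma>\<close>.\<close>
  define \<sigma>' where "\<sigma>' = max \<sigma> 1"
  have \<sigma>': "\<sigma>' > 0" "\<sigma> \<le> \<sigma>'" "1 \<le> \<sigma>'" by (auto simp: \<sigma>'_def)
  \<comment> \<open>The appended function ignores its argument 0, so the Lipschitz constant of
    \<open>\<phi>\<close> carries over with one argument more.\<close>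
  define F' where "F' = F(Suc k := (\<lambda>a. \<phi> (\<lambda>j. a (Suc j))))"
  obtain L\<phi> where L\<phi>: "L\<phi> \<ge> 0" "lip (Suc k) L\<phi> \<phi>" using lipschitz_fun_imp_lip[OF phi_lipschitz] by auto
  obtain Lf where Lf: "\<And>l. Lf l \<ge> 0 \<and> lip (Suc l) (Lf l) (F l)"
    using lipschitz_fun_imp_lip[OF F_lipschitz] by (metis Suc_eq_plus1)
  define L0 where "L0 = L\<phi> + (\<Sum>l\<le>k. Lf l)"
  have F': "lip (Suc l) L0 (F' l)" if "l < Suc (Suc k)" for l
  proof (cases "l = Suc k")
    case True
    have "lip (Suc (Suc k)) L\<phi> (\<lambda>a. \<phi> (\<lambda>j. a (Suc j)))"
      unfolding lip_def
    proof (intro allI)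
      fix x y :: "nat \<Rightarrow> real"
      have "\<bar>\<phi> (\<lambda>j. x (Suc j)) - \<phi> (\<lambda>j. y (Suc j))\<bar> \<le> L\<phi> * ldist (Suc k) (\<lambda>j. x (Suc j)) (\<lambda>j. y (Suc j))"
        by (rule lipD[OF L\<phi>(2)])
      also have "\<dots> \<le> L\<phi> * ldist (Suc (Suc k)) x y"
        using L\<phi>(1) unfolding ldist_def sum.lessThan_Suc_shift[of _ "Suc k"] by (intro mult_left_mono) auto
      finally show "\<bar>\<phi> (\<lambda>j. x (Suc j)) - \<phi> (\<lambda>j. y (Suc j))\<bar> \<le> L\<phi> * ldist (Suc (Suc k)) x y" .
    qed
    moreover have "L\<phi> \<le> L0" using Lf by (auto simp: L0_def intro: sum_nonneg)
    ultimately show ?thesis using True lip_mono by (auto simp: F'_def)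
  next
    case False
    hence "l \<le> k" using that by simp
    hence "Lf l \<le> (\<Sum>l\<le>k. Lf l)" using Lf by (intro member_le_sum) auto
    hence "Lf l \<le> L0" using L\<phi>(1) by (simp add: L0_def)
    hence "lip (Suc l) L0 (F l)" using Lf[of l] lip_mono by blast
    thus ?thesis using False by (simp add: F'_def)
  qed
  have L0: "L0 \<ge> 0" using L\<phi>(1) Lf by (auto simp: L0_def intro!: add_nonneg_nonneg sum_nonneg)
  \<comment> \<open>Supplies a nonnegative constant for the moment bounds, as Markov's inequality is
    stated with one.\<close>
  have le_max: "x \<le> ennreal C \<Longrightarrow> x \<le> ennreal (max C 0)" for x
    by (erule order_trans) (intro ennreal_leI; simp)
  have "tendsto_in_prob M (\<lambda>n \<omega>. \<bar>(\<Sum>i\<in>{1..n}. orb n F' (X_hat n (Z n \<omega>) (A n \<omega>)) (u0 n \<omega>) (Suc (Suc k)) i) / real n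
      - (\<Sum>i\<in>{1..n}. orb n F' (X_hat n (Z n \<omega>) (G n \<omega>)) (u0 n \<omega>) (Suc (Suc k)) i) / real n\<bar>) 0"
  proof (rule mean_universality[OF F' L0 sigma, where C = "max C 0" and \<sigma> = \<sigma>'])
    fix n :: nat assume n: "n \<ge> 1"
    interpret prob_space "M n" by (rule prob[OF n])
    have Am: "(\<integral>t. t \<partial>entry_law (M n) n (A n) e) = 0 \<and> (\<integral>t. t\<^sup>2 \<partial>entry_law (M n) n (A n) e) = 1"
      if "e \<in> upper_tri n" for e
    proof -
      obtain i j where e: "e = (i, j)" by force
      show ?thesis using that A_mean[OF n] A_variance[OF n] A_random[OF n] unfolding e
        by (intro conjI entry_law_moments[OF prob[OF n]]) auto
    qed
    have Gm: "(\<integral>t. t \<partial>entry_law (M n) n (G n) e) = 0 \<and> (\<integral>t. t\<^sup>2 \<partial>entry_law (M n) n (G n) e) = 1"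
      if "e \<in> upper_tri n" for e
    proof -
      obtain i j where e: "e = (i, j)" by force
      have d: "distributed (M n) lborel (\<lambda>\<omega>. G n \<omega> i j) std_normal_density" using G_normal[OF n] that e by simp
      show ?thesis using that G_random[OF n] standard_normal_distributed_expectation[OF d] standard_normal_distributed_variance[OF d]
        unfolding e by (intro conjI entry_law_moments[OF prob[OF n]]) auto
    qed
    have "noise (M n) n (A n) \<sigma>'"
      by (rule noise.intro[OF prob[OF n] n \<sigma>'(1) A_random[OF n] A_indep[OF n]
            subgaussian_mono[OF A_subgaussian[OF n] sigma \<sigma>'(2)]])
    moreover have "noise (M n) n (G n) \<sigma>'"
      by (rule noise.intro[OF prob[OF n] n \<sigma>'(1) G_random[OF n] G_indep[OF n]
            subgaussian_mono[OF subgaussian_std_normal[OF G_normal[OF n]] zero_less_one \<sigma>'(3)]])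
    ultimately show "noise_pair (M n) n (A n) (G n) \<sigma>'"
      by (rule noise_pair.intro) (rule noise_pair_axioms.intro[OF Am Gm])
  next
    show "0 \<le> max C 0" by simp
  qed (assumption | (rule A_indep_pair G_indep_pair u0_random Z_random
         le_max[OF u0_norm] le_max[OF u0_entries] le_max[OF Z_entries]; assumption))+
  thus ?thesis unfolding amp_avg_eq_orb F'_def .
qed

end
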